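(* Let $S$ be a numerical semigroup, $k$ a field, and let $R=k[\![S]\!]$ be the numerical semigroup ring, with maximal ideal $\mathfrak m$ and canonical module $\omega_R$. Then $\operatorname{gr}_{\mathfrak m}(\omega_R)$ is a canonical module of $\operatorname{gr}_{\mathfrak m}(R)$ if and only if $\operatorname{gr}_{\mathfrak m}(R)$ is Cohen-Macaulay and $S$ is $M$-pure.
   Context: A numerical semigroup is a submonoid $S$ of $(\mathbb N,+)$ with $\mathbb N\setminus S$ finite; its multiplicity $m$ is its smallest nonzero element; $k[\![S]\!]=k[\![t^s\mid s\in S]\!]\subseteq k[\![t]\!]$, with maximal ideal $(t^s\mid0\ne s\in S)$. For an $R$-module $N$, $\operatorname{gr}_{\mathfrak m}(N)=\bigoplus_{i\ge0}\mathfrak m^iN/\mathfrak m^{i+1}N$. The notion "$\operatorname{gr}_{\mathfrak m}(\omega_R)$ is a canonical module of $\operatorname{gr}_{\mathfrak m}(R)$" presupposes that $\operatorname{gr}_{\mathfrak m}(R)$ is Cohen-Macaulay; canonical modules of graded rings are understood up to isomorphism and shift of the grading. With $M=S\setminus\{0\}$, let $\operatorname{Ap}_m(S)=\{s\in S\mid s-m\notin S\}$ and $\operatorname{ord}_S(s)=\max\{l\mid s\in lM\}$, where $lM$ is the $l$-fold sum of $M$ and $0M=S$. Define a partial order $\le_M$ on $\operatorname{Ap}_m(S)$ by $\delta\le_M\delta'$ if there is $\delta''\in\operatorname{Ap}_m(S)$ with $\delta+\delta''=\delta'$ and $\operatorname{ord}_S(\delta)+\operatorname{ord}_S(\delta'')=\operatorname{ord}_S(\delta')$.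 $S$ is $M$-pure if all maximal elements of $\operatorname{Ap}_m(S)$ with respect to $\le_M$ have the same order. *)

theory Defs
  imports
    "HOL-Algebra.Module"
    "HOL-Algebra.Generated_Groups"
    "HOL-Algebra.Ring_Divisibility"
    "HOL-Computational_Algebra.Formal_Power_Series"
    "HOL-Library.Extended_Nat"
begin

section \<open>Numerical semigroups\<close>

definition numerical_semigroup :: "nat set \<Rightarrow> bool" where
  "numerical_semigroup S \<longleftrightarrow>
     0 \<in> S \<and> (\<forall>a\<in>S. \<forall>b\<in>S. a + b \<in> S) \<and> finite (UNIV - S)"

definition multiplicity_sg :: "nat set \<Rightarrow> nat" where
  "multiplicity_sg S = (LEAST s. s \<in> S \<and> s \<noteq> 0)"

text \<open>The condition \<open>s - m \<notin> S\<close> refers to subtraction in the integers, so it also holds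
  whenever \<open>s < m\<close>; it is written without truncated subtraction.\<close>

definition Apery :: "nat set \<Rightarrow> nat set" where
  "Apery S = {s \<in> S. \<not> (\<exists>u\<in>S. s = u + multiplicity_sg S)}"

text \<open>\<open>lM_sg S l\<close> is \<open>lM\<close> for \<open>M = S - {0}\<close>, with the convention \<open>0M = S\<close>.
  As \<open>S + M = M\<close>, the recursion yields \<open>1M = M\<close>.\<close>

fun lM_sg :: "nat set \<Rightarrow> nat \<Rightarrow> nat set" where
  "lM_sg S 0 = S"
| "lM_sg S (Suc l) = {a + b | a b. a \<in> lM_sg S l \<and> b \<in> S - {0}}"

text \<open>For \<open>s \<in> S\<close> the set below is nonempty and bounded by \<open>s\<close>.\<close>

definition ord_sg :: "nat set \<Rightarrow> nat \<Rightarrow> nat" where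
  "ord_sg S s = Max {l. s \<in> lM_sg S l}"

definition le_M :: "nat set \<Rightarrow> nat \<Rightarrow> nat \<Rightarrow> bool" where
  "le_M S x y \<longleftrightarrow>
     (\<exists>z\<in>Apery S. x + z = y \<and> ord_sg S x + ord_sg S z = ord_sg S y)"

definition maximal_Apery :: "nat set \<Rightarrow> nat \<Rightarrow> bool" where
  "maximal_Apery S x \<longleftrightarrow> x \<in> Apery S \<and> (\<forall>y\<in>Apery S. le_M S x y \<longrightarrow> y = x)"

definition M_pure :: "nat set \<Rightarrow> bool" where
  "M_pure S \<longleftrightarrow>
     (\<forall>x y. maximal_Apery S x \<longrightarrow> maximal_Apery S y \<longrightarrow> ord_sg S x = ord_sg S y)"


section \<open>The ring of a numerical semigroup\<close>

definition semigroup_ring :: "nat set \<Rightarrow> 'k::field fps ring" where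
  "semigroup_ring S =
     \<lparr>carrier = {f. \<forall>n. fps_nth f n \<noteq> 0 \<longrightarrow> n \<in> S},
      mult = (*), one = 1, zero = 0, add = (+)\<rparr>"

definition semigroup_max_ideal :: "nat set \<Rightarrow> 'k::field fps set" where
  "semigroup_max_ideal S =
     genideal (semigroup_ring S) {fps_X ^ s | s. s \<in> S \<and> s \<noteq> 0}"


section \<open>Modules\<close>

text \<open>The library's module records extend ring records; the fields \<open>mult\<close> and \<open>one\<close> carry no
  information for a module and are left undefined where there is no natural choice.\<close>

definition self_module :: "'a ring \<Rightarrow> ('a, 'a) module" where
  "self_module R =
     \<lparr>carrier = carrier R, mult = mult R, one = one R, zero = zero R, add = add R,
      smult = mult R\<rparr>"

definition quot_module :: "('a, 'b) module \<Rightarrow> 'b set \<Rightarrow> ('a, 'b set) module" where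
  "quot_module M U =
     \<lparr>carrier = {U +>\<^bsub>M\<^esub> x | x. x \<in> carrier M},
      mult = undefined, one = undefined, zero = U, add = (\<lambda>X Y. X <+>\<^bsub>M\<^esub> Y),
      smult = (\<lambda>r X. U <+>\<^bsub>M\<^esub> ((\<lambda>x. r \<odot>\<^bsub>M\<^esub> x) ` X))\<rparr>"

definition power_module :: "('a, 'b) module \<Rightarrow> nat \<Rightarrow> ('a, nat \<Rightarrow> 'b) module" where
  "power_module M n =
     \<lparr>carrier = {..<n} \<rightarrow>\<^sub>E carrier M,
      mult = undefined, one = undefined,
      zero = (\<lambda>j\<in>{..<n}. \<zero>\<^bsub>M\<^esub>),
      add = (\<lambda>v w. \<lambda>j\<in>{..<n}. v j \<oplus>\<^bsub>M\<^esub> w j),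
      smult = (\<lambda>r v. \<lambda>j\<in>{..<n}. r \<odot>\<^bsub>M\<^esub> v j)\<rparr>"

definition module_isomorphic ::
    "'a ring \<Rightarrow> ('a, 'b) module \<Rightarrow> ('a, 'c) module \<Rightarrow> bool" where
  "module_isomorphic R M N \<longleftrightarrow>
     (\<exists>f. bij_betw f (carrier M) (carrier N) \<and>
        (\<forall>x\<in>carrier M. \<forall>y\<in>carrier M. f (x \<oplus>\<^bsub>M\<^esub> y) = f x \<oplus>\<^bsub>N\<^esub> f y) \<and>
        (\<forall>r\<in>carrier R. \<forall>x\<in>carrier M. f (r \<odot>\<^bsub>M\<^esub> x) = r \<odot>\<^bsub>N\<^esub> f x))"

definition ideal_smult :: "('a, 'b) module \<Rightarrow> 'a set \<Rightarrow> 'b set \<Rightarrow> 'b set" where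
  "ideal_smult M I X = generate (add_monoid M) {a \<odot>\<^bsub>M\<^esub> x | a x. a \<in> I \<and> x \<in> X}"

definition fin_gen_module :: "'a ring \<Rightarrow> ('a, 'b) module \<Rightarrow> bool" where
  "fin_gen_module R M \<longleftrightarrow>
     (\<exists>A \<subseteq> carrier M. finite A \<and> ideal_smult M (carrier R) A = carrier M)"


section \<open>Cohen--Macaulay rings\<close>

definition regular_sequence :: "'a ring \<Rightarrow> 'a list \<Rightarrow> bool" where
  "regular_sequence R xs \<longleftrightarrow>
     set xs \<subseteq> carrier R \<and>
     (\<forall>i<length xs. \<forall>a\<in>carrier R.
        xs ! i \<otimes>\<^bsub>R\<^esub> a \<in> genideal R (set (take i xs)) \<longrightarrow> a \<in> genideal R (set (take i xs))) \<and>
     genideal R (set xs) \<noteq> carrier R"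

definition grade :: "'a ring \<Rightarrow> 'a set \<Rightarrow> enat" where
  "grade R I = Sup {enat (length xs) | xs. regular_sequence R xs \<and> set xs \<subseteq> I}"

definition height :: "'a ring \<Rightarrow> 'a set \<Rightarrow> enat" where
  "height R P =
     Sup {enat n | n. \<exists>Q. (\<forall>i\<le>n. primeideal (Q i) R) \<and> (\<forall>i<n. Q i \<subset> Q (Suc i)) \<and> Q n = P}"

text \<open>For a maximal ideal \<open>P\<close> of a Noetherian ring \<open>R\<close> the grade of \<open>P\<close> on \<open>R\<close> is the depth of
  the localization of \<open>R\<close> at \<open>P\<close>, and the height of \<open>P\<close> is the dimension of this
  localization. The following is the definition in Kaplansky's ``Commutative Rings''.\<close>

definition cohen_macaulay :: "'a ring \<Rightarrow> bool" where
  "cohen_macaulay R \<longleftrightarrow>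
     cring R \<and> noetherian_ring R \<and> (\<forall>P. maximalideal P R \<longrightarrow> grade R P = height R P)"


section \<open>Ext and canonical modules\<close>

text \<open>A matrix \<open>A\<close> over \<open>R\<close> with \<open>p\<close> rows and \<open>q\<close> columns, as a map from \<open>R^q\<close> to \<open>R^p\<close>.\<close>

definition matrix_map ::
    "'a ring \<Rightarrow> nat \<Rightarrow> nat \<Rightarrow> (nat \<Rightarrow> nat \<Rightarrow> 'a) \<Rightarrow> (nat \<Rightarrow> 'a) \<Rightarrow> (nat \<Rightarrow> 'a)" where
  "matrix_map R p q A v = (\<lambda>l\<in>{..<p}. \<Oplus>\<^bsub>R\<^esub>j\<in>{..<q}. A l j \<otimes>\<^bsub>R\<^esub> v j)"

text \<open>A resolution of \<open>N\<close> by finitely generated free modules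
  \<open>\<cdots> \<rightarrow> R^(n 2) \<rightarrow> R^(n 1) \<rightarrow> R^(n 0) \<rightarrow> N \<rightarrow> 0\<close>. The map from \<open>R^(n (i + 1))\<close> to
  \<open>R^(n i)\<close> is given by the matrix \<open>D i\<close>, and the augmentation sends the \<open>j\<close>-th basis vector
  of \<open>R^(n 0)\<close> to \<open>e j\<close>.\<close>

definition free_resolution ::
    "'a ring \<Rightarrow> ('a, 'b) module \<Rightarrow> (nat \<Rightarrow> nat) \<Rightarrow> (nat \<Rightarrow> nat \<Rightarrow> nat \<Rightarrow> 'a) \<Rightarrow> (nat \<Rightarrow> 'b) \<Rightarrow> bool"
  where
  "free_resolution R N n D e \<longleftrightarrow>
     (let F = (\<lambda>i. carrier (power_module (self_module R) (n i)));
          zeroF = (\<lambda>i. \<zero>\<^bsub>power_module (self_module R) (n i)\<^esub>);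
          d = (\<lambda>i. matrix_map R (n i) (n (Suc i)) (D i));
          aug = (\<lambda>v. \<Oplus>\<^bsub>N\<^esub>j\<in>{..<n 0}. v j \<odot>\<^bsub>N\<^esub> e j)
      in (\<forall>i. \<forall>l<n i. \<forall>j<n (Suc i). D i l j \<in> carrier R) \<and>
         (\<forall>j<n 0. e j \<in> carrier N) \<and>
         aug ` F 0 = carrier N \<and>
         {v \<in> F 0. aug v = \<zero>\<^bsub>N\<^esub>} = d 0 ` F 1 \<and>
         (\<forall>i. {v \<in> F (Suc i). d i v = zeroF i} = d (Suc i) ` F (Suc (Suc i))))"

text \<open>Identifying \<open>Hom(R^(n i), C)\<close> with \<open>C^(n i)\<close> through the values on the basis, composition
  with the map given by \<open>D i\<close> becomes multiplication by the transpose of \<open>D i\<close>.\<close>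

definition hom_differential ::
    "('a, 'b) module \<Rightarrow> (nat \<Rightarrow> nat) \<Rightarrow> (nat \<Rightarrow> nat \<Rightarrow> nat \<Rightarrow> 'a) \<Rightarrow> nat \<Rightarrow> (nat \<Rightarrow> 'b) \<Rightarrow> (nat \<Rightarrow> 'b)"
  where
  "hom_differential C n D i c =
     (\<lambda>j\<in>{..<n (Suc i)}. \<Oplus>\<^bsub>C\<^esub>l\<in>{..<n i}. D i l j \<odot>\<^bsub>C\<^esub> c l)"

definition hom_cocycles ::
    "('a, 'b) module \<Rightarrow> (nat \<Rightarrow> nat) \<Rightarrow> (nat \<Rightarrow> nat \<Rightarrow> nat \<Rightarrow> 'a) \<Rightarrow> nat \<Rightarrow> (nat \<Rightarrow> 'b) set" where
  "hom_cocycles C n D i =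
     {c \<in> carrier (power_module C (n i)).
        hom_differential C n D i c = \<zero>\<^bsub>power_module C (n (Suc i))\<^esub>}"

definition hom_coboundaries ::
    "('a, 'b) module \<Rightarrow> (nat \<Rightarrow> nat) \<Rightarrow> (nat \<Rightarrow> nat \<Rightarrow> nat \<Rightarrow> 'a) \<Rightarrow> nat \<Rightarrow> (nat \<Rightarrow> 'b) set" where
  "hom_coboundaries C n D i =
     (case i of
        0 \<Rightarrow> {\<zero>\<^bsub>power_module C (n 0)\<^esub>}
      | Suc k \<Rightarrow> hom_differential C n D k ` carrier (power_module C (n k)))"

text \<open>If \<open>n\<close> and \<open>D\<close> belong to a free resolution of \<open>N\<close>, this is \<open>Ext^i(N, C)\<close>; up to
  isomorphism it does not depend on the resolution.\<close>

definition Ext_module ::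
    "('a, 'b) module \<Rightarrow> (nat \<Rightarrow> nat) \<Rightarrow> (nat \<Rightarrow> nat \<Rightarrow> nat \<Rightarrow> 'a) \<Rightarrow> nat \<Rightarrow> ('a, (nat \<Rightarrow> 'b) set) module"
  where
  "Ext_module C n D i =
     quot_module (power_module C (n i)\<lparr>carrier := hom_cocycles C n D i\<rparr>)
       (hom_coboundaries C n D i)"

text \<open>Here \<open>m\<close> is the maximal ideal of a local ring \<open>R\<close>, or the homogeneous maximal ideal of a
  positively graded ring \<open>R\<close> whose degree zero part is a field. In both cases the dimension of
  \<open>R\<close> is the height of \<open>m\<close>. In the local case the condition is that \<open>C\<close> is a maximal
  Cohen--Macaulay module of type 1 and finite injective dimension, expressed through the modules
  \<open>Ext^i(R/m, C)\<close>. In the graded case these \<open>Ext\<close> modules are the graded ones with the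
  grading forgotten, since \<open>R\<close> is Noetherian and \<open>R/m\<close> is finitely generated. A graded module
  whose underlying module is isomorphic to \<open>R/m\<close> is, as a graded module, a shift of \<open>R/m\<close>, so
  for a graded module \<open>C\<close> this is the notion of a graded canonical module up to shift.\<close>

definition canonical_module :: "'a ring \<Rightarrow> 'a set \<Rightarrow> ('a, 'b) module \<Rightarrow> bool" where
  "canonical_module R m C \<longleftrightarrow>
     cohen_macaulay R \<and> maximalideal m R \<and> module R C \<and> fin_gen_module R C \<and>
     (\<exists>n D e. free_resolution R (quot_module (self_module R) m) n D e \<and>
        (\<forall>i. if enat i = height R m
             then module_isomorphic R (Ext_module C n D i) (quot_module (self_module R) m)
             else carrier (Ext_module C n D i) = {\<zero>\<^bsub>Ext_module C n D i\<^esub>}))"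


section \<open>Associated graded rings and modules\<close>

fun ideal_power_module :: "('a, 'b) module \<Rightarrow> 'a set \<Rightarrow> nat \<Rightarrow> 'b set" where
  "ideal_power_module M I 0 = carrier M"
| "ideal_power_module M I (Suc i) = ideal_smult M I (ideal_power_module M I i)"

text \<open>An element of \<open>gr_I(M)\<close> is a finitely supported family \<open>f\<close> with \<open>f i\<close> in
  \<open>I^i M / I^(i+1) M\<close>. In the product of \<open>f\<close> and \<open>g\<close> the component of degree \<open>n\<close> is the class
  modulo \<open>I^(n+1) M\<close> of the sum of all \<open>a i \<odot> y (n - i)\<close>, for representatives \<open>a i\<close> of
  \<open>f i\<close> and \<open>y j\<close> of \<open>g j\<close>; taking all representatives at once gives the same coset as any
  single choice.\<close>

definition gr_module :: "'a ring \<Rightarrow> 'a set \<Rightarrow> ('a, 'b) module \<Rightarrow> (nat \<Rightarrow> 'a set, nat \<Rightarrow> 'b set) module"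
  where
  "gr_module R I M =
     \<lparr>carrier =
        {f. (\<forall>i. \<exists>x \<in> ideal_power_module M I i. f i = ideal_power_module M I (Suc i) +>\<^bsub>M\<^esub> x) \<and>
            finite {i. f i \<noteq> ideal_power_module M I (Suc i)}},
      mult = undefined, one = undefined,
      zero = (\<lambda>i. ideal_power_module M I (Suc i)),
      add = (\<lambda>f g i. f i <+>\<^bsub>M\<^esub> g i),
      smult = (\<lambda>f g n.
        {z \<oplus>\<^bsub>M\<^esub> (\<Oplus>\<^bsub>M\<^esub>i\<in>{..n}. a i \<odot>\<^bsub>M\<^esub> y (n - i)) | z a y.
           z \<in> ideal_power_module M I (Suc n) \<and> (\<forall>i. a i \<in> f i) \<and> (\<forall>i. y i \<in> g i)})\<rparr>"

definition gr_ring :: "'a ring \<Rightarrow> 'a set \<Rightarrow> (nat \<Rightarrow> 'a set) ring" where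
  "gr_ring R I =
     (let G = gr_module R I (self_module R)
      in \<lparr>carrier = carrier G,
          mult = smult G,
          one = (\<lambda>i. if i = 0 then ideal_power_module (self_module R) I 1 +>\<^bsub>R\<^esub> \<one>\<^bsub>R\<^esub>
                     else ideal_power_module (self_module R) I (Suc i)),
          zero = zero G,
          add = add G\<rparr>)"

text \<open>The ideal of all elements without component of degree zero; it is the homogeneous maximal
  ideal when \<open>I\<close> is maximal.\<close>

definition gr_plus :: "'a ring \<Rightarrow> 'a set \<Rightarrow> (nat \<Rightarrow> 'a set) set" where
  "gr_plus R I = {f \<in> carrier (gr_ring R I). f 0 = \<zero>\<^bsub>gr_ring R I\<^esub> 0}"

end

theory Submission
  imports Defs
begin

text \<open>Put \<open>x = t\<^sup>m\<close>. The canonical module is described by linear functionals \<open>\<tau>\<close> that make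
  \<open>\<omega>/t\<^sup>q\<omega>\<close> dual to \<open>R/t\<^sup>qR\<close>; with them, membership in \<open>\<mm>\<^sup>i\<omega>\<close> up to \<open>t\<^sup>q\<omega>\<close> becomes a
  condition on the Apery set of \<open>q\<close>. In dimension one, a module \<open>C\<close> with a regular element \<open>x\<close> is
  canonical as soon as \<open>C/xC\<close> has a one-dimensional socle and is injective over the Artinian ring
  modulo \<open>x\<close>. If \<open>G = gr(R)\<close> is Cohen--Macaulay, the initial form \<open>x\<^sup>*\<close> of \<open>x\<close> is regular on \<open>G\<close>, and
  \<open>G/x\<^sup>*G\<close> has a basis indexed by the Apery elements, graded by their orders. If \<open>S\<close> is \<open>M\<close>-pure,
  then \<open>x\<^sup>*\<close> is regular on \<open>gr(\<omega>)\<close> and \<open>\<tau>\<close> makes \<open>gr(\<omega>)/x\<^sup>*gr(\<omega>)\<close> dual to \<open>G/x\<^sup>*G\<close>.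
  Conversely, if \<open>gr(\<omega>)\<close> is canonical, the dual basis vector of each Apery element \<open>w\<close> has a multiple
  in the one-dimensional socle, which \<open>\<tau>\<close> detects in top degree; so \<open>w\<close> lies below an Apery element
  of top order.\<close>

\<comment> \<open>The module \<omega> is known only through its Ext modules over some free
  resolution of the residue field, not as a fractional ideal with visible exponents. The three
  lowest degrees are therefore decoded into statements about \<omega>/t^q\<omega>: degree 0 makes
  t^q regular, degree 1 gives a one-dimensional socle, degree 2 solves an extension problem. Solving
  it once per exponent grows a dual basis with t^u e_s = e_(s-u), and \<tau> is the coefficient at
  e_0. All nonzero q in S are required: modulo t^q\<omega> with q the multiplicity, the powers of
  the maximal ideal are blurred, while for q equal to i + 2 times the multiplicity t^q\<omega>
  already lies in the i-th power times \<omega>, so that regularity of the initial form can be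
  decided there. The decisive number attached to an Apery element w is the largest i such that some
  s of order at least i keeps w + s in the Apery set. It is the degree in which the dual vector of w
  sits in the graded module, it is at most the top order minus the order of w, and purity says that
  equality always holds.\<close>
text \<open>Short form of the index notation for structures.\<close>

syntax "_index" :: "logic \<Rightarrow> index" ("\<^sub>_" [1000] 1000)

section \<open>Linear maps, quotients and free modules\<close>

text \<open>The domain is a subset K of the module and not a module record of its own, so that
  restrictions to submodules and extensions from them are maps on one and the same record.\<close>

definition linear_on ::
    "'a ring \<Rightarrow> ('a, 'b) module \<Rightarrow> ('a, 'c) module \<Rightarrow> 'b set \<Rightarrow> ('b \<Rightarrow> 'c) \<Rightarrow> bool" where
  "linear_on R M N K f \<longleftrightarrow>
     f \<in> K \<rightarrow> carrier N \<and> (\<forall>x\<in>K. \<forall>y\<in>K. f (x \<oplus>\<^sub>M y) = f x \<oplus>\<^sub>N f y) \<and>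
     (\<forall>r\<in>carrier R. \<forall>x\<in>K. f (r \<odot>\<^sub>M x) = r \<odot>\<^sub>N f x)"

lemma linear_onI:
  assumes "\<And>x. x \<in> K \<Longrightarrow> f x \<in> carrier N"
    and "\<And>x y. x \<in> K \<Longrightarrow> y \<in> K \<Longrightarrow> f (x \<oplus>\<^sub>M y) = f x \<oplus>\<^sub>N f y"
    and "\<And>r x. r \<in> carrier R \<Longrightarrow> x \<in> K \<Longrightarrow> f (r \<odot>\<^sub>M x) = r \<odot>\<^sub>N f x"
  shows "linear_on R M N K f"
  using assms unfolding linear_on_def by auto

lemma linear_on_closed: "linear_on R M N K f \<Longrightarrow> x \<in> K \<Longrightarrow> f x \<in> carrier N"
  and linear_on_add: "linear_on R M N K f \<Longrightarrow> x \<in> K \<Longrightarrow> y \<in> K \<Longrightarrow> f (x \<oplus>\<^sub>M y) = f x \<oplus>\<^sub>N f y"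
  and linear_on_smult: "linear_on R M N K f \<Longrightarrow> r \<in> carrier R \<Longrightarrow> x \<in> K \<Longrightarrow> f (r \<odot>\<^sub>M x) = r \<odot>\<^sub>N f x"
  unfolding linear_on_def by auto

lemma linear_on_subset: "linear_on R M N K f \<Longrightarrow> L \<subseteq> K \<Longrightarrow> linear_on R M N L f"
  unfolding linear_on_def by blast

lemma linear_on_compose:
  "linear_on R M N K f \<Longrightarrow> linear_on R N P L g \<Longrightarrow> f ` K \<subseteq> L \<Longrightarrow> linear_on R M P K (\<lambda>x. g (f x))"
  unfolding linear_on_def by (auto simp: image_subset_iff)

lemma (in module) smult_minus_one:
  "x \<in> carrier M \<Longrightarrow> (\<ominus> \<one>) \<odot>\<^sub>M x = \<ominus>\<^sub>M x"
  by (simp add: smult_l_minus)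

lemma (in module) smult_diff_right:
  "a \<in> carrier R \<Longrightarrow> x \<in> carrier M \<Longrightarrow> y \<in> carrier M \<Longrightarrow> a \<odot>\<^sub>M (x \<ominus>\<^sub>M y) = a \<odot>\<^sub>M x \<ominus>\<^sub>M a \<odot>\<^sub>M y"
  by (simp add: a_minus_def smult_r_distr smult_r_minus)

lemma (in module) smult_left_commute:
  "a \<in> carrier R \<Longrightarrow> b \<in> carrier R \<Longrightarrow> x \<in> carrier M \<Longrightarrow> a \<odot>\<^sub>M (b \<odot>\<^sub>M x) = b \<odot>\<^sub>M (a \<odot>\<^sub>M x)"
  by (metis R.m_comm smult_assoc1)

lemma (in abelian_group) sub_eq_zero_iff:
  "x \<in> carrier G \<Longrightarrow> y \<in> carrier G \<Longrightarrow> x \<ominus> y = \<zero> \<longleftrightarrow> x = y"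
  by (metis add.inv_solve_right minus_eq r_neg zero_closed)

lemma (in abelian_group) sub_add_cancel:
  "x \<in> carrier G \<Longrightarrow> y \<in> carrier G \<Longrightarrow> (x \<ominus> y) \<oplus> y = x"
  by (metis a_minus_def a_inv_closed a_assoc l_neg r_zero)

lemma (in abelian_group) add_sub_cancel:
  "x \<in> carrier G \<Longrightarrow> y \<in> carrier G \<Longrightarrow> (x \<oplus> y) \<ominus> y = x"
  by (metis a_minus_def a_inv_closed a_assoc r_neg r_zero)

lemma (in abelian_group) sub_zero: "x \<in> carrier G \<Longrightarrow> x \<ominus> \<zero> = x"
  by (simp add: a_minus_def)

lemma (in abelian_group) add_sub_add:
  "x \<in> carrier G \<Longrightarrow> y \<in> carrier G \<Longrightarrow> z \<in> carrier G \<Longrightarrow> w \<in> carrier G \<Longrightarrow>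
   (x \<oplus> y) \<ominus> (z \<oplus> w) = (x \<ominus> z) \<oplus> (y \<ominus> w)"
  by (simp add: a_minus_def minus_add a_ac)

lemma (in module) submodule_diff:
  "submodule H R M \<Longrightarrow> x \<in> H \<Longrightarrow> y \<in> H \<Longrightarrow> x \<ominus>\<^sub>M y \<in> H"
  using submoduleE(3,5) by (metis a_minus_def)

lemma submodule_zero: "submodule H R M \<Longrightarrow> \<zero>\<^sub>M \<in> H"
  using subgroup.one_closed[of H "add_monoid M"] by (auto simp: submodule_def)

lemma linear_on_zero:
  assumes "module R M" "module R N" "submodule K R M" "linear_on R M N K f"
  shows "f \<zero>\<^sub>M = \<zero>\<^sub>N"
proof -
  interpret M: module R M by fact
  interpret N: module R N by fact
  have z: "\<zero>\<^sub>M \<in> K" by (rule submodule_zero[OF assms(3)])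
  have "f (\<zero>\<^sub>R \<odot>\<^sub>M \<zero>\<^sub>M) = \<zero>\<^sub>R \<odot>\<^sub>N f \<zero>\<^sub>M"
    using linear_on_smult[OF assms(4) _ z] by simp
  then show ?thesis using linear_on_closed[OF assms(4) z] by simp
qed

lemma linear_on_minus:
  assumes "module R M" "module R N" "submodule K R M" "linear_on R M N K f" "x \<in> K"
  shows "f (\<ominus>\<^sub>M x) = \<ominus>\<^sub>N f x"
proof -
  interpret M: module R M by fact
  interpret N: module R N by fact
  have "x \<in> carrier M" using M.submoduleE(1)[OF assms(3)] assms(5) by auto
  have "f ((\<ominus>\<^sub>R \<one>\<^sub>R) \<odot>\<^sub>M x) = (\<ominus>\<^sub>R \<one>\<^sub>R) \<odot>\<^sub>N f x"
    using linear_on_smult[OF assms(4) _ assms(5)] by simp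
  then show ?thesis
    using linear_on_closed[OF assms(4,5)] \<open>x \<in> carrier M\<close>
    by (simp add: M.smult_minus_one N.smult_minus_one)
qed

lemma linear_on_diff:
  assumes "module R M" "module R N" "submodule K R M" "linear_on R M N K f" "x \<in> K" "y \<in> K"
  shows "f (x \<ominus>\<^sub>M y) = f x \<ominus>\<^sub>N f y"
proof -
  interpret M: module R M by fact
  show ?thesis
    using linear_on_minus[OF assms(1-4) assms(6)] linear_on_add[OF assms(4,5)]
      M.submoduleE(3)[OF assms(3,6)] by (simp add: a_minus_def)
qed

lemma linear_on_kernel:
  assumes "module R M" "module R N" "submodule K R M" "linear_on R M N K f"
  shows "submodule {x \<in> K. f x = \<zero>\<^sub>N} R M"
proof -
  interpret M: module R M by fact
  interpret N: module R N by fact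
  show ?thesis
    by (rule M.submoduleI)
       (use M.submoduleE[OF assms(3)] submodule_zero[OF assms(3)] linear_on_zero[OF assms]
          linear_on_minus[OF assms] linear_on_add[OF assms(4)] linear_on_smult[OF assms(4)] in auto)
qed

lemma linear_on_image:
  assumes "module R M" "module R N" "submodule K R M" "linear_on R M N K f"
  shows "submodule (f ` K) R N"
proof -
  interpret M: module R M by fact
  interpret N: module R N by fact
  note K = M.submoduleE[OF assms(3)]
  show ?thesis
  proof (rule N.submoduleI)
    show "f ` K \<subseteq> carrier N" using linear_on_closed[OF assms(4)] by auto
    show "\<zero>\<^sub>N \<in> f ` K" using submodule_zero[OF assms(3)] linear_on_zero[OF assms] by force
    show "\<ominus>\<^sub>N a \<in> f ` K" if "a \<in> f ` K" for a
      using that K(3) linear_on_minus[OF assms] by (metis (no_types, lifting) imageE image_eqI)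
    show "a \<oplus>\<^sub>N b \<in> f ` K" if "a \<in> f ` K" "b \<in> f ` K" for a b
      using that K(5) linear_on_add[OF assms(4)] by (smt (verit) imageE image_eqI)
    show "a \<odot>\<^sub>N b \<in> f ` K" if "a \<in> carrier R" "b \<in> f ` K" for a b
      using that K(4) linear_on_smult[OF assms(4)] by (smt (verit) imageE image_eqI)
  qed
qed

text \<open>Linear maps are mostly obtained from their graphs: this avoids separate well-definedness
  arguments for maps given by formulas such as \<open>u + a v \<mapsto> f u + a y\<close>.\<close>

lemma linear_on_graph:
  assumes "module R M" "module R N"
    and sub: "\<And>w z. (w, z) \<in> \<Gamma> \<Longrightarrow> w \<in> carrier M \<and> z \<in> carrier N"
    and add: "\<And>w z w' z'. (w, z) \<in> \<Gamma> \<Longrightarrow> (w', z') \<in> \<Gamma> \<Longrightarrow> (w \<oplus>\<^sub>M w', z \<oplus>\<^sub>N z') \<in> \<Gamma>"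
    and smult: "\<And>r w z. r \<in> carrier R \<Longrightarrow> (w, z) \<in> \<Gamma> \<Longrightarrow> (r \<odot>\<^sub>M w, r \<odot>\<^sub>N z) \<in> \<Gamma>"
    and single: "\<And>z. (\<zero>\<^sub>M, z) \<in> \<Gamma> \<Longrightarrow> z = \<zero>\<^sub>N"
  obtains f where "linear_on R M N (fst ` \<Gamma>) f" "\<And>w z. (w, z) \<in> \<Gamma> \<Longrightarrow> f w = z"
proof -
  interpret M: module R M by fact
  interpret N: module R N by fact
  have uniq: "z = z'" if "(w, z) \<in> \<Gamma>" "(w, z') \<in> \<Gamma>" for w z z'
  proof -
    have "(w \<oplus>\<^sub>M (\<ominus>\<^sub>R \<one>\<^sub>R) \<odot>\<^sub>M w, z \<oplus>\<^sub>N (\<ominus>\<^sub>R \<one>\<^sub>R) \<odot>\<^sub>N z') \<in> \<Gamma>"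
      using that add smult by auto
    then have "(\<zero>\<^sub>M, z \<ominus>\<^sub>N z') \<in> \<Gamma>"
      using sub[OF that(1)] sub[OF that(2)]
      by (simp add: M.smult_minus_one N.smult_minus_one a_minus_def M.r_neg)
    then have "z \<ominus>\<^sub>N z' = \<zero>\<^sub>N" using single by auto
    then show ?thesis using sub[OF that(1)] sub[OF that(2)] by (simp add: N.sub_eq_zero_iff)
  qed
  define f where "f w = (THE z. (w, z) \<in> \<Gamma>)" for w
  have f: "f w = z" if "(w, z) \<in> \<Gamma>" for w z
    unfolding f_def using that uniq by blast
  have "linear_on R M N (fst ` \<Gamma>) f"
  proof (rule linear_onI)
    fix x assume "x \<in> fst ` \<Gamma>"
    then obtain z where z: "(x, z) \<in> \<Gamma>" by auto
    then show "f x \<in> carrier N" using f sub by metis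
    show "f (r \<odot>\<^sub>M x) = r \<odot>\<^sub>N f x" if "r \<in> carrier R" for r
      using f smult[OF that z] z by metis
    fix y assume "y \<in> fst ` \<Gamma>"
    then obtain z' where z': "(y, z') \<in> \<Gamma>" by auto
    show "f (x \<oplus>\<^sub>M y) = f x \<oplus>\<^sub>N f y" using f add[OF z z'] z z' by metis
  qed
  then show ?thesis using f that by blast
qed

section \<open>Quotient modules\<close>

lemma submodule_abelian_subgroup:
  assumes "module R M" "submodule U R M"
  shows "abelian_subgroup U M"
proof -
  interpret M: module R M by fact
  show ?thesis
    by (rule abelian_subgroupI3)
       (use assms(2) M.abelian_group_axioms in
         \<open>auto intro!: additive_subgroup.intro simp: submodule_def\<close>)
qed

context
  fixes R :: "'a ring" and M :: "('a, 'b) module" and U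
  assumes M: "module R M" and U: "submodule U R M"
begin

interpretation M: module R M by (fact M)
interpretation U: abelian_subgroup U M by (rule submodule_abelian_subgroup[OF M U])

lemma coset_eq_iff:
  assumes "x \<in> carrier M" "y \<in> carrier M"
  shows "U +>\<^sub>M x = U +>\<^sub>M y \<longleftrightarrow> x \<ominus>\<^sub>M y \<in> U"
  using U.a_rcos_module[OF assms(2,1)] U.a_repr_independence' U.a_repr_independenceD assms
  by (metis M.minus_eq)

lemma coset_eq_self_iff:
  assumes "x \<in> carrier M"
  shows "U +>\<^sub>M x = U \<longleftrightarrow> x \<in> U"
  using U.a_rcos_const U.a_rcos_self assms by blast

lemma coset_add:
  "x \<in> carrier M \<Longrightarrow> y \<in> carrier M \<Longrightarrow> (U +>\<^sub>M x) <+>\<^sub>M (U +>\<^sub>M y) = U +>\<^sub>M (x \<oplus>\<^sub>M y)"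
  by (rule U.a_rcos_sum)

text \<open>The image of a coset under r need not fill a coset; adding U completes it, which is why
  the scalar multiplication of the quotient contains that summand.\<close>

lemma coset_smult:
  assumes r: "r \<in> carrier R" and x: "x \<in> carrier M"
  shows "U <+>\<^sub>M ((\<lambda>x. r \<odot>\<^sub>M x) ` (U +>\<^sub>M x)) = U +>\<^sub>M (r \<odot>\<^sub>M x)"
proof -
  note [simp] = M.submoduleE(4)[OF U] M.submoduleE(5)[OF U] submodule_zero[OF U]
  have [simp]: "u \<in> U \<Longrightarrow> u \<in> carrier M" for u using M.submoduleE(1)[OF U] by auto
  have "{u \<oplus>\<^sub>M r \<odot>\<^sub>M (v \<oplus>\<^sub>M x) | u v. u \<in> U \<and> v \<in> U} = {u \<oplus>\<^sub>M r \<odot>\<^sub>M x | u. u \<in> U}" (is "?L = ?R")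
  proof
    show "?L \<subseteq> ?R"
      using r x by (auto simp: M.smult_r_distr M.a_assoc[symmetric])
    show "?R \<subseteq> ?L"
    proof
      fix y assume "y \<in> ?R"
      then obtain u where "u \<in> U" "y = u \<oplus>\<^sub>M r \<odot>\<^sub>M (\<zero>\<^sub>M \<oplus>\<^sub>M x)" using x by auto
      then show "y \<in> ?L" by (metis (mono_tags, lifting) mem_Collect_eq submodule_zero[OF U])
    qed
  qed
  then show ?thesis
    unfolding set_add_def' a_r_coset_def' by (auto simp: set_eq_iff Bex_def)
qed

lemma quot_module_simps:
  "carrier (quot_module M U) = (\<lambda>x. U +>\<^sub>M x) ` carrier M"
  "\<zero>\<^bsub>quot_module M U\<^esub> = U"
  "X \<oplus>\<^bsub>quot_module M U\<^esub> Y = X <+>\<^sub>M Y"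
  "r \<odot>\<^bsub>quot_module M U\<^esub> X = U <+>\<^sub>M ((\<lambda>x. r \<odot>\<^sub>M x) ` X)"
  unfolding quot_module_def by auto

lemma module_quot_module: "module R (quot_module M U)"
proof (rule moduleI)
  show "cring R" by (rule M.R.is_cring)
  show "abelian_group (quot_module M U)"
  proof (rule abelian_groupI)
    fix X assume "X \<in> carrier (quot_module M U)"
    then obtain x where x: "x \<in> carrier M" "X = U +>\<^sub>M x" by (auto simp: quot_module_simps)
    have "U <+>\<^sub>M (U +>\<^sub>M x) = U +>\<^sub>M x"
      using coset_add[of "\<zero>\<^sub>M" x] x coset_eq_self_iff[of "\<zero>\<^sub>M"] submodule_zero[OF U] by simp
    then show "\<zero>\<^bsub>quot_module M U\<^esub> \<oplus>\<^bsub>quot_module M U\<^esub> X = X"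
      by (simp add: quot_module_simps x)
    have "(U +>\<^sub>M (\<ominus>\<^sub>M x)) <+>\<^sub>M (U +>\<^sub>M x) = U"
      using coset_add[of "\<ominus>\<^sub>M x" x] x coset_eq_self_iff[of "\<zero>\<^sub>M"] submodule_zero[OF U]
      by (simp add: M.l_neg)
    then show "\<exists>Y\<in>carrier (quot_module M U). Y \<oplus>\<^bsub>quot_module M U\<^esub> X = \<zero>\<^bsub>quot_module M U\<^esub>"
      using x by (auto simp: quot_module_simps)
  next
    show "\<zero>\<^bsub>quot_module M U\<^esub> \<in> carrier (quot_module M U)"
      using coset_eq_self_iff[of "\<zero>\<^sub>M"] submodule_zero[OF U] by (force simp: quot_module_simps)
  qed (auto simp: quot_module_simps coset_add M.a_ac)
qed (auto simp: quot_module_simps coset_add coset_smult M.smult_l_distr M.smult_r_distr M.smult_assoc1)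

lemma linear_on_coset: "linear_on R M (quot_module M U) (carrier M) (\<lambda>x. U +>\<^sub>M x)"
  by (rule linear_onI) (auto simp: quot_module_simps coset_add coset_smult)

end

lemma multiples_submodule:
  fixes R :: "'a ring" and M :: "('a, 'b) module"
  assumes M: "module R M" and x: "x \<in> carrier R"
  shows "submodule ((\<lambda>y. x \<odot>\<^sub>M y) ` carrier M) R M"
proof -
  interpret module R M by (rule M)
  show ?thesis
    by (rule linear_on_image[OF M M carrier_is_submodule])
       (rule linear_onI, rule smult_closed[OF x], assumption, rule smult_r_distr[OF x], assumption+,
         rule smult_left_commute[OF x], assumption+)
qed

section \<open>The ring as a module over itself, with ideals as submodules\<close>

lemma self_module_simps [simp]:
  "carrier (self_module R) = carrier R" "\<zero>\<^bsub>self_module R\<^esub> = \<zero>\<^sub>R" "\<one>\<^bsub>self_module R\<^esub> = \<one>\<^sub>R"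
  "x \<oplus>\<^bsub>self_module R\<^esub> y = x \<oplus>\<^sub>R y" "x \<otimes>\<^bsub>self_module R\<^esub> y = x \<otimes>\<^sub>R y"
  "x \<odot>\<^bsub>self_module R\<^esub> y = x \<otimes>\<^sub>R y"
  unfolding self_module_def by auto

lemma module_self_module:
  assumes "cring R"
  shows "module R (self_module R)"
proof -
  interpret cring R by fact
  show ?thesis
  proof (rule moduleI)
    show "abelian_group (self_module R)"
      by (rule abelian_groupI) (auto simp: a_ac intro: bexI[of _ "\<ominus>\<^sub>R _"] l_neg)
  qed (auto simp: is_cring l_distr r_distr m_assoc)
qed

lemma a_inv_self_module [simp]: "\<ominus>\<^bsub>self_module R\<^esub> x = \<ominus>\<^sub>R x"
  unfolding a_inv_def m_inv_def self_module_def by simp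

lemma a_minus_self_module [simp]: "x \<ominus>\<^bsub>self_module R\<^esub> y = x \<ominus>\<^sub>R y"
  unfolding a_minus_def by simp

lemma finsum_self_module [simp]: "finsum (self_module R) f A = finsum R f A"
  unfolding finsum_def finprod_def self_module_def by simp

lemma a_r_coset_self_module [simp]: "I +>\<^bsub>self_module R\<^esub> x = I +>\<^sub>R x"
  unfolding a_r_coset_def r_coset_def self_module_def by simp

lemma set_add_self_module [simp]: "I <+>\<^bsub>self_module R\<^esub> J = I <+>\<^sub>R J"
  unfolding set_add_def set_mult_def self_module_def by simp

lemma submodule_self_module_iff:
  assumes "cring R"
  shows "submodule I R (self_module R) \<longleftrightarrow> ideal I R"
proof -
  interpret cring R by fact
  interpret M: module R "self_module R" by (rule module_self_module[OF assms])
  show ?thesis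
  proof
    assume I: "submodule I R (self_module R)"
    note E = M.submoduleE[OF I, simplified]
    show "ideal I R"
    proof (rule idealI[OF ring_axioms])
      show "subgroup I (add_monoid R)"
        by (rule add.subgroupI) (use E in \<open>auto simp: a_inv_def\<close>)
      show "a \<in> I \<Longrightarrow> x \<in> carrier R \<Longrightarrow> x \<otimes>\<^sub>R a \<in> I" for a x using E by auto
      then show "a \<in> I \<Longrightarrow> x \<in> carrier R \<Longrightarrow> a \<otimes>\<^sub>R x \<in> I" for a x
        using E(1) by (metis m_comm subsetD)
    qed
  next
    assume "ideal I R"
    then interpret ideal I R .
    show "submodule I R (self_module R)"
      by (rule M.submoduleI) (auto intro: I_l_closed)
  qed
qed

section \<open>Finite powers of modules and free modules\<close>

lemma power_module_simps:
  "carrier (power_module M n) = {..<n} \<rightarrow>\<^sub>E carrier M"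
  "\<zero>\<^bsub>power_module M n\<^esub> = (\<lambda>j\<in>{..<n}. \<zero>\<^sub>M)"
  "v \<oplus>\<^bsub>power_module M n\<^esub> w = (\<lambda>j\<in>{..<n}. v j \<oplus>\<^sub>M w j)"
  "r \<odot>\<^bsub>power_module M n\<^esub> v = (\<lambda>j\<in>{..<n}. r \<odot>\<^sub>M v j)"
  unfolding power_module_def by auto

lemma power_module_eqI:
  assumes "v \<in> carrier (power_module M n)" "w \<in> carrier (power_module M n)" "\<And>j. j < n \<Longrightarrow> v j = w j"
  shows "v = w"
  using assms by (intro extensionalityI[of v "{..<n}" w]) (auto simp: power_module_simps PiE_def)

lemma power_module_component: "v \<in> carrier (power_module M n) \<Longrightarrow> j < n \<Longrightarrow> v j \<in> carrier M"
  by (auto simp: power_module_simps)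

lemma module_power_module:
  assumes "module R M"
  shows "module R (power_module M n)"
proof -
  interpret module R M by fact
  show ?thesis
  proof (rule moduleI)
    show "abelian_group (power_module M n)"
    proof (rule abelian_groupI)
      fix v assume v: "v \<in> carrier (power_module M n)"
      note [simp] = power_module_component[OF v]
      show "\<exists>w\<in>carrier (power_module M n). w \<oplus>\<^bsub>power_module M n\<^esub> v = \<zero>\<^bsub>power_module M n\<^esub>"
        by (rule bexI[of _ "\<lambda>j\<in>{..<n}. \<ominus>\<^sub>M v j"])
          (use v in \<open>auto simp: power_module_simps l_neg fun_eq_iff\<close>)
      show "\<zero>\<^bsub>power_module M n\<^esub> \<oplus>\<^bsub>power_module M n\<^esub> v = v"
        by (rule power_module_eqI[of _ M n]) (use v in \<open>auto simp: power_module_simps\<close>)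
      fix w assume w: "w \<in> carrier (power_module M n)"
      note [simp] = power_module_component[OF w]
      show "v \<oplus>\<^bsub>power_module M n\<^esub> w \<in> carrier (power_module M n)"
        by (auto simp: power_module_simps)
      show "v \<oplus>\<^bsub>power_module M n\<^esub> w = w \<oplus>\<^bsub>power_module M n\<^esub> v"
        by (auto simp: power_module_simps a_comm intro!: restrict_ext)
      fix u assume u: "u \<in> carrier (power_module M n)"
      note [simp] = power_module_component[OF u]
      show "(v \<oplus>\<^bsub>power_module M n\<^esub> w) \<oplus>\<^bsub>power_module M n\<^esub> u =
          v \<oplus>\<^bsub>power_module M n\<^esub> (w \<oplus>\<^bsub>power_module M n\<^esub> u)"
        by (auto simp: power_module_simps a_assoc intro!: restrict_ext)
    qed (auto simp: power_module_simps)
    fix r v assume r: "r \<in> carrier R" and v: "v \<in> carrier (power_module M n)"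
    note [simp] = power_module_component[OF v]
    show "r \<odot>\<^bsub>power_module M n\<^esub> v \<in> carrier (power_module M n)"
      using r by (auto simp: power_module_simps)
    fix s assume s: "s \<in> carrier R"
    show "(r \<oplus>\<^sub>R s) \<odot>\<^bsub>power_module M n\<^esub> v = r \<odot>\<^bsub>power_module M n\<^esub> v \<oplus>\<^bsub>power_module M n\<^esub> s \<odot>\<^bsub>power_module M n\<^esub> v"
      using r s by (auto simp: power_module_simps smult_l_distr intro!: restrict_ext)
    show "(r \<otimes>\<^sub>R s) \<odot>\<^bsub>power_module M n\<^esub> v = r \<odot>\<^bsub>power_module M n\<^esub> (s \<odot>\<^bsub>power_module M n\<^esub> v)"
      using r s by (auto simp: power_module_simps smult_assoc1 intro!: restrict_ext)
  next
    fix r v w assume r: "r \<in> carrier R"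
      and v: "v \<in> carrier (power_module M n)" and w: "w \<in> carrier (power_module M n)"
    note [simp] = power_module_component[OF v] power_module_component[OF w]
    show "r \<odot>\<^bsub>power_module M n\<^esub> (v \<oplus>\<^bsub>power_module M n\<^esub> w) =
        r \<odot>\<^bsub>power_module M n\<^esub> v \<oplus>\<^bsub>power_module M n\<^esub> r \<odot>\<^bsub>power_module M n\<^esub> w"
      unfolding power_module_simps by (rule restrict_ext) (simp add: r smult_r_distr)
  next
    show "\<one>\<^sub>R \<odot>\<^bsub>power_module M n\<^esub> v = v" if v: "v \<in> carrier (power_module M n)" for v
      using v power_module_component[OF v]
      by (intro power_module_eqI[of _ M n]) (auto simp: power_module_simps)
  qed (rule is_cring)
qed

definition basis_vec :: "'a ring \<Rightarrow> nat \<Rightarrow> nat \<Rightarrow> (nat \<Rightarrow> 'a)" where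
  "basis_vec R n j = (\<lambda>l\<in>{..<n}. if l = j then \<one>\<^sub>R else \<zero>\<^sub>R)"

definition lin_comb :: "('a, 'b) module \<Rightarrow> nat \<Rightarrow> (nat \<Rightarrow> 'b) \<Rightarrow> (nat \<Rightarrow> 'a) \<Rightarrow> 'b" where
  "lin_comb M n c v = (\<Oplus>\<^sub>M j\<in>{..<n}. v j \<odot>\<^sub>M c j)"

abbreviation free_module :: "'a ring \<Rightarrow> nat \<Rightarrow> ('a, nat \<Rightarrow> 'a) module" where
  "free_module R n \<equiv> power_module (self_module R) n"

lemma free_module_simps:
  "carrier (free_module R n) = {..<n} \<rightarrow>\<^sub>E carrier R"
  "\<zero>\<^bsub>free_module R n\<^esub> = (\<lambda>j\<in>{..<n}. \<zero>\<^sub>R)"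
  "v \<oplus>\<^bsub>free_module R n\<^esub> w = (\<lambda>j\<in>{..<n}. v j \<oplus>\<^sub>R w j)"
  "r \<odot>\<^bsub>free_module R n\<^esub> v = (\<lambda>j\<in>{..<n}. r \<otimes>\<^sub>R v j)"
  by (auto simp: power_module_simps)

lemma module_free_module: "cring R \<Longrightarrow> module R (free_module R n)"
  by (intro module_power_module module_self_module)

lemma basis_vec_closed: "cring R \<Longrightarrow> basis_vec R n j \<in> carrier (free_module R n)"
  unfolding basis_vec_def by (auto simp: free_module_simps cring.cring_simprules)

lemma linear_on_lin_comb:
  assumes "module R M" and c: "\<And>j. j < n \<Longrightarrow> c j \<in> carrier M"
  shows "linear_on R (free_module R n) M (carrier (free_module R n)) (lin_comb M n c)"
proof -
  interpret module R M by fact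
  let ?F = "free_module R n"
  have vc: "v j \<odot>\<^sub>M c j \<in> carrier M" if "v \<in> carrier ?F" "j < n" for v j
    using that c by (auto simp: free_module_simps)
  show ?thesis
  proof (rule linear_onI)
    fix v assume v: "v \<in> carrier ?F"
    note [simp] = power_module_component[OF v, simplified]
    then show "lin_comb M n c v \<in> carrier M"
      unfolding lin_comb_def by (intro M.finsum_closed Pi_I vc[OF v]) auto
    show "lin_comb M n c (r \<odot>\<^bsub>?F\<^esub> v) = r \<odot>\<^sub>M lin_comb M n c v" if r: "r \<in> carrier R" for r
    proof -
      have "r \<odot>\<^sub>M lin_comb M n c v = (\<Oplus>\<^sub>M j\<in>{..<n}. r \<odot>\<^sub>M (v j \<odot>\<^sub>M c j))"
        unfolding lin_comb_def by (rule finsum_smult_ldistr) (use v r vc in auto)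
      also have "\<dots> = lin_comb M n c (r \<odot>\<^bsub>?F\<^esub> v)"
        unfolding lin_comb_def
        by (rule M.finsum_cong') (use r c in \<open>auto simp: free_module_simps smult_assoc1\<close>)
      finally show ?thesis by simp
    qed
    fix w assume w: "w \<in> carrier ?F"
    note [simp] = power_module_component[OF w, simplified]
    have "lin_comb M n c v \<oplus>\<^sub>M lin_comb M n c w = (\<Oplus>\<^sub>M j\<in>{..<n}. v j \<odot>\<^sub>M c j \<oplus>\<^sub>M w j \<odot>\<^sub>M c j)"
      unfolding lin_comb_def by (rule M.finsum_addf[symmetric]) (use v w vc in auto)
    also have "\<dots> = lin_comb M n c (v \<oplus>\<^bsub>?F\<^esub> w)"
      unfolding lin_comb_def
      by (rule M.finsum_cong') (use c in \<open>auto simp: free_module_simps smult_l_distr\<close>)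
    finally show "lin_comb M n c (v \<oplus>\<^bsub>?F\<^esub> w) = lin_comb M n c v \<oplus>\<^sub>M lin_comb M n c w" by simp
  qed
qed

lemma linear_eq_lin_comb:
  assumes "module R M" and g: "linear_on R (free_module R n) M (carrier (free_module R n)) g"
    and v: "v \<in> carrier (free_module R n)"
  shows "g v = lin_comb M n (\<lambda>j. g (basis_vec R n j)) v"
proof -
  interpret module R M by fact
  interpret F: module R "free_module R n" by (rule module_free_module[OF R.is_cring])
  have gb: "g (basis_vec R n j) \<in> carrier M" for j
    by (rule linear_on_closed[OF g basis_vec_closed[OF R.is_cring]])
  note vc = power_module_component[OF v, simplified]
  \<comment> \<open>\<open>tr k\<close> keeps the first k coordinates of v. Adding one basis vector
    at a time gives the formula without a finite sum in the free module.\<close>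
  define tr where "tr k = (\<lambda>l\<in>{..<n}. if l < k then v l else \<zero>\<^sub>R)" for k
  have tr: "tr k \<in> carrier (free_module R n)" for k
    unfolding tr_def using vc by (auto simp: free_module_simps)
  have "k \<le> n \<Longrightarrow> g (tr k) = (\<Oplus>\<^sub>M j\<in>{..<k}. v j \<odot>\<^sub>M g (basis_vec R n j))" for k
  proof (induction k)
    case 0
    have "tr 0 = \<zero>\<^bsub>free_module R n\<^esub>" by (auto simp: tr_def free_module_simps fun_eq_iff)
    then show ?case
      using linear_on_zero[OF F.module_axioms module_axioms F.carrier_is_submodule g] by simp
  next
    case (Suc k)
    then have vk: "v k \<in> carrier R" and vj: "\<And>j. j < k \<Longrightarrow> v j \<in> carrier R"
      using vc by auto
    have "tr (Suc k) = v k \<odot>\<^bsub>free_module R n\<^esub> basis_vec R n k \<oplus>\<^bsub>free_module R n\<^esub> tr k"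
    proof (rule power_module_eqI[OF tr])
      show "v k \<odot>\<^bsub>free_module R n\<^esub> basis_vec R n k \<oplus>\<^bsub>free_module R n\<^esub> tr k \<in> carrier (free_module R n)"
        by (intro F.a_closed F.smult_closed vk tr basis_vec_closed[OF R.is_cring])
      show "tr (Suc k) j = (v k \<odot>\<^bsub>free_module R n\<^esub> basis_vec R n k \<oplus>\<^bsub>free_module R n\<^esub> tr k) j"
        if "j < n" for j
        using that vk vj by (auto simp: tr_def free_module_simps(3,4) basis_vec_def less_Suc_eq)
    qed
    then have "g (tr (Suc k)) = v k \<odot>\<^sub>M g (basis_vec R n k) \<oplus>\<^sub>M g (tr k)"
      using linear_on_add[OF g] linear_on_smult[OF g] tr vk basis_vec_closed[OF R.is_cring]
      by simp
    then show ?case using Suc vk vj gb by (simp add: lessThan_Suc Pi_def)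
  qed
  moreover have "tr n = v"
    by (rule power_module_eqI[OF tr v]) (auto simp: tr_def)
  ultimately show ?thesis by (metis lin_comb_def order_refl)
qed

lemma lin_comb_basis_vec:
  assumes "module R M" "\<And>j. j < n \<Longrightarrow> c j \<in> carrier M" "j < n"
  shows "lin_comb M n c (basis_vec R n j) = c j"
proof -
  interpret module R M by fact
  have "lin_comb M n c (basis_vec R n j) = (\<Oplus>\<^sub>M l\<in>{..<n}. if j = l then c l else \<zero>\<^sub>M)"
    unfolding lin_comb_def basis_vec_def by (rule M.finsum_cong') (use assms(2) in auto)
  also have "\<dots> = c j" using M.finsum_singleton[of j "{..<n}" c] assms(2,3) by (auto simp: Pi_def)
  finally show ?thesis .
qed

lemma linear_eqI:
  assumes "module R M"
    and "linear_on R (free_module R n) M (carrier (free_module R n)) f"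
    and "linear_on R (free_module R n) M (carrier (free_module R n)) g"
    and "\<And>j. j < n \<Longrightarrow> f (basis_vec R n j) = g (basis_vec R n j)"
    and "v \<in> carrier (free_module R n)"
  shows "f v = g v"
proof -
  interpret module R M by fact
  have "lin_comb M n (\<lambda>j. f (basis_vec R n j)) v = lin_comb M n (\<lambda>j. g (basis_vec R n j)) v"
    unfolding lin_comb_def
    by (rule M.finsum_cong')
      (use assms(4,5) linear_on_closed[OF assms(3) basis_vec_closed[OF R.is_cring]]
        power_module_component[OF assms(5)] in auto)
  then show ?thesis
    using linear_eq_lin_comb[OF assms(1,2,5)] linear_eq_lin_comb[OF assms(1,3,5)] by simp
qed

section \<open>Matrices acting on free modules, and their transposes acting on tuples\<close>

lemma matrix_map_component:
  assumes "cring R" "\<And>j. j < q \<Longrightarrow> A l j \<in> carrier R" "v \<in> carrier (free_module R q)" "l < p"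
  shows "matrix_map R p q A v l = lin_comb (self_module R) q (A l) v"
proof -
  interpret cring R by fact
  show ?thesis
    unfolding matrix_map_def lin_comb_def using assms(2-4)
    by (auto simp: free_module_simps intro!: finsum_cong' m_comm)
qed

lemma linear_on_tuple:
  assumes "\<And>j. j < q \<Longrightarrow> linear_on R M N K (f j)"
  shows "linear_on R M (power_module N q) K (\<lambda>x. \<lambda>j\<in>{..<q}. f j x)"
  using linear_on_closed[OF assms] linear_on_add[OF assms] linear_on_smult[OF assms]
  by (intro linear_onI) (auto simp: power_module_simps intro!: restrict_ext)

lemma linear_on_cong: "(\<And>x. x \<in> K \<Longrightarrow> f x = g x) \<Longrightarrow> linear_on R M N K g \<Longrightarrow>
    (\<And>x y. x \<in> K \<Longrightarrow> y \<in> K \<Longrightarrow> x \<oplus>\<^sub>M y \<in> K) \<Longrightarrow> (\<And>r x. r \<in> carrier R \<Longrightarrow> x \<in> K \<Longrightarrow> r \<odot>\<^sub>M x \<in> K) \<Longrightarrow>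
    linear_on R M N K f"
  unfolding linear_on_def by (auto simp: Pi_iff)

lemma linear_on_matrix_map:
  assumes "cring R" and A: "\<And>l j. l < p \<Longrightarrow> j < q \<Longrightarrow> A l j \<in> carrier R"
  shows "linear_on R (free_module R q) (free_module R p) (carrier (free_module R q)) (matrix_map R p q A)"
proof -
  interpret S: module R "self_module R" by (rule module_self_module[OF assms(1)])
  interpret F: module R "free_module R q" by (rule module_free_module[OF assms(1)])
  have comp: "matrix_map R p q A v l = lin_comb (self_module R) q (A l) v"
    if "l < p" "v \<in> carrier (free_module R q)" for v l
    using matrix_map_component[where A = A, OF assms(1) A[OF that(1)] that(2,1)] .
  have lin: "linear_on R (free_module R q) (self_module R) (carrier (free_module R q))
      (lin_comb (self_module R) q (A l))" if "l < p" for l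
    by (rule linear_on_lin_comb[OF S.module_axioms]) (use A that in auto)
  show ?thesis
  proof (rule linear_on_cong[OF _ linear_on_tuple[OF lin]])
    fix v assume "v \<in> carrier (free_module R q)"
    then show "matrix_map R p q A v = (\<lambda>l\<in>{..<p}. lin_comb (self_module R) q (A l) v)"
      using comp by (simp add: matrix_map_def fun_eq_iff)
  qed (assumption | rule F.a_closed F.smult_closed)+
qed

lemma matrix_map_basis_vec:
  assumes "cring R" and "\<And>l j. l < p \<Longrightarrow> j < q \<Longrightarrow> A l j \<in> carrier R" and "j < q"
  shows "matrix_map R p q A (basis_vec R q j) = (\<lambda>l\<in>{..<p}. A l j)"
proof -
  have "matrix_map R p q A (basis_vec R q j) l = A l j" if "l < p" for l
  proof -
    note A = assms(2)[OF that]
    have "matrix_map R p q A (basis_vec R q j) l = lin_comb (self_module R) q (A l) (basis_vec R q j)"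
      by (rule matrix_map_component[where A = A, OF assms(1) A basis_vec_closed[OF assms(1)] that])
    also have "\<dots> = A l j"
      by (rule lin_comb_basis_vec[OF module_self_module[OF assms(1)] _ assms(3)]) (use A in simp)
    finally show ?thesis .
  qed
  then show ?thesis by (simp add: fun_eq_iff matrix_map_def)
qed

text \<open>The transposed matrix acts on tuples over \<open>C\<close> as precomposition acts on homomorphisms.\<close>

lemma lin_comb_hom_differential:
  assumes "module R C" and D: "\<And>l j. l < n i \<Longrightarrow> j < n (Suc i) \<Longrightarrow> D i l j \<in> carrier R"
    and c: "\<And>l. l < n i \<Longrightarrow> c l \<in> carrier C" and v: "v \<in> carrier (free_module R (n (Suc i)))"
  shows "lin_comb C (n (Suc i)) (hom_differential C n D i c) v =
         lin_comb C (n i) c (matrix_map R (n i) (n (Suc i)) (D i) v)" (is "?l v = ?r v")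
proof -
  interpret module R C by fact
  let ?d = "matrix_map R (n i) (n (Suc i)) (D i)"
  have d: "linear_on R (free_module R (n (Suc i))) (free_module R (n i))
      (carrier (free_module R (n (Suc i)))) ?d"
    by (rule linear_on_matrix_map[OF R.is_cring]) (rule D)
  have hc: "hom_differential C n D i c j \<in> carrier C" if "j < n (Suc i)" for j
    unfolding hom_differential_def using that D c by (auto intro!: M.finsum_closed)
  show ?thesis
  proof (rule linear_eqI[OF module_axioms _ _ _ v])
    show "linear_on R (free_module R (n (Suc i))) C (carrier (free_module R (n (Suc i)))) ?l"
      by (rule linear_on_lin_comb[OF module_axioms hc])
    show "linear_on R (free_module R (n (Suc i))) C (carrier (free_module R (n (Suc i)))) ?r"
      by (rule linear_on_compose[OF d linear_on_lin_comb[OF module_axioms c]])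
         (use linear_on_closed[OF d] in auto)
    fix j assume j: "j < n (Suc i)"
    show "?l (basis_vec R (n (Suc i)) j) = ?r (basis_vec R (n (Suc i)) j)"
    proof -
      have "?r (basis_vec R (n (Suc i)) j) = lin_comb C (n i) c (\<lambda>l\<in>{..<n i}. D i l j)"
        using matrix_map_basis_vec[where A = "D i" and p = "n i", OF R.is_cring D j] by (simp only:)
      also have "\<dots> = hom_differential C n D i c j"
        unfolding lin_comb_def hom_differential_def using j c D[OF _ j]
        by (auto intro!: M.finsum_cong')
      finally show ?thesis using lin_comb_basis_vec[OF module_axioms hc j] by simp
    qed
  qed
qed

lemma linear_on_lin_comb_coeff:
  assumes "module R C" and v: "v \<in> carrier (free_module R n)"
  shows "linear_on R (power_module C n) C (carrier (power_module C n)) (\<lambda>c. lin_comb C n c v)"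
proof -
  interpret module R C by fact
  note vc = power_module_component[OF v, simplified]
  show ?thesis
  proof (rule linear_onI)
    fix c assume c: "c \<in> carrier (power_module C n)"
    note cc = power_module_component[OF c]
    have t: "v j \<odot>\<^sub>C c j \<in> carrier C" if "j < n" for j using cc vc that by simp
    show "lin_comb C n c v \<in> carrier C"
      unfolding lin_comb_def by (intro M.finsum_closed Pi_I t) simp
    show "lin_comb C n (r \<odot>\<^bsub>power_module C n\<^esub> c) v = r \<odot>\<^sub>C lin_comb C n c v" if r: "r \<in> carrier R" for r
    proof -
      have "r \<odot>\<^sub>C lin_comb C n c v = (\<Oplus>\<^sub>C j\<in>{..<n}. r \<odot>\<^sub>C (v j \<odot>\<^sub>C c j))"
        unfolding lin_comb_def by (rule finsum_smult_ldistr) (use r t in auto)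
      also have "\<dots> = lin_comb C n (r \<odot>\<^bsub>power_module C n\<^esub> c) v"
        unfolding lin_comb_def
        by (rule M.finsum_cong')
          (use vc cc r smult_left_commute in \<open>auto simp: power_module_simps(4)\<close>)
      finally show ?thesis by simp
    qed
    fix c' assume c': "c' \<in> carrier (power_module C n)"
    note cc' = power_module_component[OF c']
    have "lin_comb C n c v \<oplus>\<^sub>C lin_comb C n c' v = (\<Oplus>\<^sub>C j\<in>{..<n}. v j \<odot>\<^sub>C c j \<oplus>\<^sub>C v j \<odot>\<^sub>C c' j)"
      unfolding lin_comb_def by (rule M.finsum_addf[symmetric]) (use vc cc cc' in auto)
    also have "\<dots> = lin_comb C n (c \<oplus>\<^bsub>power_module C n\<^esub> c') v"
      unfolding lin_comb_def
      by (rule M.finsum_cong')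
        (use vc cc cc' in \<open>auto simp: power_module_simps(3) smult_r_distr\<close>)
    finally show "lin_comb C n (c \<oplus>\<^bsub>power_module C n\<^esub> c') v = lin_comb C n c v \<oplus>\<^sub>C lin_comb C n c' v"
      by simp
  qed
qed

lemma linear_on_hom_differential:
  assumes "module R C" and D: "\<And>l j. l < n i \<Longrightarrow> j < n (Suc i) \<Longrightarrow> D i l j \<in> carrier R"
  shows "linear_on R (power_module C (n i)) (power_module C (n (Suc i)))
    (carrier (power_module C (n i))) (hom_differential C n D i)"
proof -
  interpret module R C by fact
  interpret P: module R "power_module C (n i)" by (rule module_power_module) fact
  \<comment> \<open>\<open>col j\<close> is the j-th column of \<open>D i\<close>, so the j-th
    component of the differential is a linear combination of the entries of c with fixed
    coefficients.\<close>
  define col where "col j = (\<lambda>l\<in>{..<n i}. D i l j)" for j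
  have col: "col j \<in> carrier (free_module R (n i))" if "j < n (Suc i)" for j
    unfolding col_def using D that by (auto simp: free_module_simps)
  show ?thesis
  proof (rule linear_on_cong[OF _ linear_on_tuple[OF linear_on_lin_comb_coeff[OF assms(1) col]]])
    fix c assume c: "c \<in> carrier (power_module C (n i))"
    have "(\<Oplus>\<^sub>C l\<in>{..<n i}. D i l j \<odot>\<^sub>C c l) = lin_comb C (n i) c (col j)" if "j < n (Suc i)" for j
      unfolding lin_comb_def col_def
      by (rule M.finsum_cong') (use D that power_module_component[OF c] in auto)
    then show "hom_differential C n D i c = (\<lambda>j\<in>{..<n (Suc i)}. lin_comb C (n i) c (col j))"
      unfolding hom_differential_def by (intro restrict_ext) simp
  qed (assumption | rule P.a_closed P.smult_closed)+
qed

text \<open>Projectivity of a free module: preimages for the images of the basis vectors determine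
  the lift.\<close>

lemma linear_lift:
  assumes "module R M" "module R N" "linear_on R M N (carrier M) p" "p ` carrier M = L"
    and f: "linear_on R (free_module R n) N (carrier (free_module R n)) f"
    and img: "f ` carrier (free_module R n) \<subseteq> L"
  obtains g where "linear_on R (free_module R n) M (carrier (free_module R n)) g"
    "\<And>v. v \<in> carrier (free_module R n) \<Longrightarrow> p (g v) = f v"
proof -
  interpret module R M by fact
  have "\<exists>y\<in>carrier M. p y = f (basis_vec R n j)" for j
    using img assms(4) basis_vec_closed[OF R.is_cring, of n j] by force
  then obtain c where c: "\<And>j. c j \<in> carrier M" "\<And>j. p (c j) = f (basis_vec R n j)" by metis
  have g: "linear_on R (free_module R n) M (carrier (free_module R n)) (lin_comb M n c)"
    by (rule linear_on_lin_comb[OF assms(1)]) (rule c)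
  have "p (lin_comb M n c v) = f v" if "v \<in> carrier (free_module R n)" for v
    by (rule linear_eqI[OF assms(2) linear_on_compose[OF g assms(3)] f _ that])
       (use linear_on_closed[OF g] lin_comb_basis_vec[OF assms(1)] c in auto)
  then show ?thesis using that g by blast
qed

section \<open>Ext of the residue field in low degrees\<close>

locale resolution =
  fixes R :: "'a ring" and m :: "'a set" and C :: "('a, 'b) module"
    and n :: "nat \<Rightarrow> nat" and D :: "nat \<Rightarrow> nat \<Rightarrow> nat \<Rightarrow> 'a" and e :: "nat \<Rightarrow> 'a set"
  assumes C: "module R C" and m: "maximalideal m R"
    and res: "free_resolution R (quot_module (self_module R) m) n D e"
begin

sublocale C: module R C by (rule C)
sublocale m: maximalideal m R by (rule m)

abbreviation F where "F i \<equiv> free_module R (n i)"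
abbreviation d where "d i \<equiv> matrix_map R (n i) (n (Suc i)) (D i)"
abbreviation k where "k \<equiv> quot_module (self_module R) m"

lemma cring: "cring R" ..

sublocale S: module R "self_module R" by (rule module_self_module[OF cring])
sublocale F: module R "F i" for i by (rule module_free_module[OF cring])
sublocale P: module R "power_module C (n i)" for i by (rule module_power_module[OF C])

lemma m_submodule: "submodule m R (self_module R)"
  using submodule_self_module_iff[OF cring] m.is_ideal by simp

lemma m_carrier: "a \<in> m \<Longrightarrow> a \<in> carrier R" by (rule m.a_Hcarr)

sublocale k: module R k by (rule module_quot_module[OF S.module_axioms m_submodule])

lemma D_closed: "l < n i \<Longrightarrow> j < n (Suc i) \<Longrightarrow> D i l j \<in> carrier R"
  and e_closed: "j < n 0 \<Longrightarrow> e j \<in> carrier k"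
  and aug_image: "lin_comb k (n 0) e ` carrier (F 0) = carrier k"
  and aug_exact: "{v \<in> carrier (F 0). lin_comb k (n 0) e v = \<zero>\<^sub>k} = d 0 ` carrier (F 1)"
  and d_exact: "{v \<in> carrier (F (Suc i)). d i v = \<zero>\<^bsub>F i\<^esub>} = d (Suc i) ` carrier (F (Suc (Suc i)))"
  using res unfolding free_resolution_def Let_def lin_comb_def by auto

lemma d_linear: "linear_on R (F (Suc i)) (F i) (carrier (F (Suc i))) (d i)"
  by (rule linear_on_matrix_map[OF cring D_closed])

lemma d_closed: "v \<in> carrier (F (Suc i)) \<Longrightarrow> d i v \<in> carrier (F i)"
  by (rule linear_on_closed[OF d_linear])

lemma d_d: "v \<in> carrier (F (Suc (Suc i))) \<Longrightarrow> d i (d (Suc i) v) = \<zero>\<^bsub>F i\<^esub>"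
  using d_exact[of i] by auto

lemma basis_closed: "basis_vec R (n i) j \<in> carrier (F i)"
  by (rule basis_vec_closed[OF cring])

definition coef :: "nat \<Rightarrow> 'a" where
  "coef j = (SOME c. c \<in> carrier R \<and> m +>\<^sub>R c = e j)"

text \<open>A lift of the augmentation from the residue field to R. It turns the kernel of the
  augmentation into the set of vectors with \<open>rho v\<close> in m, where one can compute with
  elements instead of cosets.\<close>

definition rho :: "(nat \<Rightarrow> 'a) \<Rightarrow> 'a" where
  "rho = lin_comb (self_module R) (n 0) coef"

lemma coef: "j < n 0 \<Longrightarrow> coef j \<in> carrier R \<and> m +>\<^sub>R coef j = e j"
proof -
  assume "j < n 0"
  then have "\<exists>c. c \<in> carrier R \<and> m +>\<^sub>R c = e j"
    using e_closed by (force simp: quot_module_simps[OF S.module_axioms m_submodule])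
  then show ?thesis unfolding coef_def by (rule someI_ex)
qed

lemma rho_linear: "linear_on R (F 0) (self_module R) (carrier (F 0)) rho"
  unfolding rho_def by (rule linear_on_lin_comb[OF S.module_axioms]) (use coef in auto)

lemma rho_closed: "v \<in> carrier (F 0) \<Longrightarrow> rho v \<in> carrier R"
  using linear_on_closed[OF rho_linear] by simp

lemma aug_eq: "v \<in> carrier (F 0) \<Longrightarrow> lin_comb k (n 0) e v = m +>\<^sub>R rho v"
proof -
  assume v: "v \<in> carrier (F 0)"
  have c: "linear_on R (self_module R) k (carrier R) (\<lambda>x. m +>\<^sub>R x)"
    using linear_on_coset[OF S.module_axioms m_submodule] by simp
  show ?thesis
  proof (rule linear_eqI[OF k.module_axioms linear_on_lin_comb[OF k.module_axioms e_closed] _ _ v])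
    show "linear_on R (F 0) k (carrier (F 0)) (\<lambda>x. m +>\<^sub>R rho x)"
      by (rule linear_on_compose[OF rho_linear c]) (use rho_closed in auto)
    fix j assume j: "j < n 0"
    show "lin_comb k (n 0) e (basis_vec R (n 0) j) = m +>\<^sub>R rho (basis_vec R (n 0) j)"
      using lin_comb_basis_vec[OF k.module_axioms e_closed j] coef[OF j]
        lin_comb_basis_vec[OF S.module_axioms _ j, of coef] coef by (simp add: rho_def)
  qed
qed

lemma coset_eq_zero_iff: "a \<in> carrier R \<Longrightarrow> m +>\<^sub>R a = \<zero>\<^sub>k \<longleftrightarrow> a \<in> m"
  using coset_eq_self_iff[OF S.module_axioms m_submodule, of a]
  by (simp add: quot_module_simps[OF S.module_axioms m_submodule])

lemma rho_exact: "d 0 ` carrier (F 1) = {v \<in> carrier (F 0). rho v \<in> m}"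
proof -
  have "{v \<in> carrier (F 0). lin_comb k (n 0) e v = \<zero>\<^sub>k} = {v \<in> carrier (F 0). rho v \<in> m}"
    by (rule Collect_cong) (metis aug_eq coset_eq_zero_iff rho_closed)
  then show ?thesis using aug_exact by simp
qed

text \<open>Surjectivity of the augmentation gives \<open>rho v1\<close> equal to 1 only modulo m.
  The error \<mu> is carried along, because the ring need not be local and 1 + \<mu> need not be
  invertible.\<close>

lemma unit_vector: obtains v1 \<mu> where "v1 \<in> carrier (F 0)" "\<mu> \<in> m" "rho v1 = \<one>\<^sub>R \<oplus>\<^sub>R \<mu>"
proof -
  have "m +>\<^sub>R \<one>\<^sub>R \<in> carrier k"
    by (auto simp: quot_module_simps[OF S.module_axioms m_submodule])
  then obtain v1 where v1: "v1 \<in> carrier (F 0)" "m +>\<^sub>R rho v1 = m +>\<^sub>R \<one>\<^sub>R"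
    using aug_image aug_eq by (metis (no_types, lifting) imageE)
  then have "rho v1 \<ominus>\<^sub>R \<one>\<^sub>R \<in> m"
    using coset_eq_iff[OF S.module_axioms m_submodule, of "rho v1" "\<one>\<^sub>R"] rho_closed by simp
  moreover have "rho v1 = \<one>\<^sub>R \<oplus>\<^sub>R (rho v1 \<ominus>\<^sub>R \<one>\<^sub>R)"
    using rho_closed[OF v1(1)] by (metis C.R.a_comm C.R.minus_closed C.R.one_closed C.R.sub_add_cancel)
  ultimately show ?thesis using that v1(1) by blast
qed

text \<open>Together with \<open>lin_comb\<close> this identifies the linear maps from
  \<open>F i\<close> to C with the tuples on which the Ext modules are built.\<close>

definition tuple :: "nat \<Rightarrow> ((nat \<Rightarrow> 'a) \<Rightarrow> 'b) \<Rightarrow> nat \<Rightarrow> 'b" where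
  "tuple i g = (\<lambda>j\<in>{..<n i}. g (basis_vec R (n i) j))"

lemma lin_comb_linear:
  "c \<in> carrier (power_module C (n i)) \<Longrightarrow> linear_on R (F i) C (carrier (F i)) (lin_comb C (n i) c)"
  by (rule linear_on_lin_comb[OF C]) (rule power_module_component)

lemma tuple_closed:
  "linear_on R (F i) C (carrier (F i)) g \<Longrightarrow> tuple i g \<in> carrier (power_module C (n i))"
  unfolding tuple_def using linear_on_closed[OF _ basis_closed]
  by (auto simp: power_module_simps)

lemma lin_comb_tuple:
  assumes g: "linear_on R (F i) C (carrier (F i)) g" and v: "v \<in> carrier (F i)"
  shows "lin_comb C (n i) (tuple i g) v = g v"
  by (rule linear_eqI[OF C lin_comb_linear[OF tuple_closed[OF g]] g _ v])
     (use lin_comb_basis_vec[OF C] power_module_component[OF tuple_closed[OF g]] in \<open>auto simp: tuple_def\<close>)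

lemma tuple_lin_comb:
  assumes c: "c \<in> carrier (power_module C (n i))"
  shows "tuple i (lin_comb C (n i) c) = c"
proof (rule power_module_eqI[OF tuple_closed[OF lin_comb_linear[OF c]] c])
  fix j assume j: "j < n i"
  then show "tuple i (lin_comb C (n i) c) j = c j"
    using lin_comb_basis_vec[OF C power_module_component[OF c] j] by (simp add: tuple_def)
qed

lemma hom_differential_linear:
  "linear_on R (power_module C (n i)) (power_module C (n (Suc i))) (carrier (power_module C (n i)))
     (hom_differential C n D i)"
  by (rule linear_on_hom_differential[where D = D, OF C D_closed])

lemma hom_differential_eq:
  assumes c: "c \<in> carrier (power_module C (n i))"
  shows "hom_differential C n D i c = tuple (Suc i) (\<lambda>w. lin_comb C (n i) c (d i w))"
proof (rule power_module_eqI)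
  show l: "hom_differential C n D i c \<in> carrier (power_module C (n (Suc i)))"
    by (rule linear_on_closed[OF hom_differential_linear c])
  have lin: "linear_on R (F (Suc i)) C (carrier (F (Suc i))) (\<lambda>w. lin_comb C (n i) c (d i w))"
    by (rule linear_on_compose[OF d_linear lin_comb_linear[OF c]]) (use d_closed in auto)
  show "tuple (Suc i) (\<lambda>w. lin_comb C (n i) c (d i w)) \<in> carrier (power_module C (n (Suc i)))"
    by (rule tuple_closed[OF lin])
  fix j assume j: "j < n (Suc i)"
  show "hom_differential C n D i c j = tuple (Suc i) (\<lambda>w. lin_comb C (n i) c (d i w)) j"
  proof -
    have "lin_comb C (n (Suc i)) (hom_differential C n D i c) (basis_vec R (n (Suc i)) j) =
        lin_comb C (n i) c (d i (basis_vec R (n (Suc i)) j))"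
      by (rule lin_comb_hom_differential[where D = D, OF C D_closed power_module_component[OF c] basis_closed])
    then show ?thesis
      using lin_comb_basis_vec[OF C power_module_component[OF l] j] j by (simp add: tuple_def)
  qed
qed

lemma cocycle_iff:
  "c \<in> hom_cocycles C n D i \<longleftrightarrow> c \<in> carrier (power_module C (n i)) \<and>
     (\<forall>w\<in>carrier (F (Suc i)). lin_comb C (n i) c (d i w) = \<zero>\<^sub>C)"
proof (cases "c \<in> carrier (power_module C (n i))")
  case c: True
  have lin: "linear_on R (F (Suc i)) C (carrier (F (Suc i))) (\<lambda>w. lin_comb C (n i) c (d i w))"
    by (rule linear_on_compose[OF d_linear lin_comb_linear[OF c]]) (use d_closed in auto)
  have z: "lin_comb C (n (Suc i)) \<zero>\<^bsub>power_module C (n (Suc i))\<^esub> w = \<zero>\<^sub>C"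
    if "w \<in> carrier (F (Suc i))" for w
    using linear_on_zero[OF P.module_axioms C P.carrier_is_submodule linear_on_lin_comb_coeff[OF C that]] .
  have "hom_differential C n D i c = \<zero>\<^bsub>power_module C (n (Suc i))\<^esub> \<longleftrightarrow>
     (\<forall>w\<in>carrier (F (Suc i)). lin_comb C (n i) c (d i w) = \<zero>\<^sub>C)" (is "?l \<longleftrightarrow> ?r")
  proof
    assume ?l
    then show ?r using lin_comb_tuple[OF lin] z hom_differential_eq[OF c] by metis
  next
    assume ?r
    then show ?l
      unfolding hom_differential_eq[OF c] tuple_def power_module_simps(2)
      by (intro restrict_ext) (use basis_closed in simp)
  qed
  then show ?thesis using c by (simp add: hom_cocycles_def)
qed (simp add: hom_cocycles_def)

lemma coboundary_Suc_iff:
  "c \<in> hom_coboundaries C n D (Suc i) \<longleftrightarrow>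
    (\<exists>g. linear_on R (F i) C (carrier (F i)) g \<and> c = tuple (Suc i) (\<lambda>w. g (d i w)))"
proof
  assume "c \<in> hom_coboundaries C n D (Suc i)"
  then obtain b where b: "b \<in> carrier (power_module C (n i))" "c = hom_differential C n D i b"
    by (auto simp: hom_coboundaries_def)
  then show "\<exists>g. linear_on R (F i) C (carrier (F i)) g \<and> c = tuple (Suc i) (\<lambda>w. g (d i w))"
    using hom_differential_eq[OF b(1)] lin_comb_linear[OF b(1)] by blast
next
  assume "\<exists>g. linear_on R (F i) C (carrier (F i)) g \<and> c = tuple (Suc i) (\<lambda>w. g (d i w))"
  then obtain g where g: "linear_on R (F i) C (carrier (F i)) g" "c = tuple (Suc i) (\<lambda>w. g (d i w))"
    by blast
  have "c = hom_differential C n D i (tuple i g)"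
    unfolding hom_differential_eq[OF tuple_closed[OF g(1)]] g(2) tuple_def[of "Suc i"]
    by (intro restrict_ext) (use lin_comb_tuple[OF g(1) d_closed[OF basis_closed]] in simp)
  then show "c \<in> hom_coboundaries C n D (Suc i)"
    using tuple_closed[OF g(1)] by (auto simp: hom_coboundaries_def)
qed

lemma cocycles_submodule: "submodule (hom_cocycles C n D i) R (power_module C (n i))"
  unfolding hom_cocycles_def
  by (rule linear_on_kernel[OF P.module_axioms P.module_axioms P.carrier_is_submodule hom_differential_linear])

abbreviation Z where "Z i \<equiv> (power_module C (n i))\<lparr>carrier := hom_cocycles C n D i\<rparr>"

sublocale Z: module R "Z i" for i
  by (rule submodule.submodule_is_module[OF cocycles_submodule P.module_axioms])

lemma coboundaries_subset: "hom_coboundaries C n D i \<subseteq> hom_cocycles C n D i"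
proof (cases i)
  case 0
  then show ?thesis using submodule_zero[OF cocycles_submodule] by (simp add: hom_coboundaries_def)
next
  case (Suc j)
  show ?thesis
  proof
    fix c assume "c \<in> hom_coboundaries C n D i"
    then obtain g where g: "linear_on R (F j) C (carrier (F j)) g" "c = tuple (Suc j) (\<lambda>w. g (d j w))"
      using coboundary_Suc_iff Suc by blast
    have lin: "linear_on R (F (Suc j)) C (carrier (F (Suc j))) (\<lambda>w. g (d j w))"
      by (rule linear_on_compose[OF d_linear g(1)]) (use d_closed in auto)
    have "g \<zero>\<^bsub>F j\<^esub> = \<zero>\<^sub>C"
      by (rule linear_on_zero[OF F.module_axioms C F.carrier_is_submodule g(1)])
    then have "lin_comb C (n (Suc j)) c (d (Suc j) w) = \<zero>\<^sub>C" if "w \<in> carrier (F (Suc (Suc j)))" for w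
      using lin_comb_tuple[OF lin d_closed[OF that]] d_d[OF that] g(2) by simp
    then show "c \<in> hom_cocycles C n D i"
      unfolding cocycle_iff using tuple_closed[OF lin] g(2) Suc by simp
  qed
qed

lemma coboundaries_submodule: "submodule (hom_coboundaries C n D i) R (Z i)"
proof -
  have *: "submodule (hom_coboundaries C n D i) R (power_module C (n i))"
  proof (cases i)
    case 0
    then show ?thesis unfolding hom_coboundaries_def by (auto intro!: P.submoduleI)
  next
    case (Suc j)
    then show ?thesis
      using linear_on_image[OF P.module_axioms P.module_axioms P.carrier_is_submodule hom_differential_linear]
      by (simp add: hom_coboundaries_def)
  qed
  note E = P.submoduleE[OF *]
  have inv: "\<ominus>\<^bsub>Z i\<^esub> c = \<ominus>\<^bsub>power_module C (n i)\<^esub> c" if "c \<in> hom_cocycles C n D i" for c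
  proof -
    have c: "c \<in> carrier (power_module C (n i))" and c': "\<ominus>\<^bsub>power_module C (n i)\<^esub> c \<in> hom_cocycles C n D i"
      using P.submoduleE(1,3)[OF cocycles_submodule] that by auto
    show ?thesis
      by (rule Z.minus_equality) (use that c c' P.l_neg in auto)
  qed
  show ?thesis
    by (rule Z.submoduleI)
       (use E coboundaries_subset submodule_zero[OF *] inv in \<open>auto simp: subset_iff\<close>)
qed

lemma Ext_trivial_iff:
  "carrier (Ext_module C n D i) = {\<zero>\<^bsub>Ext_module C n D i\<^esub>} \<longleftrightarrow>
     hom_cocycles C n D i \<subseteq> hom_coboundaries C n D i"
proof -
  note q = quot_module_simps[OF Z.module_axioms coboundaries_submodule]
  have "x \<in> hom_cocycles C n D i \<Longrightarrow> hom_coboundaries C n D i +>\<^bsub>Z i\<^esub> x = hom_coboundaries C n D i \<longleftrightarrow>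
      x \<in> hom_coboundaries C n D i" for x
    using coset_eq_self_iff[OF Z.module_axioms coboundaries_submodule] by simp
  moreover have "hom_cocycles C n D i \<noteq> {}"
    using submodule_zero[OF cocycles_submodule] by auto
  ultimately show ?thesis unfolding Ext_module_def q by (auto simp: image_def)
qed

sublocale Ext: module R "Ext_module C n D i" for i
  unfolding Ext_module_def by (rule module_quot_module[OF Z.module_axioms coboundaries_submodule])

end

section \<open>Ext of the residue field in degrees zero, one and two, read off from elements\<close>

context resolution begin

lemma linear_smult_const:
  "y \<in> carrier C \<Longrightarrow> linear_on R (self_module R) C (carrier R) (\<lambda>a. a \<odot>\<^sub>C y)"
  by (rule linear_onI) (auto simp: C.smult_l_distr C.smult_assoc1)

lemma rho_smult_linear:
  "y \<in> carrier C \<Longrightarrow> linear_on R (F 0) C (carrier (F 0)) (\<lambda>v. rho v \<odot>\<^sub>C y)"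
  by (rule linear_on_compose[OF rho_linear linear_smult_const]) (use rho_closed in auto)

lemma rho_d: "w \<in> carrier (F 1) \<Longrightarrow> rho (d 0 w) \<in> m"
  using rho_exact by auto

lemma rho_lift:
  assumes "v \<in> carrier (F 0)" "rho v \<in> m"
  obtains w where "w \<in> carrier (F (Suc 0))" "d 0 w = v"
proof -
  have "v \<in> d 0 ` carrier (F 1)" unfolding rho_exact using assms by blast
  then show ?thesis using that by auto
qed

text \<open>If m kills y, the map sending v to \<open>rho v\<close> times y vanishes on the image of
  \<open>d 0\<close>, so it is a cocycle and hence zero. Its value at the vector with
  \<open>rho v1\<close> equal to 1 + \<mu> is y, since \<mu> kills y.\<close>

lemma Ext_0_trivialD:
  assumes E: "carrier (Ext_module C n D 0) = {\<zero>\<^bsub>Ext_module C n D 0\<^esub>}"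
    and y: "y \<in> carrier C" and my: "\<And>a. a \<in> m \<Longrightarrow> a \<odot>\<^sub>C y = \<zero>\<^sub>C"
  shows "y = \<zero>\<^sub>C"
proof -
  let ?g = "\<lambda>v. rho v \<odot>\<^sub>C y"
  have lin: "linear_on R (F 0) C (carrier (F 0)) ?g" by (rule rho_smult_linear[OF y])
  have "tuple 0 ?g \<in> hom_cocycles C n D 0"
    unfolding cocycle_iff using tuple_closed[OF lin] lin_comb_tuple[OF lin] d_closed[of _ 0] my rho_d
    by simp
  then have "tuple 0 ?g = \<zero>\<^bsub>power_module C (n 0)\<^esub>"
    using E unfolding Ext_trivial_iff by (auto simp: hom_coboundaries_def)
  moreover obtain v1 \<mu> where v1: "v1 \<in> carrier (F 0)" "\<mu> \<in> m" "rho v1 = \<one>\<^sub>R \<oplus>\<^sub>R \<mu>"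
    by (rule unit_vector)
  moreover have "lin_comb C (n 0) \<zero>\<^bsub>power_module C (n 0)\<^esub> v1 = \<zero>\<^sub>C"
    by (rule linear_on_zero[OF P.module_axioms C P.carrier_is_submodule linear_on_lin_comb_coeff[OF C v1(1)]])
  ultimately have "rho v1 \<odot>\<^sub>C y = \<zero>\<^sub>C" using lin_comb_tuple[OF lin v1(1)] by simp
  then show ?thesis using v1 y my m_carrier by (simp add: C.smult_l_distr)
qed

end

text \<open>The quotient of C by xC is given by any surjection \<open>proj\<close> onto a module X
  with kernel xC. The same results then serve for \<omega> modulo t^q and for the graded module
  modulo the initial form of t^mu.\<close>

locale resolution_mod = resolution R m C n D e
  for R :: "'a ring" and m and C :: "('a, 'b) module" and n D e +
  fixes x :: 'a and X :: "('a, 'c) module" and proj :: "'b \<Rightarrow> 'c"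
  assumes x: "x \<in> m" and regular: "y \<in> carrier C \<Longrightarrow> x \<odot>\<^sub>C y = \<zero>\<^sub>C \<Longrightarrow> y = \<zero>\<^sub>C"
    and X: "module R X" and proj_linear: "linear_on R C X (carrier C) proj"
    and proj_image: "proj ` carrier C = carrier X"
    and proj_kernel: "y \<in> carrier C \<Longrightarrow> proj y = \<zero>\<^sub>X \<longleftrightarrow> (\<exists>z\<in>carrier C. y = x \<odot>\<^sub>C z)"
begin

sublocale X: module R X by (rule X)

lemma x_carrier: "x \<in> carrier R" by (rule m_carrier[OF x])

lemma proj_closed: "y \<in> carrier C \<Longrightarrow> proj y \<in> carrier X"
  by (rule linear_on_closed[OF proj_linear])

lemma proj_x: "y \<in> carrier C \<Longrightarrow> proj (x \<odot>\<^sub>C y) = \<zero>\<^sub>X"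
  using proj_kernel x_carrier by blast

lemma smult_x_X: "y \<in> carrier X \<Longrightarrow> x \<odot>\<^sub>X y = \<zero>\<^sub>X"
  using proj_image proj_x linear_on_smult[OF proj_linear x_carrier] by (metis imageE)

lemma regular_cancel:
  "y \<in> carrier C \<Longrightarrow> z \<in> carrier C \<Longrightarrow> x \<odot>\<^sub>C y = x \<odot>\<^sub>C z \<Longrightarrow> y = z"
  using regular[of "y \<ominus>\<^sub>C z"] x_carrier by (simp add: C.smult_diff_right C.M.sub_eq_zero_iff)

text \<open>Regularity of x makes the quotient by x unique, and uniqueness makes it linear. It is
  applied to maps whose values \<open>proj\<close> sends to zero.\<close>

lemma division:
  obtains dv where "linear_on R C C {y \<in> carrier C. proj y = \<zero>\<^sub>X} dv"
    "\<And>y. y \<in> carrier C \<Longrightarrow> proj y = \<zero>\<^sub>X \<Longrightarrow> x \<odot>\<^sub>C dv y = y"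
    "\<And>z. z \<in> carrier C \<Longrightarrow> dv (x \<odot>\<^sub>C z) = z"
proof -
  let ?G = "{(x \<odot>\<^sub>C z, z) | z. z \<in> carrier C}"
  obtain dv where dv: "linear_on R C C (fst ` ?G) dv" "\<And>w z. (w, z) \<in> ?G \<Longrightarrow> dv w = z"
  proof (rule linear_on_graph[where \<Gamma> = ?G, OF C C])
    fix w z w' z' assume "(w, z) \<in> ?G" "(w', z') \<in> ?G"
    then show "(w \<oplus>\<^sub>C w', z \<oplus>\<^sub>C z') \<in> ?G" using C.smult_r_distr[OF x_carrier] by auto
  next
    fix r w z assume "r \<in> carrier R" "(w, z) \<in> ?G"
    then show "(r \<odot>\<^sub>C w, r \<odot>\<^sub>C z) \<in> ?G" using C.smult_left_commute[OF x_carrier] by auto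
  qed (use x_carrier regular in auto)
  have img: "fst ` ?G = {y \<in> carrier C. proj y = \<zero>\<^sub>X}"
    using proj_kernel x_carrier by force
  show ?thesis
  proof (rule that)
    show "linear_on R C C {y \<in> carrier C. proj y = \<zero>\<^sub>X} dv" using dv(1) img by simp
    show *: "z \<in> carrier C \<Longrightarrow> dv (x \<odot>\<^sub>C z) = z" for z using dv(2) by blast
    show "y \<in> carrier C \<Longrightarrow> proj y = \<zero>\<^sub>X \<Longrightarrow> x \<odot>\<^sub>C dv y = y" for y
      using proj_kernel * by metis
  qed
qed

lemma image_d_submodule: "submodule (d i ` carrier (F (Suc i))) R (F i)"
  by (rule linear_on_image[OF F.module_axioms F.module_axioms F.carrier_is_submodule d_linear])

text \<open>By exactness the image of \<open>d (Suc i)\<close> is the kernel of \<open>d i\<close>,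
  so a map that kills it factors through \<open>d i\<close>. Cocycles of positive degree thus become
  maps on syzygies.\<close>

lemma descend:
  assumes g: "linear_on R (F (Suc i)) C (carrier (F (Suc i))) g"
    and kill: "\<And>w. w \<in> carrier (F (Suc (Suc i))) \<Longrightarrow> g (d (Suc i) w) = \<zero>\<^sub>C"
  obtains t where "linear_on R (F i) C (d i ` carrier (F (Suc i))) t"
    "\<And>w. w \<in> carrier (F (Suc i)) \<Longrightarrow> t (d i w) = g w"
proof -
  let ?G = "{(d i w, g w) | w. w \<in> carrier (F (Suc i))}"
  obtain t where t: "linear_on R (F i) C (fst ` ?G) t" "\<And>w z. (w, z) \<in> ?G \<Longrightarrow> t w = z"
  proof (rule linear_on_graph[where \<Gamma> = ?G, OF F.module_axioms[of i] C])
    fix w z assume "(w, z) \<in> ?G"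
    then obtain u where u: "u \<in> carrier (F (Suc i))" "w = d i u" "z = g u" by blast
    then show "w \<in> carrier (F i) \<and> z \<in> carrier C"
      using d_closed linear_on_closed[OF g] by auto
    show "(r \<odot>\<^bsub>F i\<^esub> w, r \<odot>\<^sub>C z) \<in> ?G" if "r \<in> carrier R" for r
      using u linear_on_smult[OF g that u(1)] linear_on_smult[OF d_linear that u(1)]
        F.smult_closed[OF that u(1)] by (intro CollectI exI[of _ "r \<odot>\<^bsub>F (Suc i)\<^esub> u"]) simp
    fix w' z' assume "(w', z') \<in> ?G"
    then obtain u' where u': "u' \<in> carrier (F (Suc i))" "w' = d i u'" "z' = g u'" by blast
    show "(w \<oplus>\<^bsub>F i\<^esub> w', z \<oplus>\<^sub>C z') \<in> ?G"
      using u u' linear_on_add[OF g u(1) u'(1)] linear_on_add[OF d_linear u(1) u'(1)]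
        F.a_closed[OF u(1) u'(1)] by (intro CollectI exI[of _ "u \<oplus>\<^bsub>F (Suc i)\<^esub> u'"]) simp
  next
    fix z assume "(\<zero>\<^bsub>F i\<^esub>, z) \<in> ?G"
    then obtain w where w: "w \<in> carrier (F (Suc i))" "d i w = \<zero>\<^bsub>F i\<^esub>" "z = g w" by auto
    then have "w \<in> d (Suc i) ` carrier (F (Suc (Suc i)))" using d_exact[of i] by blast
    then show "z = \<zero>\<^sub>C" using kill w by auto
  qed (rule that)
  have img: "fst ` ?G = d i ` carrier (F (Suc i))" by force
  show ?thesis
  proof (rule that)
    show "linear_on R (F i) C (d i ` carrier (F (Suc i))) t" using t(1) unfolding img .
    show "w \<in> carrier (F (Suc i)) \<Longrightarrow> t (d i w) = g w" for w by (rule t(2)) blast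
  qed
qed

text \<open>Evaluation at \<open>x\<close> times a unit vector: for a cocycle of degree 1, viewed as a map on the
  kernel of the augmentation, this element of \<open>C\<close> determines the class in \<open>Ext^1\<close>, and it lies
  in the socle of \<open>C\<close> modulo \<open>x C\<close>.\<close>

context
  fixes v1 \<mu> w1
  assumes v1: "v1 \<in> carrier (F 0)" and \<mu>: "\<mu> \<in> m" "rho v1 = \<one>\<^sub>R \<oplus>\<^sub>R \<mu>"
    and w1: "w1 \<in> carrier (F (Suc 0))" "d 0 w1 = x \<odot>\<^bsub>F 0\<^esub> v1"
begin

lemma cocycle_linear:
  "c \<in> hom_cocycles C n D (Suc 0) \<Longrightarrow> linear_on R (F (Suc 0)) C (carrier (F (Suc 0))) (lin_comb C (n (Suc 0)) c)"
  unfolding cocycle_iff by (rule lin_comb_linear) simp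

lemma evaluation_linear:
  "linear_on R (Z (Suc 0)) C (hom_cocycles C n D (Suc 0)) (\<lambda>c. lin_comb C (n (Suc 0)) c w1)"
  using linear_on_lin_comb_coeff[OF C w1(1)] P.submoduleE(1)[OF cocycles_submodule, of "Suc 0"]
  unfolding linear_on_def by (auto simp: Pi_iff subset_iff)

text \<open>Let t be the map on the kernel of the augmentation induced by the cocycle; the value in
  question is t(x v1). For a in m the vector a v1 lies in that kernel as well, so a t(x v1) = x t(a
  v1).\<close>

lemma evaluation_socle:
  assumes c: "c \<in> hom_cocycles C n D (Suc 0)" and a: "a \<in> m"
  shows "proj (a \<odot>\<^sub>C lin_comb C (n (Suc 0)) c w1) = \<zero>\<^sub>X"
proof -
  let ?g = "lin_comb C (n (Suc 0)) c"
  note lin = cocycle_linear[OF c]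
  have aR: "a \<in> carrier R" by (rule m_carrier[OF a])
  have "rho (a \<odot>\<^bsub>F 0\<^esub> v1) \<in> m"
    using linear_on_smult[OF rho_linear aR v1] rho_closed[OF v1] m.I_r_closed[OF a] by simp
  then obtain wa where wa: "wa \<in> carrier (F (Suc 0))" "d 0 wa = a \<odot>\<^bsub>F 0\<^esub> v1"
    using rho_lift F.smult_closed[OF aR v1] by blast
  obtain t where t: "\<And>w. w \<in> carrier (F (Suc 0)) \<Longrightarrow> t (d 0 w) = ?g w"
    using descend[OF lin] c unfolding cocycle_iff by blast
  have "d 0 (a \<odot>\<^bsub>F (Suc 0)\<^esub> w1) = d 0 (x \<odot>\<^bsub>F (Suc 0)\<^esub> wa)"
    using linear_on_smult[OF d_linear aR w1(1)] linear_on_smult[OF d_linear x_carrier wa(1)] w1(2) wa(2)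
      F.smult_left_commute[OF aR x_carrier v1] by simp
  then have "?g (a \<odot>\<^bsub>F (Suc 0)\<^esub> w1) = ?g (x \<odot>\<^bsub>F (Suc 0)\<^esub> wa)"
    using t F.smult_closed aR x_carrier w1(1) wa(1) by metis
  then have "a \<odot>\<^sub>C ?g w1 = x \<odot>\<^sub>C ?g wa"
    using linear_on_smult[OF lin] aR x_carrier w1(1) wa(1) by simp
  then show ?thesis using proj_x linear_on_closed[OF lin wa(1)] by simp
qed

text \<open>A coboundary comes from a map g on all of \<open>F 0\<close>, for which g(x v1) = x
  g(v1).\<close>

lemma evaluation_coboundary:
  assumes c: "c \<in> hom_coboundaries C n D (Suc 0)"
  shows "proj (lin_comb C (n (Suc 0)) c w1) = \<zero>\<^sub>X"
proof -
  obtain g where g: "linear_on R (F 0) C (carrier (F 0)) g" "c = tuple (Suc 0) (\<lambda>w. g (d 0 w))"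
    using c unfolding coboundary_Suc_iff by blast
  have "linear_on R (F (Suc 0)) C (carrier (F (Suc 0))) (\<lambda>w. g (d 0 w))"
    by (rule linear_on_compose[OF d_linear g(1)]) (use d_closed in auto)
  then have "lin_comb C (n (Suc 0)) c w1 = g (x \<odot>\<^bsub>F 0\<^esub> v1)"
    using lin_comb_tuple[OF _ w1(1)] g(2) w1(2) by simp
  then show ?thesis
    using linear_on_smult[OF g(1) x_carrier v1] proj_x linear_on_closed[OF g(1) v1] by simp
qed

text \<open>The z with t(x v1) = x z is the value that an extension of t to \<open>F 0\<close> has
  to take at v1. Splitting v into \<open>rho v\<close> times v1 and a remainder in the kernel of the
  augmentation then defines the extension.\<close>

lemma evaluation_kernel:
  assumes c: "c \<in> hom_cocycles C n D (Suc 0)" and z: "proj (lin_comb C (n (Suc 0)) c w1) = \<zero>\<^sub>X"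
  shows "c \<in> hom_coboundaries C n D (Suc 0)"
proof -
  let ?g = "lin_comb C (n (Suc 0)) c"
  note lin = cocycle_linear[OF c]
  let ?N = "d 0 ` carrier (F (Suc 0))"
  obtain t where t: "linear_on R (F 0) C ?N t" "\<And>w. w \<in> carrier (F (Suc 0)) \<Longrightarrow> t (d 0 w) = ?g w"
    using descend[OF lin] c unfolding cocycle_iff by blast
  obtain z where z: "z \<in> carrier C" "?g w1 = x \<odot>\<^sub>C z"
    using z proj_kernel linear_on_closed[OF lin w1(1)] by blast
  have N: "v \<in> ?N \<longleftrightarrow> v \<in> carrier (F 0) \<and> rho v \<in> m" for v
    unfolding rho_exact[simplified] by blast
  \<comment> \<open>Up to sign \<open>rho\<close> of the remainder is the product of
    \<open>rho v\<close> and \<mu>, which lies in m, so t is defined on it.\<close>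
  let ?r = "\<lambda>v. v \<ominus>\<^bsub>F 0\<^esub> rho v \<odot>\<^bsub>F 0\<^esub> v1"
  have r_lin: "linear_on R (F 0) (F 0) (carrier (F 0)) ?r"
  proof (rule linear_onI)
    fix v assume v: "v \<in> carrier (F 0)"
    note rv = rho_closed[OF v]
    show "?r v \<in> carrier (F 0)" using v rv v1 by simp
    show "?r (a \<odot>\<^bsub>F 0\<^esub> v) = a \<odot>\<^bsub>F 0\<^esub> ?r v" if "a \<in> carrier R" for a
      using that v rv v1 linear_on_smult[OF rho_linear that v]
      by (simp add: F.smult_diff_right F.smult_assoc1)
    fix w assume w: "w \<in> carrier (F 0)"
    show "?r (v \<oplus>\<^bsub>F 0\<^esub> w) = ?r v \<oplus>\<^bsub>F 0\<^esub> ?r w"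
      using v rv v1 w rho_closed[OF w] linear_on_add[OF rho_linear v w]
      by (simp add: F.smult_l_distr F.add_sub_add)
  qed
  have rN: "?r v \<in> ?N" if v: "v \<in> carrier (F 0)" for v
  proof -
    have "rho (?r v) = rho v \<ominus>\<^sub>R rho v \<otimes>\<^sub>R rho v1"
      using linear_on_diff[OF F.module_axioms S.module_axioms F.carrier_is_submodule rho_linear v]
        F.smult_closed[OF rho_closed[OF v] v1] linear_on_smult[OF rho_linear rho_closed[OF v] v1] by simp
    also have "\<dots> = \<ominus>\<^sub>R (rho v \<otimes>\<^sub>R \<mu>)"
      using \<mu> rho_closed[OF v] m_carrier
      by (simp add: C.R.r_distr C.R.minus_eq C.R.minus_add C.R.a_assoc[symmetric] C.R.r_neg)
    also have "\<dots> \<in> m" using \<mu>(1) rho_closed[OF v] m.I_l_closed by simp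
    finally show ?thesis using N linear_on_closed[OF r_lin v] by simp
  qed
  define G where "G v = rho v \<odot>\<^sub>C z \<oplus>\<^sub>C t (?r v)" for v
  have rt: "linear_on R (F 0) C (carrier (F 0)) (\<lambda>v. t (?r v))"
    by (rule linear_on_compose[OF r_lin t(1)]) (use rN in auto)
  have G: "linear_on R (F 0) C (carrier (F 0)) G"
  proof (rule linear_onI)
    note rz = rho_smult_linear[OF z(1)]
    fix v assume v: "v \<in> carrier (F 0)"
    show "G v \<in> carrier C" unfolding G_def using linear_on_closed[OF rz v] linear_on_closed[OF rt v] by simp
    show "G (a \<odot>\<^bsub>F 0\<^esub> v) = a \<odot>\<^sub>C G v" if "a \<in> carrier R" for a
      unfolding G_def linear_on_smult[OF rz that v] linear_on_smult[OF rt that v]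
      using linear_on_closed[OF rz v] linear_on_closed[OF rt v] that by (simp add: C.smult_r_distr)
    fix w assume w: "w \<in> carrier (F 0)"
    show "G (v \<oplus>\<^bsub>F 0\<^esub> w) = G v \<oplus>\<^sub>C G w"
      unfolding G_def linear_on_add[OF rz v w] linear_on_add[OF rt v w]
      using linear_on_closed[OF rz v] linear_on_closed[OF rt v] linear_on_closed[OF rz w] linear_on_closed[OF rt w]
      by (simp add: C.M.a_ac)
  qed
  \<comment> \<open>Both sides are compared after multiplication by x, where the term
    \<open>rho v\<close> t(x v1) coming from the remainder cancels against \<open>rho v\<close> x
    z.\<close>
  have Gg: "G (d 0 w) = ?g w" if w: "w \<in> carrier (F (Suc 0))" for w
  proof (rule regular_cancel)
    let ?v = "d 0 w"
    have v: "?v \<in> carrier (F 0)" "?v \<in> ?N" using d_closed w by auto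
    have r: "rho ?v \<in> carrier R" using rho_closed v by simp
    have xv1: "x \<odot>\<^bsub>F 0\<^esub> v1 \<in> ?N" using w1 by (metis imageI)
    have tv: "t ?v \<in> carrier C" "t (x \<odot>\<^bsub>F 0\<^esub> v1) \<in> carrier C" "t (?r ?v) \<in> carrier C"
      using linear_on_closed[OF t(1)] v xv1 rN by auto
    have "x \<odot>\<^sub>C t (?r ?v) = t (x \<odot>\<^bsub>F 0\<^esub> ?r ?v)"
      using linear_on_smult[OF t(1) x_carrier rN] v by simp
    also have "x \<odot>\<^bsub>F 0\<^esub> ?r ?v = x \<odot>\<^bsub>F 0\<^esub> ?v \<ominus>\<^bsub>F 0\<^esub> rho ?v \<odot>\<^bsub>F 0\<^esub> (x \<odot>\<^bsub>F 0\<^esub> v1)"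
      using v v1 x_carrier r by (simp add: F.smult_diff_right F.smult_left_commute)
    also have "t \<dots> = t (x \<odot>\<^bsub>F 0\<^esub> ?v) \<ominus>\<^sub>C t (rho ?v \<odot>\<^bsub>F 0\<^esub> (x \<odot>\<^bsub>F 0\<^esub> v1))"
      by (rule linear_on_diff[OF F.module_axioms C image_d_submodule t(1)])
         (use F.submoduleE(4)[OF image_d_submodule] x_carrier v xv1 r in auto)
    also have "\<dots> = x \<odot>\<^sub>C t ?v \<ominus>\<^sub>C rho ?v \<odot>\<^sub>C t (x \<odot>\<^bsub>F 0\<^esub> v1)"
      using linear_on_smult[OF t(1)] x_carrier v xv1 r by simp
    also have "t (x \<odot>\<^bsub>F 0\<^esub> v1) = x \<odot>\<^sub>C z" using t(2)[OF w1(1)] w1(2) z(2) by simp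
    finally have "x \<odot>\<^sub>C t (?r ?v) = x \<odot>\<^sub>C t ?v \<ominus>\<^sub>C rho ?v \<odot>\<^sub>C (x \<odot>\<^sub>C z)" .
    then have "x \<odot>\<^sub>C G ?v = rho ?v \<odot>\<^sub>C (x \<odot>\<^sub>C z) \<oplus>\<^sub>C (x \<odot>\<^sub>C t ?v \<ominus>\<^sub>C rho ?v \<odot>\<^sub>C (x \<odot>\<^sub>C z))"
      unfolding G_def using r z(1) tv x_carrier by (simp add: C.smult_r_distr C.smult_left_commute)
    also have "\<dots> = x \<odot>\<^sub>C t ?v"
      using r z(1) tv x_carrier by (metis C.M.a_comm C.M.minus_closed C.M.sub_add_cancel C.smult_closed)
    finally show "x \<odot>\<^sub>C G ?v = x \<odot>\<^sub>C ?g w" using t(2)[OF w] by simp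
  qed (use w d_closed linear_on_closed[OF G] linear_on_closed[OF lin] in auto)
  have "c = tuple (Suc 0) ?g" using c tuple_lin_comb unfolding cocycle_iff by simp
  also have "\<dots> = tuple (Suc 0) (\<lambda>w. G (d 0 w))"
    unfolding tuple_def by (intro restrict_ext) (use Gg basis_closed in simp)
  finally show ?thesis using G unfolding coboundary_Suc_iff by blast
qed

text \<open>For y in the socle modulo xC, the product of \<open>rho (d 0 w)\<close> with y lies in
  xC; dividing it by x gives the cocycle.\<close>

lemma evaluation_surj:
  assumes y: "y \<in> carrier C" and soc: "\<And>a. a \<in> m \<Longrightarrow> proj (a \<odot>\<^sub>C y) = \<zero>\<^sub>X"
  obtains c where "c \<in> hom_cocycles C n D (Suc 0)" "lin_comb C (n (Suc 0)) c w1 = rho v1 \<odot>\<^sub>C y"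
proof -
  obtain dv where dv: "linear_on R C C {y \<in> carrier C. proj y = \<zero>\<^sub>X} dv"
    "\<And>y. y \<in> carrier C \<Longrightarrow> proj y = \<zero>\<^sub>X \<Longrightarrow> x \<odot>\<^sub>C dv y = y"
    "\<And>z. z \<in> carrier C \<Longrightarrow> dv (x \<odot>\<^sub>C z) = z" using division by blast
  have l1: "linear_on R (F (Suc 0)) C (carrier (F (Suc 0))) (\<lambda>w. rho (d 0 w) \<odot>\<^sub>C y)"
    by (rule linear_on_compose[OF d_linear rho_smult_linear[OF y]]) (use d_closed in auto)
  have lin: "linear_on R (F (Suc 0)) C (carrier (F (Suc 0))) (\<lambda>w. dv (rho (d 0 w) \<odot>\<^sub>C y))"
    by (rule linear_on_compose[OF l1 dv(1)])
       (use linear_on_closed[OF l1] soc rho_d in \<open>auto simp: image_subset_iff\<close>)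
  have "dv \<zero>\<^sub>C = \<zero>\<^sub>C" using dv(3)[of "\<zero>\<^sub>C"] x_carrier by simp
  moreover have "rho \<zero>\<^bsub>F 0\<^esub> = \<zero>\<^sub>R"
    using linear_on_zero[OF F.module_axioms S.module_axioms F.carrier_is_submodule rho_linear] by simp
  ultimately have "tuple (Suc 0) (\<lambda>w. dv (rho (d 0 w) \<odot>\<^sub>C y)) \<in> hom_cocycles C n D (Suc 0)"
    unfolding cocycle_iff using tuple_closed[OF lin] lin_comb_tuple[OF lin d_closed] d_d y
    by simp
  moreover have "lin_comb C (n (Suc 0)) (tuple (Suc 0) (\<lambda>w. dv (rho (d 0 w) \<odot>\<^sub>C y))) w1 = rho v1 \<odot>\<^sub>C y"
    using lin_comb_tuple[OF lin w1(1)] w1(2) linear_on_smult[OF rho_linear x_carrier v1]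
      rho_closed[OF v1] dv(3)[of "rho v1 \<odot>\<^sub>C y"] y x_carrier by (simp add: C.smult_assoc1)
  ultimately show ?thesis using that by blast
qed

end

lemma evaluation_vectors:
  obtains v1 \<mu> w1 where "v1 \<in> carrier (F 0)" "\<mu> \<in> m" "rho v1 = \<one>\<^sub>R \<oplus>\<^sub>R \<mu>"
    "w1 \<in> carrier (F (Suc 0))" "d 0 w1 = x \<odot>\<^bsub>F 0\<^esub> v1"
proof -
  obtain v1 \<mu> where v1: "v1 \<in> carrier (F 0)" "\<mu> \<in> m" "rho v1 = \<one>\<^sub>R \<oplus>\<^sub>R \<mu>" by (rule unit_vector)
  have "rho (x \<odot>\<^bsub>F 0\<^esub> v1) \<in> m"
    using linear_on_smult[OF rho_linear x_carrier v1(1)] rho_closed[OF v1(1)] m.I_r_closed[OF x] by simp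
  then obtain w1 where "w1 \<in> carrier (F (Suc 0))" "d 0 w1 = x \<odot>\<^bsub>F 0\<^esub> v1"
    using rho_lift F.smult_closed[OF x_carrier v1(1)] by blast
  then show ?thesis by (rule that[OF v1])
qed

text \<open>Evaluation identifies the classes of degree one with the socle of C/xC, since
  \<open>rho v1\<close> acts as 1 there. The generator \<sigma> is the value of a cocycle whose
  class corresponds to 1 in the residue field.\<close>

lemma socle_of_Ext_1:
  assumes iso: "module_isomorphic R (Ext_module C n D (Suc 0)) k"
  obtains \<sigma> where "\<sigma> \<in> carrier C" "proj \<sigma> \<noteq> \<zero>\<^sub>X" "\<And>a. a \<in> m \<Longrightarrow> proj (a \<odot>\<^sub>C \<sigma>) = \<zero>\<^sub>X"
    "\<And>y. y \<in> carrier C \<Longrightarrow> (\<And>a. a \<in> m \<Longrightarrow> proj (a \<odot>\<^sub>C y) = \<zero>\<^sub>X) \<Longrightarrow>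
       \<exists>a\<in>carrier R. proj y = a \<odot>\<^sub>X proj \<sigma>"
proof -
  obtain v1 \<mu> w1 where v1: "v1 \<in> carrier (F 0)" and \<mu>: "\<mu> \<in> m" "rho v1 = \<one>\<^sub>R \<oplus>\<^sub>R \<mu>"
    and w1: "w1 \<in> carrier (F (Suc 0))" "d 0 w1 = x \<odot>\<^bsub>F 0\<^esub> v1" by (rule evaluation_vectors)
  note soc = evaluation_socle[OF v1 \<mu> w1] and cob = evaluation_coboundary[OF v1 \<mu> w1]
    and ker = evaluation_kernel[OF v1 \<mu> w1] and surj = evaluation_surj[OF v1 \<mu> w1]
    and lin = evaluation_linear[OF v1 \<mu> w1]
  let ?E = "Ext_module C n D (Suc 0)" and ?Z = "Z (Suc 0)"
    and ?B = "hom_coboundaries C n D (Suc 0)" and ?H = "hom_cocycles C n D (Suc 0)"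
  let ?ev = "\<lambda>c. lin_comb C (n (Suc 0)) c w1"
  note E = quot_module_simps[OF Z.module_axioms coboundaries_submodule, of "Suc 0", folded Ext_module_def]
  obtain f where f: "bij_betw f (carrier ?E) (carrier k)"
    "\<And>x y. x \<in> carrier ?E \<Longrightarrow> y \<in> carrier ?E \<Longrightarrow> f (x \<oplus>\<^bsub>?E\<^esub> y) = f x \<oplus>\<^sub>k f y"
    "\<And>r x. r \<in> carrier R \<Longrightarrow> x \<in> carrier ?E \<Longrightarrow> f (r \<odot>\<^bsub>?E\<^esub> x) = r \<odot>\<^sub>k f x"
    using iso unfolding module_isomorphic_def by blast
  let ?cl = "\<lambda>c. ?B +>\<^bsub>?Z\<^esub> c"
  have cl: "linear_on R ?Z ?E ?H ?cl"
    using linear_on_coset[OF Z.module_axioms coboundaries_submodule, of "Suc 0"]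
    unfolding Ext_module_def by simp
  have f_lin: "linear_on R ?E k (carrier ?E) f"
    using f bij_betwE[OF f(1)] by (intro linear_onI) auto
  have mk: "m +>\<^sub>R \<one>\<^sub>R \<in> carrier k"
    by (auto simp: quot_module_simps[OF S.module_axioms m_submodule])
  have "\<exists>X\<in>carrier ?E. f X = m +>\<^sub>R \<one>\<^sub>R"
    using mk bij_betw_imp_surj_on[OF f(1)] by (metis imageE)
  then obtain c1 where c1: "c1 \<in> ?H" "f (?cl c1) = m +>\<^sub>R \<one>\<^sub>R"
    unfolding E(1) by auto
  have evc: "?ev c \<in> carrier C" if "c \<in> ?H" for c using linear_on_closed[OF lin that] .
  show ?thesis
  proof (rule that)
    show s: "?ev c1 \<in> carrier C" by (rule evc[OF c1(1)])
    show "proj (?ev c1) \<noteq> \<zero>\<^sub>X"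
    proof
      assume "proj (?ev c1) = \<zero>\<^sub>X"
      then have "c1 \<in> ?B" using ker c1(1) by blast
      then have "?cl c1 = \<zero>\<^bsub>?E\<^esub>"
        using coset_eq_self_iff[OF Z.module_axioms coboundaries_submodule] c1(1) E(2) by simp
      then have "m +>\<^sub>R \<one>\<^sub>R = \<zero>\<^sub>k"
        using linear_on_zero[OF Ext.module_axioms k.module_axioms Ext.carrier_is_submodule f_lin] c1(2)
        by simp
      then have "\<one>\<^sub>R \<in> m" using coset_eq_zero_iff by simp
      then show False using m.one_imp_carrier m.I_notcarr by simp
    qed
    show "proj (a \<odot>\<^sub>C ?ev c1) = \<zero>\<^sub>X" if "a \<in> m" for a by (rule soc[OF c1(1) that])
    fix y assume y: "y \<in> carrier C" and ys: "\<And>a. a \<in> m \<Longrightarrow> proj (a \<odot>\<^sub>C y) = \<zero>\<^sub>X"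
    obtain c where c: "c \<in> ?H" "?ev c = rho v1 \<odot>\<^sub>C y" using surj[OF y ys] by blast
    have "?cl c \<in> carrier ?E" using linear_on_closed[OF cl c(1)] .
    then have "f (?cl c) \<in> carrier k" by (rule linear_on_closed[OF f_lin])
    then obtain a where a: "a \<in> carrier R" "f (?cl c) = m +>\<^sub>R a"
      by (auto simp: quot_module_simps[OF S.module_axioms m_submodule])
    have coset_lin: "linear_on R (self_module R) k (carrier R) (\<lambda>x. m +>\<^sub>R x)"
      using linear_on_coset[OF S.module_axioms m_submodule] by simp
    have "f (?cl (a \<odot>\<^bsub>?Z\<^esub> c1)) = a \<odot>\<^sub>k (m +>\<^sub>R \<one>\<^sub>R)"
      using linear_on_smult[OF cl a(1) c1(1)] f(3)[OF a(1) linear_on_closed[OF cl c1(1)]] c1(2) by simp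
    also have "\<dots> = m +>\<^sub>R a"
      using linear_on_smult[OF coset_lin a(1), of "\<one>\<^sub>R"] a(1) by simp
    finally have "f (?cl (a \<odot>\<^bsub>?Z\<^esub> c1)) = f (?cl c)" using a(2) by simp
    moreover have ac1: "a \<odot>\<^bsub>?Z\<^esub> c1 \<in> ?H" using Z.smult_closed[OF a(1), of c1 "Suc 0"] c1(1) by simp
    ultimately have "?cl c = ?cl (a \<odot>\<^bsub>?Z\<^esub> c1)"
      using bij_betw_imp_inj_on[OF f(1)] linear_on_closed[OF cl] c(1) by (metis inj_onD)
    then have "c \<ominus>\<^bsub>?Z\<^esub> a \<odot>\<^bsub>?Z\<^esub> c1 \<in> ?B"
      using coset_eq_iff[OF Z.module_axioms coboundaries_submodule, of c "Suc 0" "a \<odot>\<^bsub>?Z\<^esub> c1"] c(1) ac1 by simp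
    then have "proj (?ev (c \<ominus>\<^bsub>?Z\<^esub> a \<odot>\<^bsub>?Z\<^esub> c1)) = \<zero>\<^sub>X" by (rule cob)
    moreover have "?ev (c \<ominus>\<^bsub>?Z\<^esub> a \<odot>\<^bsub>?Z\<^esub> c1) = rho v1 \<odot>\<^sub>C y \<ominus>\<^sub>C a \<odot>\<^sub>C ?ev c1"
      using linear_on_diff[OF Z.module_axioms C Z.carrier_is_submodule, of "Suc 0" ?ev c "a \<odot>\<^bsub>?Z\<^esub> c1"]
        lin c ac1 linear_on_smult[OF lin a(1) c1(1)] by simp
    ultimately have "proj (rho v1 \<odot>\<^sub>C y \<ominus>\<^sub>C a \<odot>\<^sub>C ?ev c1) = \<zero>\<^sub>X" by simp
    then have "proj (rho v1 \<odot>\<^sub>C y) \<ominus>\<^sub>X a \<odot>\<^sub>X proj (?ev c1) = \<zero>\<^sub>X"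
      using linear_on_diff[OF C X C.carrier_is_submodule proj_linear, of "rho v1 \<odot>\<^sub>C y" "a \<odot>\<^sub>C ?ev c1"]
        linear_on_smult[OF proj_linear a(1) s] y s a(1) rho_closed[OF v1] by simp
    then have "proj (rho v1 \<odot>\<^sub>C y) = a \<odot>\<^sub>X proj (?ev c1)"
      using X.M.sub_eq_zero_iff proj_closed y s a(1) rho_closed[OF v1] by simp
    \<comment> \<open>The error \<mu> y disappears, because y lies in the socle modulo xC and \<mu>
      in m.\<close>
    moreover have "proj (rho v1 \<odot>\<^sub>C y) = proj y"
      using \<mu> m_carrier[OF \<mu>(1)] y ys[OF \<mu>(1)] linear_on_add[OF proj_linear, of y "\<mu> \<odot>\<^sub>C y"] proj_closed
      by (simp add: C.smult_l_distr)
    ultimately show "\<exists>a\<in>carrier R. proj y = a \<odot>\<^sub>X proj (?ev c1)" using a(1) by auto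
  qed
qed

text \<open>The homomorphism lifts to a map g on \<open>F 1\<close> with values in C. What prevents
  g from descending to the kernel of the augmentation is its composite with \<open>d 1\<close>;
  divided by x this is a cocycle of degree 2. Once it is removed, evaluation at x v1 and division by
  x produce y.\<close>

lemma hom_of_Ext_2:
  assumes E: "carrier (Ext_module C n D 2) = {\<zero>\<^bsub>Ext_module C n D 2\<^esub>}"
    and psi: "linear_on R (self_module R) X m \<psi>" and psi_x: "\<psi> x = \<zero>\<^sub>X"
  obtains y where "y \<in> carrier X" "\<And>a. a \<in> m \<Longrightarrow> \<psi> a = a \<odot>\<^sub>X y"
proof -
  obtain v1 \<mu> w1 where v1: "v1 \<in> carrier (F 0)" and \<mu>: "\<mu> \<in> m" "rho v1 = \<one>\<^sub>R \<oplus>\<^sub>R \<mu>"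
    and w1: "w1 \<in> carrier (F (Suc 0))" "d 0 w1 = x \<odot>\<^bsub>F 0\<^esub> v1" by (rule evaluation_vectors)
  obtain dv where dv: "linear_on R C C {y \<in> carrier C. proj y = \<zero>\<^sub>X} dv"
    "\<And>y. y \<in> carrier C \<Longrightarrow> proj y = \<zero>\<^sub>X \<Longrightarrow> x \<odot>\<^sub>C dv y = y"
    "\<And>z. z \<in> carrier C \<Longrightarrow> dv (x \<odot>\<^sub>C z) = z" using division by blast
  have psi0: "\<psi> \<zero>\<^sub>R = \<zero>\<^sub>X"
    using linear_on_zero[OF S.module_axioms X m_submodule psi] by simp
  have rd: "linear_on R (F 1) (self_module R) (carrier (F 1)) (\<lambda>w. rho (d 0 w))"
    using linear_on_compose[OF d_linear[of 0] rho_linear] d_closed[of _ 0] by auto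
  have pf: "linear_on R (F 1) X (carrier (F 1)) (\<lambda>w. \<psi> (rho (d 0 w)))"
    by (rule linear_on_compose[OF rd psi]) (use rho_d in auto)
  obtain g where g: "linear_on R (F 1) C (carrier (F 1)) g"
    "\<And>w. w \<in> carrier (F 1) \<Longrightarrow> proj (g w) = \<psi> (rho (d 0 w))"
    using linear_lift[OF C X proj_linear proj_image pf] linear_on_closed[OF pf] by blast
  have rho0: "rho \<zero>\<^bsub>F 0\<^esub> = \<zero>\<^sub>R"
    using linear_on_zero[OF F.module_axioms S.module_axioms F.carrier_is_submodule rho_linear] by simp
  have gd: "g (d 1 u) \<in> {y \<in> carrier C. proj y = \<zero>\<^sub>X}" if "u \<in> carrier (F 2)" for u
    using that g(2) d_closed[of u 1] d_d[of u 0] rho0 psi0 linear_on_closed[OF g(1)]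
    by (simp add: numeral_2_eq_2)
  define h where "h u = dv (g (d 1 u))" for u
  have gdl: "linear_on R (F 2) C (carrier (F 2)) (\<lambda>u. g (d 1 u))"
    using linear_on_compose[OF d_linear[of 1] g(1)] d_closed[of _ 1] by (auto simp: numeral_2_eq_2)
  have h: "linear_on R (F 2) C (carrier (F 2)) h"
    unfolding h_def by (rule linear_on_compose[OF gdl dv(1)]) (use gd in auto)
  have xh: "x \<odot>\<^sub>C h u = g (d 1 u)" if "u \<in> carrier (F 2)" for u
    unfolding h_def using dv(2) gd[OF that] by simp
  have "h (d 2 u) = \<zero>\<^sub>C" if u: "u \<in> carrier (F 3)" for u
  proof -
    have du: "d 2 u \<in> carrier (F 2)" using d_closed[of u 2] u by (simp add: numeral_3_eq_3 numeral_2_eq_2)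
    have "x \<odot>\<^sub>C h (d 2 u) = g (d 1 (d 2 u))" by (rule xh[OF du])
    also have "d 1 (d 2 u) = \<zero>\<^bsub>F 1\<^esub>" using d_d[of u 1] u by (simp add: numeral_3_eq_3 numeral_2_eq_2)
    also have "g \<dots> = \<zero>\<^sub>C"
      by (rule linear_on_zero[OF F.module_axioms C F.carrier_is_submodule g(1)])
    finally show ?thesis using regular linear_on_closed[OF h du] by simp
  qed
  then have "tuple 2 h \<in> hom_cocycles C n D 2"
    unfolding cocycle_iff using tuple_closed[OF h] lin_comb_tuple[OF h] d_closed[of _ 2]
    by (simp add: numeral_3_eq_3 numeral_2_eq_2)
  then have "tuple 2 h \<in> hom_coboundaries C n D (Suc 1)"
    using E unfolding Ext_trivial_iff by (auto simp: numeral_2_eq_2)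
  then obtain h' where h': "linear_on R (F 1) C (carrier (F 1)) h'"
    "tuple 2 h = tuple (Suc 1) (\<lambda>w. h' (d 1 w))"
    unfolding coboundary_Suc_iff by blast
  have h'dl: "linear_on R (F 2) C (carrier (F 2)) (\<lambda>u. h' (d 1 u))"
    using linear_on_compose[OF d_linear[of 1] h'(1)] d_closed[of _ 1] by (auto simp: numeral_2_eq_2)
  have hh': "h u = h' (d 1 u)" if "u \<in> carrier (F 2)" for u
    using lin_comb_tuple[OF h that] lin_comb_tuple[OF h'dl that] h'(2) by (simp add: numeral_2_eq_2)
  \<comment> \<open>Subtracting x h' leaves the projection unchanged and makes the composite with
    \<open>d 1\<close> vanish.\<close>
  define g2 where "g2 w = g w \<ominus>\<^sub>C x \<odot>\<^sub>C h' w" for w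
  have g2: "linear_on R (F 1) C (carrier (F 1)) g2"
  proof (rule linear_onI)
    fix w assume w: "w \<in> carrier (F 1)"
    note cl = linear_on_closed[OF g(1) w] linear_on_closed[OF h'(1) w]
    show "g2 w \<in> carrier C" unfolding g2_def using cl x_carrier by simp
    show "g2 (r \<odot>\<^bsub>F 1\<^esub> w) = r \<odot>\<^sub>C g2 w" if "r \<in> carrier R" for r
      unfolding g2_def linear_on_smult[OF g(1) that w] linear_on_smult[OF h'(1) that w]
      using cl x_carrier that by (simp add: C.smult_diff_right C.smult_left_commute)
    fix w' assume w': "w' \<in> carrier (F 1)"
    show "g2 (w \<oplus>\<^bsub>F 1\<^esub> w') = g2 w \<oplus>\<^sub>C g2 w'"
      unfolding g2_def linear_on_add[OF g(1) w w'] linear_on_add[OF h'(1) w w']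
      using cl linear_on_closed[OF g(1) w'] linear_on_closed[OF h'(1) w'] x_carrier
      by (simp add: C.smult_r_distr C.M.add_sub_add)
  qed
  have g2_kill: "g2 (d 1 u) = \<zero>\<^sub>C" if u: "u \<in> carrier (F 2)" for u
    unfolding g2_def using xh[OF u] hh'[OF u] gd[OF u] C.M.sub_eq_zero_iff by simp
  have proj_g2: "proj (g2 w) = \<psi> (rho (d 0 w))" if w: "w \<in> carrier (F 1)" for w
  proof -
    note cl = linear_on_closed[OF g(1) w] linear_on_closed[OF h'(1) w]
    have "proj (g2 w) = proj (g w) \<ominus>\<^sub>X proj (x \<odot>\<^sub>C h' w)"
      unfolding g2_def
      by (rule linear_on_diff[OF C X C.carrier_is_submodule proj_linear]) (use cl x_carrier in auto)
    then show ?thesis using proj_x cl g(2)[OF w] proj_closed by (metis X.M.sub_zero)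
  qed
  obtain t where t: "linear_on R (F 0) C (d 0 ` carrier (F (Suc 0))) t"
    "\<And>w. w \<in> carrier (F (Suc 0)) \<Longrightarrow> t (d 0 w) = g2 w"
    using descend[of 0 g2] g2 g2_kill by (auto simp: numeral_2_eq_2)
  have N: "v \<in> d 0 ` carrier (F (Suc 0)) \<longleftrightarrow> v \<in> carrier (F 0) \<and> rho v \<in> m" for v
    unfolding rho_exact[simplified] by blast
  have proj_t: "proj (t v) = \<psi> (rho v)" if "v \<in> d 0 ` carrier (F (Suc 0))" for v
    using that t(2) proj_g2 by auto
  let ?xv = "x \<odot>\<^bsub>F 0\<^esub> v1"
  have r1: "rho v1 \<in> carrier R" by (rule rho_closed[OF v1])
  have xv: "?xv \<in> d 0 ` carrier (F (Suc 0))" using w1 by (metis imageI)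
  have txv: "t ?xv \<in> carrier C" by (rule linear_on_closed[OF t(1) xv])
  have "rho ?xv = rho v1 \<otimes>\<^sub>R x"
    using linear_on_smult[OF rho_linear x_carrier v1] C.R.m_comm[OF x_carrier r1] by simp
  moreover have "\<psi> (rho v1 \<otimes>\<^sub>R x) = rho v1 \<odot>\<^sub>X \<psi> x"
    using linear_on_smult[OF psi r1 x] by simp
  ultimately have "proj (t ?xv) = \<zero>\<^sub>X" using proj_t[OF xv] psi_x r1 by simp
  then have y1: "dv (t ?xv) \<in> carrier C" "x \<odot>\<^sub>C dv (t ?xv) = t ?xv"
    using dv(2) txv linear_on_closed[OF dv(1)] by auto
  let ?y1 = "dv (t ?xv)"
  have psimu: "\<psi> \<mu> \<in> carrier X" by (rule linear_on_closed[OF psi \<mu>(1)])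
  have key: "\<psi> a = a \<odot>\<^sub>X (proj ?y1 \<ominus>\<^sub>X \<psi> \<mu>)" if a: "a \<in> m" for a
  proof -
    have aR: "a \<in> carrier R" by (rule m_carrier[OF a])
    have rav: "rho (a \<odot>\<^bsub>F 0\<^esub> v1) = a \<oplus>\<^sub>R a \<otimes>\<^sub>R \<mu>"
      using linear_on_smult[OF rho_linear aR v1] \<mu> m_carrier[OF \<mu>(1)] aR by (simp add: C.R.r_distr)
    have amu: "a \<otimes>\<^sub>R \<mu> \<in> m" using m.I_l_closed[OF \<mu>(1) aR] .
    have av: "a \<odot>\<^bsub>F 0\<^esub> v1 \<in> d 0 ` carrier (F (Suc 0))"
      using N rav a amu F.smult_closed[OF aR v1] by simp
    have "x \<odot>\<^sub>C (a \<odot>\<^sub>C ?y1) = a \<odot>\<^sub>C t ?xv"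
      using C.smult_left_commute[OF x_carrier aR y1(1)] y1(2) by simp
    also have "\<dots> = t (x \<odot>\<^bsub>F 0\<^esub> (a \<odot>\<^bsub>F 0\<^esub> v1))"
      using linear_on_smult[OF t(1) aR xv] F.smult_left_commute[OF aR x_carrier v1] by simp
    also have "\<dots> = x \<odot>\<^sub>C t (a \<odot>\<^bsub>F 0\<^esub> v1)" by (rule linear_on_smult[OF t(1) x_carrier av])
    finally have "a \<odot>\<^sub>C ?y1 = t (a \<odot>\<^bsub>F 0\<^esub> v1)"
      using regular_cancel aR y1(1) linear_on_closed[OF t(1) av] by simp
    then have "a \<odot>\<^sub>X proj ?y1 = \<psi> (a \<oplus>\<^sub>R a \<otimes>\<^sub>R \<mu>)"
      using linear_on_smult[OF proj_linear aR y1(1)] proj_t[OF av] rav by simp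
    also have "\<dots> = \<psi> a \<oplus>\<^sub>X a \<odot>\<^sub>X \<psi> \<mu>"
      using linear_on_add[OF psi a amu] linear_on_smult[OF psi aR \<mu>(1)] by simp
    finally show ?thesis
      using linear_on_closed[OF psi a] psimu aR proj_closed[OF y1(1)]
      by (simp add: X.smult_diff_right X.M.add_sub_cancel)
  qed
  \<comment> \<open>The subtrahend \<psi> \<mu> compensates for \<open>rho v1\<close> being 1 +
    \<mu> rather than 1.\<close>
  show ?thesis by (rule that[of "proj ?y1 \<ominus>\<^sub>X \<psi> \<mu>"]) (use key psimu proj_closed[OF y1(1)] in auto)
qed

end

section \<open>Free resolutions and extension of homomorphisms over Noetherian rings\<close>

lemma (in module) submodule_Int:
  assumes H: "submodule H R M" and K: "submodule K R M"
  shows "submodule (H \<inter> K) R M"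
proof (rule submoduleI)
  show "H \<inter> K \<subseteq> carrier M" using submoduleE(1)[OF H] by blast
  show "\<zero>\<^sub>M \<in> H \<inter> K" using submodule_zero[OF H] submodule_zero[OF K] by blast
qed (simp_all add: submoduleE(3,4,5)[OF H] submoduleE(3,4,5)[OF K])

lemma finsum_submodule:
  assumes "module R M" "submodule K R M" "finite A" "\<And>a. a \<in> A \<Longrightarrow> f a \<in> K"
  shows "finsum M f A \<in> K"
proof -
  interpret module R M by fact
  note E = submoduleE[OF assms(2)]
  show ?thesis using assms(3,4)
  proof (induction A rule: finite_induct)
    case empty then show ?case using submodule_zero[OF assms(2)] by simp
  next
    case (insert a A)
    then have "f \<in> A \<rightarrow> carrier M" "f a \<in> carrier M" using E(1) by auto
    then show ?case using insert E(5) by simp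
  qed
qed

lemma lin_comb_submodule:
  assumes "module R M" "submodule K R M" "\<And>j. j < n \<Longrightarrow> c j \<in> K" "v \<in> carrier (free_module R n)"
  shows "lin_comb M n c v \<in> K"
  unfolding lin_comb_def
  by (rule finsum_submodule[OF assms(1,2)])
     (use module.submoduleE(4)[OF assms(1,2)] assms(3) power_module_component[OF assms(4)] in auto)

lemma component_linear:
  assumes "cring R" "l < q"
  shows "linear_on R (free_module R q) (self_module R) (carrier (free_module R q)) (\<lambda>v. v l)"
  by (rule linear_onI) (use power_module_component assms in \<open>fastforce simp: free_module_simps(3,4)\<close>)+

text \<open>Generation by B is expressed through the submodules containing B, which avoids spans.
  The induction is on the number of coordinates that may be nonzero: the last of these coordinates
  form an ideal with finitely many generators, and the vectors on which it vanishes are covered by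
  the induction hypothesis.\<close>

lemma submodule_finitely_generated:
  assumes "cring R" "noetherian_ring R" and K: "submodule K R (free_module R q)"
  shows "\<exists>B\<subseteq>K. finite B \<and> (\<forall>N. submodule N R (free_module R q) \<longrightarrow> B \<subseteq> N \<longrightarrow> K \<subseteq> N)"
proof -
  interpret cring R by fact
  interpret S: module R "self_module R" by (rule module_self_module[OF assms(1)])
  interpret F: module R "free_module R q" by (rule module_free_module[OF assms(1)])
  let ?F = "free_module R q"
  have "k \<le> q \<Longrightarrow> submodule K R ?F \<Longrightarrow> (\<And>v l. v \<in> K \<Longrightarrow> k \<le> l \<Longrightarrow> l < q \<Longrightarrow> v l = \<zero>\<^sub>R) \<Longrightarrow>
     \<exists>B\<subseteq>K. finite B \<and> (\<forall>N. submodule N R ?F \<longrightarrow> B \<subseteq> N \<longrightarrow> K \<subseteq> N)" for k K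
  proof (induction k arbitrary: K)
    case 0
    have "v = \<zero>\<^bsub>?F\<^esub>" if "v \<in> K" for v
      by (rule power_module_eqI[OF _ F.zero_closed])
         (use 0 that F.submoduleE(1)[OF 0(2)] in \<open>auto simp: free_module_simps(2)\<close>)
    then show ?case using submodule_zero by (intro exI[of _ "{}"]) fastforce
  next
    case (Suc k)
    have kq: "k < q" using Suc.prems(1) by simp
    note comp = component_linear[OF assms(1) kq]
    have sub_comp: "linear_on R ?F (self_module R) L (\<lambda>v. v k)" if "submodule L R ?F" for L
      by (rule linear_on_subset[OF comp F.submoduleE(1)[OF that]])
    have ideal_comp: "ideal ((\<lambda>v. v k) ` L) R" if "submodule L R ?F" for L
      using linear_on_image[OF F.module_axioms S.module_axioms that sub_comp[OF that]]
        submodule_self_module_iff[OF assms(1)] by simp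
    obtain A where A: "A \<subseteq> carrier R" "finite A" "(\<lambda>v. v k) ` K = genideal R A"
      using noetherian_ring.finetely_gen[OF assms(2) ideal_comp[OF Suc.prems(2)]] by blast
    have "A \<subseteq> (\<lambda>v. v k) ` K" using A genideal_self by simp
    then have "\<exists>v. v \<in> K \<and> v k = a" if "a \<in> A" for a using that by auto
    then obtain pre where pre: "\<And>a. a \<in> A \<Longrightarrow> pre a \<in> K \<and> pre a k = a" by metis
    define K' where "K' = {v \<in> K. v k = \<zero>\<^sub>R}"
    have K': "submodule K' R ?F"
      using linear_on_kernel[OF F.module_axioms S.module_axioms Suc.prems(2) sub_comp[OF Suc.prems(2)]]
      by (simp add: K'_def)
    have "v l = \<zero>\<^sub>R" if "v \<in> K'" "k \<le> l" "l < q" for v l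
      using that Suc.prems(3)[of v l] by (cases "l = k") (auto simp: K'_def)
    then obtain B' where B': "B' \<subseteq> K'" "finite B'" "\<And>N. submodule N R ?F \<Longrightarrow> B' \<subseteq> N \<Longrightarrow> K' \<subseteq> N"
      using Suc.IH[OF _ K'] kq by (metis less_imp_le)
    have "K \<subseteq> N" if N: "submodule N R ?F" "B' \<union> pre ` A \<subseteq> N" for N
    proof
      fix v assume v: "v \<in> K"
      have NK: "submodule (N \<inter> K) R ?F"
        by (rule F.submodule_Int[OF N(1) Suc.prems(2)])
      have "A \<subseteq> (\<lambda>v. v k) ` (N \<inter> K)"
      proof
        fix a assume "a \<in> A"
        then have "pre a \<in> N \<inter> K" "a = pre a k" using pre N(2) by auto
        then show "a \<in> (\<lambda>v. v k) ` (N \<inter> K)" by (intro image_eqI)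
      qed
      then have "genideal R A \<subseteq> (\<lambda>v. v k) ` (N \<inter> K)" by (rule genideal_minimal[OF ideal_comp[OF NK]])
      then have "v k \<in> (\<lambda>v. v k) ` (N \<inter> K)" using A(3) v by blast
      then obtain u where u: "u \<in> N" "u \<in> K" "u k = v k" by auto
      have vc: "v \<in> carrier ?F" "u \<in> carrier ?F" using F.submoduleE(1)[OF Suc.prems(2)] v u by auto
      have "(v \<ominus>\<^bsub>?F\<^esub> u) k = v k \<ominus>\<^sub>R u k"
        using linear_on_diff[OF F.module_axioms S.module_axioms F.carrier_is_submodule comp vc] by simp
      then have "v \<ominus>\<^bsub>?F\<^esub> u \<in> K'"
        unfolding K'_def using u F.submodule_diff[OF Suc.prems(2) v u(2)] power_module_component[OF vc(1) kq]
        by (simp add: r_neg a_minus_def)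
      then have "v \<ominus>\<^bsub>?F\<^esub> u \<in> N" using B'(3)[OF N(1)] N(2) by auto
      then have "v \<ominus>\<^bsub>?F\<^esub> u \<oplus>\<^bsub>?F\<^esub> u \<in> N" using F.submoduleE(5)[OF N(1)] u(1) by blast
      then show "v \<in> N" using F.sub_add_cancel[OF vc] by simp
    qed
    moreover have "B' \<union> pre ` A \<subseteq> K" using B'(1) pre by (auto simp: K'_def)
    moreover have "finite (B' \<union> pre ` A)" using A B' by simp
    ultimately show ?case by blast
  qed
  from this[of q K] show ?thesis using K by simp
qed

text \<open>The columns of the matrix are finitely many generators of K.\<close>

lemma submodule_matrix_image:
  assumes "cring R" "noetherian_ring R" and K: "submodule K R (free_module R q)"
  obtains r A where "\<And>l j. l < q \<Longrightarrow> j < r \<Longrightarrow> A l j \<in> carrier R"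
    "matrix_map R q r A ` carrier (free_module R r) = K"
proof -
  interpret F: module R "free_module R q" by (rule module_free_module[OF assms(1)])
  obtain B where B: "B \<subseteq> K" "finite B" "\<And>N. submodule N R (free_module R q) \<Longrightarrow> B \<subseteq> N \<Longrightarrow> K \<subseteq> N"
    using submodule_finitely_generated[OF assms] by blast
  obtain bs where bs: "set bs = B" using B(2) finite_list by blast
  define r where "r = length bs"
  define A where "A l j = (bs ! j) l" for l j
  have bsK: "bs ! j \<in> K" if "j < r" for j using that B(1) bs nth_mem by (auto simp: r_def)
  then have bsF: "bs ! j \<in> carrier (free_module R q)" if "j < r" for j
    using that F.submoduleE(1)[OF K] by auto
  have A: "A l j \<in> carrier R" if "l < q" "j < r" for l j
    using power_module_component[OF bsF[OF that(2)] that(1)] by (simp add: A_def)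
  note lin = linear_on_matrix_map[where A = A and p = q and q = r, OF assms(1) A]
  have col: "matrix_map R q r A (basis_vec R r j) = bs ! j" if "j < r" for j
  proof -
    have "matrix_map R q r A (basis_vec R r j) = (\<lambda>l\<in>{..<q}. A l j)"
      by (rule matrix_map_basis_vec[where A = A and p = q, OF assms(1) A that])
    also have "\<dots> = bs ! j"
      by (rule power_module_eqI[of _ "self_module R" q, OF _ bsF[OF that]])
         (use A that in \<open>auto simp: free_module_simps(1) A_def\<close>)
    finally show ?thesis .
  qed
  have "matrix_map R q r A ` carrier (free_module R r) = K"
  proof
    have "B \<subseteq> matrix_map R q r A ` carrier (free_module R r)"
    proof
      fix b assume "b \<in> B"
      then obtain j where "j < r" "b = bs ! j" using bs by (metis in_set_conv_nth r_def)
      then show "b \<in> matrix_map R q r A ` carrier (free_module R r)"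
        using col basis_vec_closed[OF assms(1)] by (metis imageI)
    qed
    then show "K \<subseteq> matrix_map R q r A ` carrier (free_module R r)"
      using B(3) linear_on_image[OF module_free_module[OF assms(1)] F.module_axioms
          module.carrier_is_submodule[OF module_free_module[OF assms(1)]] lin] by blast
    show "matrix_map R q r A ` carrier (free_module R r) \<subseteq> K"
    proof
      fix y assume "y \<in> matrix_map R q r A ` carrier (free_module R r)"
      then obtain v where v: "v \<in> carrier (free_module R r)" "y = matrix_map R q r A v" by auto
      have "matrix_map R q r A v = lin_comb (free_module R q) r (\<lambda>j. matrix_map R q r A (basis_vec R r j)) v"
        by (rule linear_eq_lin_comb[OF F.module_axioms lin v(1)])
      also have "\<dots> \<in> K"
        by (rule lin_comb_submodule[OF F.module_axioms K _ v(1)]) (use col bsK in simp)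
      finally show "y \<in> K" using v(2) by simp
    qed
  qed
  then show ?thesis using that A by blast
qed

text \<open>The kernel of each matrix is finitely generated, hence the image of a next matrix. The
  iteration carries triples of a row count, a column count and a matrix.\<close>

lemma free_resolution_exists:
  assumes "cring R" "noetherian_ring R" "ideal m R"
  obtains n D e where "free_resolution R (quot_module (self_module R) m) n D e"
proof -
  interpret cring R by fact
  interpret S: module R "self_module R" by (rule module_self_module[OF assms(1)])
  interpret m: ideal m R by fact
  let ?k = "quot_module (self_module R) m"
  have ms: "submodule m R (self_module R)" using submodule_self_module_iff assms(1,3) by blast
  interpret k: module R ?k by (rule module_quot_module[OF S.module_axioms ms])
  interpret F: module R "free_module R q" for q by (rule module_free_module[OF assms(1)])
  define e where "e = (\<lambda>j::nat. m +>\<^sub>R \<one>\<^sub>R)"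
  have e: "e j \<in> carrier ?k" for j
    by (auto simp: e_def quot_module_simps[OF S.module_axioms ms])
  have aug: "linear_on R (free_module R 1) ?k (carrier (free_module R 1)) (lin_comb ?k 1 e)"
    by (rule linear_on_lin_comb[OF k.module_axioms e])
  obtain r A where A: "\<And>l j. l < 1 \<Longrightarrow> j < r \<Longrightarrow> A l j \<in> carrier R"
    "matrix_map R 1 r A ` carrier (free_module R r) = {v \<in> carrier (free_module R 1). lin_comb ?k 1 e v = \<zero>\<^bsub>?k\<^esub>}"
    using submodule_matrix_image[OF assms(1,2)
        linear_on_kernel[OF F.module_axioms k.module_axioms F.carrier_is_submodule aug]] by blast
  define closed where
    "closed s \<longleftrightarrow> (\<forall>l<fst s. \<forall>j<fst (snd s). snd (snd s) l j \<in> carrier R)" for s :: "nat \<times> nat \<times> (nat \<Rightarrow> nat \<Rightarrow> 'a)"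
  \<comment> \<open>Consecutive stages fit together: the source of s is the target of t, and the
    sequence is exact between them.\<close>
  define Q where "Q s t \<longleftrightarrow> fst t = fst (snd s) \<and>
        {v \<in> carrier (free_module R (fst (snd s))).
           matrix_map R (fst s) (fst (snd s)) (snd (snd s)) v = \<zero>\<^bsub>free_module R (fst s)\<^esub>} =
          matrix_map R (fst t) (fst (snd t)) (snd (snd t)) ` carrier (free_module R (fst (snd t)))"
    for s t :: "nat \<times> nat \<times> (nat \<Rightarrow> nat \<Rightarrow> 'a)"
  have step: "\<exists>t. closed t \<and> Q s t" if "closed s" for s
  proof -
    obtain p q A0 where pq: "s = (p, q, A0)" by (metis surj_pair)
    have cl: "A0 l j \<in> carrier R" if "l < p" "j < q" for l j
      using \<open>closed s\<close> that by (auto simp: pq closed_def)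
    note lin = linear_on_matrix_map[where A = A0 and p = p and q = q, OF assms(1) cl]
    obtain r' A' where "\<And>l j. l < q \<Longrightarrow> j < r' \<Longrightarrow> A' l j \<in> carrier R"
      "matrix_map R q r' A' ` carrier (free_module R r') =
        {v \<in> carrier (free_module R q). matrix_map R p q A0 v = \<zero>\<^bsub>free_module R p\<^esub>}"
      using submodule_matrix_image[OF assms(1,2)
          linear_on_kernel[OF F.module_axioms F.module_axioms F.carrier_is_submodule lin]] by blast
    then have "closed (q, r', A')" "Q s (q, r', A')" by (auto simp: pq closed_def Q_def)
    then show ?thesis by blast
  qed
  define nxt where "nxt s = (SOME t. closed t \<and> Q s t)" for s
  have nxt: "closed (nxt s) \<and> Q s (nxt s)" if "closed s" for s
    unfolding nxt_def by (rule someI_ex[OF step[OF that]])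
  define s where "s = rec_nat (1, r, A) (\<lambda>_. nxt)"
  have s0: "s 0 = (1, r, A)" and sS: "s (Suc i) = nxt (s i)" for i by (simp_all add: s_def)
  have cl: "closed (s i)" for i
  proof (induction i)
    case 0 then show ?case using A(1) by (simp add: s0 closed_def)
  qed (simp add: sS nxt)
  have Qs: "Q (s i) (s (Suc i))" for i using nxt[OF cl] by (simp add: sS)
  define n D where "n i = fst (s i)" and "D i = snd (snd (s i))" for i
  have n_Suc: "n (Suc i) = fst (snd (s i))" for i using Qs[of i] by (simp add: n_def Q_def)
  have n01: "n 0 = 1" "n (Suc 0) = r" "D 0 = A" using n_Suc[of 0] by (auto simp: n_def D_def s0)
  have D: "D i l j \<in> carrier R" if "l < n i" "j < n (Suc i)" for i l j
    using cl[of i] that unfolding n_Suc by (simp add: closed_def D_def n_def)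
  have ex: "{v \<in> carrier (free_module R (n (Suc i))). matrix_map R (n i) (n (Suc i)) (D i) v = \<zero>\<^bsub>free_module R (n i)\<^esub>} =
      matrix_map R (n (Suc i)) (n (Suc (Suc i))) (D (Suc i)) ` carrier (free_module R (n (Suc (Suc i))))" for i
    using Qs[of i] unfolding n_Suc[of "Suc i"] unfolding n_Suc[of i] by (simp add: Q_def n_def D_def)
  have surj: "lin_comb ?k 1 e ` carrier (free_module R 1) = carrier ?k"
  proof
    show "lin_comb ?k 1 e ` carrier (free_module R 1) \<subseteq> carrier ?k"
      using linear_on_closed[OF aug] by auto
    show "carrier ?k \<subseteq> lin_comb ?k 1 e ` carrier (free_module R 1)"
    proof
      fix y assume "y \<in> carrier ?k"
      then obtain a where a: "a \<in> carrier R" "y = m +>\<^sub>R a"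
        by (auto simp: quot_module_simps[OF S.module_axioms ms])
      have l: "linear_on R (self_module R) ?k (carrier R) (\<lambda>x. m +>\<^sub>R x)"
        using linear_on_coset[OF S.module_axioms ms] by simp
      have "lin_comb ?k 1 e (\<lambda>j\<in>{..<1}. a) = a \<odot>\<^bsub>?k\<^esub> (m +>\<^sub>R \<one>\<^sub>R)"
        unfolding lin_comb_def using e[of 0] a(1) by (simp add: lessThan_Suc e_def)
      also have "\<dots> = y" using linear_on_smult[OF l a(1), of "\<one>\<^sub>R"] a by simp
      finally show "y \<in> lin_comb ?k 1 e ` carrier (free_module R 1)"
        using a(1) by (intro image_eqI[of _ _ "\<lambda>j\<in>{..<1}. a"]) (auto simp: free_module_simps(1))
    qed
  qed
  have "free_resolution R ?k n D e"
    unfolding free_resolution_def Let_def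
  proof (intro conjI allI impI)
    show "D i l j \<in> carrier R" if "l < n i" "j < n (Suc i)" for i l j by (rule D[OF that])
    show "e j \<in> carrier ?k" for j by (rule e)
    show "(\<lambda>v. \<Oplus>\<^bsub>?k\<^esub> j\<in>{..<n 0}. v j \<odot>\<^bsub>?k\<^esub> e j) ` carrier (free_module R (n 0)) = carrier ?k"
      using surj unfolding n01 lin_comb_def .
    show "{v \<in> carrier (free_module R (n 0)). (\<Oplus>\<^bsub>?k\<^esub> j\<in>{..<n 0}. v j \<odot>\<^bsub>?k\<^esub> e j) = \<zero>\<^bsub>?k\<^esub>} =
        matrix_map R (n 0) (n (Suc 0)) (D 0) ` carrier (free_module R (n 1))"
      using A(2) unfolding n01 lin_comb_def One_nat_def by (rule sym)
  qed (rule ex)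
  then show ?thesis by (rule that)
qed

text \<open>\<open>B i\<close> plays the role of the \<open>i\<close>-th power of \<open>m\<close>: if a power of \<open>m\<close> annihilates an element
  modulo \<open>U\<close>, then some multiple of the element lies in the socle modulo \<open>U\<close>.\<close>

lemma socle_multiple:
  fixes B :: "nat \<Rightarrow> 'a set"
  assumes "module R M" and v: "v \<in> carrier M" "v \<notin> U"
    and B0: "B 0 = carrier R" and B: "\<And>i. B i \<subseteq> carrier R"
    and BS: "\<And>i a b. a \<in> m \<Longrightarrow> b \<in> B i \<Longrightarrow> a \<otimes>\<^sub>R b \<in> B (Suc i)" and m: "m \<subseteq> carrier R"
    and BN: "\<And>b. b \<in> B N \<Longrightarrow> b \<odot>\<^sub>M v \<in> U"
  obtains b where "b \<in> carrier R" "b \<odot>\<^sub>M v \<notin> U" "\<And>a. a \<in> m \<Longrightarrow> a \<odot>\<^sub>M (b \<odot>\<^sub>M v) \<in> U"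
proof -
  interpret module R M by fact
  let ?P = "\<lambda>i. \<exists>b\<in>B i. b \<odot>\<^sub>M v \<notin> U"
  have "?P 0" using v B0 by (intro bexI[of _ "\<one>\<^sub>R"]) auto
  have "\<exists>i. ?P i \<and> \<not> ?P (Suc i)"
  proof (rule ccontr)
    assume "\<not> ?thesis"
    then have "?P i" for i using \<open>?P 0\<close> by (induction i) blast+
    then show False using BN by blast
  qed
  then obtain i b where i: "b \<in> B i" "b \<odot>\<^sub>M v \<notin> U" "\<not> ?P (Suc i)" by blast
  have "a \<odot>\<^sub>M (b \<odot>\<^sub>M v) \<in> U" if "a \<in> m" for a
  proof -
    have "(a \<otimes>\<^sub>R b) \<odot>\<^sub>M v \<in> U" using i(3) BS[OF that i(1)] by blast
    then show ?thesis using that i(1) m B v(1) by (simp add: smult_assoc1 subset_iff)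
  qed
  then show ?thesis using that[of b] i B by blast
qed

text \<open>An element killed by x is killed by \<open>B N\<close>, whose elements are multiples of
  x. If it were nonzero, some multiple of it would be nonzero and killed by m, against the vanishing
  in degree zero.\<close>

lemma regular_of_Ext_0:
  fixes B :: "nat \<Rightarrow> 'a set"
  assumes res: "resolution R m C n D e" and E: "carrier (Ext_module C n D 0) = {\<zero>\<^bsub>Ext_module C n D 0\<^esub>}"
    and x: "x \<in> carrier R"
    and B: "B 0 = carrier R" "\<And>i. B i \<subseteq> carrier R" "\<And>i a b. a \<in> m \<Longrightarrow> b \<in> B i \<Longrightarrow> a \<otimes>\<^sub>R b \<in> B (Suc i)"
    and BN: "\<And>b. b \<in> B N \<Longrightarrow> \<exists>r\<in>carrier R. b = x \<otimes>\<^sub>R r"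
    and y: "y \<in> carrier C" "x \<odot>\<^sub>C y = \<zero>\<^sub>C"
  shows "y = \<zero>\<^sub>C"
proof (rule ccontr)
  interpret resolution R m C n D e by (rule res)
  assume "y \<noteq> \<zero>\<^sub>C"
  then have ny: "y \<notin> {\<zero>\<^sub>C}" by simp
  have By: "b \<odot>\<^sub>C y \<in> {\<zero>\<^sub>C}" if b: "b \<in> B N" for b
  proof -
    obtain r where r: "r \<in> carrier R" "b = x \<otimes>\<^sub>R r" using BN[OF b] by blast
    then have "b \<odot>\<^sub>C y = r \<odot>\<^sub>C (x \<odot>\<^sub>C y)" using C.smult_assoc1[OF r(1) x y(1)] C.R.m_comm[OF r(1) x] by simp
    then show ?thesis using y(2) C.smult_r_null[OF r(1)] by simp
  qed
  have mc: "m \<subseteq> carrier R" using m.a_subset .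
  obtain b where b: "b \<in> carrier R" "b \<odot>\<^sub>C y \<notin> {\<zero>\<^sub>C}" "\<And>a. a \<in> m \<Longrightarrow> a \<odot>\<^sub>C (b \<odot>\<^sub>C y) \<in> {\<zero>\<^sub>C}"
    by (rule socle_multiple[where B = B and m = m and N = N, OF C y(1) ny B mc By]) simp_all
  have "b \<odot>\<^sub>C y = \<zero>\<^sub>C"
    by (rule Ext_0_trivialD[OF E C.smult_closed[OF b(1) y(1)]]) (use b(3) in blast)
  then show False using b(2) by blast
qed

text \<open>The isomorphism runs from the image to the quotient, because
  \<open>module_isomorphic\<close> is directed and the Ext module stands on its left side. It sends
  y to the coset of a chosen preimage.\<close>

lemma module_isomorphic_quot:
  assumes M: "module R M" and N: "module R N" and f: "linear_on R M N (carrier M) f"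
    and surj: "f ` carrier M = carrier N"
    and ker: "\<And>x. x \<in> carrier M \<Longrightarrow> f x = \<zero>\<^sub>N \<longleftrightarrow> x \<in> K" and K: "submodule K R M"
  shows "module_isomorphic R N (quot_module M K)"
proof -
  interpret M: module R M by fact
  interpret N: module R N by fact
  interpret Q: module R "quot_module M K" by (rule module_quot_module[OF M K])
  define pre where "pre y = (SOME x. x \<in> carrier M \<and> f x = y)" for y
  have pre: "pre y \<in> carrier M \<and> f (pre y) = y" if "y \<in> carrier N" for y
    unfolding pre_def by (rule someI_ex) (use that surj in \<open>metis imageE\<close>)
  define g where "g y = K +>\<^sub>M pre y" for y
  have eq: "K +>\<^sub>M x = K +>\<^sub>M y \<longleftrightarrow> f x = f y" if "x \<in> carrier M" "y \<in> carrier M" for x y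
  proof -
    have "K +>\<^sub>M x = K +>\<^sub>M y \<longleftrightarrow> x \<ominus>\<^sub>M y \<in> K" by (rule coset_eq_iff[OF M K that])
    also have "\<dots> \<longleftrightarrow> f (x \<ominus>\<^sub>M y) = \<zero>\<^sub>N" using ker that by simp
    also have "f (x \<ominus>\<^sub>M y) = f x \<ominus>\<^sub>N f y"
      by (rule linear_on_diff[OF M N M.carrier_is_submodule f that])
    finally show ?thesis using N.M.sub_eq_zero_iff linear_on_closed[OF f] that by simp
  qed
  have gf: "g (f x) = K +>\<^sub>M x" if "x \<in> carrier M" for x
    unfolding g_def using eq pre[of "f x"] linear_on_closed[OF f that] that by simp
  have c: "linear_on R M (quot_module M K) (carrier M) (\<lambda>x. K +>\<^sub>M x)" by (rule linear_on_coset[OF M K])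
  have "bij_betw g (carrier N) (carrier (quot_module M K))"
    unfolding bij_betw_def
  proof
    show "inj_on g (carrier N)"
      by (rule inj_onI) (metis eq g_def pre)
    show "g ` carrier N = carrier (quot_module M K)"
    proof -
      have "g ` carrier N = (\<lambda>x. g (f x)) ` carrier M" unfolding surj[symmetric] by (rule image_image)
      also have "\<dots> = (\<lambda>x. K +>\<^sub>M x) ` carrier M" by (rule image_cong[OF refl]) (rule gf)
      finally show ?thesis unfolding quot_module_simps(1)[OF M K] .
    qed
  qed
  moreover have "g (x \<oplus>\<^sub>N y) = g x \<oplus>\<^bsub>quot_module M K\<^esub> g y" if xy: "x \<in> carrier N" "y \<in> carrier N" for x y
  proof -
    obtain a where a: "a \<in> carrier M" "x = f a" using pre[OF xy(1)] by metis
    obtain b where b: "b \<in> carrier M" "y = f b" using pre[OF xy(2)] by metis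
    note ab = a(1) b(1)
    show ?thesis
      using gf[of "a \<oplus>\<^sub>M b"] gf[of a] gf[of b] a b linear_on_add[OF f ab(1,2)] linear_on_add[OF c ab(1,2)]
      by simp
  qed
  moreover have "g (r \<odot>\<^sub>N x) = r \<odot>\<^bsub>quot_module M K\<^esub> g x" if rx: "r \<in> carrier R" "x \<in> carrier N" for r x
  proof -
    obtain a where a: "a \<in> carrier M" "x = f a" using pre[OF rx(2)] by metis
    then show ?thesis
      using gf[of "r \<odot>\<^sub>M a"] gf[of a] linear_on_smult[OF f rx(1) a(1)] linear_on_smult[OF c rx(1) a(1)] rx(1)
      by simp
  qed
  ultimately show ?thesis unfolding module_isomorphic_def by blast
qed

section \<open>Maximal extensions of homomorphisms\<close>

lemma (in module) submodule_Union_chain: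
  assumes "subset.chain {K. submodule K R M} CC" "CC \<noteq> {}"
  shows "submodule (\<Union>CC) R M"
proof -
  have sub: "submodule K R M" if "K \<in> CC" for K using assms(1) that by (auto simp: subset.chain_def)
  show ?thesis
  proof (rule submoduleI)
    show "\<Union>CC \<subseteq> carrier M" using submoduleE(1)[OF sub] by blast
    show "\<zero>\<^sub>M \<in> \<Union>CC" using submodule_zero[OF sub] assms(2) by blast
    show "\<ominus>\<^sub>M a \<in> \<Union>CC" if "a \<in> \<Union>CC" for a using that submoduleE(3)[OF sub] by (meson UnionE UnionI)
    show "r \<odot>\<^sub>M a \<in> \<Union>CC" if "r \<in> carrier R" "a \<in> \<Union>CC" for r a
      using that submoduleE(4)[OF sub] by (meson UnionE UnionI)
    fix a b assume "a \<in> \<Union>CC" "b \<in> \<Union>CC"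
    then obtain H K where HK: "H \<in> CC" "K \<in> CC" "a \<in> H" "b \<in> K" by blast
    then have "H \<subseteq> K \<or> K \<subseteq> H" using assms(1) by (auto simp: subset.chain_def)
    then show "a \<oplus>\<^sub>M b \<in> \<Union>CC"
      using HK submoduleE(5)[OF sub] by (meson UnionI subsetD)
  qed
qed

text \<open>A form of Baer's criterion: over an Artinian quotient it is enough to extend
  homomorphisms from \<open>m\<close> to \<open>R\<close>.\<close>

lemma linear_extension:
  assumes M: "module R M" and X: "module R X" and m: "maximalideal m R" and x: "x \<in> m"
    and fg: "\<And>K. submodule K R M \<Longrightarrow> \<exists>B\<subseteq>K. finite B \<and> (\<forall>N. submodule N R M \<longrightarrow> B \<subseteq> N \<longrightarrow> K \<subseteq> N)"
    and inj: "\<And>\<psi>. linear_on R (self_module R) X m \<psi> \<Longrightarrow> \<psi> x = \<zero>\<^sub>X \<Longrightarrow> \<exists>y\<in>carrier X. \<forall>a\<in>m. \<psi> a = a \<odot>\<^sub>X y"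
    and climb: "\<And>U v. submodule U R M \<Longrightarrow> (\<And>w. w \<in> carrier M \<Longrightarrow> x \<odot>\<^sub>M w \<in> U) \<Longrightarrow> v \<in> carrier M \<Longrightarrow> v \<notin> U \<Longrightarrow>
      \<exists>b\<in>carrier R. b \<odot>\<^sub>M v \<notin> U \<and> (\<forall>a\<in>m. a \<odot>\<^sub>M (b \<odot>\<^sub>M v) \<in> U)"
    and N: "submodule N R M" and f: "linear_on R M X N f"
    and xN: "\<And>w. w \<in> carrier M \<Longrightarrow> x \<odot>\<^sub>M w \<in> N \<and> f (x \<odot>\<^sub>M w) = \<zero>\<^sub>X"
  obtains g where "linear_on R M X (carrier M) g" "\<And>u. u \<in> N \<Longrightarrow> g u = f u"
proof -
  interpret M: module R M by fact
  interpret X: module R X by fact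
  interpret m: maximalideal m R by fact
  interpret S: module R "self_module R" by (rule module_self_module[OF M.R.is_cring])
  let ?P = "\<lambda>K h. linear_on R M X K h \<and> (\<forall>u\<in>N. h u = f u)"
  \<comment> \<open>Only the domains are ordered, not pairs of a domain and a map: finite generation
    makes the union of a chain equal to one of its members, so that no maps have to be glued along
    the chain.\<close>
  define AA where "AA = {K. submodule K R M \<and> N \<subseteq> K \<and> (\<exists>h. ?P K h)}"
  have NA: "N \<in> AA" using N f by (auto simp: AA_def)
  have "\<exists>K\<in>AA. \<forall>L\<in>AA. K \<subseteq> L \<longrightarrow> L = K"
  proof (rule subset_Zorn_nonempty)
    show "AA \<noteq> {}" using NA by blast
    fix CC assume CC: "CC \<noteq> {}" "subset.chain AA CC"
    have ch: "subset.chain {K. submodule K R M} CC" using CC(2) by (auto simp: subset.chain_def AA_def)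
    have U: "submodule (\<Union>CC) R M" by (rule M.submodule_Union_chain[OF ch CC(1)])
    obtain B where B: "B \<subseteq> \<Union>CC" "finite B" "\<And>N. submodule N R M \<Longrightarrow> B \<subseteq> N \<Longrightarrow> \<Union>CC \<subseteq> N"
      using fg[OF U] by blast
    obtain K where K: "K \<in> CC" "B \<subseteq> K"
      using finite_subset_Union_chain[OF B(2,1) CC(1) CC(2)] by blast
    have "K \<in> AA" using K(1) CC(2) by (auto simp: subset.chain_def)
    then have "submodule K R M" unfolding AA_def by blast
    then have "\<Union>CC = K" using B(3)[of K] K by blast
    then show "\<Union>CC \<in> AA" using \<open>K \<in> AA\<close> by (simp only:)
  qed
  then obtain K where K: "K \<in> AA" "\<forall>L\<in>AA. K \<subseteq> L \<longrightarrow> L = K" by (rule bexE)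
  from K(1) obtain h where Ks: "submodule K R M" "N \<subseteq> K"
    and h: "linear_on R M X K h" "\<forall>u\<in>N. h u = f u" unfolding AA_def by blast
  have "K = carrier M"
  proof (rule ccontr)
    assume "K \<noteq> carrier M"
    then obtain v0 where "v0 \<in> carrier M" "v0 \<notin> K" using M.submoduleE(1)[OF Ks(1)] by blast
    \<comment> \<open>Passing to a multiple of v0 makes m times the vector land in K, so the map
      that governs the extension is defined on m, where \<open>inj\<close> applies.\<close>
    then obtain b where b: "b \<in> carrier R" "b \<odot>\<^sub>M v0 \<notin> K" "\<forall>a\<in>m. a \<odot>\<^sub>M (b \<odot>\<^sub>M v0) \<in> K"
      using climb[OF Ks(1), of v0] xN Ks(2) by blast
    define v where "v = b \<odot>\<^sub>M v0"
    have v: "v \<in> carrier M" "v \<notin> K" "\<And>a. a \<in> m \<Longrightarrow> a \<odot>\<^sub>M v \<in> K"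
      using b \<open>v0 \<in> carrier M\<close> by (auto simp: v_def)
    have ms: "m \<subseteq> carrier R" using m.a_subset by simp
    define \<psi> where "\<psi> a = h (a \<odot>\<^sub>M v)" for a
    have psi: "linear_on R (self_module R) X m \<psi>"
    proof (rule linear_onI)
      fix a assume a: "a \<in> m"
      then have aR: "a \<in> carrier R" using ms by blast
      show "\<psi> a \<in> carrier X" unfolding \<psi>_def by (rule linear_on_closed[OF h(1) v(3)[OF a]])
      show "\<psi> (r \<odot>\<^bsub>self_module R\<^esub> a) = r \<odot>\<^sub>X \<psi> a" if "r \<in> carrier R" for r
        unfolding \<psi>_def using linear_on_smult[OF h(1) that v(3)[OF a]] M.smult_assoc1[OF that aR v(1)] by simp
      fix a' assume a': "a' \<in> m"
      then have aR': "a' \<in> carrier R" using ms by blast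
      show "\<psi> (a \<oplus>\<^bsub>self_module R\<^esub> a') = \<psi> a \<oplus>\<^sub>X \<psi> a'"
        unfolding \<psi>_def using linear_on_add[OF h(1) v(3)[OF a] v(3)[OF a']] M.smult_l_distr[OF aR aR' v(1)] by simp
    qed
    have "\<psi> x = \<zero>\<^sub>X" unfolding \<psi>_def using h(2) xN[OF v(1)] by simp
    then obtain y where y: "y \<in> carrier X" "\<forall>a\<in>m. \<psi> a = a \<odot>\<^sub>X y" using inj[OF psi] by blast
    \<comment> \<open>The extension sends u + a v to h(u) + a y. It is single-valued because a v
      lies in K only for a in m, and there a y equals h(a v).\<close>
    let ?G = "{(u \<oplus>\<^sub>M a \<odot>\<^sub>M v, h u \<oplus>\<^sub>X a \<odot>\<^sub>X y) | u a. u \<in> K \<and> a \<in> carrier R}"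
    have Kc: "u \<in> carrier M" if "u \<in> K" for u using that M.submoduleE(1)[OF Ks(1)] by blast
    have hc: "h u \<in> carrier X" if "u \<in> K" for u using linear_on_closed[OF h(1) that] .
    have inm: "a \<in> m" if a: "a \<in> carrier R" "a \<odot>\<^sub>M v \<in> K" for a
    proof (rule ccontr)
      assume "a \<notin> m"
      define J where "J = {r \<in> carrier R. r \<odot>\<^sub>M v \<in> K}"
      have "linear_on R (self_module R) M (carrier R) (\<lambda>r. r \<odot>\<^sub>M v)"
        by (rule linear_onI) (use v(1) in \<open>auto simp: M.smult_l_distr M.smult_assoc1\<close>)
      have "ideal J R"
        unfolding submodule_self_module_iff[OF M.R.is_cring, symmetric]
      proof (rule S.submoduleI)
        show "\<ominus>\<^bsub>self_module R\<^esub> r \<in> J" if "r \<in> J" for r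
          using that v(1) M.submoduleE(3)[OF Ks(1)] by (simp add: J_def M.smult_l_minus)
        show "r \<oplus>\<^bsub>self_module R\<^esub> s \<in> J" if "r \<in> J" "s \<in> J" for r s
          using that v(1) M.submoduleE(5)[OF Ks(1)] by (simp add: J_def M.smult_l_distr)
        show "r \<odot>\<^bsub>self_module R\<^esub> s \<in> J" if "r \<in> carrier R" "s \<in> J" for r s
          using that v(1) M.submoduleE(4)[OF Ks(1)] by (simp add: J_def M.smult_assoc1)
      qed (use v(1) submodule_zero[OF Ks(1)] in \<open>auto simp: J_def\<close>)
      moreover have "m \<subseteq> J" using v(3) ms by (auto simp: J_def)
      moreover have "J \<subseteq> carrier R" "a \<in> J" using a by (auto simp: J_def)
      ultimately have "J = carrier R" using m.I_maximal \<open>a \<notin> m\<close> by blast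
      then have "\<one>\<^sub>R \<odot>\<^sub>M v \<in> K" using M.R.one_closed unfolding J_def by blast
      then show False using v(1,2) by simp
    qed
    obtain g where g: "linear_on R M X (fst ` ?G) g" "\<And>w z. (w, z) \<in> ?G \<Longrightarrow> g w = z"
    proof (rule linear_on_graph[where \<Gamma> = ?G, OF M X])
      fix w z assume "(w, z) \<in> ?G"
      then obtain u a where ua: "u \<in> K" "a \<in> carrier R" "w = u \<oplus>\<^sub>M a \<odot>\<^sub>M v" "z = h u \<oplus>\<^sub>X a \<odot>\<^sub>X y" by blast
      then show "w \<in> carrier M \<and> z \<in> carrier X" using Kc hc v(1) y(1) by simp
      show "(r \<odot>\<^sub>M w, r \<odot>\<^sub>X z) \<in> ?G" if r: "r \<in> carrier R" for r
        using r ua Kc[OF ua(1)] hc[OF ua(1)] v(1) y(1) M.submoduleE(4)[OF Ks(1) r ua(1)]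
          linear_on_smult[OF h(1) r ua(1)]
        by (intro CollectI exI[of _ "r \<odot>\<^sub>M u"] exI[of _ "r \<otimes>\<^sub>R a"])
           (simp add: M.smult_r_distr X.smult_r_distr M.smult_assoc1 X.smult_assoc1)
      fix w' z' assume "(w', z') \<in> ?G"
      then obtain u' a' where ua': "u' \<in> K" "a' \<in> carrier R" "w' = u' \<oplus>\<^sub>M a' \<odot>\<^sub>M v" "z' = h u' \<oplus>\<^sub>X a' \<odot>\<^sub>X y" by blast
      show "(w \<oplus>\<^sub>M w', z \<oplus>\<^sub>X z') \<in> ?G"
        using ua ua' Kc[OF ua(1)] hc[OF ua(1)] Kc[OF ua'(1)] hc[OF ua'(1)] v(1) y(1) M.submoduleE(5)[OF Ks(1) ua(1) ua'(1)]
          linear_on_add[OF h(1) ua(1) ua'(1)]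
        by (intro CollectI exI[of _ "u \<oplus>\<^sub>M u'"] exI[of _ "a \<oplus>\<^sub>R a'"])
           (simp add: M.smult_l_distr X.smult_l_distr M.M.a_ac X.M.a_ac)
    next
      fix z assume "(\<zero>\<^sub>M, z) \<in> ?G"
      then obtain u a where ua: "u \<in> K" "a \<in> carrier R" "\<zero>\<^sub>M = u \<oplus>\<^sub>M a \<odot>\<^sub>M v" "z = h u \<oplus>\<^sub>X a \<odot>\<^sub>X y" by blast
      have av: "a \<odot>\<^sub>M v \<in> carrier M" using ua v by simp
      have "a \<odot>\<^sub>M v = \<ominus>\<^sub>M u"
        using ua(3) Kc[OF ua(1)] av by (metis M.M.a_comm M.M.minus_equality)
      then have "a \<odot>\<^sub>M v \<in> K" using M.submoduleE(3)[OF Ks(1) ua(1)] by simp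
      then have am: "a \<in> m" using inm ua(2) by blast
      have "z = h u \<oplus>\<^sub>X h (a \<odot>\<^sub>M v)" using ua(4) y(2) am by (simp add: \<psi>_def)
      also have "\<dots> = h \<zero>\<^sub>M" using linear_on_add[OF h(1) ua(1) v(3)[OF am]] ua(3) by simp
      also have "\<dots> = \<zero>\<^sub>X" by (rule linear_on_zero[OF M X Ks(1) h(1)])
      finally show "z = \<zero>\<^sub>X" .
    qed (rule that)
    define L where "L = fst ` ?G"
    have Lmem: "w \<in> L \<longleftrightarrow> (\<exists>u a. u \<in> K \<and> a \<in> carrier R \<and> w = u \<oplus>\<^sub>M a \<odot>\<^sub>M v)" for w
      unfolding L_def by force
    have KL: "K \<subseteq> L"
    proof
      fix u assume "u \<in> K"
      then have "u = u \<oplus>\<^sub>M \<zero>\<^sub>R \<odot>\<^sub>M v" using Kc v(1) by simp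
      then show "u \<in> L" unfolding Lmem using \<open>u \<in> K\<close> M.R.zero_closed by blast
    qed
    have vL: "v \<in> L"
      unfolding Lmem using v(1) submodule_zero[OF Ks(1)] M.R.one_closed
      by (intro exI[of _ "\<zero>\<^sub>M"] exI[of _ "\<one>\<^sub>R"]) simp
    have gh: "g u = h u" if "u \<in> K" for u
    proof (rule g(2))
      have "u = u \<oplus>\<^sub>M \<zero>\<^sub>R \<odot>\<^sub>M v" "h u = h u \<oplus>\<^sub>X \<zero>\<^sub>R \<odot>\<^sub>X y" using that Kc hc v(1) y(1) by simp_all
      then show "(u, h u) \<in> ?G" using that M.R.zero_closed by blast
    qed
    have "submodule L R M"
    proof (rule M.submoduleI)
      show "L \<subseteq> carrier M" unfolding Lmem subset_iff using Kc v(1) by auto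
      show "\<zero>\<^sub>M \<in> L" using KL submodule_zero[OF Ks(1)] by blast
      have sm: "r \<odot>\<^sub>M w \<in> L" if r: "r \<in> carrier R" and "w \<in> L" for r w
      proof -
        obtain u a where ua: "u \<in> K" "a \<in> carrier R" "w = u \<oplus>\<^sub>M a \<odot>\<^sub>M v" using \<open>w \<in> L\<close> Lmem by blast
        then have "r \<odot>\<^sub>M w = r \<odot>\<^sub>M u \<oplus>\<^sub>M (r \<otimes>\<^sub>R a) \<odot>\<^sub>M v"
          using r Kc v(1) by (simp add: M.smult_r_distr M.smult_assoc1)
        then show ?thesis unfolding Lmem using M.submoduleE(4)[OF Ks(1) r ua(1)] r ua(2) M.R.m_closed by blast
      qed
      then show "r \<in> carrier R \<Longrightarrow> w \<in> L \<Longrightarrow> r \<odot>\<^sub>M w \<in> L" for r w .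
      show "\<ominus>\<^sub>M w \<in> L" if "w \<in> L" for w
        using sm[of "\<ominus>\<^sub>R \<one>\<^sub>R" w] that \<open>L \<subseteq> carrier M\<close> M.smult_minus_one by auto
      fix w w' assume "w \<in> L" "w' \<in> L"
      then obtain u a u' a' where ua: "u \<in> K" "a \<in> carrier R" "w = u \<oplus>\<^sub>M a \<odot>\<^sub>M v"
        "u' \<in> K" "a' \<in> carrier R" "w' = u' \<oplus>\<^sub>M a' \<odot>\<^sub>M v" unfolding Lmem by blast
      then have "w \<oplus>\<^sub>M w' = (u \<oplus>\<^sub>M u') \<oplus>\<^sub>M (a \<oplus>\<^sub>R a') \<odot>\<^sub>M v"
        using Kc v(1) by (simp add: M.smult_l_distr M.M.a_ac)
      then show "w \<oplus>\<^sub>M w' \<in> L" unfolding Lmem using M.submoduleE(5)[OF Ks(1)] ua M.R.a_closed by blast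
    qed
    moreover have "linear_on R M X L g" using g(1) by (simp add: L_def)
    ultimately have "L \<in> AA" unfolding AA_def using KL Ks(2) gh h(2) by (intro CollectI conjI exI[of _ g]) auto
    then have "L = K" using K(2) KL by blast
    then show False using vL v(2) by blast
  qed
  then show ?thesis using that h by blast
qed

section \<open>A criterion for canonical modules in dimension one\<close>

text \<open>The sets \<open>B i\<close> stand for the powers of m; \<open>B_N\<close> says that some
  power consists of multiples of x, as for an Artinian quotient. The socle of X is generated by
  \<open>proj \<sigma>\<close>, and \<open>injective\<close> is Baer's condition modulo x for the
  single ideal m.\<close>

locale canonical_criterion = resolution_mod R m C n D e x X proj
  for R :: "'a ring" and m and C :: "('a, 'b) module" and n D e x
    and X :: "('a, 'c) module" and proj +
  fixes B :: "nat \<Rightarrow> 'a set" and N :: nat and \<sigma> :: 'b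
  assumes noetherian: "noetherian_ring R"
    and x_regular: "a \<in> carrier R \<Longrightarrow> x \<otimes>\<^sub>R a = \<zero>\<^sub>R \<Longrightarrow> a = \<zero>\<^sub>R"
    and B_0: "B 0 = carrier R" and B_carrier: "B i \<subseteq> carrier R"
    and B_Suc: "a \<in> m \<Longrightarrow> b \<in> B i \<Longrightarrow> a \<otimes>\<^sub>R b \<in> B (Suc i)"
    and B_N: "b \<in> B N \<Longrightarrow> \<exists>r\<in>carrier R. b = x \<otimes>\<^sub>R r"
    and \<sigma>: "\<sigma> \<in> carrier C" "proj \<sigma> \<noteq> \<zero>\<^sub>X" "a \<in> m \<Longrightarrow> proj (a \<odot>\<^sub>C \<sigma>) = \<zero>\<^sub>X"
    and socle: "y \<in> carrier C \<Longrightarrow> (\<And>a. a \<in> m \<Longrightarrow> proj (a \<odot>\<^sub>C y) = \<zero>\<^sub>X) \<Longrightarrow>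
       \<exists>a\<in>carrier R. proj y = a \<odot>\<^sub>X proj \<sigma>"
    and injective: "linear_on R (self_module R) X m \<psi> \<Longrightarrow> \<psi> x = \<zero>\<^sub>X \<Longrightarrow> \<exists>y\<in>carrier X. \<forall>a\<in>m. \<psi> a = a \<odot>\<^sub>X y"
begin

lemma x_regular_free:
  assumes "v \<in> carrier (F i)" "x \<odot>\<^bsub>F i\<^esub> v = \<zero>\<^bsub>F i\<^esub>"
  shows "v = \<zero>\<^bsub>F i\<^esub>"
proof (rule power_module_eqI[OF assms(1) F.zero_closed])
  fix j assume j: "j < n i"
  have "x \<otimes>\<^sub>R v j = \<zero>\<^sub>R" using fun_cong[OF assms(2), of j] j by (simp add: free_module_simps(2,4))
  then show "v j = \<zero>\<^bsub>F i\<^esub> j"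
    using x_regular power_module_component[OF assms(1) j] j by (simp add: free_module_simps(2))
qed

text \<open>Multiples of x in \<open>F 0\<close> lie in the image of \<open>d 0\<close>, as x is in
  m. Hence all values of a cocycle are killed by x.\<close>

lemma Ext_0_trivial: "carrier (Ext_module C n D 0) = {\<zero>\<^bsub>Ext_module C n D 0\<^esub>}"
  unfolding Ext_trivial_iff
proof
  fix c assume c: "c \<in> hom_cocycles C n D 0"
  then have cP: "c \<in> carrier (power_module C (n 0))" by (simp add: cocycle_iff)
  note lin = lin_comb_linear[OF cP]
  have "lin_comb C (n 0) c v = \<zero>\<^sub>C" if v: "v \<in> carrier (F 0)" for v
  proof -
    have xv: "x \<odot>\<^bsub>F 0\<^esub> v \<in> carrier (F 0)" by (rule F.smult_closed[OF x_carrier v])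
    have "rho (x \<odot>\<^bsub>F 0\<^esub> v) \<in> m"
      using linear_on_smult[OF rho_linear x_carrier v] rho_closed[OF v] m.I_r_closed[OF x] by simp
    then obtain w where w: "w \<in> carrier (F (Suc 0))" "d 0 w = x \<odot>\<^bsub>F 0\<^esub> v" using rho_lift[OF xv] by blast
    have "x \<odot>\<^sub>C lin_comb C (n 0) c v = \<zero>\<^sub>C"
      using c w linear_on_smult[OF lin x_carrier v] unfolding cocycle_iff by metis
    then show ?thesis using regular linear_on_closed[OF lin v] by blast
  qed
  then have "tuple 0 (lin_comb C (n 0) c) = \<zero>\<^bsub>power_module C (n 0)\<^esub>"
    unfolding tuple_def power_module_simps(2) by (intro restrict_ext) (use basis_closed in blast)
  then show "c \<in> hom_coboundaries C n D 0"
    using tuple_lin_comb[OF cP] by (simp add: hom_coboundaries_def)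
qed

text \<open>The annihilator of \<open>proj \<sigma>\<close> is a proper ideal that contains m, hence
  equals m by maximality.\<close>

lemma \<sigma>_annihilator:
  assumes a: "a \<in> carrier R" "proj (a \<odot>\<^sub>C \<sigma>) = \<zero>\<^sub>X"
  shows "a \<in> m"
proof (rule ccontr)
  assume "a \<notin> m"
  define J where "J = {r \<in> carrier R. proj (r \<odot>\<^sub>C \<sigma>) = \<zero>\<^sub>X}"
  have "linear_on R (self_module R) X (carrier R) (\<lambda>r. proj (r \<odot>\<^sub>C \<sigma>))"
    by (rule linear_on_compose[OF linear_smult_const[OF \<sigma>(1)] proj_linear]) (use \<sigma>(1) in auto)
  then have "submodule {r \<in> carrier R. proj (r \<odot>\<^sub>C \<sigma>) = \<zero>\<^sub>X} R (self_module R)"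
    using linear_on_kernel[OF S.module_axioms X S.carrier_is_submodule] by simp
  then have "ideal J R" unfolding J_def using submodule_self_module_iff[OF cring] by blast
  moreover have "m \<subseteq> J" using \<sigma>(3) m_carrier by (auto simp: J_def)
  moreover have "a \<in> J" "J \<subseteq> carrier R" using a by (auto simp: J_def)
  ultimately have "J = carrier R" using m.I_maximal \<open>a \<notin> m\<close> by blast
  then have "proj (\<one>\<^sub>R \<odot>\<^sub>C \<sigma>) = \<zero>\<^sub>X" using C.R.one_closed unfolding J_def by blast
  then show False using \<sigma> by simp
qed

text \<open>A cocycle c whose evaluation projects to \<open>proj \<sigma>\<close> generates: sending
  a to the class of a c has kernel m, and it is onto because every evaluation lies in the socle
  modulo xC.\<close>

lemma Ext_1_isomorphic: "module_isomorphic R (Ext_module C n D (Suc 0)) k"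
proof -
  obtain v1 \<mu> w1 where v1: "v1 \<in> carrier (F 0)" and \<mu>: "\<mu> \<in> m" "rho v1 = \<one>\<^sub>R \<oplus>\<^sub>R \<mu>"
    and w1: "w1 \<in> carrier (F (Suc 0))" "d 0 w1 = x \<odot>\<^bsub>F 0\<^esub> v1" by (rule evaluation_vectors)
  note soc = evaluation_socle[OF v1 \<mu> w1] and cob = evaluation_coboundary[OF v1 \<mu> w1]
    and ker = evaluation_kernel[OF v1 \<mu> w1] and surj = evaluation_surj[OF v1 \<mu> w1]
    and lin = evaluation_linear[OF v1 \<mu> w1]
  let ?E = "Ext_module C n D (Suc 0)" and ?Z = "Z (Suc 0)"
    and ?B = "hom_coboundaries C n D (Suc 0)" and ?H = "hom_cocycles C n D (Suc 0)"
  let ?ev = "\<lambda>c. lin_comb C (n (Suc 0)) c w1"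
  let ?cl = "\<lambda>c. ?B +>\<^bsub>?Z\<^esub> c"
  note E = quot_module_simps[OF Z.module_axioms coboundaries_submodule, of "Suc 0", folded Ext_module_def]
  have cl: "linear_on R ?Z ?E ?H ?cl"
    using linear_on_coset[OF Z.module_axioms coboundaries_submodule, of "Suc 0"]
    unfolding Ext_module_def by simp
  obtain c where c: "c \<in> ?H" "?ev c = rho v1 \<odot>\<^sub>C \<sigma>" using surj[OF \<sigma>(1,3)] by blast
  have B_iff: "c' \<in> ?B \<longleftrightarrow> proj (?ev c') = \<zero>\<^sub>X" if "c' \<in> ?H" for c' using ker cob that by blast
  have pc: "proj (?ev c) = proj \<sigma>"
    using \<mu> m_carrier[OF \<mu>(1)] \<sigma>(1,2) \<sigma>(3)[OF \<mu>(1)] linear_on_add[OF proj_linear, of \<sigma> "\<mu> \<odot>\<^sub>C \<sigma>"] proj_closed c(2)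
    by (simp add: C.smult_l_distr)
  have evc: "?ev c' \<in> carrier C" if "c' \<in> ?H" for c' using linear_on_closed[OF lin that] .
  have pev: "proj (?ev (a \<odot>\<^bsub>?Z\<^esub> c)) = a \<odot>\<^sub>X proj \<sigma>" if a: "a \<in> carrier R" for a
    using linear_on_smult[OF lin a c(1)] linear_on_smult[OF proj_linear a evc[OF c(1)]] pc by simp
  have ac: "a \<odot>\<^bsub>?Z\<^esub> c \<in> ?H" if "a \<in> carrier R" for a using Z.smult_closed[OF that, of c "Suc 0"] c(1) by simp
  let ?f = "\<lambda>a. ?cl (a \<odot>\<^bsub>?Z\<^esub> c)"
  have f: "linear_on R (self_module R) ?E (carrier (self_module R)) ?f"
  proof (rule linear_on_compose[OF _ cl])
    show "linear_on R (self_module R) ?Z (carrier (self_module R)) (\<lambda>a. a \<odot>\<^bsub>?Z\<^esub> c)"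
    proof (rule linear_onI)
      fix a assume "a \<in> carrier (self_module R)"
      then have a: "a \<in> carrier R" by simp
      show "a \<odot>\<^bsub>?Z\<^esub> c \<in> carrier ?Z" using ac[OF a] by simp
      show "(r \<odot>\<^bsub>self_module R\<^esub> a) \<odot>\<^bsub>?Z\<^esub> c = r \<odot>\<^bsub>?Z\<^esub> (a \<odot>\<^bsub>?Z\<^esub> c)" if "r \<in> carrier R" for r
        using Z.smult_assoc1[of r a c "Suc 0"] that a c(1) by simp
      fix a' assume "a' \<in> carrier (self_module R)"
      then show "(a \<oplus>\<^bsub>self_module R\<^esub> a') \<odot>\<^bsub>?Z\<^esub> c = a \<odot>\<^bsub>?Z\<^esub> c \<oplus>\<^bsub>?Z\<^esub> a' \<odot>\<^bsub>?Z\<^esub> c"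
        using Z.smult_l_distr[of a a' c "Suc 0"] a c(1) by simp
    qed
  qed (use ac in auto)
  have "module_isomorphic R ?E (quot_module (self_module R) m)"
  proof (rule module_isomorphic_quot[OF S.module_axioms Ext.module_axioms f _ _ m_submodule])
    show "?f a = \<zero>\<^bsub>?E\<^esub> \<longleftrightarrow> a \<in> m" if "a \<in> carrier (self_module R)" for a
    proof -
      have a: "a \<in> carrier R" using that by simp
      have "?f a = \<zero>\<^bsub>?E\<^esub> \<longleftrightarrow> a \<odot>\<^bsub>?Z\<^esub> c \<in> ?B"
        using coset_eq_self_iff[OF Z.module_axioms coboundaries_submodule] ac[OF a] E(2) by simp
      also have "\<dots> \<longleftrightarrow> a \<odot>\<^sub>X proj \<sigma> = \<zero>\<^sub>X" using B_iff[OF ac[OF a]] pev[OF a] by simp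
      also have "\<dots> \<longleftrightarrow> a \<in> m"
        using linear_on_smult[OF proj_linear a \<sigma>(1)] \<sigma>_annihilator[OF a] \<sigma>(3) by metis
      finally show ?thesis .
    qed
    show "?f ` carrier (self_module R) = carrier ?E"
    proof
      show "?f ` carrier (self_module R) \<subseteq> carrier ?E" using linear_on_closed[OF f] by blast
      show "carrier ?E \<subseteq> ?f ` carrier (self_module R)"
      proof
        fix Y assume "Y \<in> carrier ?E"
        then obtain c' where c': "c' \<in> ?H" "Y = ?cl c'" unfolding E(1) by auto
        obtain a where a: "a \<in> carrier R" "proj (?ev c') = a \<odot>\<^sub>X proj \<sigma>"
          using socle[OF evc[OF c'(1)] soc[OF c'(1)]] by blast
        have mem: "c' \<ominus>\<^bsub>?Z\<^esub> a \<odot>\<^bsub>?Z\<^esub> c \<in> ?H"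
          using Z.minus_closed[of c' "Suc 0" "a \<odot>\<^bsub>?Z\<^esub> c"] c'(1) ac[OF a(1)] by simp
        have "?ev (c' \<ominus>\<^bsub>?Z\<^esub> a \<odot>\<^bsub>?Z\<^esub> c) = ?ev c' \<ominus>\<^sub>C ?ev (a \<odot>\<^bsub>?Z\<^esub> c)"
          using linear_on_diff[OF Z.module_axioms C Z.carrier_is_submodule, of "Suc 0" ?ev c' "a \<odot>\<^bsub>?Z\<^esub> c"]
            lin ac[OF a(1)] c'(1) by simp
        then have "proj (?ev (c' \<ominus>\<^bsub>?Z\<^esub> a \<odot>\<^bsub>?Z\<^esub> c)) = proj (?ev c') \<ominus>\<^sub>X proj (?ev (a \<odot>\<^bsub>?Z\<^esub> c))"
          using linear_on_diff[OF C X C.carrier_is_submodule proj_linear evc[OF c'(1)] evc[OF ac[OF a(1)]]] by simp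
        also have "\<dots> = \<zero>\<^sub>X"
          using pev[OF a(1)] a(2) proj_closed[OF evc[OF c'(1)]] X.M.sub_eq_zero_iff by simp
        finally have "c' \<ominus>\<^bsub>?Z\<^esub> a \<odot>\<^bsub>?Z\<^esub> c \<in> ?B" using B_iff[OF mem] by simp
        then have "?cl c' = ?f a"
          using coset_eq_iff[OF Z.module_axioms coboundaries_submodule, of c' "Suc 0" "a \<odot>\<^bsub>?Z\<^esub> c"]
            c'(1) ac[OF a(1)] by simp
        then show "Y \<in> ?f ` carrier (self_module R)" using c'(2) a(1) by simp
      qed
    qed
  qed
  then show ?thesis .
qed

text \<open>Multiplication by \<open>x\<close> on the resolution is null-homotopic; \<open>x - s d\<close> for the
  homotopy \<open>s\<close> maps to the cycles and agrees with \<open>x\<close> there.\<close>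

lemma homotopy:
  "\<exists>p. linear_on R (F (Suc i)) (F (Suc i)) (carrier (F (Suc i))) p \<and>
     (\<forall>v\<in>carrier (F (Suc i)). d i (p v) = \<zero>\<^bsub>F i\<^esub>) \<and>
     (\<forall>v\<in>carrier (F (Suc i)). d i v = \<zero>\<^bsub>F i\<^esub> \<longrightarrow> p v = x \<odot>\<^bsub>F (Suc i)\<^esub> v)"
proof (induction i)
  have step: "\<exists>p. linear_on R (F (Suc i)) (F (Suc i)) (carrier (F (Suc i))) p \<and>
     (\<forall>v\<in>carrier (F (Suc i)). d i (p v) = \<zero>\<^bsub>F i\<^esub>) \<and>
     (\<forall>v\<in>carrier (F (Suc i)). d i v = \<zero>\<^bsub>F i\<^esub> \<longrightarrow> p v = x \<odot>\<^bsub>F (Suc i)\<^esub> v)"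
    if q: "linear_on R (F i) (F i) (carrier (F i)) q" "q ` carrier (F i) \<subseteq> d i ` carrier (F (Suc i))"
      and qd: "\<And>w. w \<in> carrier (F (Suc i)) \<Longrightarrow> q (d i w) = x \<odot>\<^bsub>F i\<^esub> d i w" for i q
  proof -
    obtain s where s: "linear_on R (F i) (F (Suc i)) (carrier (F i)) s"
      "\<And>v. v \<in> carrier (F i) \<Longrightarrow> d i (s v) = q v"
      using linear_lift[OF F.module_axioms F.module_axioms d_linear refl q] by blast
    define p where "p v = x \<odot>\<^bsub>F (Suc i)\<^esub> v \<ominus>\<^bsub>F (Suc i)\<^esub> s (d i v)" for v
    have sd: "linear_on R (F (Suc i)) (F (Suc i)) (carrier (F (Suc i))) (\<lambda>v. s (d i v))"
      by (rule linear_on_compose[OF d_linear s(1)]) (use d_closed in blast)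
    have p: "linear_on R (F (Suc i)) (F (Suc i)) (carrier (F (Suc i))) p"
    proof (rule linear_onI)
      fix v assume v: "v \<in> carrier (F (Suc i))"
      note c = linear_on_closed[OF sd v]
      show "p v \<in> carrier (F (Suc i))" unfolding p_def using v c x_carrier by (intro F.minus_closed F.smult_closed)
      show "p (r \<odot>\<^bsub>F (Suc i)\<^esub> v) = r \<odot>\<^bsub>F (Suc i)\<^esub> p v" if "r \<in> carrier R" for r
        unfolding p_def linear_on_smult[OF sd that v]
        using F.smult_diff_right[OF that F.smult_closed[OF x_carrier v] c] F.smult_left_commute[OF x_carrier that v]
        by simp
      fix w assume w: "w \<in> carrier (F (Suc i))"
      show "p (v \<oplus>\<^bsub>F (Suc i)\<^esub> w) = p v \<oplus>\<^bsub>F (Suc i)\<^esub> p w"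
        unfolding p_def linear_on_add[OF sd v w] F.smult_r_distr[OF x_carrier v w]
        by (rule F.add_sub_add[OF F.smult_closed[OF x_carrier v] F.smult_closed[OF x_carrier w] c linear_on_closed[OF sd w]])
    qed
    have "d i (p v) = \<zero>\<^bsub>F i\<^esub>" if v: "v \<in> carrier (F (Suc i))" for v
    proof -
      have "d i (p v) = d i (x \<odot>\<^bsub>F (Suc i)\<^esub> v) \<ominus>\<^bsub>F i\<^esub> d i (s (d i v))"
        unfolding p_def
        by (rule linear_on_diff[OF F.module_axioms F.module_axioms F.carrier_is_submodule d_linear
              F.smult_closed[OF x_carrier v] linear_on_closed[OF sd v]])
      also have "\<dots> = x \<odot>\<^bsub>F i\<^esub> d i v \<ominus>\<^bsub>F i\<^esub> x \<odot>\<^bsub>F i\<^esub> d i v"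
        using linear_on_smult[OF d_linear x_carrier v] s(2)[OF d_closed[OF v]] qd[OF v] by simp
      also have "\<dots> = \<zero>\<^bsub>F i\<^esub>" using F.sub_eq_zero_iff F.smult_closed[OF x_carrier d_closed[OF v]] by blast
      finally show ?thesis .
    qed
    moreover have "p v = x \<odot>\<^bsub>F (Suc i)\<^esub> v" if v: "v \<in> carrier (F (Suc i))" "d i v = \<zero>\<^bsub>F i\<^esub>" for v
      unfolding p_def v(2) linear_on_zero[OF F.module_axioms F.module_axioms F.carrier_is_submodule s(1)]
      by (rule F.sub_zero[OF F.smult_closed[OF x_carrier v(1)]])
    ultimately show ?thesis using p by blast
  qed
  {
    case 0
    show ?case
    \<comment> \<open>In degree zero multiplication by x itself maps into the image of
      \<open>d 0\<close>, because x annihilates the residue field.\<close>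
    proof (rule step[of 0 "\<lambda>v. x \<odot>\<^bsub>F 0\<^esub> v"])
      show "linear_on R (F 0) (F 0) (carrier (F 0)) (\<lambda>v. x \<odot>\<^bsub>F 0\<^esub> v)"
        by (rule linear_onI) (simp_all add: x_carrier F.smult_r_distr F.smult_left_commute)
      show "(\<lambda>v. x \<odot>\<^bsub>F 0\<^esub> v) ` carrier (F 0) \<subseteq> d 0 ` carrier (F (Suc 0))"
      proof (rule image_subsetI)
        fix v assume v: "v \<in> carrier (F 0)"
        have "rho (x \<odot>\<^bsub>F 0\<^esub> v) \<in> m"
          using linear_on_smult[OF rho_linear x_carrier v] rho_closed[OF v] m.I_r_closed[OF x] by simp
        then show "x \<odot>\<^bsub>F 0\<^esub> v \<in> d 0 ` carrier (F (Suc 0))"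
          using rho_lift[OF F.smult_closed[OF x_carrier v]] by (metis imageI)
      qed
    qed simp
  next
    case (Suc i)
    then obtain p where p: "linear_on R (F (Suc i)) (F (Suc i)) (carrier (F (Suc i))) p"
      "\<forall>v\<in>carrier (F (Suc i)). d i (p v) = \<zero>\<^bsub>F i\<^esub>"
      "\<forall>v\<in>carrier (F (Suc i)). d i v = \<zero>\<^bsub>F i\<^esub> \<longrightarrow> p v = x \<odot>\<^bsub>F (Suc i)\<^esub> v" by blast
    show ?case
    proof (rule step[OF p(1)])
      show "p ` carrier (F (Suc i)) \<subseteq> d (Suc i) ` carrier (F (Suc (Suc i)))"
        unfolding d_exact[symmetric] using p(2) linear_on_closed[OF p(1)] by blast
      show "p (d (Suc i) w) = x \<odot>\<^bsub>F (Suc i)\<^esub> d (Suc i) w" if "w \<in> carrier (F (Suc (Suc i)))" for w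
        using p(3) d_closed[OF that] d_d[OF that] by blast
    qed
  }
qed

text \<open>A cocycle is a map t on a syzygy N inside a free module. Its reduction modulo x extends
  to the whole free module by injectivity of X. After lifting this extension to C, the difference to
  t is divisible by x on N, and the homotopy extends exactly such a multiple of x.\<close>

lemma Ext_higher_trivial: "carrier (Ext_module C n D (Suc (Suc i))) = {\<zero>\<^bsub>Ext_module C n D (Suc (Suc i))\<^esub>}"
  unfolding Ext_trivial_iff
proof
  fix c assume c: "c \<in> hom_cocycles C n D (Suc (Suc i))"
  let ?F = "F (Suc i)" and ?N = "d (Suc i) ` carrier (F (Suc (Suc i)))"
  have cP: "c \<in> carrier (power_module C (n (Suc (Suc i))))" using c by (simp add: cocycle_iff)
  obtain t where t: "linear_on R ?F C ?N t"
    "\<And>w. w \<in> carrier (F (Suc (Suc i))) \<Longrightarrow> t (d (Suc i) w) = lin_comb C (n (Suc (Suc i))) c w"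
    using descend[OF lin_comb_linear[OF cP]] c unfolding cocycle_iff by blast
  note Nsub = image_d_submodule[of "Suc i"]
  have N: "v \<in> ?N \<longleftrightarrow> v \<in> carrier ?F \<and> d i v = \<zero>\<^bsub>F i\<^esub>" for v unfolding d_exact[symmetric] by blast
  have f: "linear_on R ?F X ?N (\<lambda>u. proj (t u))"
    by (rule linear_on_compose[OF t(1) proj_linear]) (use linear_on_closed[OF t(1)] in blast)
  \<comment> \<open>The reduction of t is extended by zero to the multiples of x, as
    \<open>linear_extension\<close> works modulo x. This is consistent because x v in N forces v in
    N: the map with kernel N goes into a free module, on which x is regular.\<close>
  let ?G = "{(u \<oplus>\<^bsub>?F\<^esub> x \<odot>\<^bsub>?F\<^esub> v, proj (t u)) | u v. u \<in> ?N \<and> v \<in> carrier ?F}"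
  have xv: "x \<odot>\<^bsub>?F\<^esub> v \<in> carrier ?F" if "v \<in> carrier ?F" for v by (rule F.smult_closed[OF x_carrier that])
  have uF: "u \<in> carrier ?F" if "u \<in> ?N" for u using that N by blast
  have tu: "t u \<in> carrier C" if "u \<in> ?N" for u by (rule linear_on_closed[OF t(1) that])
  obtain h where h: "linear_on R ?F X (fst ` ?G) h" "\<And>w z. (w, z) \<in> ?G \<Longrightarrow> h w = z"
  proof (rule linear_on_graph[where \<Gamma> = ?G, OF F.module_axioms X])
    fix w z assume "(w, z) \<in> ?G"
    then obtain u v where uv: "u \<in> ?N" "v \<in> carrier ?F" "w = u \<oplus>\<^bsub>?F\<^esub> x \<odot>\<^bsub>?F\<^esub> v" "z = proj (t u)" by blast
    show "w \<in> carrier ?F \<and> z \<in> carrier X"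
      unfolding uv(3,4) using F.a_closed[OF uF[OF uv(1)] xv[OF uv(2)]] proj_closed[OF tu[OF uv(1)]] by blast
    show "(r \<odot>\<^bsub>?F\<^esub> w, r \<odot>\<^sub>X z) \<in> ?G" if r: "r \<in> carrier R" for r
    proof -
      have "r \<odot>\<^bsub>?F\<^esub> w = r \<odot>\<^bsub>?F\<^esub> u \<oplus>\<^bsub>?F\<^esub> x \<odot>\<^bsub>?F\<^esub> (r \<odot>\<^bsub>?F\<^esub> v)"
        unfolding uv(3) using F.smult_r_distr[OF r uF[OF uv(1)] xv[OF uv(2)]] F.smult_left_commute[OF r x_carrier uv(2)]
        by simp
      moreover have "r \<odot>\<^sub>X z = proj (t (r \<odot>\<^bsub>?F\<^esub> u))"
        unfolding uv(4) using linear_on_smult[OF f r uv(1)] by simp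
      ultimately show ?thesis using F.submoduleE(4)[OF Nsub r uv(1)] F.smult_closed[OF r uv(2)] by blast
    qed
    fix w' z' assume "(w', z') \<in> ?G"
    then obtain u' v' where uv': "u' \<in> ?N" "v' \<in> carrier ?F" "w' = u' \<oplus>\<^bsub>?F\<^esub> x \<odot>\<^bsub>?F\<^esub> v'" "z' = proj (t u')" by blast
    show "(w \<oplus>\<^bsub>?F\<^esub> w', z \<oplus>\<^sub>X z') \<in> ?G"
    proof -
      have "w \<oplus>\<^bsub>?F\<^esub> w' = (u \<oplus>\<^bsub>?F\<^esub> u') \<oplus>\<^bsub>?F\<^esub> x \<odot>\<^bsub>?F\<^esub> (v \<oplus>\<^bsub>?F\<^esub> v')"
        unfolding uv(3) uv'(3) F.smult_r_distr[OF x_carrier uv(2) uv'(2)]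
        using uF[OF uv(1)] uF[OF uv'(1)] xv[OF uv(2)] xv[OF uv'(2)] by (simp add: F.a_ac)
      moreover have "z \<oplus>\<^sub>X z' = proj (t (u \<oplus>\<^bsub>?F\<^esub> u'))"
        unfolding uv(4) uv'(4) using linear_on_add[OF f uv(1) uv'(1)] by simp
      ultimately show ?thesis using F.submoduleE(5)[OF Nsub uv(1) uv'(1)] F.a_closed[OF uv(2) uv'(2)] by blast
    qed
  next
    fix z assume "(\<zero>\<^bsub>?F\<^esub>, z) \<in> ?G"
    then obtain u v where uv: "u \<in> ?N" "v \<in> carrier ?F" "\<zero>\<^bsub>?F\<^esub> = u \<oplus>\<^bsub>?F\<^esub> x \<odot>\<^bsub>?F\<^esub> v" "z = proj (t u)" by blast
    have u: "u = \<ominus>\<^bsub>?F\<^esub> (x \<odot>\<^bsub>?F\<^esub> v)"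
      using uv(3) F.minus_equality[OF _ xv[OF uv(2)] uF[OF uv(1)]] by simp
    then have xN: "x \<odot>\<^bsub>?F\<^esub> v \<in> ?N"
      using F.submoduleE(3)[OF Nsub uv(1)] F.minus_minus[OF xv[OF uv(2)]] by simp
    then have "x \<odot>\<^bsub>F i\<^esub> d i v = \<zero>\<^bsub>F i\<^esub>"
      using N linear_on_smult[OF d_linear x_carrier uv(2)] by simp
    then have "d i v = \<zero>\<^bsub>F i\<^esub>" by (rule x_regular_free[OF d_closed[OF uv(2)]])
    then have vN: "v \<in> ?N" using N uv(2) by blast
    have "proj (t (x \<odot>\<^bsub>?F\<^esub> v)) = \<zero>\<^sub>X"
      using linear_on_smult[OF f x_carrier vN] smult_x_X[OF proj_closed[OF tu[OF vN]]] by simp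
    then show "z = \<zero>\<^sub>X"
      unfolding uv(4) u using linear_on_minus[OF F.module_axioms X Nsub f xN] by simp
  qed (rule that)
  define K where "K = fst ` ?G"
  have Kmem: "w \<in> K \<longleftrightarrow> (\<exists>u v. u \<in> ?N \<and> v \<in> carrier ?F \<and> w = u \<oplus>\<^bsub>?F\<^esub> x \<odot>\<^bsub>?F\<^esub> v)" for w
    unfolding K_def by (auto simp: image_def)
  have zN: "\<zero>\<^bsub>?F\<^esub> \<in> ?N" by (rule submodule_zero[OF Nsub])
  have "submodule K R ?F"
  proof (rule F.submoduleI)
    show Kc: "K \<subseteq> carrier ?F"
    proof
      fix w assume "w \<in> K"
      then obtain u v where "u \<in> ?N" "v \<in> carrier ?F" "w = u \<oplus>\<^bsub>?F\<^esub> x \<odot>\<^bsub>?F\<^esub> v" unfolding Kmem by blast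
      then show "w \<in> carrier ?F" using F.a_closed[OF uF xv] by simp
    qed
    show "\<zero>\<^bsub>?F\<^esub> \<in> K"
      unfolding Kmem using zN x_carrier by (intro exI[of _ "\<zero>\<^bsub>?F\<^esub>"] conjI F.zero_closed) simp_all
    have sm: "r \<odot>\<^bsub>?F\<^esub> w \<in> K" if r: "r \<in> carrier R" and w: "w \<in> K" for r w
    proof -
      obtain u v where uv: "u \<in> ?N" "v \<in> carrier ?F" "w = u \<oplus>\<^bsub>?F\<^esub> x \<odot>\<^bsub>?F\<^esub> v" using w unfolding Kmem by blast
      have "r \<odot>\<^bsub>?F\<^esub> w = r \<odot>\<^bsub>?F\<^esub> u \<oplus>\<^bsub>?F\<^esub> x \<odot>\<^bsub>?F\<^esub> (r \<odot>\<^bsub>?F\<^esub> v)"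
        unfolding uv(3) using F.smult_r_distr[OF r uF[OF uv(1)] xv[OF uv(2)]] F.smult_left_commute[OF r x_carrier uv(2)]
        by simp
      then show ?thesis unfolding Kmem using F.submoduleE(4)[OF Nsub r uv(1)] F.smult_closed[OF r uv(2)] by blast
    qed
    then show "r \<in> carrier R \<Longrightarrow> w \<in> K \<Longrightarrow> r \<odot>\<^bsub>?F\<^esub> w \<in> K" for r w .
    show "\<ominus>\<^bsub>?F\<^esub> w \<in> K" if w: "w \<in> K" for w
      using sm[of "\<ominus>\<^sub>R \<one>\<^sub>R" w] w Kc F.smult_minus_one[of w] by auto
    fix w w' assume "w \<in> K" "w' \<in> K"
    then obtain u v u' v' where uv: "u \<in> ?N" "v \<in> carrier ?F" "w = u \<oplus>\<^bsub>?F\<^esub> x \<odot>\<^bsub>?F\<^esub> v"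
      "u' \<in> ?N" "v' \<in> carrier ?F" "w' = u' \<oplus>\<^bsub>?F\<^esub> x \<odot>\<^bsub>?F\<^esub> v'" unfolding Kmem by blast
    have "w \<oplus>\<^bsub>?F\<^esub> w' = (u \<oplus>\<^bsub>?F\<^esub> u') \<oplus>\<^bsub>?F\<^esub> x \<odot>\<^bsub>?F\<^esub> (v \<oplus>\<^bsub>?F\<^esub> v')"
      unfolding uv(3,6) F.smult_r_distr[OF x_carrier uv(2,5)]
      using uF[OF uv(1)] uF[OF uv(4)] xv[OF uv(2)] xv[OF uv(5)] by (simp add: F.a_ac)
    then show "w \<oplus>\<^bsub>?F\<^esub> w' \<in> K"
      unfolding Kmem using F.submoduleE(5)[OF Nsub uv(1,4)] F.a_closed[OF uv(2,5)] by blast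
  qed
  note Ks = this
  have hK: "linear_on R ?F X K h" using h(1) by (simp only: K_def)
  have xK: "x \<odot>\<^bsub>?F\<^esub> v \<in> K \<and> h (x \<odot>\<^bsub>?F\<^esub> v) = \<zero>\<^sub>X" if v: "v \<in> carrier ?F" for v
  proof
    have e: "x \<odot>\<^bsub>?F\<^esub> v = \<zero>\<^bsub>?F\<^esub> \<oplus>\<^bsub>?F\<^esub> x \<odot>\<^bsub>?F\<^esub> v" using xv[OF v] by simp
    then show "x \<odot>\<^bsub>?F\<^esub> v \<in> K" unfolding Kmem using zN v by blast
    have "h (x \<odot>\<^bsub>?F\<^esub> v) = proj (t \<zero>\<^bsub>?F\<^esub>)" by (rule h(2)) (use e zN v in blast)
    then show "h (x \<odot>\<^bsub>?F\<^esub> v) = \<zero>\<^sub>X" using linear_on_zero[OF F.module_axioms X Nsub f] by simp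
  qed
  have hN: "h u = proj (t u)" "u \<in> K" if u: "u \<in> ?N" for u
  proof -
    have e: "u = u \<oplus>\<^bsub>?F\<^esub> x \<odot>\<^bsub>?F\<^esub> \<zero>\<^bsub>?F\<^esub>" using uF[OF u] x_carrier by simp
    show "h u = proj (t u)" by (rule h(2)) (use e u F.zero_closed in blast)
    show "u \<in> K" unfolding Kmem using e u F.zero_closed by blast
  qed
  obtain g where g: "linear_on R ?F X (carrier ?F) g" "\<And>u. u \<in> K \<Longrightarrow> g u = h u"
  proof (rule linear_extension[OF F.module_axioms X m x _ _ _ Ks hK xK])
    show "\<exists>B\<subseteq>L. finite B \<and> (\<forall>N. submodule N R ?F \<longrightarrow> B \<subseteq> N \<longrightarrow> L \<subseteq> N)" if "submodule L R ?F" for L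
      by (rule submodule_finitely_generated[OF cring noetherian that])
    show "\<exists>b\<in>carrier R. b \<odot>\<^bsub>?F\<^esub> v \<notin> U \<and> (\<forall>a\<in>m. a \<odot>\<^bsub>?F\<^esub> (b \<odot>\<^bsub>?F\<^esub> v) \<in> U)"
      if U: "submodule U R ?F" "\<And>w. w \<in> carrier ?F \<Longrightarrow> x \<odot>\<^bsub>?F\<^esub> w \<in> U" and v: "v \<in> carrier ?F" "v \<notin> U" for U v
    proof -
      have BNU: "b \<odot>\<^bsub>?F\<^esub> v \<in> U" if b: "b \<in> B N" for b
      proof -
        obtain r where r: "r \<in> carrier R" "b = x \<otimes>\<^sub>R r" using B_N[OF b] by blast
        then show ?thesis using U(2)[OF F.smult_closed[OF r(1) v(1)]] F.smult_assoc1[OF x_carrier r(1) v(1)] by simp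
      qed
      have mc: "m \<subseteq> carrier R" using m_carrier by blast
      obtain b where "b \<in> carrier R" "b \<odot>\<^bsub>?F\<^esub> v \<notin> U" "\<And>a. a \<in> m \<Longrightarrow> a \<odot>\<^bsub>?F\<^esub> (b \<odot>\<^bsub>?F\<^esub> v) \<in> U"
        using socle_multiple[where B = B and m = m and N = N, OF F.module_axioms v B_0 B_carrier B_Suc mc BNU]
        by (metis (no_types, lifting))
      then show ?thesis by blast
    qed
    show "\<exists>y\<in>carrier X. \<forall>a\<in>m. \<psi> a = a \<odot>\<^sub>X y"
      if "linear_on R (self_module R) X m \<psi>" "\<psi> x = \<zero>\<^sub>X" for \<psi> by (rule injective[OF that])
  qed (assumption | rule that)+
  obtain g0 where g0: "linear_on R ?F C (carrier ?F) g0" "\<And>v. v \<in> carrier ?F \<Longrightarrow> proj (g0 v) = g v"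
    using linear_lift[OF C X proj_linear proj_image g(1)] linear_on_closed[OF g(1)] by blast
  obtain dv where dv: "linear_on R C C {y \<in> carrier C. proj y = \<zero>\<^sub>X} dv"
    "\<And>y. y \<in> carrier C \<Longrightarrow> proj y = \<zero>\<^sub>X \<Longrightarrow> x \<odot>\<^sub>C dv y = y"
    "\<And>z. z \<in> carrier C \<Longrightarrow> dv (x \<odot>\<^sub>C z) = z" using division by blast
  obtain p where p: "linear_on R ?F ?F (carrier ?F) p"
    "\<And>v. v \<in> carrier ?F \<Longrightarrow> p v \<in> ?N" "\<And>u. u \<in> ?N \<Longrightarrow> p u = x \<odot>\<^bsub>?F\<^esub> u"
  proof -
    obtain p where p: "linear_on R ?F ?F (carrier ?F) p"
      "\<forall>v\<in>carrier ?F. d i (p v) = \<zero>\<^bsub>F i\<^esub>"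
      "\<forall>v\<in>carrier ?F. d i v = \<zero>\<^bsub>F i\<^esub> \<longrightarrow> p v = x \<odot>\<^bsub>?F\<^esub> v" using homotopy by blast
    show ?thesis by (rule that[OF p(1)]) (use p(2,3) N linear_on_closed[OF p(1)] in blast)+
  qed
  let ?D = "\<lambda>u. t u \<ominus>\<^sub>C g0 u"
  have Dl: "linear_on R ?F C ?N ?D"
  proof (rule linear_onI)
    fix u assume u: "u \<in> ?N"
    note cl = tu[OF u] linear_on_closed[OF g0(1) uF[OF u]]
    show "?D u \<in> carrier C" using cl by simp
    show "?D (r \<odot>\<^bsub>?F\<^esub> u) = r \<odot>\<^sub>C ?D u" if r: "r \<in> carrier R" for r
      using linear_on_smult[OF t(1) r u] linear_on_smult[OF g0(1) r uF[OF u]] C.smult_diff_right[OF r cl] by simp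
    fix u' assume u': "u' \<in> ?N"
    show "?D (u \<oplus>\<^bsub>?F\<^esub> u') = ?D u \<oplus>\<^sub>C ?D u'"
      using linear_on_add[OF t(1) u u'] linear_on_add[OF g0(1) uF[OF u] uF[OF u']]
        C.M.add_sub_add[OF cl(1) tu[OF u'] cl(2) linear_on_closed[OF g0(1) uF[OF u']]] by simp
  qed
  have D0: "?D u \<in> {y \<in> carrier C. proj y = \<zero>\<^sub>X}" if u: "u \<in> ?N" for u
  proof -
    note cl = tu[OF u] linear_on_closed[OF g0(1) uF[OF u]]
    have "proj (?D u) = proj (t u) \<ominus>\<^sub>X proj (g0 u)"
      by (rule linear_on_diff[OF C X C.carrier_is_submodule proj_linear cl])
    also have "proj (g0 u) = proj (t u)" using g0(2)[OF uF[OF u]] g(2)[OF hN(2)[OF u]] hN(1)[OF u] by simp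
    finally show ?thesis using linear_on_closed[OF Dl u] proj_closed[OF cl(1)] X.M.sub_eq_zero_iff by simp
  qed
  have h1: "linear_on R ?F C ?N (\<lambda>u. dv (?D u))"
    by (rule linear_on_compose[OF Dl dv(1)]) (use D0 in blast)
  have h1p: "linear_on R ?F C (carrier ?F) (\<lambda>v. dv (?D (p v)))"
    by (rule linear_on_compose[OF p(1) h1]) (use p(2) in blast)
  \<comment> \<open>On N the map p is multiplication by x and undoes the division in
    \<open>dv\<close>, so G agrees with t there; elsewhere p brings the argument into N.\<close>
  define G where "G v = g0 v \<oplus>\<^sub>C dv (?D (p v))" for v
  have G: "linear_on R ?F C (carrier ?F) G"
  proof (rule linear_onI)
    fix v assume v: "v \<in> carrier ?F"
    note cl = linear_on_closed[OF g0(1) v] linear_on_closed[OF h1p v]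
    show "G v \<in> carrier C" unfolding G_def using cl by simp
    show "G (r \<odot>\<^bsub>?F\<^esub> v) = r \<odot>\<^sub>C G v" if r: "r \<in> carrier R" for r
      unfolding G_def linear_on_smult[OF g0(1) r v] linear_on_smult[OF h1p r v]
      using C.smult_r_distr[OF r cl] by simp
    fix w assume w: "w \<in> carrier ?F"
    show "G (v \<oplus>\<^bsub>?F\<^esub> w) = G v \<oplus>\<^sub>C G w"
      unfolding G_def linear_on_add[OF g0(1) v w] linear_on_add[OF h1p v w]
      using cl linear_on_closed[OF g0(1) w] linear_on_closed[OF h1p w] by (simp add: C.M.a_ac)
  qed
  have Gt: "G u = t u" if u: "u \<in> ?N" for u
  proof -
    note cl = tu[OF u] linear_on_closed[OF g0(1) uF[OF u]]
    have "dv (?D (p u)) = x \<odot>\<^sub>C dv (?D u)"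
      unfolding p(3)[OF u] by (rule linear_on_smult[OF h1 x_carrier u])
    also have "\<dots> = ?D u" using dv(2) D0[OF u] by blast
    finally show ?thesis
      unfolding G_def using cl by (metis C.M.a_comm C.M.minus_closed C.M.sub_add_cancel)
  qed
  have "tuple (Suc (Suc i)) (lin_comb C (n (Suc (Suc i))) c) = tuple (Suc (Suc i)) (\<lambda>w. G (d (Suc i) w))"
    unfolding tuple_def by (intro restrict_ext) (use Gt t(2) basis_closed in simp)
  then show "c \<in> hom_coboundaries C n D (Suc (Suc i))"
    unfolding coboundary_Suc_iff using G tuple_lin_comb[OF cP] by metis
qed

end

text \<open>Dimension one leaves three cases: degree 0 by regularity of x, degree 1 by the socle,
  all higher degrees by injectivity modulo x.\<close>

lemma canonical_moduleI:
  assumes cm: "cohen_macaulay R" and m: "maximalideal m R" and C: "module R C" and fg: "fin_gen_module R C"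
    and ht: "height R m = enat 1"
    and x: "x \<in> m" and reg: "\<And>y. y \<in> carrier C \<Longrightarrow> x \<odot>\<^sub>C y = \<zero>\<^sub>C \<Longrightarrow> y = \<zero>\<^sub>C"
    and X: "module R X" "linear_on R C X (carrier C) proj" "proj ` carrier C = carrier X"
    and ker: "\<And>y. y \<in> carrier C \<Longrightarrow> proj y = \<zero>\<^sub>X \<longleftrightarrow> (\<exists>z\<in>carrier C. y = x \<odot>\<^sub>C z)"
    and xreg: "\<And>a. a \<in> carrier R \<Longrightarrow> x \<otimes>\<^sub>R a = \<zero>\<^sub>R \<Longrightarrow> a = \<zero>\<^sub>R"
    and B: "B 0 = carrier R" "\<And>i. B i \<subseteq> carrier R" "\<And>a b i. a \<in> m \<Longrightarrow> b \<in> B i \<Longrightarrow> a \<otimes>\<^sub>R b \<in> B (Suc i)"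
      "\<And>b. b \<in> B N \<Longrightarrow> \<exists>r\<in>carrier R. b = x \<otimes>\<^sub>R r"
    and \<sigma>: "\<sigma> \<in> carrier C" "proj \<sigma> \<noteq> \<zero>\<^sub>X" "\<And>a. a \<in> m \<Longrightarrow> proj (a \<odot>\<^sub>C \<sigma>) = \<zero>\<^sub>X"
    and socle: "\<And>y. y \<in> carrier C \<Longrightarrow> (\<And>a. a \<in> m \<Longrightarrow> proj (a \<odot>\<^sub>C y) = \<zero>\<^sub>X) \<Longrightarrow>
       \<exists>a\<in>carrier R. proj y = a \<odot>\<^sub>X proj \<sigma>"
    and inj: "\<And>\<psi>. linear_on R (self_module R) X m \<psi> \<Longrightarrow> \<psi> x = \<zero>\<^sub>X \<Longrightarrow> \<exists>y\<in>carrier X. \<forall>a\<in>m. \<psi> a = a \<odot>\<^sub>X y"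
  shows "canonical_module R m C"
proof -
  have cr: "cring R" "noetherian_ring R" using cm by (auto simp: cohen_macaulay_def)
  obtain n D e where res: "free_resolution R (quot_module (self_module R) m) n D e"
    using free_resolution_exists[OF cr maximalideal.axioms(1)[OF m]] by blast
  have r: "resolution R m C n D e" by (rule resolution.intro[OF C m res])
  have rm: "resolution_mod R m C n D e x X proj"
  proof (rule resolution_mod.intro[OF r resolution_mod_axioms.intro])
    show "y \<in> carrier C \<Longrightarrow> x \<odot>\<^sub>C y = \<zero>\<^sub>C \<Longrightarrow> y = \<zero>\<^sub>C" for y by (rule reg)
    show "y \<in> carrier C \<Longrightarrow> (proj y = \<zero>\<^sub>X) = (\<exists>z\<in>carrier C. y = x \<odot>\<^sub>C z)" for y by (rule ker)
  qed (rule x X)+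
  interpret canonical_criterion R m C n D e x X proj B N \<sigma>
  proof (rule canonical_criterion.intro[OF rm canonical_criterion_axioms.intro])
    show "a \<in> carrier R \<Longrightarrow> x \<otimes>\<^sub>R a = \<zero>\<^sub>R \<Longrightarrow> a = \<zero>\<^sub>R" for a by (rule xreg)
    show "B i \<subseteq> carrier R" for i by (rule B(2))
    show "a \<in> m \<Longrightarrow> b \<in> B i \<Longrightarrow> a \<otimes>\<^sub>R b \<in> B (Suc i)" for a b i by (rule B(3))
    show "b \<in> B N \<Longrightarrow> \<exists>r\<in>carrier R. b = x \<otimes>\<^sub>R r" for b by (rule B(4))
    show "a \<in> m \<Longrightarrow> proj (a \<odot>\<^sub>C \<sigma>) = \<zero>\<^sub>X" for a by (rule \<sigma>(3))
    show "y \<in> carrier C \<Longrightarrow> (\<And>a. a \<in> m \<Longrightarrow> proj (a \<odot>\<^sub>C y) = \<zero>\<^sub>X) \<Longrightarrow> \<exists>a\<in>carrier R. proj y = a \<odot>\<^sub>X proj \<sigma>" for y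
      by (rule socle)
    show "linear_on R (self_module R) X m \<psi> \<Longrightarrow> \<psi> x = \<zero>\<^sub>X \<Longrightarrow> \<exists>y\<in>carrier X. \<forall>a\<in>m. \<psi> a = a \<odot>\<^sub>X y" for \<psi> by (rule inj)
  qed (rule cr(2) B(1) \<sigma>(1,2))+
  have "if enat i = height R m then module_isomorphic R (Ext_module C n D i) k
        else carrier (Ext_module C n D i) = {\<zero>\<^bsub>Ext_module C n D i\<^esub>}" for i
  proof (cases i)
    case 0
    then show ?thesis using Ext_0_trivial ht by simp
  next
    case (Suc j)
    show ?thesis
    proof (cases j)
      case 0
      then show ?thesis using Ext_1_isomorphic ht Suc by simp
    next
      case (Suc j')
      then show ?thesis using Ext_higher_trivial[of j'] ht \<open>i = Suc j\<close> by simp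
    qed
  qed
  then show ?thesis unfolding canonical_module_def using cm m C fg res by blast
qed

section \<open>Orders in a numerical semigroup\<close>

text \<open>The generalized Apery set of an element \<open>q\<close>; \<open>Apery S\<close> is the case of the multiplicity.\<close>

definition Ap :: "nat set \<Rightarrow> nat \<Rightarrow> nat set" where
  "Ap S q = {s \<in> S. \<not> (\<exists>u\<in>S. s = u + q)}"

text \<open>The combinatorial form of membership in a power of the maximal ideal: in a module dual
  to R modulo t^q, multiplication by t^u moves the dual vector at s + u to the one at s and so puts
  the latter into the i-th power times the module.\<close>

definition reaches :: "nat set \<Rightarrow> nat \<Rightarrow> nat \<Rightarrow> nat \<Rightarrow> bool" where
  "reaches S q i s \<longleftrightarrow> (\<exists>u\<in>lM_sg S i. s + u \<in> Ap S q)"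

locale numerical_sg =
  fixes S :: "nat set"
  assumes S: "numerical_semigroup S"
begin

abbreviation mu where "mu \<equiv> multiplicity_sg S"
abbreviation lM where "lM \<equiv> lM_sg S"
abbreviation ord where "ord \<equiv> ord_sg S"

lemma zero_in: "0 \<in> S" and add_in: "a \<in> S \<Longrightarrow> b \<in> S \<Longrightarrow> a + b \<in> S"
  using S by (auto simp: numerical_semigroup_def)

lemma conductor: obtains c where "\<And>n. n \<ge> c \<Longrightarrow> n \<in> S"
proof -
  have "finite (UNIV - S)" using S by (simp add: numerical_semigroup_def)
  then obtain c where "\<forall>n\<in>UNIV - S. n < c" by (auto simp: finite_nat_set_iff_bounded)
  then have "n \<in> S" if "n \<ge> c" for n using that by (metis DiffI UNIV_I not_le)
  then show ?thesis by (rule that)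
qed

lemma mu: "mu \<in> S" "mu > 0" "s \<in> S \<Longrightarrow> s \<noteq> 0 \<Longrightarrow> mu \<le> s"
proof -
  obtain c where c: "\<And>n. n \<ge> c \<Longrightarrow> n \<in> S" using conductor by blast
  have "Suc c \<in> S \<and> Suc c \<noteq> 0" using c[of "Suc c"] by simp
  then have "mu \<in> S \<and> mu \<noteq> 0" unfolding multiplicity_sg_def by (rule LeastI)
  then show "mu \<in> S" "mu > 0" by auto
  show "s \<in> S \<Longrightarrow> s \<noteq> 0 \<Longrightarrow> mu \<le> s" unfolding multiplicity_sg_def by (simp add: Least_le)
qed

lemma Apery_eq: "Apery S = Ap S mu"
  unfolding Apery_def Ap_def ..

lemma lM_subset: "s \<in> lM l \<Longrightarrow> s \<in> S"
  by (induction l arbitrary: s) (auto intro: add_in)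

lemma lM_add_S: "a \<in> lM i \<Longrightarrow> b \<in> S \<Longrightarrow> a + b \<in> lM i"
proof (induction i arbitrary: a)
  case 0 then show ?case by (simp add: add_in)
next
  case (Suc i)
  then obtain a' c where "a = a' + c" "a' \<in> lM i" "c \<in> S - {0}" by auto
  then have "a + b = (a' + b) + c" "a' + b \<in> lM i" using Suc by auto
  then show ?case using \<open>c \<in> S - {0}\<close> by (simp only: lM_sg.simps) blast
qed

lemma lM_add: "a \<in> lM i \<Longrightarrow> b \<in> lM j \<Longrightarrow> a + b \<in> lM (i + j)"
proof (induction j arbitrary: b)
  case 0 then show ?case by (simp add: lM_add_S)
next
  case (Suc j)
  then obtain b' c where b: "b = b' + c" "b' \<in> lM j" "c \<in> S - {0}" by auto
  then have "a + b' \<in> lM (i + j)" "a + b = (a + b') + c" using Suc by auto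
  then show ?case unfolding add_Suc_right using b(3) by (simp only: lM_sg.simps) blast
qed

lemma lM_Suc_subset: "s \<in> lM (Suc i) \<Longrightarrow> s \<in> lM i"
  using lM_add_S by auto

lemma lM_mono: "i \<le> j \<Longrightarrow> s \<in> lM j \<Longrightarrow> s \<in> lM i"
  by (induction j rule: dec_induct) (use lM_Suc_subset in blast)+

lemma lM_1: "s \<in> S \<Longrightarrow> s \<noteq> 0 \<Longrightarrow> s \<in> lM (Suc 0)"
  using zero_in by force

lemma lM_ge: "s \<in> lM l \<Longrightarrow> l * mu \<le> s"
  using mu(3) by (induction l arbitrary: s) fastforce+

lemma mult_mu_lM: "i * mu \<in> lM i"
proof (induction i)
  case 0 then show ?case by (simp add: zero_in)
next
  case (Suc i)
  have "Suc i * mu = i * mu + mu" by simp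
  moreover have "mu \<in> S - {0}" using mu by simp
  ultimately show ?case using Suc by (simp only: lM_sg.simps) blast
qed

lemma lM_le: "s \<in> lM l \<Longrightarrow> l \<le> s"
  using lM_ge[of s l] mu(2) by (metis Suc_leI le_trans mult.right_neutral mult_le_mono2 One_nat_def)

lemma lM_iff: "s \<in> S \<Longrightarrow> s \<in> lM l \<longleftrightarrow> l \<le> ord s"
proof -
  assume s: "s \<in> S"
  have fin: "finite {l. s \<in> lM l}" using lM_le by (auto simp: finite_nat_set_iff_bounded_le)
  have ne: "{l. s \<in> lM l} \<noteq> {}" using s by (auto intro!: exI[of _ 0])
  have "s \<in> lM (ord s)" using Max_in[OF fin ne] by (simp add: ord_sg_def)
  then show ?thesis
    using lM_mono Max_ge[OF fin] unfolding ord_sg_def by blast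
qed

lemma ord_mult_mu: "s \<in> S \<Longrightarrow> ord s * mu \<le> s"
  using lM_iff lM_ge by blast

lemma ord_0: "ord 0 = 0"
  using ord_mult_mu[OF zero_in] mu(2) by simp

lemma ord_add: "a \<in> S \<Longrightarrow> b \<in> S \<Longrightarrow> ord a + ord b \<le> ord (a + b)"
  using lM_add lM_iff add_in by blast

lemma mu_multiple: "b * mu \<in> S"
  using mult_mu_lM lM_subset by blast

section \<open>Apery sets and multiples of the multiplicity\<close>

lemma Ap_S: "s \<in> Ap S q \<Longrightarrow> s \<in> S" by (simp add: Ap_def)

lemma Ap_divisor: "a + b \<in> Ap S q \<Longrightarrow> a \<in> S \<Longrightarrow> b \<in> S \<Longrightarrow> a \<in> Ap S q"
proof -
  assume ab: "a + b \<in> Ap S q" "a \<in> S" "b \<in> S"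
  have "a \<noteq> u + q" if "u \<in> S" for u
  proof
    assume "a = u + q"
    then have "a + b = (u + b) + q" "u + b \<in> S" using that ab(3) add_in by auto
    then show False using ab(1) by (auto simp: Ap_def)
  qed
  then show ?thesis using ab(2) by (auto simp: Ap_def)
qed

lemma Ap_cases: "s \<in> S \<Longrightarrow> s \<in> Ap S q \<or> (\<exists>u\<in>S. s = u + q)"
  by (auto simp: Ap_def)

lemma finite_Ap: "finite (Ap S q)"
proof -
  obtain c where c: "\<And>n. n \<ge> c \<Longrightarrow> n \<in> S" using conductor by blast
  have "s < c + q" if "s \<in> Ap S q" for s
  proof (rule ccontr)
    assume "\<not> s < c + q"
    then have "s - q \<in> S" "s = (s - q) + q" using c[of "s - q"] by auto
    then show False using that by (auto simp: Ap_def)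
  qed
  then show ?thesis by (auto simp: finite_nat_set_iff_bounded)
qed

lemma zero_Ap: "q \<noteq> 0 \<Longrightarrow> 0 \<in> Ap S q"
  by (auto simp: Ap_def zero_in)

lemma Ap_decomp:
  assumes "s \<in> S" obtains w b where "w \<in> Ap S mu" "s = w + b * mu"
proof -
  have "\<exists>w\<in>Ap S mu. \<exists>b. s = w + b * mu" using assms
  proof (induction s rule: less_induct)
    case (less s)
    show ?case
    proof (cases "s \<in> Ap S mu")
      case True then show ?thesis by (intro bexI[of _ s] exI[of _ 0]) auto
    next
      case False
      then obtain u where u: "u \<in> S" "s = u + mu" using less.prems Ap_cases by blast
      then obtain w b where "w \<in> Ap S mu" "u = w + b * mu" using less.IH[of u] mu(2) by auto
      then show ?thesis using u by (intro bexI[of _ w] exI[of _ "Suc b"]) auto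
    qed
  qed
  then show ?thesis using that by blast
qed

lemma Ap_minus_not_in:
  assumes w: "w \<in> Ap S mu" and u: "u \<in> S" "u + n * mu = w + b * mu"
  shows "n \<le> b"
proof (rule ccontr)
  assume "\<not> n \<le> b"
  then obtain j where "n = Suc (b + j)" using less_imp_Suc_add by (metis not_le)
  then have "w = (u + j * mu) + mu" using u(2) by (simp add: algebra_simps)
  moreover have "u + j * mu \<in> S" using u(1) mu_multiple add_in by blast
  ultimately show False using w by (auto simp: Ap_def)
qed

text \<open>The Apery set of \<open>n * mu\<close> is cut into n levels, each a translate of the
  Apery set of \<open>mu\<close>, and b is the level of the element.\<close>

lemma Ap_multiple:
  assumes w: "w \<in> Ap S mu"
  shows "w + b * mu \<in> Ap S (n * mu) \<longleftrightarrow> b < n"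
proof
  assume *: "w + b * mu \<in> Ap S (n * mu)"
  show "b < n"
  proof (rule ccontr)
    assume "\<not> b < n"
    then have "b * mu = (b - n) * mu + n * mu" by (simp flip: add_mult_distrib)
    then have "w + b * mu = (w + (b - n) * mu) + n * mu" by simp
    moreover have "w + (b - n) * mu \<in> S" using w Ap_S mu_multiple add_in by blast
    ultimately show False using * by (auto simp: Ap_def)
  qed
next
  assume "b < n"
  then show "w + b * mu \<in> Ap S (n * mu)"
  proof -
    have "w + b * mu \<noteq> u + n * mu" if "u \<in> S" for u
      using Ap_minus_not_in[OF w that, of n b] \<open>b < n\<close> by auto
    moreover have "w + b * mu \<in> S" using Ap_S[OF w] mu_multiple add_in by blast
    ultimately show ?thesis unfolding Ap_def by blast
  qed
qed

text \<open>Adding \<open>mu\<close> raises the order by at least one, so the excess of the order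
  over b never decreases. It is bounded by w, because an element of order l is at least
  \<open>l * mu\<close>; so it is eventually constant.\<close>

lemma ord_eventually_linear:
  assumes w: "w \<in> S"
  shows "\<exists>B. \<forall>b\<ge>B. ord (w + Suc b * mu) = Suc (ord (w + b * mu))"
proof -
  have wb: "w + b * mu \<in> S" for b using w mu_multiple add_in by blast
  have step: "Suc (ord (w + b * mu)) \<le> ord (w + Suc b * mu)" for b
  proof -
    have "ord (w + b * mu) + ord mu \<le> ord (w + b * mu + mu)" by (rule ord_add[OF wb mu(1)])
    moreover have "1 \<le> ord mu" using lM_iff[OF mu(1), of "Suc 0"] lM_1[OF mu(1)] mu(2) by simp
    ultimately show ?thesis by (simp add: algebra_simps)
  qed
  define g where "g b = ord (w + b * mu) - b" for b
  have ge: "b \<le> ord (w + b * mu)" for b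
  proof (induction b)
    case (Suc b) then show ?case using step[of b] by linarith
  qed simp
  have mono: "g b \<le> g (Suc b)" for b using step[of b] ge[of b] by (simp add: g_def)
  have le: "g b \<le> w" for b
  proof -
    have "ord (w + b * mu) * mu \<le> (w + b) * mu"
    proof -
      have "ord (w + b * mu) * mu \<le> w + b * mu" by (rule ord_mult_mu[OF wb])
      also have "\<dots> \<le> w * mu + b * mu" using mu(2) by simp
      finally show ?thesis by (simp add: add_mult_distrib)
    qed
    then show ?thesis using mu(2) by (simp add: g_def)
  qed
  have fin: "finite (range g)" using le by (auto simp: finite_nat_set_iff_bounded_le)
  obtain B where B: "g B = Max (range g)" using Max_in[OF fin] by (metis (no_types) empty_iff image_iff rangeI)
  have "g b = g B" if "b \<ge> B" for b
    using that Max_ge[OF fin, of "g b"] lift_Suc_mono_le[of g, OF mono that] B by (simp add: antisym)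
  then have "ord (w + Suc b * mu) = Suc (ord (w + b * mu))" if "b \<ge> B" for b
  proof -
    have "ord (w + Suc b * mu) - Suc b = ord (w + b * mu) - b"
      using \<open>\<And>b. B \<le> b \<Longrightarrow> g b = g B\<close>[of b] \<open>\<And>b. B \<le> b \<Longrightarrow> g b = g B\<close>[of "Suc b"] that
      by (simp add: g_def)
    then show ?thesis using ge[of b] ge[of "Suc b"] by linarith
  qed
  then show ?thesis by blast
qed

text \<open>In ring terms t^mu generates a reduction of the maximal ideal: from some power on, the
  next power is t^mu times the previous one. As there are finitely many Apery elements, the bounds
  of \<open>ord_eventually_linear\<close> have a maximum.\<close>

lemma reduction:
  obtains N where "\<And>i s. N \<le> i \<Longrightarrow> s \<in> lM (Suc i) \<Longrightarrow> \<exists>u\<in>lM i. s = u + mu"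
proof -
  obtain B where B: "\<And>w b. w \<in> Ap S mu \<Longrightarrow> b \<ge> B w \<Longrightarrow> ord (w + Suc b * mu) = Suc (ord (w + b * mu))"
    using ord_eventually_linear[OF Ap_S] by metis
  define B0 where "B0 = Max (B ` Ap S mu)"
  define W where "W = Max (Ap S mu)"
  have le: "B w \<le> B0" "w \<le> W" if "w \<in> Ap S mu" for w
    using that finite_Ap by (simp_all add: B0_def W_def)
  show ?thesis
  \<comment> \<open>Comparing \<open>Suc i * mu <= w + b * mu <= (W + b) * mu\<close> gives i + 1 <=
    W + b, so i >= W + B0 + 1 forces b - 1 >= B0, where the order already grows linearly.\<close>
  proof (rule that[of "W + B0 + 1"])
    fix i s assume i: "W + B0 + 1 \<le> i" and s: "s \<in> lM (Suc i)"
    obtain w b where wb: "w \<in> Ap S mu" "s = w + b * mu" using Ap_decomp[OF lM_subset[OF s]] .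
    have "Suc i * mu \<le> w + b * mu" using lM_ge[OF s] wb(2) by simp
    also have "\<dots> \<le> (W + b) * mu"
    proof -
      have "w \<le> W * 1" using le(2)[OF wb(1)] by simp
      also have "\<dots> \<le> W * mu" using mu(2) by (intro mult_le_mono2) simp
      finally show ?thesis by (simp add: add_mult_distrib)
    qed
    finally have "Suc i \<le> W + b" using mu(2) by (simp only: mult_le_cancel2)
    then obtain b' where b': "b = Suc b'" "B0 \<le> b'" using i by (cases b) auto
    have "ord s = Suc (ord (w + b' * mu))" using B[OF wb(1), of b'] b' le(1)[OF wb(1)] wb(2) by simp
    moreover have "Suc i \<le> ord s" using s lM_iff lM_subset by blast
    moreover have "w + b' * mu \<in> S" using wb(1) Ap_S mu_multiple add_in by blast
    ultimately have "w + b' * mu \<in> lM i" using lM_iff by simp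
    then show "\<exists>u\<in>lM i. s = u + mu" using wb(2) b'(1) by (intro bexI[of _ "w + b' * mu"]) auto
  qed
qed

section \<open>The top order of Apery elements, and purity\<close>

definition top_order where "top_order = Max (ord ` Ap S mu)"

lemma ord_le_top: "w \<in> Ap S mu \<Longrightarrow> ord w \<le> top_order"
  unfolding top_order_def using finite_Ap by simp

lemma top_order_attained: obtains w where "w \<in> Ap S mu" "ord w = top_order"
proof -
  have "top_order \<in> ord ` Ap S mu"
    unfolding top_order_def using finite_Ap zero_Ap mu(2) by (intro Max_in) auto
  then show ?thesis using that by auto
qed

text \<open>Superadditivity of the order, applied to an element of the Apery set, whose orders are
  bounded by the top order.\<close>

lemma reaches_le: "reaches S mu i w \<Longrightarrow> w \<in> S \<Longrightarrow> i + ord w \<le> top_order"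
proof -
  assume "reaches S mu i w" and w: "w \<in> S"
  then obtain u where u: "u \<in> lM i" "w + u \<in> Ap S mu" by (auto simp: reaches_def)
  have "i \<le> ord u" using u(1) lM_iff lM_subset by blast
  then show ?thesis using ord_add[OF w lM_subset[OF u(1)]] ord_le_top[OF u(2)] by simp
qed

lemma reaches_antimono: "i \<le> j \<Longrightarrow> reaches S q j s \<Longrightarrow> reaches S q i s"
  unfolding reaches_def using lM_mono by blast

lemma le_M_iff: "le_M S x y \<longleftrightarrow> (\<exists>z\<in>Ap S mu. x + z = y \<and> ord x + ord z = ord y)"
  by (simp add: le_M_def Apery_eq)

text \<open>The two increments add up. Superadditivity, applied to a + b and to x + (a + b), bounds
  the order of the increment from both sides.\<close>

lemma le_M_trans:
  assumes xy: "le_M S x y" and yz: "le_M S y z" and x: "x \<in> S" and z: "z \<in> Ap S mu"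
  shows "le_M S x z"
proof -
  obtain a b where a: "a \<in> Ap S mu" "x + a = y" "ord x + ord a = ord y"
    and b: "b \<in> Ap S mu" "y + b = z" "ord y + ord b = ord z" using xy yz by (auto simp: le_M_iff)
  have ab: "a + b \<in> S" using a b Ap_S add_in by blast
  have eq: "(a + b) + x = z" using a(2) b(2) by simp
  then have "(a + b) + x \<in> Ap S mu" using z by simp
  then have "a + b \<in> Ap S mu" using Ap_divisor ab x by blast
  moreover have "ord x + ord (a + b) = ord z"
    using ord_add[OF ab x] ord_add[OF Ap_S[OF a(1)] Ap_S[OF b(1)]] a(3) b(3) unfolding eq by linarith
  ultimately show ?thesis unfolding le_M_iff using a b by (auto simp: ac_simps)
qed

lemma maximal_above:
  assumes "w \<in> Ap S mu" obtains y where "maximal_Apery S y" "le_M S w y"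
proof -
  have "le_M S w w" unfolding le_M_iff using zero_Ap[of mu] mu(2) ord_0 by force
  then have ne: "{y \<in> Ap S mu. le_M S w y} \<noteq> {}" using assms by blast
  have fin: "finite {y \<in> Ap S mu. le_M S w y}" using finite_Ap by simp
  \<comment> \<open>The numerically largest element above w is maximal, since whatever lies above it
    is at least as large as a number.\<close>
  define y where "y = Max {y \<in> Ap S mu. le_M S w y}"
  have y: "y \<in> Ap S mu" "le_M S w y" using Max_in[OF fin ne] by (auto simp: y_def)
  have "z = y" if z: "z \<in> Ap S mu" "le_M S y z" for z
  proof -
    have "z \<le> y" unfolding y_def
      by (rule Max_ge[OF fin]) (use z le_M_trans[OF y(2) z(2) Ap_S[OF assms] z(1)] in simp)
    moreover have "y \<le> z" using z(2) by (auto simp: le_M_iff)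
    ultimately show ?thesis by simp
  qed
  then have "maximal_Apery S y" unfolding maximal_Apery_def Apery_eq using y(1) by blast
  then show ?thesis using that y(2) by blast
qed

text \<open>Purity means that every Apery element attains the bound of \<open>reaches_le\<close>. If
  w attains it through u, superadditivity turns the reach into the relation from w to w + u; a
  maximal w then has u = 0 and top order.\<close>

lemma M_pure_iff:
  "M_pure S \<longleftrightarrow> (\<forall>w\<in>Ap S mu. reaches S mu (top_order - ord w) w)"
proof
  assume pure: "M_pure S"
  show "\<forall>w\<in>Ap S mu. reaches S mu (top_order - ord w) w"
  proof
    fix w assume w: "w \<in> Ap S mu"
    obtain y where y: "maximal_Apery S y" "le_M S w y" by (rule maximal_above[OF w])
    obtain w' where w': "w' \<in> Ap S mu" "ord w' = top_order" by (rule top_order_attained)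
    obtain y' where y': "maximal_Apery S y'" "le_M S w' y'" by (rule maximal_above[OF w'(1)])
    have "top_order \<le> ord y'" using y'(2) w'(2) by (auto simp: le_M_iff)
    moreover have "ord y' \<le> top_order" using y'(1) ord_le_top by (simp add: maximal_Apery_def Apery_eq)
    moreover have "ord y = ord y'" using pure y(1) y'(1) unfolding M_pure_def by blast
    ultimately have "ord y = top_order" by simp
    then obtain z where z: "z \<in> Ap S mu" "w + z = y" "ord w + ord z = top_order"
      using y(2) by (auto simp: le_M_iff)
    have "z \<in> lM (top_order - ord w)" using z lM_iff[OF Ap_S[OF z(1)]] by simp
    moreover have "w + z \<in> Ap S mu" using y(1) z(2) by (simp add: maximal_Apery_def Apery_eq)
    ultimately show "reaches S mu (top_order - ord w) w" by (auto simp: reaches_def)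
  qed
next
  assume *: "\<forall>w\<in>Ap S mu. reaches S mu (top_order - ord w) w"
  have "ord w = top_order" if max: "maximal_Apery S w" for w
  proof -
    have w: "w \<in> Ap S mu" using max by (simp add: maximal_Apery_def Apery_eq)
    then obtain u where u: "u \<in> lM (top_order - ord w)" "w + u \<in> Ap S mu"
      using * by (auto simp: reaches_def)
    have uS: "u \<in> S" by (rule lM_subset[OF u(1)])
    have ou: "top_order - ord w \<le> ord u" using u(1) lM_iff[OF uS] by simp
    have uA: "u \<in> Ap S mu" using Ap_divisor[of u w mu] u(2) uS Ap_S[OF w] by (simp add: add.commute)
    have "ord w + ord u = ord (w + u)"
      using ou ord_add[OF Ap_S[OF w] uS] ord_le_top[OF u(2)] ord_le_top[OF w] by simp
    then have "le_M S w (w + u)" unfolding le_M_iff using uA by blast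
    then have "w + u = w" using max u(2) unfolding maximal_Apery_def Apery_eq by blast
    then show ?thesis using ou ord_le_top[OF w] ord_0 by simp
  qed
  then show "M_pure S" unfolding M_pure_def by simp
qed

lemma ord_linear_imp:
  assumes "\<And>s. s \<in> S \<Longrightarrow> ord (s + mu) = Suc (ord s)" and "w \<in> S"
  shows "ord (w + b * mu) = ord w + b"
proof (induction b)
  case (Suc b)
  have "w + b * mu \<in> S" using assms(2) mu_multiple add_in by blast
  from assms(1)[OF this] Suc show ?case by (simp add: algebra_simps)
qed simp

text \<open>The combinatorial core of the regularity of \<open>x\<close> on the associated graded module.\<close>

lemma reaches_shift:
  assumes lin: "\<And>s. s \<in> S \<Longrightarrow> ord (s + mu) = Suc (ord s)"
    and pure: "\<And>w. w \<in> Ap S mu \<Longrightarrow> reaches S mu (top_order - ord w) w"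
    and s: "s \<in> S" "s + mu \<in> Ap S (n * mu)" and r: "reaches S (n * mu) (Suc i) s"
  shows "reaches S (n * mu) i (s + mu)"
proof -
  have ordl: "ord (w + b * mu) = ord w + b" if "w \<in> S" for w b
    by (rule ord_linear_imp[OF lin that])
  obtain w b where wb: "w \<in> Ap S mu" "s + mu = w + b * mu" using Ap_decomp[OF Ap_S[OF s(2)]] .
  have bn: "b < n" using s(2) wb Ap_multiple by simp
  obtain v where v: "v \<in> lM (top_order - ord w)" "w + v \<in> Ap S mu" using pure[OF wb(1)] by (auto simp: reaches_def)
  \<comment> \<open>The element \<open>s + mu\<close> lies on level b. The summand v leads to top
    order inside the Apery set of \<open>mu\<close>, and j further multiples of \<open>mu\<close> go
    up to the last level n - 1.\<close>
  define j where "j = n - Suc b"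
  have eq: "(s + mu) + (v + j * mu) = (w + v) + (n - 1) * mu"
  proof -
    have "n - 1 = b + j" using bn by (simp add: j_def)
    then show ?thesis using wb(2) by (simp add: algebra_simps)
  qed
  have "(s + mu) + (v + j * mu) \<in> Ap S (n * mu)"
    unfolding eq using Ap_multiple[OF v(2), of "n - 1" n] bn by simp
  moreover have "v + j * mu \<in> lM (top_order - ord w + j)" by (rule lM_add[OF v(1) mult_mu_lM])
  ultimately have big: "reaches S (n * mu) (top_order - ord w + j) (s + mu)" by (auto simp: reaches_def)
  have "i \<le> top_order - ord w + j"
  proof (rule ccontr)
    assume "\<not> ?thesis"
    then have i: "top_order - ord w + j < i" by simp
    \<comment> \<open>If i were larger, the orders of \<open>s + mu\<close> and u would add up to
      more than \<open>top_order + n\<close>, whereas their sum \<open>s + u + mu\<close> has at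
      most that order.\<close>
    obtain u where u: "u \<in> lM (Suc i)" "s + u \<in> Ap S (n * mu)" using r by (auto simp: reaches_def)
    have uS: "u \<in> S" by (rule lM_subset[OF u(1)])
    obtain w' b' where w': "w' \<in> Ap S mu" "s + u = w' + b' * mu" using Ap_decomp[OF Ap_S[OF u(2)]] .
    have "b' < n" using u(2) w' Ap_multiple by simp
    have "Suc i \<le> ord u" using u(1) lM_iff[OF uS, of "Suc i"] by blast
    moreover have "ord (s + mu) = ord w + b" using ordl[OF Ap_S[OF wb(1)]] wb(2) by simp
    moreover have "ord (s + mu) + ord u \<le> ord (s + u + mu)"
      using ord_add[OF Ap_S[OF s(2)] uS] by (simp add: ac_simps)
    moreover have "ord (s + u + mu) = Suc (ord w' + b')"
      using lin[OF Ap_S[OF u(2)]] ordl[OF Ap_S[OF w'(1)]] w'(2) by simp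
    ultimately show False
      using i ord_le_top[OF w'(1)] ord_le_top[OF wb(1)] \<open>b' < n\<close> bn by (simp add: j_def)
  qed
  then show ?thesis using big reaches_antimono by blast
qed

end

section \<open>Filtrations by powers of an ideal\<close>

locale plain_module = module R M for R :: "'a ring" (structure) and M :: "('a, 'b) module" (structure)

lemma plain_moduleI: "module R M \<Longrightarrow> plain_module R M"
  by (simp add: plain_module_def)

locale filtered = fixes R :: "'a ring" and I :: "'a set" and M :: "('a, 'b) module"
  assumes M: "module R M" and I: "ideal I R"
begin

sublocale M: plain_module R M by (rule plain_moduleI[OF M])
sublocale I: ideal I R by (rule I)

abbreviation L where "L i \<equiv> ideal_power_module M I i"

text \<open>The product of an ideal and a set is defined as an additive subgroup only. In each
  generator the ideal absorbs scalars, and induction over the generated group extends this to sums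
  and inverses.\<close>

lemma ideal_smult_submodule:
  assumes X: "X \<subseteq> carrier M"
  shows "submodule (ideal_smult M I X) R M"
proof -
  let ?T = "{a \<odot>\<^sub>M x | a x. a \<in> I \<and> x \<in> X}"
  have T: "?T \<subseteq> carrier (add_monoid M)"
    using X I.a_Hcarr by auto
  note grp = M.M.a_group
  interpret G: subgroup "ideal_smult M I X" "add_monoid M"
    unfolding ideal_smult_def by (rule group.generate_is_subgroup[OF grp T])
  have sm: "r \<odot>\<^sub>M y \<in> generate (add_monoid M) ?T" if r: "r \<in> carrier R" and y: "y \<in> generate (add_monoid M) ?T" for r y
    using y
  proof induction
    case one
    then show ?case using generate.one[of "add_monoid M" ?T] r by simp
  next
    case (incl h)
    then obtain a x where ax: "a \<in> I" "x \<in> X" "h = a \<odot>\<^sub>M x" by blast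
    have "r \<odot>\<^sub>M h = (r \<otimes>\<^sub>R a) \<odot>\<^sub>M x" using ax X I.a_Hcarr r by (simp add: M.smult_assoc1 subset_iff)
    then have "r \<odot>\<^sub>M h \<in> ?T" using I.I_l_closed[OF ax(1) r] ax(2) by blast
    then show ?case by (rule generate.incl)
  next
    case (inv h)
    then obtain a x where ax: "a \<in> I" "x \<in> X" "h = a \<odot>\<^sub>M x" by blast
    have x: "x \<in> carrier M" using ax(2) X by blast
    have "r \<odot>\<^sub>M h = (r \<otimes>\<^sub>R a) \<odot>\<^sub>M x" using ax x I.a_Hcarr r by (simp add: M.smult_assoc1)
    then have "r \<odot>\<^sub>M h \<in> ?T" using I.I_l_closed[OF ax(1) r] ax(2) by blast
    moreover have "r \<odot>\<^sub>M (inv\<^bsub>add_monoid M\<^esub> h) = inv\<^bsub>add_monoid M\<^esub> (r \<odot>\<^sub>M h)"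
      using M.smult_r_minus[OF r] ax x I.a_Hcarr by (simp add: a_inv_def)
    ultimately show ?case using generate.inv[of "r \<odot>\<^sub>M h" ?T "add_monoid M"] by simp
  next
    case (eng h1 h2)
    have "h1 \<in> carrier M" "h2 \<in> carrier M"
      using group.generate_in_carrier[OF grp T] eng by auto
    then show ?case using generate.eng[OF eng.IH] M.smult_r_distr[OF r] by simp
  qed
  show ?thesis
    by (intro submodule.intro G.subgroup_axioms submodule_axioms.intro)
       (use sm in \<open>simp add: ideal_smult_def\<close>)
qed

lemma L_submodule: "submodule (L i) R M"
  by (induction i) (simp_all add: M.carrier_is_submodule ideal_smult_submodule M.submoduleE(1))

lemma L_carrier: "y \<in> L i \<Longrightarrow> y \<in> carrier M"
  using M.submoduleE(1)[OF L_submodule] by blast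

lemma L_Suc: "a \<in> I \<Longrightarrow> y \<in> L i \<Longrightarrow> a \<odot>\<^sub>M y \<in> L (Suc i)"
  by (auto simp: ideal_smult_def intro!: generate.incl)

lemma L_least:
  assumes N: "submodule N R M" and "\<And>a y. a \<in> I \<Longrightarrow> y \<in> L i \<Longrightarrow> a \<odot>\<^sub>M y \<in> N"
  shows "L (Suc i) \<subseteq> N"
proof -
  have sg: "subgroup N (add_monoid M)" using N by (simp add: submodule_def)
  show ?thesis
    unfolding ideal_power_module.simps ideal_smult_def
    by (rule group.generate_subgroup_incl[OF M.M.a_group _ sg]) (use assms(2) in blast)
qed

lemma L_Suc_subset: "L (Suc i) \<subseteq> L i"
  by (rule L_least[OF L_submodule]) (use M.submoduleE(4)[OF L_submodule] I.a_Hcarr in blast)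

lemma L_mono: "i \<le> j \<Longrightarrow> y \<in> L j \<Longrightarrow> y \<in> L i"
  by (induction j rule: dec_induct) (use L_Suc_subset in blast)+

end

lemma filtered_self: "cring R \<Longrightarrow> ideal I R \<Longrightarrow> filtered R I (self_module R)"
  by (simp add: filtered_def module_self_module)

context filtered begin

sublocale J: filtered R I "self_module R" by (rule filtered_self[OF M.R.is_cring I])

lemma J_carrier: "a \<in> J.L i \<Longrightarrow> a \<in> carrier R"
  using J.L_carrier by simp

text \<open>The scalars that take y into the target form an ideal, so it suffices to treat products
  of an element of I with an element of the preceding power.\<close>

lemma J_L: "a \<in> J.L i \<Longrightarrow> y \<in> L j \<Longrightarrow> a \<odot>\<^sub>M y \<in> L (i + j)"
proof (induction i arbitrary: a y j)
  case 0
  then show ?case using M.submoduleE(4)[OF L_submodule] by simp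
next
  case (Suc i)
  have "J.L (Suc i) \<subseteq> {a \<in> carrier R. a \<odot>\<^sub>M y \<in> L (Suc i + j)}"
  proof (rule J.L_least)
    have yc: "y \<in> carrier M" by (rule L_carrier[OF Suc.prems(2)])
    have lin: "linear_on R (self_module R) M (carrier R) (\<lambda>a. a \<odot>\<^sub>M y)"
      by (rule linear_onI) (use yc in \<open>auto simp: M.smult_l_distr M.smult_assoc1\<close>)
    note E = M.submoduleE[OF L_submodule[of "Suc i + j"]]
    show "submodule {a \<in> carrier R. a \<odot>\<^sub>M y \<in> L (Suc i + j)} R (self_module R)"
    proof (rule J.M.submoduleI)
      show "\<ominus>\<^bsub>self_module R\<^esub> r \<in> {a \<in> carrier R. a \<odot>\<^sub>M y \<in> L (Suc i + j)}"
        if "r \<in> {a \<in> carrier R. a \<odot>\<^sub>M y \<in> L (Suc i + j)}" for r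
        using that yc E(3) by (simp add: M.smult_l_minus)
      show "r \<oplus>\<^bsub>self_module R\<^esub> s \<in> {a \<in> carrier R. a \<odot>\<^sub>M y \<in> L (Suc i + j)}"
        if "r \<in> {a \<in> carrier R. a \<odot>\<^sub>M y \<in> L (Suc i + j)}" "s \<in> {a \<in> carrier R. a \<odot>\<^sub>M y \<in> L (Suc i + j)}" for r s
        using that yc E(5) by (simp add: M.smult_l_distr)
      show "r \<odot>\<^bsub>self_module R\<^esub> s \<in> {a \<in> carrier R. a \<odot>\<^sub>M y \<in> L (Suc i + j)}"
        if "r \<in> carrier R" "s \<in> {a \<in> carrier R. a \<odot>\<^sub>M y \<in> L (Suc i + j)}" for r s
        using that yc E(4) by (simp add: M.smult_assoc1)
    qed (use yc submodule_zero[OF L_submodule[of "Suc i + j"]] in auto)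
    fix b c assume b: "b \<in> I" and c: "c \<in> J.L i"
    have bc: "b \<in> carrier R" "c \<in> carrier R" using b c I.a_Hcarr J_carrier by auto
    have "(b \<otimes>\<^sub>R c) \<odot>\<^sub>M y = b \<odot>\<^sub>M (c \<odot>\<^sub>M y)" by (rule M.smult_assoc1[OF bc yc])
    also have "\<dots> \<in> L (Suc (i + j))" by (rule L_Suc[OF b Suc.IH[OF c Suc.prems(2)]])
    finally show "b \<odot>\<^bsub>self_module R\<^esub> c \<in> {a \<in> carrier R. a \<odot>\<^sub>M y \<in> L (Suc i + j)}"
      using bc by simp
  qed
  then show ?case using Suc.prems(1) by blast
qed

end

section \<open>Convolution of sequences\<close>

text \<open>The component of degree n of a product in the associated graded module, computed on
  representatives. The same formula describes the action of a power series on a family of dual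
  vectors.\<close>

definition conv :: "('a, 'b) module \<Rightarrow> (nat \<Rightarrow> 'a) \<Rightarrow> (nat \<Rightarrow> 'b) \<Rightarrow> nat \<Rightarrow> 'b" where
  "conv M a y n = (\<Oplus>\<^sub>M i\<in>{..n}. a i \<odot>\<^sub>M y (n - i))"

context plain_module begin

lemma conv_closed:
  "(\<And>i. a i \<in> carrier R) \<Longrightarrow> (\<And>i. y i \<in> carrier M) \<Longrightarrow> conv M a y n \<in> carrier M"
  unfolding conv_def by (intro M.finsum_closed Pi_I smult_closed)

lemma conv_cong:
  assumes "\<And>i. i \<le> n \<Longrightarrow> a i \<odot>\<^sub>M y (n - i) = a' i \<odot>\<^sub>M y' (n - i)"
    and "\<And>i. i \<le> n \<Longrightarrow> a' i \<odot>\<^sub>M y' (n - i) \<in> carrier M"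
  shows "conv M a y n = conv M a' y' n"
  unfolding conv_def by (rule M.finsum_cong') (use assms in auto)

lemma conv_add_right:
  assumes "\<And>i. a i \<in> carrier R" "\<And>i. y i \<in> carrier M" "\<And>i. z i \<in> carrier M"
  shows "conv M a (\<lambda>i. y i \<oplus>\<^sub>M z i) n = conv M a y n \<oplus>\<^sub>M conv M a z n"
proof -
  have "conv M a (\<lambda>i. y i \<oplus>\<^sub>M z i) n = (\<Oplus>\<^sub>M i\<in>{..n}. a i \<odot>\<^sub>M y (n - i) \<oplus>\<^sub>M a i \<odot>\<^sub>M z (n - i))"
    unfolding conv_def by (rule M.finsum_cong') (use assms in \<open>auto simp: smult_r_distr\<close>)
  also have "\<dots> = conv M a y n \<oplus>\<^sub>M conv M a z n"
    unfolding conv_def by (rule M.finsum_addf) (use assms in auto)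
  finally show ?thesis .
qed

lemma conv_add_left:
  assumes "\<And>i. a i \<in> carrier R" "\<And>i. b i \<in> carrier R" "\<And>i. y i \<in> carrier M"
  shows "conv M (\<lambda>i. a i \<oplus> b i) y n = conv M a y n \<oplus>\<^sub>M conv M b y n"
proof -
  have "conv M (\<lambda>i. a i \<oplus> b i) y n = (\<Oplus>\<^sub>M i\<in>{..n}. a i \<odot>\<^sub>M y (n - i) \<oplus>\<^sub>M b i \<odot>\<^sub>M y (n - i))"
    unfolding conv_def by (rule M.finsum_cong') (use assms in \<open>auto simp: smult_l_distr\<close>)
  also have "\<dots> = conv M a y n \<oplus>\<^sub>M conv M b y n"
    unfolding conv_def by (rule M.finsum_addf) (use assms in auto)
  finally show ?thesis .
qed

lemma conv_smult:
  assumes "r \<in> carrier R" "\<And>i. a i \<in> carrier R" "\<And>i. y i \<in> carrier M"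
  shows "conv M a (\<lambda>i. r \<odot>\<^sub>M y i) n = r \<odot>\<^sub>M conv M a y n"
proof -
  have "r \<odot>\<^sub>M conv M a y n = (\<Oplus>\<^sub>M i\<in>{..n}. r \<odot>\<^sub>M (a i \<odot>\<^sub>M y (n - i)))"
    unfolding conv_def by (rule finsum_smult_ldistr) (use assms in auto)
  also have "\<dots> = conv M a (\<lambda>i. r \<odot>\<^sub>M y i) n"
    unfolding conv_def by (rule M.finsum_cong') (use assms smult_left_commute in auto)
  finally show ?thesis by simp
qed

lemma conv_single:
  assumes "\<And>i. i \<noteq> j \<Longrightarrow> a i = \<zero>" "a j \<in> carrier R" "\<And>i. y i \<in> carrier M"
  shows "conv M a y n = (if j \<le> n then a j \<odot>\<^sub>M y (n - j) else \<zero>\<^sub>M)"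
proof -
  have "conv M a y n = (\<Oplus>\<^sub>M i\<in>{..n}. if j = i then a i \<odot>\<^sub>M y (n - i) else \<zero>\<^sub>M)"
    unfolding conv_def by (rule M.finsum_cong') (use assms in auto)
  also have "\<dots> = (if j \<le> n then a j \<odot>\<^sub>M y (n - j) else \<zero>\<^sub>M)"
  proof (cases "j \<le> n")
    case True
    have "(\<lambda>i. if j = i then a i \<odot>\<^sub>M y (n - i) else \<zero>\<^sub>M) = (\<lambda>i. if j = i then a j \<odot>\<^sub>M y (n - j) else \<zero>\<^sub>M)"
      by auto
    then show ?thesis
      using M.finsum_singleton[of j "{..n}" "\<lambda>i. a j \<odot>\<^sub>M y (n - j)"] True assms(2,3) by simp
  next
    case False
    then have "(\<Oplus>\<^sub>M i\<in>{..n}. if j = i then a i \<odot>\<^sub>M y (n - i) else \<zero>\<^sub>M) = (\<Oplus>\<^sub>M i\<in>{..n}. \<zero>\<^sub>M)"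
      by (intro M.finsum_cong') auto
    then show ?thesis using False by simp
  qed
  finally show ?thesis .
qed

lemma conv_assoc:
  assumes a: "\<And>i. a i \<in> carrier R" and b: "\<And>i. b i \<in> carrier R" and y: "\<And>i. y i \<in> carrier M"
  shows "conv M (conv (self_module R) a b) y n = conv M a (conv M b y) n"
proof -
  have [simp]: "a i \<in> carrier R" "b i \<in> carrier R" "y i \<in> carrier M" for i by (rule a b y)+
  have sm: "(\<Oplus> i\<in>A. f i) \<odot>\<^sub>M z = (\<Oplus>\<^sub>M i\<in>A. f i \<odot>\<^sub>M z)"
    if "finite A" "\<And>i. f i \<in> carrier R" "z \<in> carrier M" for A :: "nat set" and f z
    using that(1) by induction (use that(2,3) in \<open>auto simp: smult_l_distr\<close>)
  \<comment> \<open>The outer bound k is separated from n: in the induction the triangle of index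
    pairs grows by one diagonal while the indices of y keep their dependence on n.\<close>
  have "k \<le> n \<Longrightarrow> (\<Oplus>\<^sub>M i\<in>{..k}. (\<Oplus> j\<in>{..i}. a j \<otimes> b (i - j)) \<odot>\<^sub>M y (n - i)) =
      (\<Oplus>\<^sub>M j\<in>{..k}. a j \<odot>\<^sub>M (\<Oplus>\<^sub>M i\<in>{..k - j}. b i \<odot>\<^sub>M y (n - j - i)))" for k
  proof (induction k)
    case 0
    then show ?case by (simp add: smult_assoc1)
  next
    case (Suc k)
    let ?T = "\<lambda>j. a j \<odot>\<^sub>M (b (Suc k - j) \<odot>\<^sub>M y (n - Suc k))"
    let ?U = "\<lambda>j. a j \<odot>\<^sub>M (\<Oplus>\<^sub>M i\<in>{..k - j}. b i \<odot>\<^sub>M y (n - j - i))"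
    have Uc: "?U j \<in> carrier M" for j by (intro smult_closed M.finsum_closed) auto
    have "(\<Oplus> j\<in>{..Suc k}. a j \<otimes> b (Suc k - j)) \<odot>\<^sub>M y (n - Suc k) = (\<Oplus>\<^sub>M j\<in>{..Suc k}. ?T j)"
      by (simp add: sm smult_assoc1 del: M.finsum_Suc R.finsum_Suc)
    then have "(\<Oplus>\<^sub>M i\<in>{..Suc k}. (\<Oplus> j\<in>{..i}. a j \<otimes> b (i - j)) \<odot>\<^sub>M y (n - i)) =
        (\<Oplus>\<^sub>M j\<in>{..Suc k}. ?T j) \<oplus>\<^sub>M (\<Oplus>\<^sub>M j\<in>{..k}. ?U j)"
      using Suc by (subst M.finsum_Suc) (auto intro!: smult_closed R.finsum_closed simp del: R.finsum_Suc M.finsum_Suc)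
    also have "(\<Oplus>\<^sub>M j\<in>{..Suc k}. ?T j) = ?T (Suc k) \<oplus>\<^sub>M (\<Oplus>\<^sub>M j\<in>{..k}. ?T j)"
      by (rule M.finsum_Suc) auto
    also have "?T (Suc k) \<oplus>\<^sub>M (\<Oplus>\<^sub>M j\<in>{..k}. ?T j) \<oplus>\<^sub>M (\<Oplus>\<^sub>M j\<in>{..k}. ?U j) =
        ?T (Suc k) \<oplus>\<^sub>M (\<Oplus>\<^sub>M j\<in>{..k}. ?T j \<oplus>\<^sub>M ?U j)"
      using Uc by (subst M.finsum_addf) (auto simp: M.a_assoc)
    also have "(\<Oplus>\<^sub>M j\<in>{..k}. ?T j \<oplus>\<^sub>M ?U j) = (\<Oplus>\<^sub>M j\<in>{..k}. a j \<odot>\<^sub>M (\<Oplus>\<^sub>M i\<in>{..Suc k - j}. b i \<odot>\<^sub>M y (n - j - i)))"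
    proof (rule M.finsum_cong')
      fix j assume "j \<in> {..k}"
      then have j: "Suc k - j = Suc (k - j)" "n - Suc k = n - j - Suc (k - j)" by auto
      have "(\<Oplus>\<^sub>M i\<in>{..Suc (k - j)}. b i \<odot>\<^sub>M y (n - j - i)) =
          b (Suc (k - j)) \<odot>\<^sub>M y (n - j - Suc (k - j)) \<oplus>\<^sub>M (\<Oplus>\<^sub>M i\<in>{..k - j}. b i \<odot>\<^sub>M y (n - j - i))"
        by (rule M.finsum_Suc) auto
      then show "?T j \<oplus>\<^sub>M ?U j = a j \<odot>\<^sub>M (\<Oplus>\<^sub>M i\<in>{..Suc k - j}. b i \<odot>\<^sub>M y (n - j - i))"
        unfolding j by (simp add: smult_r_distr M.finsum_closed Pi_def)
    qed (auto intro!: smult_closed M.finsum_closed)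
    also have "?T (Suc k) \<oplus>\<^sub>M \<dots> = (\<Oplus>\<^sub>M j\<in>{..Suc k}. a j \<odot>\<^sub>M (\<Oplus>\<^sub>M i\<in>{..Suc k - j}. b i \<odot>\<^sub>M y (n - j - i)))"
      by (subst M.finsum_Suc) (auto intro!: smult_closed M.finsum_closed simp del: M.finsum_Suc)
    finally show ?case .
  qed
  from this[of n] show ?thesis unfolding conv_def by simp
qed

end

section \<open>The ring of a numerical semigroup and its canonical module\<close>

lemma height_eq_one:
  assumes Q: "primeideal Q A" and P: "primeideal P A" and QP: "Q \<subset> P"
    and only: "\<And>P'. primeideal P' A \<Longrightarrow> P' \<subset> P \<Longrightarrow> P' = Q"
  shows "height A P = enat 1"
  unfolding height_def
proof (rule antisym)
  let ?H = "{enat n |n. \<exists>Q. (\<forall>i\<le>n. primeideal (Q i) A) \<and> (\<forall>i<n. Q i \<subset> Q (Suc i)) \<and> Q n = P}"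
  show "Sup ?H \<le> enat 1"
  proof (rule Sup_least, clarify)
    fix n Q assume Q: "\<forall>i\<le>n. primeideal (Q i) A" "\<forall>i<n. Q i \<subset> Q (Suc i)" "P = Q n"
    show "enat n \<le> enat 1"
    proof (rule ccontr)
      assume "\<not> enat n \<le> enat 1"
      then have "2 \<le> n" by simp
      then obtain k where k: "n = Suc (Suc k)" by (metis add_2_eq_Suc le_Suc_ex)
      have "Q k \<subset> Q (Suc k)" "Q (Suc k) \<subset> P" using Q k by auto
      then show False using only[of "Q k"] only[of "Q (Suc k)"] Q(1) k by auto
    qed
  qed
  have "enat 1 \<in> ?H"
  proof (intro CollectI exI conjI)
    show "enat 1 = enat 1" ..
    let ?Q = "\<lambda>i::nat. if i = 0 then Q else P"
    show "\<forall>i\<le>1. primeideal (?Q i) A" using Q P by simp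
    show "\<forall>i<1. ?Q i \<subset> ?Q (Suc i)" using QP by auto
    show "?Q 1 = P" by simp
  qed
  then show "enat 1 \<le> Sup ?H" by (rule Sup_upper)
qed

lemma prime_pow_mem:
  assumes "primeideal P A" "f \<in> carrier A" "f [^]\<^sub>A (k::nat) \<in> P"
  shows "f \<in> P"
  using assms(3)
proof (induction k)
  interpret P: primeideal P A by fact
  case 0
  then show ?case using P.one_imp_carrier P.I_notcarr by simp
next
  interpret P: primeideal P A by fact
  case (Suc k)
  then show ?case using P.I_prime[of "f [^]\<^sub>A k" f] assms(2) by auto
qed

lemma cring_idealI:
  fixes A :: "'a ring"
  assumes "cring A" "J \<subseteq> carrier A" "\<zero>\<^sub>A \<in> J" "\<And>f g. f \<in> J \<Longrightarrow> g \<in> J \<Longrightarrow> f \<oplus>\<^sub>A g \<in> J"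
    and "\<And>f g. f \<in> J \<Longrightarrow> g \<in> carrier A \<Longrightarrow> g \<otimes>\<^sub>A f \<in> J"
  shows "ideal J A"
proof -
  interpret cring A by fact
  interpret S: module A "self_module A" by (rule module_self_module[OF assms(1)])
  show ?thesis
    unfolding submodule_self_module_iff[OF assms(1), symmetric]
  proof (rule S.submoduleI)
    show "\<ominus>\<^bsub>self_module A\<^esub> f \<in> J" if "f \<in> J" for f
    proof -
      have "(\<ominus>\<^sub>A \<one>\<^sub>A) \<otimes>\<^sub>A f = \<ominus>\<^sub>A f" using that assms(2) by (auto simp: l_minus)
      then show ?thesis using assms(5)[OF that, of "\<ominus>\<^sub>A \<one>\<^sub>A"] by simp
    qed
  qed (use assms in auto)
qed

lemma (in numerical_sg) lM_SucI: "a \<in> lM i \<Longrightarrow> b \<in> S - {0} \<Longrightarrow> a + b \<in> lM (Suc i)"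
  by (simp only: lM_sg.simps) blast

locale sg_ring = numerical_sg S for S +
  fixes R :: "'k::field fps ring" and mm :: "'k fps set"
  assumes R: "R = semigroup_ring S" and mm: "mm = semigroup_max_ideal S" and max: "maximalideal mm R"
begin

lemma R_simps [simp]:
  "f \<in> carrier R \<longleftrightarrow> (\<forall>n. fps_nth f n \<noteq> 0 \<longrightarrow> n \<in> S)"
  "f \<otimes>\<^sub>R g = f * g" "f \<oplus>\<^sub>R g = f + g" "\<one>\<^sub>R = 1" "\<zero>\<^sub>R = 0"
  by (simp_all add: R semigroup_ring_def)

lemma nonzero_mult_nth:
  fixes f g :: "'k fps"
  assumes "fps_nth (f * g) n \<noteq> 0"
  obtains i j where "n = i + j" "fps_nth f i \<noteq> 0" "fps_nth g j \<noteq> 0"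
proof -
  have "(\<Sum>i=0..n. fps_nth f i * fps_nth g (n - i)) \<noteq> 0" using assms by (simp add: fps_mult_nth)
  then obtain i where "i \<in> {0..n}" "fps_nth f i * fps_nth g (n - i) \<noteq> 0" using sum.not_neutral_contains_not_neutral by blast
  then have "n = i + (n - i)" "fps_nth f i \<noteq> 0" "fps_nth g (n - i) \<noteq> 0" by auto
  then show ?thesis by (rule that)
qed

lemma cring_R: "cring R"
proof -
  have mult: "f * g \<in> carrier R" if "f \<in> carrier R" "g \<in> carrier R" for f g
    using that add_in unfolding R_simps by (metis nonzero_mult_nth)
  have add: "f + g \<in> carrier R" if "f \<in> carrier R" "g \<in> carrier R" for f g
    using that unfolding R_simps by (metis add.right_neutral fps_add_nth)
  have uminus: "- f \<in> carrier R" if "f \<in> carrier R" for f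
    using that unfolding R_simps by simp
  have one: "1 \<in> carrier R" using zero_in by (simp add: fps_one_nth)
  have grp: "abelian_group R"
  proof (rule abelian_groupI)
    show "\<exists>g\<in>carrier R. g \<oplus>\<^sub>R f = \<zero>\<^sub>R" if "f \<in> carrier R" for f
      using uminus[OF that] by (intro bexI[of _ "- f"]) simp_all
    show "f \<oplus>\<^sub>R g \<in> carrier R" if "f \<in> carrier R" "g \<in> carrier R" for f g using add[OF that] by simp
  qed (simp_all add: ac_simps)
  show ?thesis
  proof (rule cringI[OF grp])
    show "comm_monoid R"
    proof (rule comm_monoidI)
      show "f \<otimes>\<^sub>R g \<in> carrier R" if "f \<in> carrier R" "g \<in> carrier R" for f g using mult[OF that] by simp
      show "\<one>\<^sub>R \<in> carrier R" using one by simp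
    qed (simp_all add: ac_simps)
  qed (simp add: distrib_right)
qed

sublocale cring R by (rule cring_R)
sublocale mm: maximalideal mm R by (rule max)

lemma a_inv_R [simp]: "f \<in> carrier R \<Longrightarrow> \<ominus>\<^sub>R f = - f"
  by (rule minus_equality) simp_all

lemma a_minus_R [simp]: "g \<in> carrier R \<Longrightarrow> f \<ominus>\<^sub>R g = f - g"
  unfolding a_minus_def by (subst a_inv_R) simp_all

lemma const_closed: "fps_const c \<in> carrier R"
  using zero_in by simp

lemma X_power_closed: "s \<in> S \<Longrightarrow> fps_X ^ s \<in> carrier R"
  by simp

lemma mult_closed: "f \<in> carrier R \<Longrightarrow> g \<in> carrier R \<Longrightarrow> f * g \<in> carrier R"
  using m_closed[of f g] unfolding R_simps(2) .

lemma ideal_criterion: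
  assumes "J \<subseteq> carrier R" "0 \<in> J" "\<And>f g. f \<in> J \<Longrightarrow> g \<in> J \<Longrightarrow> f + g \<in> J"
    and "\<And>f g. f \<in> J \<Longrightarrow> g \<in> carrier R \<Longrightarrow> g * f \<in> J"
  shows "ideal J R"
  by (rule cring_idealI[OF cring_R]) (use assms in \<open>simp_all del: R_simps(1)\<close>)

text \<open>The ideal is generated algebraically, so series with infinitely many terms are not
  visibly in it. Equality follows from maximality, as the series of R without constant term form a
  proper ideal containing the generators.\<close>

lemma mm_iff: "f \<in> mm \<longleftrightarrow> f \<in> carrier R \<and> fps_nth f 0 = 0"
proof -
  let ?J = "{f \<in> carrier R. fps_nth f 0 = 0}"
  have J: "ideal ?J R"
  proof (rule ideal_criterion)
    show "f + g \<in> ?J" if "f \<in> ?J" "g \<in> ?J" for f g using that a_closed[of f g] by auto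
    show "g * f \<in> ?J" if "f \<in> ?J" "g \<in> carrier R" for f g using that mult_closed[of g f] by auto
  qed auto
  have "mm \<subseteq> ?J"
    unfolding mm semigroup_max_ideal_def R[symmetric]
    by (rule genideal_minimal[OF J]) (auto split: if_splits)
  moreover have "?J \<noteq> carrier R" using one_closed by force
  ultimately have "?J = mm" using mm.I_maximal[OF J] by blast
  then show ?thesis by blast
qed

lemma X_power_mm: "s \<in> S \<Longrightarrow> s \<noteq> 0 \<Longrightarrow> fps_X ^ s \<in> mm"
  by (auto simp: mm_iff)

text \<open>The quotient of \<open>R\<close> by \<open>t^q\<close> has the monomials with exponents in \<open>Ap S q\<close> as a basis.\<close>

lemma Ap_expansion:
  assumes q: "q \<in> S" and f: "f \<in> carrier R"
  obtains g where "g \<in> carrier R" "f = (\<Sum>s\<in>Ap S q. fps_const (fps_nth f s) * fps_X ^ s) + fps_X ^ q * g"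
    "\<And>n. fps_nth g n \<noteq> 0 \<Longrightarrow> n \<in> S \<and> fps_nth f (n + q) \<noteq> 0"
proof
  define g where "g = Abs_fps (\<lambda>n. if n \<in> S then fps_nth f (n + q) else 0)"
  show "g \<in> carrier R" "\<And>n. fps_nth g n \<noteq> 0 \<Longrightarrow> n \<in> S \<and> fps_nth f (n + q) \<noteq> 0"
    by (auto simp: g_def split: if_splits)
  show "f = (\<Sum>s\<in>Ap S q. fps_const (fps_nth f s) * fps_X ^ s) + fps_X ^ q * g"
  proof (rule fps_ext)
    fix n
    have "fps_nth (\<Sum>s\<in>Ap S q. fps_const (fps_nth f s) * fps_X ^ s) n =
        (\<Sum>s\<in>Ap S q. if n = s then fps_nth f s else 0)"
      by (simp add: fps_sum_nth if_distrib cong: if_cong)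
    also have "\<dots> = (if n \<in> Ap S q then fps_nth f n else 0)" using finite_Ap by simp
    finally have "fps_nth (\<Sum>s\<in>Ap S q. fps_const (fps_nth f s) * fps_X ^ s) n = \<dots>" .
    note lhs1 = this
    have lhs2: "fps_nth (fps_X ^ q * g) n = (if n < q then 0 else fps_nth g (n - q))"
      by (simp add: fps_X_power_mult_nth)
    consider "n \<in> Ap S q" | u where "u \<in> S" "n = u + q" | "n \<notin> S" using Ap_cases by blast
    then show "fps_nth f n = fps_nth ((\<Sum>s\<in>Ap S q. fps_const (fps_nth f s) * fps_X ^ s) + fps_X ^ q * g) n"
    proof cases
      case 1
      then have "n - q \<notin> S" if "\<not> n < q" using that by (auto simp: Ap_def)
      then show ?thesis unfolding fps_add_nth lhs1 lhs2 using 1 by (auto simp: g_def)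
    next
      case (2 u)
      then have "n \<notin> Ap S q" by (auto simp: Ap_def)
      then show ?thesis unfolding fps_add_nth lhs1 lhs2 using 2 by (auto simp: g_def)
    next
      case 3
      then have "n \<notin> Ap S q" "fps_nth f n = 0" using f by (auto simp: Ap_def)
      moreover have "n - q \<notin> S" if "\<not> n < q"
      proof
        assume "n - q \<in> S"
        then have "n - q + q \<in> S" using q add_in by blast
        then show False using that 3 by simp
      qed
      ultimately show ?thesis unfolding fps_add_nth lhs1 lhs2 by (auto simp: g_def)
    qed
  qed
qed

sublocale powers: filtered R mm "self_module R"
  by (rule filtered_self[OF cring_R mm.is_ideal])

abbreviation Pw where "Pw i \<equiv> ideal_power_module (self_module R) mm i"

lemma X_power_Pw: "s \<in> lM i \<Longrightarrow> fps_X ^ s \<in> Pw i"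
proof (induction i arbitrary: s)
  case 0 then show ?case by simp
next
  case (Suc i)
  then obtain a b where ab: "s = a + b" "a \<in> lM i" "b \<in> S - {0}" by auto
  then have "fps_X ^ b \<odot>\<^bsub>self_module R\<^esub> fps_X ^ a \<in> Pw (Suc i)"
    using powers.L_Suc X_power_mm Suc.IH by blast
  then show ?case using ab(1) by (simp add: power_add mult.commute)
qed

lemma Pw_mult: "f \<in> Pw i \<Longrightarrow> g \<in> Pw j \<Longrightarrow> f * g \<in> Pw (i + j)"
  using powers.J_L[of f i g j] by simp

lemma Pw_mult_R: "f \<in> carrier R \<Longrightarrow> g \<in> Pw i \<Longrightarrow> f * g \<in> Pw i"
  using Pw_mult[of f 0 g i] by simp

lemma Pw_add: "f \<in> Pw i \<Longrightarrow> g \<in> Pw i \<Longrightarrow> f + g \<in> Pw i"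
  using powers.M.submoduleE(5)[OF powers.L_submodule] by simp

lemma Pw_zero: "0 \<in> Pw i"
  using submodule_zero[OF powers.L_submodule] by simp

lemma Pw_sum: "finite A \<Longrightarrow> (\<And>a. a \<in> A \<Longrightarrow> f a \<in> Pw i) \<Longrightarrow> sum f A \<in> Pw i"
  by (induction A rule: finite_induct) (auto intro: Pw_add Pw_zero)

text \<open>For the direction from exponents to membership, infinitely many terms have to be
  gathered into finitely many products: apart from a multiple of the monomial with exponent
  \<open>i * mu\<close>, itself in the i-th power, only exponents in a finite Apery set
  remain.\<close>

lemma Pw_iff: "f \<in> Pw i \<longleftrightarrow> (\<forall>n. fps_nth f n \<noteq> 0 \<longrightarrow> n \<in> lM i)"
proof
  have "Pw i \<subseteq> {f \<in> carrier R. \<forall>n. fps_nth f n \<noteq> 0 \<longrightarrow> n \<in> lM i}" (is "_ \<subseteq> ?N i")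
  proof (induction i)
    case 0 then show ?case by auto
  next
    case (Suc i)
    have N: "f \<in> ?N j \<longleftrightarrow> (\<forall>n. fps_nth f n \<noteq> 0 \<longrightarrow> n \<in> lM j)" for f j using lM_subset by auto
    show ?case
    proof (rule powers.L_least)
      show "submodule (?N (Suc i)) R (self_module R)"
        unfolding submodule_self_module_iff[OF cring_R]
      proof (rule ideal_criterion)
        show "f + g \<in> ?N (Suc i)" if "f \<in> ?N (Suc i)" "g \<in> ?N (Suc i)" for f g
          using that unfolding N by (metis add.right_neutral fps_add_nth)
        have *: "f * g \<in> ?N (Suc i)" if "f \<in> ?N (Suc i)" "g \<in> carrier R" for f g
          unfolding N
        proof (intro allI impI)
          fix n assume "fps_nth (f * g) n \<noteq> 0"
          then obtain a b where ab: "n = a + b" "fps_nth f a \<noteq> 0" "fps_nth g b \<noteq> 0" by (rule nonzero_mult_nth)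
          then have "a \<in> lM (Suc i)" "b \<in> S" using that unfolding N by auto
          then show "n \<in> lM (Suc i)" using ab(1) lM_add_S by blast
        qed
        show "g * f \<in> ?N (Suc i)" if "f \<in> ?N (Suc i)" "g \<in> carrier R" for f g
          unfolding mult.commute[of g f] by (rule *[OF that])
      qed auto
      fix f g assume f: "f \<in> mm" and g: "g \<in> Pw i"
      have "f * g \<in> ?N (Suc i)"
        unfolding N
      proof (intro allI impI)
        fix n assume "fps_nth (f * g) n \<noteq> 0"
        then obtain a b where ab: "n = a + b" "fps_nth f a \<noteq> 0" "fps_nth g b \<noteq> 0" by (rule nonzero_mult_nth)
        then have "a \<in> S - {0}" using f by (auto simp: mm_iff intro: gr0I)
        moreover have "b \<in> lM i" using g ab(3) Suc by blast
        ultimately show "n \<in> lM (Suc i)" using lM_SucI[of b i a] ab(1) by (simp only: add.commute)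
      qed
      then show "f \<odot>\<^bsub>self_module R\<^esub> g \<in> ?N (Suc i)" by simp
    qed
  qed
  then show "\<forall>n. fps_nth f n \<noteq> 0 \<longrightarrow> n \<in> lM i" if "f \<in> Pw i" using that by blast
next
  assume f: "\<forall>n. fps_nth f n \<noteq> 0 \<longrightarrow> n \<in> lM i"
  then have fR: "f \<in> carrier R" using lM_subset by auto
  have q: "i * mu \<in> S" by (rule mu_multiple)
  obtain g where g: "g \<in> carrier R"
    "f = (\<Sum>s\<in>Ap S (i * mu). fps_const (fps_nth f s) * fps_X ^ s) + fps_X ^ (i * mu) * g"
    using Ap_expansion[OF q fR] by blast
  have "fps_const (fps_nth f s) * fps_X ^ s \<in> Pw i" for s
  proof (cases "fps_nth f s = 0")
    case False
    then show ?thesis using f X_power_Pw Pw_mult_R[OF const_closed] by blast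
  qed (simp add: Pw_zero)
  moreover have "g * fps_X ^ (i * mu) \<in> Pw i" by (rule Pw_mult_R[OF g(1) X_power_Pw[OF mult_mu_lM]])
  ultimately show "f \<in> Pw i" using g(2) Pw_add Pw_sum[OF finite_Ap] by (metis (no_types, lifting) mult.commute)
qed

text \<open>All exponents from a bound c on lie in S. If the order of g is at least
  \<open>subdegree f + c\<close>, the quotient of g by f has order at least c and therefore lies in
  R.\<close>

lemma multiple_of_high_order:
  assumes "f \<in> carrier R" "f \<noteq> 0"
  obtains N where "\<And>g :: 'k fps. (\<And>n. n < N \<Longrightarrow> fps_nth g n = 0) \<Longrightarrow> \<exists>h\<in>carrier R. g = f * h"
proof -
  obtain c where c: "\<And>n. n \<ge> c \<Longrightarrow> n \<in> S" using conductor by blast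
  show ?thesis
  proof (rule that[of "subdegree f + c"])
    fix g :: "'k fps" assume g: "\<And>n. n < subdegree f + c \<Longrightarrow> fps_nth g n = 0"
    show "\<exists>h\<in>carrier R. g = f * h"
    proof (cases "g = 0")
      case True
      then show ?thesis by (intro bexI[of _ 0]) auto
    next
      case False
      have sd: "subdegree f + c \<le> subdegree g" using g False by (intro subdegree_geI) auto
      then have "f dvd g" using assms(2) by (simp add: fps_dvd_iff False)
      then obtain h where h: "g = f * h" by auto
      then have "subdegree g = subdegree f + subdegree h" using False by (auto intro!: subdegree_mult)
      then have "c \<le> subdegree h" using sd by simp
      then have "h \<in> carrier R" using c by (auto dest: subdegree_leI order_trans)
      then show ?thesis using h by blast
    qed
  qed
qed

text \<open>R is a domain, so the zero ideal is prime. A nonzero prime contains some nonzero f, and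
  high powers of elements of \<open>mm\<close> are multiples of f, so it contains
  \<open>mm\<close>.\<close>

lemma height_mm: "height R mm = enat 1"
proof -
  interpret dom: domain R
    by (rule domain.intro[OF cring_R]) (unfold_locales, auto)
  have nz: "mm \<noteq> {0}" using X_power_mm[OF mu(1)] mu(2) by auto
  have prime0: "primeideal {0} R" using dom.zeroprimeideal by simp
  have primem: "primeideal mm R" by (rule maximalideal_prime[OF max])
  have only: "P = {0}" if P: "primeideal P R" "P \<subset> mm" for P
  proof (rule ccontr)
    interpret P: primeideal P R by (rule P)
    assume "P \<noteq> {0}"
    moreover have "0 \<in> P" using P.zero_closed by simp
    ultimately obtain f where f: "f \<in> P" "f \<noteq> 0" by blast
    have fR: "f \<in> carrier R" using P.a_Hcarr[OF f(1)] .
    obtain N where N: "\<And>g :: 'k fps. (\<And>n. n < N \<Longrightarrow> fps_nth g n = 0) \<Longrightarrow> \<exists>h\<in>carrier R. g = f * h"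
      using multiple_of_high_order[OF fR f(2)] by blast
    have pow: "g ^ k \<in> carrier R \<and> (g ^ k \<in> P \<longrightarrow> g \<in> P)" if g: "g \<in> carrier R" for g k
    proof (induction k)
      case 0
      have "1 \<notin> P" using P.one_imp_carrier P.I_notcarr by auto
      then show ?case using one_closed by simp
    next
      case (Suc k)
      have "g * g ^ k \<in> carrier R" using mult_closed[OF g] Suc by blast
      moreover have "g \<in> P" if "g * g ^ k \<in> P"
        using P.I_prime[of g "g ^ k"] that Suc g by auto
      ultimately show ?case by simp
    qed
    have "mm \<subseteq> P"
    proof
      fix g assume g: "g \<in> mm"
      have "fps_nth (g ^ N) n = 0" if "n < N" for n
        using that g by (intro startsby_zero_power_prefix[rule_format]) (auto simp: mm_iff)
      then obtain h where h: "h \<in> carrier R" "g ^ N = f * h" using N by blast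
      then have "g ^ N \<in> P" using P.I_r_closed[OF f(1) h(1)] by simp
      then show "g \<in> P" using pow[of g N] g mm_iff by blast
    qed
    then show False using P(2) by blast
  qed
  show ?thesis
    by (rule height_eq_one[OF prime0 primem _ only]) (use nz mm.zero_closed in auto)
qed

end

section \<open>Functionals that dualize a module modulo a monomial\<close>

definition k_functional :: "('k::field fps, 'b) module \<Rightarrow> ('b \<Rightarrow> 'k) \<Rightarrow> bool" where
  "k_functional M \<tau> \<longleftrightarrow>
     (\<forall>x\<in>carrier M. \<forall>y\<in>carrier M. \<tau> (x \<oplus>\<^sub>M y) = \<tau> x + \<tau> y) \<and>
     (\<forall>c. \<forall>y\<in>carrier M. \<tau> (fps_const c \<odot>\<^sub>M y) = c * \<tau> y)"

text \<open>A functional on \<open>M\<close> modulo \<open>t^q M\<close> which makes it dual to \<open>R\<close> modulo \<open>t^q R\<close>.\<close>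

definition dualizing :: "nat set \<Rightarrow> ('k::field fps, 'b) module \<Rightarrow> nat \<Rightarrow> ('b \<Rightarrow> 'k) \<Rightarrow> bool" where
  "dualizing S M q \<tau> \<longleftrightarrow> k_functional M \<tau> \<and> (\<forall>y\<in>carrier M. \<tau> (fps_X ^ q \<odot>\<^sub>M y) = 0) \<and>
     (\<forall>y\<in>carrier M. (\<forall>s\<in>Ap S q. \<tau> (fps_X ^ s \<odot>\<^sub>M y) = 0) \<longrightarrow> (\<exists>z\<in>carrier M. y = fps_X ^ q \<odot>\<^sub>M z)) \<and>
     (\<forall>c. \<exists>y\<in>carrier M. \<forall>s\<in>Ap S q. \<tau> (fps_X ^ s \<odot>\<^sub>M y) = c s)"

context sg_ring begin

lemma finsum_R: "finite A \<Longrightarrow> (\<And>a. a \<in> A \<Longrightarrow> f a \<in> carrier R) \<Longrightarrow> finsum R f A = sum f A"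
  by (induction A rule: finite_induct) (auto simp: Pi_def simp del: R_simps(1))

lemma k_functional_zero:
  assumes "module R M" "k_functional M \<tau>"
  shows "\<tau> \<zero>\<^sub>M = 0"
proof -
  interpret M: module R M by fact
  have "fps_const 0 \<odot>\<^sub>M \<zero>\<^sub>M = \<zero>\<^sub>M" using M.smult_r_null[OF const_closed[of 0]] .
  then show ?thesis using assms(2) M.M.zero_closed unfolding k_functional_def by (metis mult_zero_left)
qed

lemma k_functional_sum:
  assumes "module R M" "k_functional M \<tau>" "finite A" "\<And>s. s \<in> A \<Longrightarrow> g s \<in> carrier R" "y \<in> carrier M"
  shows "\<tau> ((\<Sum>s\<in>A. g s) \<odot>\<^sub>M y) = (\<Sum>s\<in>A. \<tau> (g s \<odot>\<^sub>M y))"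
proof -
  interpret M: module R M by fact
  show ?thesis using assms(3,4)
  proof (induction A rule: finite_induct)
    case empty
    then show ?case using k_functional_zero[OF assms(1,2)] M.smult_l_null[OF assms(5)] by simp
  next
    case (insert a A)
    have s: "(\<Sum>s\<in>A. g s) \<in> carrier R" using finsum_R[OF insert(1), of g] insert(4) finsum_closed[of g A] by (metis Pi_I insertCI)
    have "(g a \<oplus>\<^sub>R (\<Sum>s\<in>A. g s)) \<odot>\<^sub>M y = g a \<odot>\<^sub>M y \<oplus>\<^sub>M (\<Sum>s\<in>A. g s) \<odot>\<^sub>M y"
      by (rule M.smult_l_distr) (use insert s assms(5) in blast)+
    then have "\<tau> ((g a + (\<Sum>s\<in>A. g s)) \<odot>\<^sub>M y) = \<tau> (g a \<odot>\<^sub>M y) + \<tau> ((\<Sum>s\<in>A. g s) \<odot>\<^sub>M y)"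
      using assms(2,5) M.smult_closed[OF s assms(5)] M.smult_closed[OF insert(4)[of a] assms(5)]
      unfolding k_functional_def R_simps(3) by simp
    moreover have "\<tau> ((\<Sum>s\<in>A. g s) \<odot>\<^sub>M y) = (\<Sum>s\<in>A. \<tau> (g s \<odot>\<^sub>M y))"
      by (rule insert.IH) (use insert(4) in blast)
    ultimately show ?case using insert(1,2) by simp
  qed
qed

text \<open>The functional kills t^q M, so only the finitely many terms of f with exponents in the
  Apery set of q contribute.\<close>

lemma k_functional_expansion:
  assumes M: "module R M" and t: "k_functional M \<tau>" and q: "q \<in> S"
    and tq: "\<And>y. y \<in> carrier M \<Longrightarrow> \<tau> (fps_X ^ q \<odot>\<^sub>M y) = 0" and f: "f \<in> carrier R" and y: "y \<in> carrier M"
  shows "\<tau> (f \<odot>\<^sub>M y) = (\<Sum>s\<in>Ap S q. fps_nth f s * \<tau> (fps_X ^ s \<odot>\<^sub>M y))"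
proof -
  interpret M: module R M by fact
  obtain g where g: "g \<in> carrier R" "f = (\<Sum>s\<in>Ap S q. fps_const (fps_nth f s) * fps_X ^ s) + fps_X ^ q * g"
    using Ap_expansion[OF q f] by blast
  let ?P = "\<Sum>s\<in>Ap S q. fps_const (fps_nth f s) * fps_X ^ s"
  have t1: "fps_const (fps_nth f s) * fps_X ^ s \<in> carrier R" if "s \<in> Ap S q" for s
    by (rule mult_closed[OF const_closed X_power_closed[OF Ap_S[OF that]]])
  have P: "?P \<in> carrier R"
    using finsum_R[OF finite_Ap, of q "\<lambda>s. fps_const (fps_nth f s) * fps_X ^ s"] t1
      finsum_closed[of "\<lambda>s. fps_const (fps_nth f s) * fps_X ^ s" "Ap S q"] by (metis (no_types, lifting) Pi_I)
  have qg: "fps_X ^ q * g \<in> carrier R" by (rule mult_closed[OF X_power_closed[OF q] g(1)])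
  have "(?P \<oplus>\<^sub>R fps_X ^ q * g) \<odot>\<^sub>M y = ?P \<odot>\<^sub>M y \<oplus>\<^sub>M (fps_X ^ q * g) \<odot>\<^sub>M y"
    by (rule M.smult_l_distr[OF P qg y])
  moreover have "(fps_X ^ q * g) \<odot>\<^sub>M y = fps_X ^ q \<odot>\<^sub>M (g \<odot>\<^sub>M y)"
    using M.smult_assoc1[OF X_power_closed[OF q] g(1) y] by simp
  ultimately have "f \<odot>\<^sub>M y = ?P \<odot>\<^sub>M y \<oplus>\<^sub>M fps_X ^ q \<odot>\<^sub>M (g \<odot>\<^sub>M y)"
    using g(2) by (metis R_simps(3))
  then have "\<tau> (f \<odot>\<^sub>M y) = \<tau> (?P \<odot>\<^sub>M y) + \<tau> (fps_X ^ q \<odot>\<^sub>M (g \<odot>\<^sub>M y))"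
    using t M.smult_closed[OF P y] M.smult_closed[OF X_power_closed[OF q] M.smult_closed[OF g(1) y]]
    unfolding k_functional_def by simp
  also have "\<dots> = (\<Sum>s\<in>Ap S q. \<tau> ((fps_const (fps_nth f s) * fps_X ^ s) \<odot>\<^sub>M y))"
    using tq[OF M.smult_closed[OF g(1) y]] k_functional_sum[OF M t finite_Ap t1 y] by simp
  also have "\<dots> = (\<Sum>s\<in>Ap S q. fps_nth f s * \<tau> (fps_X ^ s \<odot>\<^sub>M y))"
  proof (rule sum.cong[OF refl])
    fix s assume s: "s \<in> Ap S q"
    note Xs = X_power_closed[OF Ap_S[OF s]]
    have "(fps_const (fps_nth f s) * fps_X ^ s) \<odot>\<^sub>M y = fps_const (fps_nth f s) \<odot>\<^sub>M (fps_X ^ s \<odot>\<^sub>M y)"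
      using M.smult_assoc1[OF const_closed Xs y] by simp
    then show "\<tau> ((fps_const (fps_nth f s) * fps_X ^ s) \<odot>\<^sub>M y) = fps_nth f s * \<tau> (fps_X ^ s \<odot>\<^sub>M y)"
      using t M.smult_closed[OF Xs y] unfolding k_functional_def by simp
  qed
  finally show ?thesis .
qed

end

text \<open>The hypotheses are what Ext in degrees one and two yields for \<omega>/t^q\<omega>. In
  effect X is an injective hull of the residue field over R/t^qR, and its dual basis is constructed
  by hand.\<close>

locale dual_basis = sg_ring S R mm for S and R :: "'k::field fps ring" and mm +
  fixes q :: nat and X :: "('k fps, 'c) module" and \<sigma> :: 'c
  assumes q: "q \<in> S" "q \<noteq> 0" and X: "module R X"
    and q_X: "y \<in> carrier X \<Longrightarrow> fps_X ^ q \<odot>\<^sub>X y = \<zero>\<^sub>X"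
    and \<sigma>: "\<sigma> \<in> carrier X" "\<sigma> \<noteq> \<zero>\<^sub>X" "a \<in> mm \<Longrightarrow> a \<odot>\<^sub>X \<sigma> = \<zero>\<^sub>X"
    and socle: "y \<in> carrier X \<Longrightarrow> (\<And>a. a \<in> mm \<Longrightarrow> a \<odot>\<^sub>X y = \<zero>\<^sub>X) \<Longrightarrow> \<exists>a\<in>carrier R. y = a \<odot>\<^sub>X \<sigma>"
    and injective: "linear_on R (self_module R) X mm \<psi> \<Longrightarrow> \<psi> (fps_X ^ q) = \<zero>\<^sub>X \<Longrightarrow>
      \<exists>y\<in>carrier X. \<forall>a\<in>mm. \<psi> a = a \<odot>\<^sub>X y"
begin

sublocale X: plain_module R X by (rule plain_moduleI[OF X])

text \<open>The coefficients of a series as constants of R, so that the action of r on a family e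
  becomes a convolution, the sum over i of r_i e_(j-i).\<close>

definition K :: "'k fps \<Rightarrow> nat \<Rightarrow> 'k fps" where "K r i = fps_const (fps_nth r i)"

lemma K_closed: "K r i \<in> carrier R" unfolding K_def by (rule const_closed)

lemma K_zero: "fps_nth r i = 0 \<Longrightarrow> y \<in> carrier X \<Longrightarrow> K r i \<odot>\<^sub>X y = \<zero>\<^sub>X"
  using X.smult_l_null[of y] by (simp add: K_def)

lemma K_mult: "K (f * g) = conv (self_module R) (K f) (K g)"
proof
  fix n
  have "conv (self_module R) (K f) (K g) n = (\<Sum>i\<in>{..n}. K f i * K g (n - i))"
    unfolding conv_def finsum_self_module self_module_simps R_simps(2)
    by (rule finsum_R) (auto intro!: mult_closed K_closed simp del: R_simps(1))
  also have "\<dots> = fps_const (\<Sum>i\<in>{..n}. fps_nth f i * fps_nth g (n - i))"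
    by (simp add: K_def fps_eq_iff fps_sum_nth)
  also have "\<dots> = K (f * g) n" by (simp add: K_def fps_mult_nth atLeast0AtMost)
  finally show "K (f * g) n = conv (self_module R) (K f) (K g) n" ..
qed

text \<open>A dual basis below the exponent N: e_j behaves like t^(-j), with r e_j equal to the sum
  of the r_i e_(j-i), and e_j = 0 off the Apery set.\<close>

definition good :: "nat \<Rightarrow> (nat \<Rightarrow> 'c) \<Rightarrow> bool" where
  "good N e \<longleftrightarrow> (\<forall>j. e j \<in> carrier X) \<and> (\<forall>j. j \<notin> Ap S q \<or> N \<le> j \<longrightarrow> e j = \<zero>\<^sub>X) \<and>
     (\<forall>j\<in>Ap S q. j < N \<longrightarrow> (\<forall>r\<in>carrier R. r \<odot>\<^sub>X e j = conv X (K r) e j)) \<and> (0 < N \<longrightarrow> e 0 = \<sigma>)"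

lemma conv_zero:
  assumes "\<And>i. e i \<in> carrier X" "\<And>i. i \<le> n \<Longrightarrow> fps_nth r i \<noteq> 0 \<Longrightarrow> e (n - i) = \<zero>\<^sub>X"
  shows "conv X (K r) e n = \<zero>\<^sub>X"
proof -
  have "K r i \<odot>\<^sub>X e (n - i) = \<zero>\<^sub>X" if "i \<le> n" for i
    using K_zero[OF _ assms(1)] assms(2)[OF that] X.smult_r_null[OF K_closed] by metis
  then have "conv X (K r) e n = (\<Oplus>\<^sub>X i\<in>{..n}. \<zero>\<^sub>X)"
    unfolding conv_def by (intro X.M.finsum_cong') auto
  then show ?thesis by simp
qed

lemma conv_const: 
  assumes "\<And>i. e i \<in> carrier X"
  shows "conv X (K (fps_const c)) e n = fps_const c \<odot>\<^sub>X e n"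
proof -
  have "conv X (K (fps_const c)) e n = (if 0 \<le> n then K (fps_const c) 0 \<odot>\<^sub>X e (n - 0) else \<zero>\<^sub>X)"
    by (rule X.conv_single) (use assms zero_in in \<open>auto simp: K_def\<close>)
  then show ?thesis by (simp add: K_def)
qed

lemma K_add: "K (f + g) i = K f i \<oplus>\<^sub>R K g i"
  by (simp add: K_def)

text \<open>The map \<psi> is the action that \<open>mm\<close> must have on the new vector e_N; it
  involves only earlier vectors, since series in \<open>mm\<close> have no constant term. It is
  linear by associativity of the convolution and kills t^q, so injectivity of X realizes it by an
  element.\<close>

lemma good_step:
  assumes e: "good N e" and N: "N \<in> Ap S q" "0 < N"
  shows "\<exists>e'. good (Suc N) e'"
proof -
  have ec: "e j \<in> carrier X" and e0: "j \<notin> Ap S q \<or> N \<le> j \<Longrightarrow> e j = \<zero>\<^sub>X" for j using e by (auto simp: good_def)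
  have ecv: "r \<odot>\<^sub>X e j = conv X (K r) e j" if "j \<in> Ap S q" "j < N" "r \<in> carrier R" for j r
    using e that by (auto simp: good_def)
  define \<psi> where "\<psi> f = conv X (K f) e N" for f
  have psi_c: "\<psi> f \<in> carrier X" for f unfolding \<psi>_def by (rule X.conv_closed[OF K_closed ec])
  have psi: "linear_on R (self_module R) X mm \<psi>"
  proof (rule linear_onI)
    show "\<psi> f \<in> carrier X" for f by (rule psi_c)
    show "\<psi> (f \<oplus>\<^bsub>self_module R\<^esub> g) = \<psi> f \<oplus>\<^sub>X \<psi> g" for f g
    proof -
      have "\<psi> (f + g) = conv X (\<lambda>i. K f i \<oplus>\<^sub>R K g i) e N" unfolding \<psi>_def by (simp only: K_add[abs_def])
      also have "\<dots> = \<psi> f \<oplus>\<^sub>X \<psi> g" unfolding \<psi>_def by (rule X.conv_add_left[OF K_closed K_closed ec])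
      finally show ?thesis by simp
    qed
    fix r f assume r: "r \<in> carrier R" and f: "f \<in> mm"
    have f0: "fps_nth f 0 = 0" and fR: "f \<in> carrier R" using f by (auto simp: mm_iff)
    have "\<psi> (f * r) = conv X (K f) (conv X (K r) e) N"
      unfolding \<psi>_def K_mult by (rule X.conv_assoc[OF K_closed K_closed ec])
    also have "\<dots> = conv X (K f) (\<lambda>i. r \<odot>\<^sub>X e i) N"
    proof (rule X.conv_cong)
      show "K f i \<odot>\<^sub>X (r \<odot>\<^sub>X e (N - i)) \<in> carrier X" for i
        by (intro X.smult_closed K_closed r ec)
      fix i assume i: "i \<le> N"
      show "K f i \<odot>\<^sub>X conv X (K r) e (N - i) = K f i \<odot>\<^sub>X (r \<odot>\<^sub>X e (N - i))"
      proof (cases "fps_nth f i = 0")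
        case True
        then show ?thesis using K_zero X.conv_closed[OF K_closed ec] X.smult_closed[OF r ec] by simp
      next
        case False
        then have iS: "i \<in> S" and i0: "0 < i" using fR f0 by (auto intro: gr0I)
        show ?thesis
        proof (cases "N - i \<in> Ap S q")
          case True
          then show ?thesis using ecv[OF True _ r] i0 N(2) by simp
        next
          case False
          \<comment> \<open>As N is in the Apery set and i in S, membership of N - i in S would put
            it into the Apery set. Hence no N - i - v with v in S lies in the Apery set either, and
            both sides vanish.\<close>
          have nS: "N - i \<notin> S" using Ap_divisor[of "N - i" i q] N(1) i iS False by auto
          have "e (N - i - v) = \<zero>\<^sub>X" if v: "v \<le> N - i" "fps_nth r v \<noteq> 0" for v
          proof (rule e0, rule disjI1)
            show "N - i - v \<notin> Ap S q"
            proof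
              assume "N - i - v \<in> Ap S q"
              then have "N - i - v + v \<in> S" using Ap_S add_in r v(2) by auto
              moreover have "N - i - v + v = N - i" using v(1) by simp
              ultimately show False using nS by (simp only:)
            qed
          qed
          then have "conv X (K r) e (N - i) = \<zero>\<^sub>X" by (rule conv_zero[OF ec])
          moreover have "e (N - i) = \<zero>\<^sub>X" using e0 False by blast
          ultimately show ?thesis using X.smult_r_null[OF r] by simp
        qed
      qed
    qed
    also have "\<dots> = r \<odot>\<^sub>X \<psi> f" unfolding \<psi>_def by (rule X.conv_smult[OF r K_closed ec])
    finally show "\<psi> (r \<odot>\<^bsub>self_module R\<^esub> f) = r \<odot>\<^sub>X \<psi> f" by (simp add: mult.commute)
  qed
  have "\<psi> (fps_X ^ q) = \<zero>\<^sub>X"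
    unfolding \<psi>_def
  proof (rule conv_zero[OF ec])
    fix i assume i: "i \<le> N" "fps_nth (fps_X ^ q :: 'k fps) i \<noteq> 0"
    then have "i = q" by (simp split: if_splits)
    then have "N - i \<notin> S" using N(1) i(1) by (auto simp: Ap_def)
    then show "e (N - i) = \<zero>\<^sub>X" using e0 Ap_S by blast
  qed
  then obtain y where y: "y \<in> carrier X" "\<forall>a\<in>mm. \<psi> a = a \<odot>\<^sub>X y" using injective[OF psi] by blast
  define e' where "e' = e(N := y)"
  have e'c: "e' j \<in> carrier X" for j using ec y(1) by (simp add: e'_def)
  have conv_small: "conv X (K r) e' j = conv X (K r) e j" if "j < N" for r j
    by (rule X.conv_cong) (use that X.smult_closed[OF K_closed ec] in \<open>auto simp: e'_def\<close>)
  have "r \<odot>\<^sub>X e' j = conv X (K r) e' j" if j: "j \<in> Ap S q" "j < Suc N" and r: "r \<in> carrier R" for j r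
  proof (cases "j < N")
    case True
    then show ?thesis using ecv[OF j(1) True r] conv_small[OF True] by (simp add: e'_def)
  next
    case False
    then have jN: "j = N" using j(2) by simp
    \<comment> \<open>The constant term acts on e_N directly; the rest of r lies in
      \<open>mm\<close>, where y realizes \<psi>.\<close>
    define c where "c = fps_nth r 0"
    define r' where "r' = r - fps_const c"
    have rr: "r = fps_const c + r'" by (simp add: r'_def)
    have r': "r' \<in> mm" unfolding mm_iff using r zero_in by (auto simp: r'_def c_def split: if_splits)
    have r'R: "r' \<in> carrier R" using r' mm_iff by blast
    have "conv X (K r) e' N = conv X (\<lambda>i. K (fps_const c) i \<oplus>\<^sub>R K r' i) e' N"
      by (subst rr) (simp only: K_add[abs_def])
    also have "\<dots> = conv X (K (fps_const c)) e' N \<oplus>\<^sub>X conv X (K r') e' N"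
      by (rule X.conv_add_left[OF K_closed K_closed e'c])
    also have "conv X (K (fps_const c)) e' N = fps_const c \<odot>\<^sub>X y"
      using conv_const[of e' c N, OF e'c] by (simp add: e'_def)
    also have "conv X (K r') e' N = conv X (K r') e N"
    proof (rule X.conv_cong)
      fix i assume "i \<le> N"
      show "K r' i \<odot>\<^sub>X e' (N - i) = K r' i \<odot>\<^sub>X e (N - i)"
      proof (cases "i = 0")
        case True
        have "fps_nth r' 0 = 0" using r' mm_iff by blast
        then show ?thesis using K_zero[of r' 0] True e'c ec by simp
      next
        case False
        then have "N - i \<noteq> N" using N(2) by simp
        then show ?thesis by (simp add: e'_def)
      qed
    qed (rule X.smult_closed[OF K_closed ec])
    also have "\<dots> = r' \<odot>\<^sub>X y" using y(2) r' by (simp add: \<psi>_def)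
    also have "fps_const c \<odot>\<^sub>X y \<oplus>\<^sub>X r' \<odot>\<^sub>X y = r \<odot>\<^sub>X y"
      using X.smult_l_distr[OF const_closed r'R y(1), of c] rr by simp
    finally have "conv X (K r) e' N = r \<odot>\<^sub>X y" .
    moreover have "e' j = y" using jN by (simp add: e'_def)
    ultimately show ?thesis unfolding jN[symmetric] by (simp only:)
  qed
  moreover have "e' 0 = \<sigma>" using N(2) e by (simp add: e'_def good_def)
  ultimately have "good (Suc N) e'" unfolding good_def using e'c e0 N(1) by (auto simp: e'_def)
  then show ?thesis by blast
qed

lemma good_exists: "\<exists>e. good N e"
proof (induction N)
  case 0
  show ?case by (rule exI[of _ "\<lambda>_. \<zero>\<^sub>X"]) (simp add: good_def)
next
  case (Suc N)
  then obtain e where e: "good N e" by blast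
  consider "N = 0" | "0 < N" "N \<in> Ap S q" | "0 < N" "N \<notin> Ap S q" by blast
  then show ?case
  proof cases
    case 1
    define e' where "e' = (\<lambda>_. \<zero>\<^sub>X)((0::nat) := \<sigma>)"
    have e'c: "e' j \<in> carrier X" for j using \<sigma>(1) by (simp add: e'_def)
    have "r \<odot>\<^sub>X e' 0 = conv X (K r) e' 0" if r: "r \<in> carrier R" for r
    proof -
      define r' where "r' = r - fps_const (fps_nth r 0)"
      have r': "r' \<in> mm" unfolding mm_iff using r zero_in by (auto simp: r'_def split: if_splits)
      have "(fps_const (fps_nth r 0) \<oplus>\<^sub>R r') \<odot>\<^sub>X \<sigma> = fps_const (fps_nth r 0) \<odot>\<^sub>X \<sigma> \<oplus>\<^sub>X r' \<odot>\<^sub>X \<sigma>"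
        by (rule X.smult_l_distr[OF const_closed _ \<sigma>(1)]) (use r' mm_iff in blast)
      then have "r \<odot>\<^sub>X \<sigma> = fps_const (fps_nth r 0) \<odot>\<^sub>X \<sigma>"
        using \<sigma>(3)[OF r'] X.smult_closed[OF const_closed \<sigma>(1)] by (simp add: r'_def)
      then show ?thesis
        using X.smult_closed[OF const_closed \<sigma>(1)] by (simp add: conv_def e'_def K_def)
    qed
    then have "good (Suc 0) e'" unfolding good_def using e'c zero_Ap[OF q(2)] by (auto simp: e'_def)
    then show ?thesis using 1 by blast
  next
    case 2
    then show ?thesis using good_step[OF e] by blast
  next
    case 3
    have "good (Suc N) e"
      using e 3 unfolding good_def by (metis Suc_leD less_antisym)
    then show ?thesis by blast
  qed
qed

text \<open>The elements \<open>e s\<close> behave like the dual basis of the monomials \<open>t^s\<close>.\<close>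

lemma dual_basis_exists:
  obtains e where "\<And>s. e s \<in> carrier X" "e 0 = \<sigma>"
    "\<And>s u. s \<in> Ap S q \<Longrightarrow> u \<in> S \<Longrightarrow> u \<le> s \<Longrightarrow> fps_X ^ u \<odot>\<^sub>X e s = e (s - u)"
    "\<And>s u. s \<in> Ap S q \<Longrightarrow> u \<in> S \<Longrightarrow> s < u \<Longrightarrow> fps_X ^ u \<odot>\<^sub>X e s = \<zero>\<^sub>X"
    "\<And>s. s \<notin> Ap S q \<Longrightarrow> e s = \<zero>\<^sub>X"
proof -
  define N where "N = Suc (Max (Ap S q))"
  have N: "s < N" if "s \<in> Ap S q" for s using Max_ge[OF finite_Ap that] by (simp add: N_def)
  obtain e where e: "good N e" using good_exists by blast
  have ec: "e j \<in> carrier X" and e0: "j \<notin> Ap S q \<Longrightarrow> e j = \<zero>\<^sub>X" for j using e by (auto simp: good_def)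
  have act: "fps_X ^ u \<odot>\<^sub>X e s = (if u \<le> s then e (s - u) else \<zero>\<^sub>X)" if s: "s \<in> Ap S q" and u: "u \<in> S" for s u
  proof -
    have "fps_X ^ u \<odot>\<^sub>X e s = conv X (K (fps_X ^ u)) e s"
      using e s N[OF s] X_power_closed[OF u] unfolding good_def by blast
    also have "\<dots> = (if u \<le> s then K (fps_X ^ u) u \<odot>\<^sub>X e (s - u) else \<zero>\<^sub>X)"
    proof (rule X.conv_single)
      show "K (fps_X ^ u) i = \<zero>\<^sub>R" if "i \<noteq> u" for i using that by (simp add: K_def)
    qed (rule K_closed ec)+
    also have "K (fps_X ^ u) u = \<one>\<^sub>R" by (simp add: K_def)
    finally show ?thesis using X.smult_one[OF ec] by simp
  qed
  show ?thesis
    by (rule that[of e]) (use ec e0 act e in \<open>auto simp: good_def N_def\<close>)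
qed

text \<open>The vectors e_s with s in the Apery set form a basis of X over the field, and \<tau>
  reads off the coefficient at e_0. As t^u moves e_s to e_(s-u), the value \<tau>(t^u y) is the
  coefficient of y at e_u.\<close>

lemma dualizing_quotient:
  obtains \<tau> where "k_functional X \<tau>"
    "\<And>y. y \<in> carrier X \<Longrightarrow> (\<And>s. s \<in> Ap S q \<Longrightarrow> \<tau> (fps_X ^ s \<odot>\<^sub>X y) = 0) \<Longrightarrow> y = \<zero>\<^sub>X"
    "\<And>c. \<exists>y\<in>carrier X. \<forall>s\<in>Ap S q. \<tau> (fps_X ^ s \<odot>\<^sub>X y) = c s"
proof -
  obtain e where ec: "\<And>s. e s \<in> carrier X" and e0: "e 0 = \<sigma>"
    and el: "\<And>s u. s \<in> Ap S q \<Longrightarrow> u \<in> S \<Longrightarrow> u \<le> s \<Longrightarrow> fps_X ^ u \<odot>\<^sub>X e s = e (s - u)"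
    and eg: "\<And>s u. s \<in> Ap S q \<Longrightarrow> u \<in> S \<Longrightarrow> s < u \<Longrightarrow> fps_X ^ u \<odot>\<^sub>X e s = \<zero>\<^sub>X"
    and en: "\<And>s. s \<notin> Ap S q \<Longrightarrow> e s = \<zero>\<^sub>X" using dual_basis_exists by blast
  have cec: "fps_const k \<odot>\<^sub>X e s \<in> carrier X" for k s by (rule X.smult_closed[OF const_closed ec])
  define Y where "Y c = (\<Oplus>\<^sub>X s\<in>Ap S q. fps_const (c s) \<odot>\<^sub>X e s)" for c :: "nat \<Rightarrow> 'k"
  have Yc: "Y c \<in> carrier X" for c unfolding Y_def by (intro X.M.finsum_closed Pi_I cec)
  have Y_add: "Y (\<lambda>s. c s + d s) = Y c \<oplus>\<^sub>X Y d" for c d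
  proof -
    have "Y (\<lambda>s. c s + d s) = (\<Oplus>\<^sub>X s\<in>Ap S q. fps_const (c s) \<odot>\<^sub>X e s \<oplus>\<^sub>X fps_const (d s) \<odot>\<^sub>X e s)"
      unfolding Y_def
    proof (rule X.M.finsum_cong'[OF refl])
      fix s
      show "fps_const (c s + d s) \<odot>\<^sub>X e s = fps_const (c s) \<odot>\<^sub>X e s \<oplus>\<^sub>X fps_const (d s) \<odot>\<^sub>X e s"
        using X.smult_l_distr[OF const_closed const_closed ec, of "c s" "d s" s] by simp
    qed (intro Pi_I X.M.a_closed cec)
    also have "\<dots> = Y c \<oplus>\<^sub>X Y d" unfolding Y_def by (rule X.M.finsum_addf) (intro Pi_I cec)+
    finally show ?thesis .
  qed
  have Y_smult: "fps_const k \<odot>\<^sub>X Y c = Y (\<lambda>s. k * c s)" for k c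
  proof -
    have "fps_const k \<odot>\<^sub>X Y c = (\<Oplus>\<^sub>X s\<in>Ap S q. fps_const k \<odot>\<^sub>X (fps_const (c s) \<odot>\<^sub>X e s))"
      unfolding Y_def by (rule X.finsum_smult_ldistr[OF finite_Ap const_closed]) (intro Pi_I cec)
    also have "\<dots> = Y (\<lambda>s. k * c s)"
      unfolding Y_def
    proof (rule X.M.finsum_cong'[OF refl])
      fix s
      show "fps_const k \<odot>\<^sub>X (fps_const (c s) \<odot>\<^sub>X e s) = fps_const (k * c s) \<odot>\<^sub>X e s"
        using X.smult_assoc1[OF const_closed const_closed ec, of k "c s" s] by simp
    qed (intro Pi_I cec)
    finally show ?thesis .
  qed
  have X_Y: "fps_X ^ u \<odot>\<^sub>X Y c = (\<Oplus>\<^sub>X s\<in>Ap S q. fps_const (c s) \<odot>\<^sub>X (fps_X ^ u \<odot>\<^sub>X e s))" if u: "u \<in> S" for u c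
  proof -
    have "fps_X ^ u \<odot>\<^sub>X Y c = (\<Oplus>\<^sub>X s\<in>Ap S q. fps_X ^ u \<odot>\<^sub>X (fps_const (c s) \<odot>\<^sub>X e s))"
      unfolding Y_def by (rule X.finsum_smult_ldistr[OF finite_Ap X_power_closed[OF u]]) (intro Pi_I cec)
    also have "\<dots> = (\<Oplus>\<^sub>X s\<in>Ap S q. fps_const (c s) \<odot>\<^sub>X (fps_X ^ u \<odot>\<^sub>X e s))"
      by (rule X.M.finsum_cong'[OF refl])
         (intro Pi_I X.smult_closed const_closed X_power_closed u ec, rule X.smult_left_commute[OF X_power_closed[OF u] const_closed ec])
    finally show ?thesis .
  qed
  have Y_single: "Y (\<lambda>s. if s = j then k else 0) = fps_const k \<odot>\<^sub>X e j" if j: "j \<in> Ap S q" for j k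
  proof -
    have "Y (\<lambda>s. if s = j then k else 0) = (\<Oplus>\<^sub>X s\<in>Ap S q. if j = s then fps_const k \<odot>\<^sub>X e s else \<zero>\<^sub>X)"
      unfolding Y_def
    proof (rule X.M.finsum_cong'[OF refl])
      show "fps_const (if s = j then k else 0) \<odot>\<^sub>X e s = (if j = s then fps_const k \<odot>\<^sub>X e s else \<zero>\<^sub>X)" for s
        using X.smult_l_null[OF ec] by simp
    qed (use cec in simp)
    also have "\<dots> = fps_const k \<odot>\<^sub>X e j"
      by (rule X.M.finsum_singleton[OF j finite_Ap]) (intro Pi_I cec)
    finally show ?thesis .
  qed
  \<comment> \<open>Multiplication by t^j, for j the largest exponent with nonzero coefficient,
    leaves only the multiple of \<sigma> coming from e_j.\<close>
  have indep: "c s = 0" if Y0: "Y c = \<zero>\<^sub>X" and s: "s \<in> Ap S q" for c s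
  proof (rule ccontr)
    assume "c s \<noteq> 0"
    define T where "T = {s \<in> Ap S q. c s \<noteq> 0}"
    have T: "finite T" "T \<noteq> {}" using finite_Ap s \<open>c s \<noteq> 0\<close> by (auto simp: T_def)
    define j where "j = Max T"
    have j: "j \<in> Ap S q" "c j \<noteq> 0" using Max_in[OF T] by (auto simp: j_def T_def)
    have jmax: "c i = 0" if "i \<in> Ap S q" "j < i" for i
      using Max_ge[OF T(1), of i] that by (force simp: j_def T_def)
    have "fps_X ^ j \<odot>\<^sub>X Y c = (\<Oplus>\<^sub>X s\<in>Ap S q. if j = s then fps_const (c s) \<odot>\<^sub>X \<sigma> else \<zero>\<^sub>X)"
      unfolding X_Y[OF Ap_S[OF j(1)]]
    proof (rule X.M.finsum_cong'[OF refl])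
      fix i assume i: "i \<in> Ap S q"
      consider "i < j" | "i = j" | "j < i" by linarith
      then show "fps_const (c i) \<odot>\<^sub>X (fps_X ^ j \<odot>\<^sub>X e i) = (if j = i then fps_const (c i) \<odot>\<^sub>X \<sigma> else \<zero>\<^sub>X)"
      proof cases
        case 1
        then show ?thesis using eg[OF i Ap_S[OF j(1)]] X.smult_r_null[OF const_closed] by simp
      next
        case 2
        then show ?thesis using el[OF i Ap_S[OF j(1)]] e0 by simp
      next
        case 3
        then show ?thesis
          using jmax[OF i] X.smult_l_null[OF X.smult_closed[OF X_power_closed[OF Ap_S[OF j(1)]] ec]] by simp
      qed
    qed (use X.smult_closed[OF const_closed \<sigma>(1)] in simp)
    also have "\<dots> = fps_const (c j) \<odot>\<^sub>X \<sigma>"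
      by (rule X.M.finsum_singleton[OF j(1) finite_Ap]) (intro Pi_I X.smult_closed const_closed \<sigma>(1))
    finally have "fps_const (c j) \<odot>\<^sub>X \<sigma> = \<zero>\<^sub>X"
      using Y0 X.smult_r_null[OF X_power_closed[OF Ap_S[OF j(1)]]] by simp
    then have "fps_const (inverse (c j)) \<odot>\<^sub>X (fps_const (c j) \<odot>\<^sub>X \<sigma>) = \<zero>\<^sub>X"
      using X.smult_r_null[OF const_closed] by simp
    then have "\<sigma> = \<zero>\<^sub>X"
      using X.smult_assoc1[OF const_closed const_closed \<sigma>(1), of "inverse (c j)" "c j"] j(2) X.smult_one[OF \<sigma>(1)]
      by simp
    then show False using \<sigma>(2) by simp
  qed
  have not_Ap: "fps_X ^ s \<odot>\<^sub>X y = \<zero>\<^sub>X" if s: "s \<in> S" "s \<notin> Ap S q" and y: "y \<in> carrier X" for s y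
  proof -
    obtain u where u: "u \<in> S" "s = u + q" using Ap_cases s by blast
    have "fps_X ^ s \<odot>\<^sub>X y = fps_X ^ q \<odot>\<^sub>X (fps_X ^ u \<odot>\<^sub>X y)"
      using X.smult_assoc1[OF X_power_closed[OF q(1)] X_power_closed[OF u(1)] y] u(2)
      by (simp add: power_add mult.commute)
    then show ?thesis using q_X[OF X.smult_closed[OF X_power_closed[OF u(1)] y]] by simp
  qed
  have \<sigma>_const: "a \<odot>\<^sub>X \<sigma> = fps_const (fps_nth a 0) \<odot>\<^sub>X \<sigma>" if a: "a \<in> carrier R" for a
  proof -
    define a' where "a' = a - fps_const (fps_nth a 0)"
    have a': "a' \<in> mm" unfolding mm_iff using a zero_in by (auto simp: a'_def split: if_splits)
    have "(fps_const (fps_nth a 0) \<oplus>\<^sub>R a') \<odot>\<^sub>X \<sigma> = fps_const (fps_nth a 0) \<odot>\<^sub>X \<sigma> \<oplus>\<^sub>X a' \<odot>\<^sub>X \<sigma>"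
      by (rule X.smult_l_distr[OF const_closed _ \<sigma>(1)]) (use a' mm_iff in blast)
    then show ?thesis using \<sigma>(3)[OF a'] X.smult_closed[OF const_closed \<sigma>(1)] by (simp add: a'_def)
  qed
  \<comment> \<open>Induction on a bound N from which on all t^s kill y. In the step t^N y is a
    socle element, and subtracting the corresponding multiple of e_N lowers the bound.\<close>
  have span_N: "\<exists>c. y = Y c" if "y \<in> carrier X" "\<And>s. s \<in> S \<Longrightarrow> N \<le> s \<Longrightarrow> fps_X ^ s \<odot>\<^sub>X y = \<zero>\<^sub>X" for N y
    using that
  proof (induction N arbitrary: y)
    case 0
    have "y = \<zero>\<^sub>X" using "0.prems"(2)[OF zero_in] X.smult_one[OF "0.prems"(1)] by simp
    moreover have "Y (\<lambda>_. 0) = \<zero>\<^sub>X"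
    proof -
      have "Y (\<lambda>_. 0) = (\<Oplus>\<^sub>X s\<in>Ap S q. \<zero>\<^sub>X)"
        unfolding Y_def by (rule X.M.finsum_cong'[OF refl]) (use X.smult_l_null[OF ec] in auto)
      then show ?thesis by simp
    qed
    ultimately show ?case by metis
  next
    case (Suc N)
    show ?case
    proof (cases "N \<in> Ap S q")
      case False
      have "fps_X ^ s \<odot>\<^sub>X y = \<zero>\<^sub>X" if "s \<in> S" "N \<le> s" for s
        using Suc.prems that not_Ap[OF that(1) _ Suc.prems(1)] False by (cases "s = N") auto
      then show ?thesis by (rule Suc.IH[OF Suc.prems(1)])
    next
      case True
      note NS = Ap_S[OF True]
      let ?z = "fps_X ^ N \<odot>\<^sub>X y"
      have zc: "?z \<in> carrier X" by (rule X.smult_closed[OF X_power_closed[OF NS] Suc.prems(1)])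
      have "a \<odot>\<^sub>X ?z = \<zero>\<^sub>X" if a: "a \<in> mm" for a
      proof -
        have aR: "a \<in> carrier R" using a mm_iff by blast
        have aN: "a * fps_X ^ N \<in> carrier R" by (rule mult_closed[OF aR X_power_closed[OF NS]])
        obtain g where g: "g \<in> carrier R" "a * fps_X ^ N = (\<Sum>s\<in>Ap S q. fps_const (fps_nth (a * fps_X ^ N) s) * fps_X ^ s) + fps_X ^ q * g"
          using Ap_expansion[OF q(1) aN] by blast
        have coef0: "fps_nth (a * fps_X ^ N) s = 0" if "s \<le> N" for s
          using that a by (auto simp: fps_mult_fps_X_power_commute[symmetric] fps_X_power_mult_nth mm_iff)
        let ?t = "\<lambda>s. fps_const (fps_nth (a * fps_X ^ N) s) * fps_X ^ s"
        have tR: "?t s \<in> carrier R" if "s \<in> Ap S q" for s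
          by (rule mult_closed[OF const_closed X_power_closed[OF Ap_S[OF that]]])
        have t0: "?t s \<odot>\<^sub>X y = \<zero>\<^sub>X" if s: "s \<in> Ap S q" for s
        proof (cases "s \<le> N")
          case True
          then show ?thesis using coef0 X.smult_l_null[OF Suc.prems(1)] by simp
        next
          case False
          then have "fps_X ^ s \<odot>\<^sub>X y = \<zero>\<^sub>X" using Suc.prems(2)[OF Ap_S[OF s]] by simp
          then show ?thesis
            using X.smult_assoc1[OF const_closed X_power_closed[OF Ap_S[OF s]] Suc.prems(1)] X.smult_r_null[OF const_closed]
            by simp
        qed
        have sum0: "sum ?t A \<in> carrier R \<and> sum ?t A \<odot>\<^sub>X y = \<zero>\<^sub>X" if "finite A" "A \<subseteq> Ap S q" for A
          using that
        proof (induction A rule: finite_induct)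
          case empty
          then show ?case using X.smult_l_null[OF Suc.prems(1)] by simp
        next
          case (insert s A)
          have IH: "sum ?t A \<in> carrier R" "sum ?t A \<odot>\<^sub>X y = \<zero>\<^sub>X" using insert by blast+
          have s: "s \<in> Ap S q" using insert by simp
          have "(?t s \<oplus>\<^sub>R sum ?t A) \<odot>\<^sub>X y = \<zero>\<^sub>X"
            using X.smult_l_distr[OF tR[OF s] IH(1) Suc.prems(1)] t0[OF s] IH(2) by simp
          moreover have "?t s \<oplus>\<^sub>R sum ?t A \<in> carrier R" by (rule a_closed[OF tR[OF s] IH(1)])
          ultimately show ?case unfolding R_simps(3) sum.insert[OF insert(1,2)] by blast
        qed
        note s0 = sum0[OF finite_Ap subset_refl]
        have qg: "fps_X ^ q * g \<in> carrier R" by (rule mult_closed[OF X_power_closed[OF q(1)] g(1)])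
        have "a \<odot>\<^sub>X ?z = (a * fps_X ^ N) \<odot>\<^sub>X y"
          using X.smult_assoc1[OF aR X_power_closed[OF NS] Suc.prems(1)] by simp
        also have "\<dots> = (sum ?t (Ap S q) \<oplus>\<^sub>R fps_X ^ q * g) \<odot>\<^sub>X y" using g(2) by simp
        also have "\<dots> = \<zero>\<^sub>X \<oplus>\<^sub>X (fps_X ^ q * g) \<odot>\<^sub>X y"
          using X.smult_l_distr[OF conjunct1[OF s0] qg Suc.prems(1)] s0 by (simp only:)
        also have "(fps_X ^ q * g) \<odot>\<^sub>X y = fps_X ^ q \<odot>\<^sub>X (g \<odot>\<^sub>X y)"
          using X.smult_assoc1[OF X_power_closed[OF q(1)] g(1) Suc.prems(1)] by simp
        also have "\<dots> = \<zero>\<^sub>X" by (rule q_X[OF X.smult_closed[OF g(1) Suc.prems(1)]])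
        finally show ?thesis by simp
      qed
      then obtain b where b: "b \<in> carrier R" "?z = b \<odot>\<^sub>X \<sigma>" using socle[OF zc] by blast
      define k where "k = fps_nth b 0"
      have zk: "?z = fps_const k \<odot>\<^sub>X \<sigma>" unfolding k_def by (rule trans[OF b(2) \<sigma>_const[OF b(1)]])
      define y' where "y' = y \<ominus>\<^sub>X fps_const k \<odot>\<^sub>X e N"
      have y'c: "y' \<in> carrier X" unfolding y'_def by (rule X.M.minus_closed[OF Suc.prems(1) cec])
      have "fps_X ^ s \<odot>\<^sub>X y' = \<zero>\<^sub>X" if s: "s \<in> S" "N \<le> s" for s
      proof -
        note Xs = X_power_closed[OF s(1)]
        have "fps_X ^ s \<odot>\<^sub>X y' = fps_X ^ s \<odot>\<^sub>X y \<ominus>\<^sub>X fps_const k \<odot>\<^sub>X (fps_X ^ s \<odot>\<^sub>X e N)"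
          unfolding y'_def X.smult_diff_right[OF Xs Suc.prems(1) cec] X.smult_left_commute[OF Xs const_closed ec] ..
        moreover have "fps_X ^ s \<odot>\<^sub>X y = fps_const k \<odot>\<^sub>X (fps_X ^ s \<odot>\<^sub>X e N)"
        proof (cases "s = N")
          case True
          then show ?thesis using zk el[OF \<open>N \<in> Ap S q\<close> NS] e0 by simp
        next
          case False
          then show ?thesis using Suc.prems(2)[OF s(1)] eg[OF True s(1)] s(2) X.smult_r_null[OF const_closed] by simp
        qed
        ultimately show ?thesis
          using X.M.sub_eq_zero_iff X.smult_closed[OF Xs Suc.prems(1)] by metis
      qed
      then obtain c where "y' = Y c" using Suc.IH[OF y'c] by blast
      then have "y = Y c \<oplus>\<^sub>X Y (\<lambda>s. if s = N then k else 0)"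
        unfolding Y_single[OF True] y'_def using X.M.sub_add_cancel[OF Suc.prems(1) cec] by metis
      then show ?thesis using Y_add by metis
    qed
  qed
  have span: "\<exists>c. y = Y c" if y: "y \<in> carrier X" for y
  proof (rule span_N[OF y])
    fix s assume s: "s \<in> S" "Suc (Max (Ap S q)) \<le> s"
    have "s \<notin> Ap S q" using Max_ge[OF finite_Ap, of s q] s(2) by auto
    then show "fps_X ^ s \<odot>\<^sub>X y = \<zero>\<^sub>X" by (rule not_Ap[OF s(1) _ y])
  qed
  have inj: "c s = d s" if cd: "Y c = Y d" and s: "s \<in> Ap S q" for c d s
  proof -
    have "Y (\<lambda>s. c s + (-1) * d s) = Y c \<oplus>\<^sub>X fps_const (-1) \<odot>\<^sub>X Y d" by (simp only: Y_add Y_smult)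
    also have "\<dots> = (fps_const 1 \<oplus>\<^sub>R fps_const (-1)) \<odot>\<^sub>X Y d"
      unfolding cd X.smult_l_distr[OF const_closed const_closed Yc] using X.smult_one[OF Yc] by simp
    also have "fps_const 1 \<oplus>\<^sub>R fps_const (-1) = \<zero>\<^sub>R" unfolding R_simps(3,5) fps_const_add by simp
    also have "\<zero>\<^sub>R \<odot>\<^sub>X Y d = \<zero>\<^sub>X" by (rule X.smult_l_null[OF Yc])
    finally show ?thesis using indep[OF _ s] by fastforce
  qed
  define \<tau> where "\<tau> y = (SOME c. y = Y c) 0" for y
  have zA: "0 \<in> Ap S q" by (rule zero_Ap[OF q(2)])
  have tY: "\<tau> (Y c) = c 0" for c
  proof -
    have "Y c = Y (SOME d. Y c = Y d)" by (rule someI[of "\<lambda>d. Y c = Y d" c]) simp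
    then show ?thesis unfolding \<tau>_def using inj[OF _ zA] by metis
  qed
  have tf: "k_functional X \<tau>"
    unfolding k_functional_def
  proof (intro conjI ballI allI)
    fix x y assume "x \<in> carrier X" "y \<in> carrier X"
    then obtain c d where cd: "x = Y c" "y = Y d" using span by metis
    show "\<tau> (x \<oplus>\<^sub>X y) = \<tau> x + \<tau> y" unfolding cd Y_add[symmetric] tY ..
  next
    fix k y assume "y \<in> carrier X"
    then obtain c where c: "y = Y c" using span by metis
    show "\<tau> (fps_const k \<odot>\<^sub>X y) = k * \<tau> y" unfolding c Y_smult tY ..
  qed
  have te: "\<tau> (e j) = (if j = 0 then 1 else 0)" if "j \<in> Ap S q" for j
    using tY[of "\<lambda>s. if s = j then 1 else 0"] Y_single[OF that, of 1] X.smult_one[OF ec, of j] by (auto split: if_splits)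
  have t0: "\<tau> \<zero>\<^sub>X = 0" by (rule k_functional_zero[OF X tf])
  have t_fin: "\<tau> (finsum X f A) = (\<Sum>a\<in>A. \<tau> (f a))" if "finite A" "\<And>a. a \<in> A \<Longrightarrow> f a \<in> carrier X" for f and A :: "nat set"
    using that
  proof (induction A rule: finite_induct)
    case (insert a A)
    then have "f \<in> A \<rightarrow> carrier X" "f a \<in> carrier X" by auto
    then have "finsum X f (insert a A) = f a \<oplus>\<^sub>X finsum X f A" "finsum X f A \<in> carrier X"
      using insert(1,2) by (auto intro: X.M.finsum_closed)
    then show ?case using insert tf \<open>f a \<in> carrier X\<close> unfolding k_functional_def by auto
  qed (simp add: t0)
  have tX: "\<tau> (fps_X ^ u \<odot>\<^sub>X Y c) = c u" if u: "u \<in> Ap S q" for u c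
  proof -
    note Xu = X_power_closed[OF Ap_S[OF u]]
    have "\<tau> (fps_X ^ u \<odot>\<^sub>X Y c) = (\<Sum>s\<in>Ap S q. \<tau> (fps_const (c s) \<odot>\<^sub>X (fps_X ^ u \<odot>\<^sub>X e s)))"
      unfolding X_Y[OF Ap_S[OF u]]
      by (rule t_fin[OF finite_Ap]) (intro X.smult_closed const_closed Xu ec)
    also have "\<dots> = (\<Sum>s\<in>Ap S q. if s = u then c s else 0)"
    proof (rule sum.cong[OF refl])
      fix s assume s: "s \<in> Ap S q"
      have "\<tau> (fps_const (c s) \<odot>\<^sub>X (fps_X ^ u \<odot>\<^sub>X e s)) = c s * \<tau> (fps_X ^ u \<odot>\<^sub>X e s)"
        using tf X.smult_closed[OF Xu ec, of s] unfolding k_functional_def by blast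
      also have "\<tau> (fps_X ^ u \<odot>\<^sub>X e s) = (if s = u then 1 else 0)"
      proof (cases "u \<le> s")
        case True
        have "\<tau> (e (s - u)) = (if s = u then 1 else 0)"
        proof (cases "s - u \<in> Ap S q")
          case True
          then show ?thesis using te[OF True] \<open>u \<le> s\<close> by auto
        next
          case False
          then have "s \<noteq> u" using zA by auto
          then show ?thesis using en[OF False] t0 by simp
        qed
        then show ?thesis using el[OF s Ap_S[OF u] True] by simp
      next
        case False
        then show ?thesis using eg[OF s Ap_S[OF u]] t0 by auto
      qed
      finally show "\<tau> (fps_const (c s) \<odot>\<^sub>X (fps_X ^ u \<odot>\<^sub>X e s)) = (if s = u then c s else 0)" by simp
    qed
    also have "\<dots> = c u" using u finite_Ap by simp
    finally show ?thesis .
  qed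
  show ?thesis
  proof (rule that[OF tf])
    fix y assume y: "y \<in> carrier X" "\<And>s. s \<in> Ap S q \<Longrightarrow> \<tau> (fps_X ^ s \<odot>\<^sub>X y) = 0"
    obtain c where c: "y = Y c" using span[OF y(1)] by blast
    have c0: "c s = 0" if "s \<in> Ap S q" for s using y(2)[OF that] tX[OF that] c by simp
    have "Y c = (\<Oplus>\<^sub>X s\<in>Ap S q. \<zero>\<^sub>X)"
      unfolding Y_def by (rule X.M.finsum_cong'[OF refl]) (use X.smult_l_null[OF ec] c0 in auto)
    then show "y = \<zero>\<^sub>X" using c by simp
  next
    show "\<exists>y\<in>carrier X. \<forall>s\<in>Ap S q. \<tau> (fps_X ^ s \<odot>\<^sub>X y) = c s" for c
      by (intro bexI[of _ "Y c"] ballI tX Yc)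
  qed
qed

end

section \<open>The functionals of a canonical module\<close>

context sg_ring begin

lemma Pw_multiple:
  assumes q: "q \<in> S"
  obtains N where "\<And>b. b \<in> Pw N \<Longrightarrow> \<exists>h\<in>carrier R. b = fps_X ^ q * h"
proof -
  have "(fps_X ^ q :: 'k fps) \<noteq> 0" by (metis fps_X_power_nth fps_zero_nth zero_neq_one)
  then obtain N where N: "\<And>g :: 'k fps. (\<And>n. n < N \<Longrightarrow> fps_nth g n = 0) \<Longrightarrow> \<exists>h\<in>carrier R. g = fps_X ^ q * h"
    using multiple_of_high_order[OF X_power_closed[OF q]] by blast
  show ?thesis
  proof (rule that[of N])
    fix b assume "b \<in> Pw N"
    then have "fps_nth b n = 0" if "n < N" for n using that lM_le unfolding Pw_iff by (metis not_le)
    then show "\<exists>h\<in>carrier R. b = fps_X ^ q * h" by (rule N)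
  qed
qed

text \<open>Ext in degree 0 gives regularity of t^q. Degrees 1 and 2 then describe
  \<omega>/t^q\<omega>, and the functional found on this quotient is pulled back to
  \<omega>.\<close>

theorem canonical_module_dualizing:
  assumes can: "canonical_module R mm \<omega>" and q: "q \<in> S" "q \<noteq> 0"
  shows "\<exists>\<tau>. dualizing S \<omega> q \<tau>" and "\<And>y. y \<in> carrier \<omega> \<Longrightarrow> fps_X ^ q \<odot>\<^bsub>\<omega>\<^esub> y = \<zero>\<^bsub>\<omega>\<^esub> \<Longrightarrow> y = \<zero>\<^bsub>\<omega>\<^esub>"
proof -
  have M: "module R \<omega>" using can by (simp add: canonical_module_def)
  interpret M: module R \<omega> by (rule M)
  obtain n D e where res: "free_resolution R (quot_module (self_module R) mm) n D e"
    and Ext: "\<And>i. if enat i = height R mm then module_isomorphic R (Ext_module \<omega> n D i) (quot_module (self_module R) mm)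
             else carrier (Ext_module \<omega> n D i) = {\<zero>\<^bsub>Ext_module \<omega> n D i\<^esub>}"
    using can unfolding canonical_module_def by blast
  have E0: "carrier (Ext_module \<omega> n D 0) = {\<zero>\<^bsub>Ext_module \<omega> n D 0\<^esub>}"
    and E1: "module_isomorphic R (Ext_module \<omega> n D (Suc 0)) (quot_module (self_module R) mm)"
    and E2: "carrier (Ext_module \<omega> n D 2) = {\<zero>\<^bsub>Ext_module \<omega> n D 2\<^esub>}"
    using Ext[of 0] Ext[of 1] Ext[of 2] by (simp_all add: height_mm)
  have r: "resolution R mm \<omega> n D e" by (rule resolution.intro[OF M max res])
  interpret r: resolution R mm \<omega> n D e by (rule r)
  let ?x = "fps_X ^ q :: 'k fps"
  have x: "?x \<in> mm" by (rule X_power_mm[OF q])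
  have xR: "?x \<in> carrier R" by (rule X_power_closed[OF q(1)])
  obtain N where N: "\<And>b. b \<in> Pw N \<Longrightarrow> \<exists>h\<in>carrier R. b = ?x * h" using Pw_multiple[OF q(1)] by blast
  have BS: "a \<otimes>\<^sub>R b \<in> Pw (Suc i)" if "a \<in> mm" "b \<in> Pw i" for i a b
    using powers.L_Suc[OF that] by simp
  have P0: "Pw 0 = carrier R" and Pc: "Pw i \<subseteq> carrier R" for i using powers.J_carrier by auto
  have BN: "\<exists>h\<in>carrier R. b = ?x \<otimes>\<^sub>R h" if "b \<in> Pw N" for b
    using N[OF that] by (simp del: R_simps(1))
  show reg: "y = \<zero>\<^bsub>\<omega>\<^esub>" if y: "y \<in> carrier \<omega>" "?x \<odot>\<^bsub>\<omega>\<^esub> y = \<zero>\<^bsub>\<omega>\<^esub>" for y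
    by (rule regular_of_Ext_0[where B = Pw and N = N, OF r E0 xR P0 Pc BS BN y])
  define U where "U = (\<lambda>z. ?x \<odot>\<^bsub>\<omega>\<^esub> z) ` carrier \<omega>"
  have U: "submodule U R \<omega>"
    unfolding U_def by (rule multiples_submodule[OF M xR])
  define X where "X = quot_module \<omega> U"
  define proj where "proj y = U +>\<^bsub>\<omega>\<^esub> y" for y
  have X: "module R X" unfolding X_def by (rule module_quot_module[OF M U])
  have pl: "linear_on R \<omega> X (carrier \<omega>) proj"
    unfolding X_def proj_def by (rule linear_on_coset[OF M U])
  have pi: "proj ` carrier \<omega> = carrier X"
    unfolding X_def proj_def quot_module_simps(1)[OF M U] ..
  have pk: "proj y = \<zero>\<^sub>X \<longleftrightarrow> (\<exists>z\<in>carrier \<omega>. y = ?x \<odot>\<^bsub>\<omega>\<^esub> z)" if "y \<in> carrier \<omega>" for y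
  proof -
    have "proj y = \<zero>\<^sub>X \<longleftrightarrow> y \<in> U"
      unfolding X_def proj_def quot_module_simps(2)[OF M U] by (rule coset_eq_self_iff[OF M U that])
    then show ?thesis by (simp add: U_def image_iff)
  qed
  interpret r: resolution_mod R mm \<omega> n D e ?x X proj
  proof (rule resolution_mod.intro[OF r resolution_mod_axioms.intro])
    show "y \<in> carrier \<omega> \<Longrightarrow> ?x \<odot>\<^bsub>\<omega>\<^esub> y = \<zero>\<^bsub>\<omega>\<^esub> \<Longrightarrow> y = \<zero>\<^bsub>\<omega>\<^esub>" for y by (rule reg)
    show "y \<in> carrier \<omega> \<Longrightarrow> (proj y = \<zero>\<^sub>X) = (\<exists>z\<in>carrier \<omega>. y = ?x \<odot>\<^bsub>\<omega>\<^esub> z)" for y by (rule pk)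
  qed (rule x X pl pi)+
  obtain \<sigma> where \<sigma>: "\<sigma> \<in> carrier \<omega>" "proj \<sigma> \<noteq> \<zero>\<^sub>X" "\<And>a. a \<in> mm \<Longrightarrow> proj (a \<odot>\<^bsub>\<omega>\<^esub> \<sigma>) = \<zero>\<^sub>X"
    and soc: "\<And>y. y \<in> carrier \<omega> \<Longrightarrow> (\<And>a. a \<in> mm \<Longrightarrow> proj (a \<odot>\<^bsub>\<omega>\<^esub> y) = \<zero>\<^sub>X) \<Longrightarrow>
       \<exists>a\<in>carrier R. proj y = a \<odot>\<^sub>X proj \<sigma>" using r.socle_of_Ext_1[OF E1] by blast
  have pa: "proj (a \<odot>\<^bsub>\<omega>\<^esub> y) = a \<odot>\<^sub>X proj y" if "a \<in> carrier R" "y \<in> carrier \<omega>" for a y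
    by (rule linear_on_smult[OF pl that])
  have mR: "a \<in> carrier R" if "a \<in> mm" for a using that mm_iff by blast
  interpret db: dual_basis S R mm q X "proj \<sigma>"
  proof (rule dual_basis.intro[OF sg_ring_axioms dual_basis_axioms.intro])
    show "?x \<odot>\<^sub>X y = \<zero>\<^sub>X" if "y \<in> carrier X" for y by (rule r.smult_x_X[OF that])
    show "a \<odot>\<^sub>X proj \<sigma> = \<zero>\<^sub>X" if "a \<in> mm" for a using \<sigma>(3)[OF that] pa[OF mR[OF that] \<sigma>(1)] by simp
    show "\<exists>a\<in>carrier R. y = a \<odot>\<^sub>X proj \<sigma>" if y: "y \<in> carrier X" and 0: "\<And>a. a \<in> mm \<Longrightarrow> a \<odot>\<^sub>X y = \<zero>\<^sub>X" for y
    proof -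
      obtain y0 where y0: "y0 \<in> carrier \<omega>" "y = proj y0" using y pi by (metis imageE)
      have "proj (a \<odot>\<^bsub>\<omega>\<^esub> y0) = \<zero>\<^sub>X" if "a \<in> mm" for a using 0[OF that] pa[OF mR[OF that] y0(1)] y0(2) by simp
      then show ?thesis using soc[OF y0(1)] y0(2) by blast
    qed
    show "\<exists>y\<in>carrier X. \<forall>a\<in>mm. \<psi> a = a \<odot>\<^sub>X y"
      if psi: "linear_on R (self_module R) X mm \<psi>" "\<psi> ?x = \<zero>\<^sub>X" for \<psi>
    proof -
      obtain y where "y \<in> carrier X" "\<And>a. a \<in> mm \<Longrightarrow> \<psi> a = a \<odot>\<^sub>X y"
        using r.hom_of_Ext_2[OF E2 psi] by (metis (no_types))
      then show ?thesis by blast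
    qed
    show "proj \<sigma> \<in> carrier X" by (rule linear_on_closed[OF pl \<sigma>(1)])
  qed (rule q \<sigma>(2) X)+
  obtain \<tau> where \<tau>: "k_functional X \<tau>"
    "\<And>y. y \<in> carrier X \<Longrightarrow> (\<And>s. s \<in> Ap S q \<Longrightarrow> \<tau> (fps_X ^ s \<odot>\<^sub>X y) = 0) \<Longrightarrow> y = \<zero>\<^sub>X"
    "\<And>c. \<exists>y\<in>carrier X. \<forall>s\<in>Ap S q. \<tau> (fps_X ^ s \<odot>\<^sub>X y) = c s" using db.dualizing_quotient by blast
  have pc: "proj y \<in> carrier X" if "y \<in> carrier \<omega>" for y by (rule linear_on_closed[OF pl that])
  have "dualizing S \<omega> q (\<lambda>y. \<tau> (proj y))"
    unfolding dualizing_def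
  proof (intro conjI ballI allI impI)
    show "k_functional \<omega> (\<lambda>y. \<tau> (proj y))"
      using \<tau>(1) linear_on_add[OF pl] pa[OF const_closed] pc unfolding k_functional_def by simp
    show "\<tau> (proj (?x \<odot>\<^bsub>\<omega>\<^esub> y)) = 0" if "y \<in> carrier \<omega>" for y
      using r.proj_x[OF that] k_functional_zero[OF X \<tau>(1)] by simp
  next
    fix y assume y: "y \<in> carrier \<omega>" and 0: "\<forall>s\<in>Ap S q. \<tau> (proj (fps_X ^ s \<odot>\<^bsub>\<omega>\<^esub> y)) = 0"
    have "\<tau> (fps_X ^ s \<odot>\<^sub>X proj y) = 0" if "s \<in> Ap S q" for s
      using bspec[OF 0 that] unfolding pa[OF X_power_closed[OF Ap_S[OF that]] y] .
    then have "proj y = \<zero>\<^sub>X" by (rule \<tau>(2)[OF pc[OF y]])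
    then show "\<exists>z\<in>carrier \<omega>. y = ?x \<odot>\<^bsub>\<omega>\<^esub> z" using pk[OF y] by simp
  next
    fix c
    obtain Y where Y: "Y \<in> carrier X" "\<forall>s\<in>Ap S q. \<tau> (fps_X ^ s \<odot>\<^sub>X Y) = c s" using \<tau>(3) by blast
    then obtain y where y: "y \<in> carrier \<omega>" "Y = proj y" using pi by (metis imageE)
    have "\<tau> (proj (fps_X ^ s \<odot>\<^bsub>\<omega>\<^esub> y)) = c s" if "s \<in> Ap S q" for s
      unfolding pa[OF X_power_closed[OF Ap_S[OF that]] y(1)] y(2)[symmetric] by (rule bspec[OF Y(2) that])
    then show "\<exists>y\<in>carrier \<omega>. \<forall>s\<in>Ap S q. \<tau> (proj (fps_X ^ s \<odot>\<^bsub>\<omega>\<^esub> y)) = c s" using y(1) by blast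
  qed
  then show "\<exists>\<tau>. dualizing S \<omega> q \<tau>" by blast
qed

end

section \<open>Associated graded modules\<close>

declare ideal_power_module.simps(2) [simp del]

context filtered begin

text \<open>Elements of the associated graded module are written through sequences of representatives.\<close>

definition reps :: "(nat \<Rightarrow> 'b) set" where
  "reps = {y. (\<forall>i. y i \<in> L i) \<and> (\<exists>N. \<forall>i\<ge>N. y i \<in> L (Suc i))}"

definition cls :: "(nat \<Rightarrow> 'b) \<Rightarrow> nat \<Rightarrow> 'b set" where
  "cls y = (\<lambda>i. L (Suc i) +>\<^sub>M y i)"

abbreviation gr where "gr \<equiv> gr_module R I M"

lemma reps_L: "y \<in> reps \<Longrightarrow> y i \<in> L i"
  by (simp add: reps_def)

lemma reps_carrier: "y \<in> reps \<Longrightarrow> y i \<in> carrier M"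
  using reps_L L_carrier by blast

lemma cls_eq_iff:
  assumes "\<And>i. y i \<in> carrier M" "\<And>i. z i \<in> carrier M"
  shows "cls y = cls z \<longleftrightarrow> (\<forall>i. y i \<ominus>\<^sub>M z i \<in> L (Suc i))"
  unfolding cls_def fun_eq_iff using coset_eq_iff[OF M L_submodule] assms by blast

lemma coset_eq_L: "y \<in> carrier M \<Longrightarrow> L i +>\<^sub>M y = L i \<longleftrightarrow> y \<in> L i"
  by (rule coset_eq_self_iff[OF M L_submodule])

lemma gr_carrier: "carrier gr = cls ` reps"
proof
  show "carrier gr \<subseteq> cls ` reps"
  proof
    fix f assume "f \<in> carrier gr"
    then have f: "\<forall>i. \<exists>y\<in>L i. f i = L (Suc i) +>\<^sub>M y" "finite {i. f i \<noteq> L (Suc i)}"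
      unfolding gr_module_def by auto
    then obtain y where y: "\<And>i. y i \<in> L i" "\<And>i. f i = L (Suc i) +>\<^sub>M y i" by metis
    obtain N where N: "\<forall>i\<in>{i. f i \<noteq> L (Suc i)}. i < N" using f(2) unfolding finite_nat_set_iff_bounded by blast
    have "y i \<in> L (Suc i)" if "N \<le> i" for i
    proof -
      have "f i = L (Suc i)" using N that by force
      then show ?thesis using coset_eq_L[OF L_carrier[OF y(1)]] y(2) by metis
    qed
    then have "y \<in> reps" using y(1) unfolding reps_def by blast
    moreover have "f = cls y" using y(2) by (auto simp: cls_def)
    ultimately show "f \<in> cls ` reps" by blast
  qed
  show "cls ` reps \<subseteq> carrier gr"
  proof (rule image_subsetI)
    fix y assume y: "y \<in> reps"
    then obtain N where "\<forall>i\<ge>N. y i \<in> L (Suc i)" by (auto simp: reps_def)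
    then have "cls y i = L (Suc i)" if "N \<le> i" for i
      unfolding cls_def using coset_eq_L[OF reps_carrier[OF y]] that by blast
    then have "{i. cls y i \<noteq> L (Suc i)} \<subseteq> {..<N}" by force
    then have "finite {i. cls y i \<noteq> L (Suc i)}" by (rule finite_subset) simp
    then show "cls y \<in> carrier gr"
      unfolding gr_module_def using reps_L[OF y] by (auto simp: cls_def)
  qed
qed

lemma zero_reps: "(\<lambda>_. \<zero>\<^sub>M) \<in> reps"
  using submodule_zero[OF L_submodule] by (auto simp: reps_def simp del: ideal_power_module.simps)

lemma add_reps: "y \<in> reps \<Longrightarrow> z \<in> reps \<Longrightarrow> (\<lambda>i. y i \<oplus>\<^sub>M z i) \<in> reps"
proof -
  assume y: "y \<in> reps" and z: "z \<in> reps"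
  obtain A B where "\<forall>i\<ge>A. y i \<in> L (Suc i)" "\<forall>i\<ge>B. z i \<in> L (Suc i)" using y z unfolding reps_def by blast
  then have "\<forall>i\<ge>max A B. y i \<oplus>\<^sub>M z i \<in> L (Suc i)" using M.submoduleE(5)[OF L_submodule] by simp
  moreover have "y i \<oplus>\<^sub>M z i \<in> L i" for i using M.submoduleE(5)[OF L_submodule] reps_L y z by blast
  ultimately show ?thesis unfolding reps_def by blast
qed

lemma uminus_reps: "y \<in> reps \<Longrightarrow> (\<lambda>i. \<ominus>\<^sub>M y i) \<in> reps"
proof -
  assume y: "y \<in> reps"
  obtain A where "\<forall>i\<ge>A. y i \<in> L (Suc i)" using y unfolding reps_def by blast
  then have "\<forall>i\<ge>A. \<ominus>\<^sub>M y i \<in> L (Suc i)" using M.submoduleE(3)[OF L_submodule] by blast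
  moreover have "\<ominus>\<^sub>M y i \<in> L i" for i using M.submoduleE(3)[OF L_submodule] reps_L y by blast
  ultimately show ?thesis unfolding reps_def by blast
qed

lemma gr_zero: "\<zero>\<^bsub>gr\<^esub> = cls (\<lambda>_. \<zero>\<^sub>M)"
  unfolding gr_module_def cls_def using coset_eq_L[OF M.M.zero_closed] submodule_zero[OF L_submodule] by simp

lemma gr_add:
  assumes "y \<in> reps" "z \<in> reps"
  shows "cls y \<oplus>\<^bsub>gr\<^esub> cls z = cls (\<lambda>i. y i \<oplus>\<^sub>M z i)"
  unfolding gr_module_def cls_def using coset_add[OF M L_submodule reps_carrier[OF assms(1)] reps_carrier[OF assms(2)]]
  by simp

lemma finsum_L: "finite A \<Longrightarrow> (\<And>a. a \<in> A \<Longrightarrow> f a \<in> L i) \<Longrightarrow> finsum M f A \<in> L i"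
  by (rule finsum_submodule[OF M L_submodule])

end

context filtered begin

lemma conv_L:
  assumes "\<And>i. a i \<in> J.L i" "\<And>i. y i \<in> L i"
  shows "conv M a y n \<in> L n"
  unfolding conv_def
proof (rule finsum_L)
  fix i assume "i \<in> {..n}"
  then show "a i \<odot>\<^sub>M y (n - i) \<in> L n" using J_L[OF assms(1)[of i] assms(2)[of "n - i"]] by simp
qed simp

lemma conv_L_Suc:
  assumes "\<And>i. i \<le> n \<Longrightarrow> a i \<odot>\<^sub>M y (n - i) \<in> L (Suc n)"
  shows "conv M a y n \<in> L (Suc n)"
  unfolding conv_def by (rule finsum_L) (use assms in auto)

lemma conv_reps:
  assumes a: "a \<in> J.reps" and y: "y \<in> reps"
  shows "conv M a y \<in> reps"
proof -
  obtain A B where A: "\<And>i. A \<le> i \<Longrightarrow> a i \<in> J.L (Suc i)" and B: "\<And>i. B \<le> i \<Longrightarrow> y i \<in> L (Suc i)"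
    using a y unfolding J.reps_def reps_def by blast
  have "conv M a y n \<in> L (Suc n)" if n: "A + B \<le> n" for n
  proof (rule conv_L_Suc)
    fix i assume i: "i \<le> n"
    show "a i \<odot>\<^sub>M y (n - i) \<in> L (Suc n)"
    proof (cases "A \<le> i")
      case True
      then show ?thesis using J_L[OF A[OF True] reps_L[OF y, of "n - i"]] i by simp
    next
      case False
      then have "B \<le> n - i" using n i by simp
      then show ?thesis using J_L[OF J.reps_L[OF a, of i] B[of "n - i"]] i by simp
    qed
  qed
  moreover have "conv M a y n \<in> L n" for n by (rule conv_L[OF J.reps_L[OF a] reps_L[OF y]])
  ultimately show ?thesis unfolding reps_def by blast
qed

lemma mem_coset_iff:
  assumes "y \<in> carrier M" "y' \<in> carrier M"
  shows "y' \<in> L i +>\<^sub>M y \<longleftrightarrow> y' \<ominus>\<^sub>M y \<in> L i"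
proof -
  interpret U: abelian_subgroup "L i" M by (rule submodule_abelian_subgroup[OF M L_submodule])
  show ?thesis using U.a_rcos_module[OF assms] by (simp add: a_minus_def)
qed

lemma coset_carrier: "y \<in> carrier M \<Longrightarrow> y' \<in> L i +>\<^sub>M y \<Longrightarrow> y' \<in> carrier M"
  using L_carrier by (auto simp: a_r_coset_def')

end

context filtered begin

text \<open>Changing a representative of degree i by an element one power deeper changes the degree
  n part of the product only by elements of power n + 1. So the set of all products is a single
  coset.\<close>

lemma gr_smult:
  assumes a: "a \<in> J.reps" and y: "y \<in> reps"
  shows "J.cls a \<odot>\<^bsub>gr\<^esub> cls y = cls (conv M a y)"
proof
  fix n
  note ac = J.reps_carrier[OF a] and yc = reps_carrier[OF y]
  have aR: "a i \<in> carrier R" for i using ac by simp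
  have cc: "conv M a y n \<in> carrier M" by (rule M.conv_closed[OF aR yc])
  have "(J.cls a \<odot>\<^bsub>gr\<^esub> cls y) n =
      {z \<oplus>\<^sub>M conv M b w n | z b w. z \<in> L (Suc n) \<and> (\<forall>i. b i \<in> J.cls a i) \<and> (\<forall>i. w i \<in> cls y i)}"
    unfolding gr_module_def conv_def by simp
  also have "\<dots> = L (Suc n) +>\<^sub>M conv M a y n"
  proof
    have "a i \<in> J.cls a i" for i
      unfolding J.cls_def using J.mem_coset_iff[OF ac ac] submodule_zero[OF J.L_submodule] aR
      by (simp add: M.R.r_neg a_minus_def del: ideal_power_module.simps)
    moreover have "y i \<in> cls y i" for i
      unfolding cls_def using mem_coset_iff[OF yc yc] submodule_zero[OF L_submodule] yc
      by (simp add: M.M.r_neg a_minus_def del: ideal_power_module.simps)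
    ultimately show "L (Suc n) +>\<^sub>M conv M a y n \<subseteq>
      {z \<oplus>\<^sub>M conv M b w n | z b w. z \<in> L (Suc n) \<and> (\<forall>i. b i \<in> J.cls a i) \<and> (\<forall>i. w i \<in> cls y i)}"
      unfolding a_r_coset_def' by blast
    show "{z \<oplus>\<^sub>M conv M b w n | z b w. z \<in> L (Suc n) \<and> (\<forall>i. b i \<in> J.cls a i) \<and> (\<forall>i. w i \<in> cls y i)} \<subseteq>
      L (Suc n) +>\<^sub>M conv M a y n"
    proof clarify
      fix z b w assume z: "z \<in> L (Suc n)" and b: "\<forall>i. b i \<in> J.cls a i" and w: "\<forall>i. w i \<in> cls y i"
      have bR: "b i \<in> carrier R" for i using J.coset_carrier[OF ac, of "b i" "Suc i" i] b unfolding J.cls_def by simp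
      have wc: "w i \<in> carrier M" for i using coset_carrier[OF yc, of "w i" "Suc i" i] w unfolding cls_def by blast
      have da: "b i \<ominus>\<^sub>R a i \<in> J.L (Suc i)" for i
        using spec[OF b, of i] J.mem_coset_iff[OF ac[of i], of "b i" "Suc i"] bR unfolding J.cls_def by simp
      have dy: "w i \<ominus>\<^sub>M y i \<in> L (Suc i)" for i
        using spec[OF w, of i] mem_coset_iff[OF yc[of i] wc[of i], of "Suc i"] unfolding cls_def by blast
      have wL: "w i \<in> L i" for i
      proof -
        have "w i = (w i \<ominus>\<^sub>M y i) \<oplus>\<^sub>M y i" using M.M.sub_add_cancel[OF wc yc] by simp
        moreover have "(w i \<ominus>\<^sub>M y i) \<oplus>\<^sub>M y i \<in> L i"
          using M.submoduleE(5)[OF L_submodule] L_Suc_subset dy reps_L[OF y] by blast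
        ultimately show ?thesis by simp
      qed
      \<comment> \<open>The representatives are exchanged one after the other: the scalars while w
        is kept, then w against the original scalars.\<close>
      let ?b = "\<lambda>i. b i \<ominus>\<^sub>R a i" and ?w = "\<lambda>i. w i \<ominus>\<^sub>M y i"
      have "conv M b w n = conv M (\<lambda>i. ?b i \<oplus>\<^sub>R a i) w n"
        using M.R.sub_add_cancel[OF bR aR] by simp
      also have "\<dots> = conv M ?b w n \<oplus>\<^sub>M conv M a w n"
        by (rule M.conv_add_left) (use bR aR wc in auto)
      also have "conv M a w n = conv M a (\<lambda>i. ?w i \<oplus>\<^sub>M y i) n"
        using M.M.sub_add_cancel[OF wc yc] by simp
      also have "\<dots> = conv M a ?w n \<oplus>\<^sub>M conv M a y n"
        by (rule M.conv_add_right) (use aR wc yc in auto)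
      finally have e: "conv M b w n = conv M ?b w n \<oplus>\<^sub>M (conv M a ?w n \<oplus>\<^sub>M conv M a y n)" .
      have 1: "conv M ?b w n \<in> L (Suc n)"
      proof (rule conv_L_Suc)
        fix i assume "i \<le> n"
        then show "?b i \<odot>\<^sub>M w (n - i) \<in> L (Suc n)" using J_L[OF da wL, of i "n - i"] by simp
      qed
      have 2: "conv M a ?w n \<in> L (Suc n)"
      proof (rule conv_L_Suc)
        fix i assume "i \<le> n"
        then show "a i \<odot>\<^sub>M ?w (n - i) \<in> L (Suc n)" using J_L[OF J.reps_L[OF a] dy, of i "n - i"] by simp
      qed
      have "z \<oplus>\<^sub>M conv M b w n = (z \<oplus>\<^sub>M (conv M ?b w n \<oplus>\<^sub>M conv M a ?w n)) \<oplus>\<^sub>M conv M a y n"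
        unfolding e using L_carrier[OF z] L_carrier[OF 1] L_carrier[OF 2] cc by (simp add: M.M.a_assoc)
      moreover have "z \<oplus>\<^sub>M (conv M ?b w n \<oplus>\<^sub>M conv M a ?w n) \<in> L (Suc n)"
        using M.submoduleE(5)[OF L_submodule] z 1 2 by blast
      ultimately show "z \<oplus>\<^sub>M conv M b w n \<in> L (Suc n) +>\<^sub>M conv M a y n"
        unfolding a_r_coset_def' by blast
    qed
  qed
  finally show "(J.cls a \<odot>\<^bsub>gr\<^esub> cls y) n = cls (conv M a y) n" by (simp add: cls_def)
qed

lemma gr_abelian_group: "abelian_group gr"
proof (rule abelian_groupI)
  note rc = reps_carrier
  show "\<zero>\<^bsub>gr\<^esub> \<in> carrier gr" unfolding gr_zero gr_carrier using zero_reps by blast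
  fix f assume "f \<in> carrier gr"
  then obtain y where y: "y \<in> reps" "f = cls y" unfolding gr_carrier by blast
  show "\<zero>\<^bsub>gr\<^esub> \<oplus>\<^bsub>gr\<^esub> f = f"
    unfolding gr_zero y(2) gr_add[OF zero_reps y(1)] using rc[OF y(1)] by simp
  have "cls (\<lambda>i. \<ominus>\<^sub>M y i) \<oplus>\<^bsub>gr\<^esub> f = \<zero>\<^bsub>gr\<^esub>"
    unfolding gr_zero y(2) gr_add[OF uminus_reps[OF y(1)] y(1)] using rc[OF y(1)] by (simp add: M.M.l_neg)
  then show "\<exists>g\<in>carrier gr. g \<oplus>\<^bsub>gr\<^esub> f = \<zero>\<^bsub>gr\<^esub>" unfolding gr_carrier using uminus_reps[OF y(1)] by blast
  fix g assume "g \<in> carrier gr"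
  then obtain z where z: "z \<in> reps" "g = cls z" unfolding gr_carrier by blast
  show "f \<oplus>\<^bsub>gr\<^esub> g \<in> carrier gr"
    unfolding y(2) z(2) gr_add[OF y(1) z(1)] gr_carrier using add_reps[OF y(1) z(1)] by blast
  show "f \<oplus>\<^bsub>gr\<^esub> g = g \<oplus>\<^bsub>gr\<^esub> f"
    unfolding y(2) z(2) gr_add[OF y(1) z(1)] gr_add[OF z(1) y(1)] using rc[OF y(1)] rc[OF z(1)] by (simp add: M.M.a_comm)
  fix h assume "h \<in> carrier gr"
  then obtain w where w: "w \<in> reps" "h = cls w" unfolding gr_carrier by blast
  show "f \<oplus>\<^bsub>gr\<^esub> g \<oplus>\<^bsub>gr\<^esub> h = f \<oplus>\<^bsub>gr\<^esub> (g \<oplus>\<^bsub>gr\<^esub> h)"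
    unfolding y(2) z(2) w(2) gr_add[OF y(1) z(1)] gr_add[OF z(1) w(1)] gr_add[OF add_reps[OF y(1) z(1)] w(1)]
      gr_add[OF y(1) add_reps[OF z(1) w(1)]]
    using rc[OF y(1)] rc[OF z(1)] rc[OF w(1)] by (simp add: M.M.a_assoc)
qed

end

context filtered begin

abbreviation G where "G \<equiv> gr_ring R I"

definition one_rep :: "nat \<Rightarrow> 'a" where "one_rep i = (if i = 0 then \<one>\<^sub>R else \<zero>\<^sub>R)"

lemma one_reps: "one_rep \<in> J.reps"
proof -
  have "one_rep i \<in> J.L i" for i
    using submodule_zero[OF J.L_submodule, of i] by (cases i) (auto simp: one_rep_def simp del: ideal_power_module.simps(2))
  moreover have "one_rep i \<in> J.L (Suc i)" if "1 \<le> i" for i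
    using submodule_zero[OF J.L_submodule, of "Suc i"] that by (auto simp: one_rep_def simp del: ideal_power_module.simps(2))
  ultimately show ?thesis unfolding J.reps_def by blast
qed

lemma G_carrier: "carrier G = J.cls ` J.reps"
  and G_zero: "\<zero>\<^sub>G = J.cls (\<lambda>_. \<zero>\<^sub>R)"
  and G_add: "a \<in> J.reps \<Longrightarrow> b \<in> J.reps \<Longrightarrow> J.cls a \<oplus>\<^sub>G J.cls b = J.cls (\<lambda>i. a i \<oplus>\<^sub>R b i)"
  and G_mult: "a \<in> J.reps \<Longrightarrow> b \<in> J.reps \<Longrightarrow> J.cls a \<otimes>\<^sub>G J.cls b = J.cls (conv (self_module R) a b)"
proof -
  show "carrier G = J.cls ` J.reps" using J.gr_carrier by (simp add: gr_ring_def Let_def)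
  show "\<zero>\<^sub>G = J.cls (\<lambda>_. \<zero>\<^sub>R)" using J.gr_zero by (simp add: gr_ring_def Let_def)
  show "a \<in> J.reps \<Longrightarrow> b \<in> J.reps \<Longrightarrow> J.cls a \<oplus>\<^sub>G J.cls b = J.cls (\<lambda>i. a i \<oplus>\<^sub>R b i)"
    using J.gr_add by (simp add: gr_ring_def Let_def)
  show "a \<in> J.reps \<Longrightarrow> b \<in> J.reps \<Longrightarrow> J.cls a \<otimes>\<^sub>G J.cls b = J.cls (conv (self_module R) a b)"
    using J.gr_smult by (simp add: gr_ring_def Let_def)
qed

lemma G_one: "\<one>\<^sub>G = J.cls one_rep"
proof
  fix i
  have "ideal_power_module (self_module R) I (Suc i) +>\<^sub>R \<zero>\<^sub>R = ideal_power_module (self_module R) I (Suc i)"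
    using J.coset_eq_L[of "\<zero>\<^sub>R" "Suc i"] submodule_zero[OF J.L_submodule, of "Suc i"]
    by (simp del: ideal_power_module.simps)
  then show "\<one>\<^sub>G i = J.cls one_rep i"
    by (auto simp: gr_ring_def Let_def J.cls_def one_rep_def simp del: ideal_power_module.simps)
qed

lemma conv_one: "y \<in> reps \<Longrightarrow> conv M one_rep y = y"
proof
  fix n assume y: "y \<in> reps"
  have "conv M one_rep y n = (if 0 \<le> n then one_rep 0 \<odot>\<^sub>M y (n - 0) else \<zero>\<^sub>M)"
    by (rule M.conv_single) (use reps_carrier[OF y] in \<open>auto simp: one_rep_def\<close>)
  then show "conv M one_rep y n = y n" using reps_carrier[OF y] by (simp add: one_rep_def)
qed

text \<open>Each axiom is an identity between convolutions of representatives, with associativity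
  supplied by \<open>conv_assoc\<close>.\<close>

lemma gr_module: "cring G \<Longrightarrow> module G gr"
proof (rule moduleI)
  show "abelian_group gr" by (rule gr_abelian_group)
  fix f g y assume "f \<in> carrier G" "y \<in> carrier gr"
  then obtain a w where a: "a \<in> J.reps" "f = J.cls a" and w: "w \<in> reps" "y = cls w"
    unfolding G_carrier gr_carrier by blast
  have aR: "a i \<in> carrier R" for i using J.reps_carrier[OF a(1)] by simp
  note wc = reps_carrier[OF w(1)]
  show "f \<odot>\<^bsub>gr\<^esub> y \<in> carrier gr"
    unfolding a(2) w(2) gr_smult[OF a(1) w(1)] gr_carrier using conv_reps[OF a(1) w(1)] by blast
  {
    assume "g \<in> carrier G"
    then obtain b where b: "b \<in> J.reps" "g = J.cls b" unfolding G_carrier by blast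
    have bR: "b i \<in> carrier R" for i using J.reps_carrier[OF b(1)] by simp
    have ab: "(\<lambda>i. a i \<oplus>\<^sub>R b i) \<in> J.reps" using J.add_reps[OF a(1) b(1)] by simp
    have "conv M (\<lambda>i. a i \<oplus>\<^sub>R b i) w = (\<lambda>n. conv M a w n \<oplus>\<^sub>M conv M b w n)"
      by (intro ext M.conv_add_left aR bR wc)
    then show "(f \<oplus>\<^sub>G g) \<odot>\<^bsub>gr\<^esub> y = f \<odot>\<^bsub>gr\<^esub> y \<oplus>\<^bsub>gr\<^esub> g \<odot>\<^bsub>gr\<^esub> y"
      unfolding a(2) b(2) w(2) G_add[OF a(1) b(1)] gr_smult[OF ab w(1)] gr_smult[OF a(1) w(1)]
        gr_smult[OF b(1) w(1)] gr_add[OF conv_reps[OF a(1) w(1)] conv_reps[OF b(1) w(1)]] by simp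
    have "conv M (conv (self_module R) a b) w = conv M a (conv M b w)"
      by (intro ext M.conv_assoc aR bR wc)
    then show "f \<otimes>\<^sub>G g \<odot>\<^bsub>gr\<^esub> y = f \<odot>\<^bsub>gr\<^esub> (g \<odot>\<^bsub>gr\<^esub> y)"
      unfolding a(2) b(2) w(2) G_mult[OF a(1) b(1)] gr_smult[OF J.conv_reps[OF a(1) b(1)] w(1)] gr_smult[OF b(1) w(1)]
        gr_smult[OF a(1) conv_reps[OF b(1) w(1)]] by simp
  }
next
  fix f y z assume "f \<in> carrier G" "y \<in> carrier gr" "z \<in> carrier gr"
  then obtain a w v where a: "a \<in> J.reps" "f = J.cls a" and w: "w \<in> reps" "y = cls w" and v: "v \<in> reps" "z = cls v"
    unfolding G_carrier gr_carrier by blast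
  have aR: "a i \<in> carrier R" for i using J.reps_carrier[OF a(1)] by simp
  have "conv M a (\<lambda>i. w i \<oplus>\<^sub>M v i) = (\<lambda>n. conv M a w n \<oplus>\<^sub>M conv M a v n)"
    by (intro ext M.conv_add_right aR reps_carrier[OF w(1)] reps_carrier[OF v(1)])
  then show "f \<odot>\<^bsub>gr\<^esub> (y \<oplus>\<^bsub>gr\<^esub> z) = f \<odot>\<^bsub>gr\<^esub> y \<oplus>\<^bsub>gr\<^esub> f \<odot>\<^bsub>gr\<^esub> z"
    unfolding a(2) w(2) v(2) gr_add[OF w(1) v(1)] gr_smult[OF a(1) add_reps[OF w(1) v(1)]] gr_smult[OF a(1) w(1)]
      gr_smult[OF a(1) v(1)] gr_add[OF conv_reps[OF a(1) w(1)] conv_reps[OF a(1) v(1)]] by simp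
next
  fix y assume "y \<in> carrier gr"
  then obtain w where w: "w \<in> reps" "y = cls w" unfolding gr_carrier by blast
  show "\<one>\<^sub>G \<odot>\<^bsub>gr\<^esub> y = y"
    unfolding G_one w(2) gr_smult[OF one_reps w(1)] conv_one[OF w(1)] ..
qed

text \<open>Here \<open>hom\<close> stands for homogeneous: the sequence represents an element
  concentrated in degree i.\<close>

definition hom_rep :: "nat \<Rightarrow> 'b \<Rightarrow> nat \<Rightarrow> 'b" where
  "hom_rep i y j = (if j = i then y else \<zero>\<^sub>M)"

lemma hom_reps: "y \<in> L i \<Longrightarrow> hom_rep i y \<in> reps"
proof -
  assume y: "y \<in> L i"
  have "hom_rep i y j \<in> L j" for j using y submodule_zero[OF L_submodule] by (simp add: hom_rep_def)
  moreover have "hom_rep i y j \<in> L (Suc j)" if "Suc i \<le> j" for j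
    using that submodule_zero[OF L_submodule, of "Suc j"] by (simp add: hom_rep_def del: ideal_power_module.simps)
  ultimately show ?thesis unfolding reps_def by blast
qed

end

context filtered begin

lemma conv_hom:
  assumes "a \<in> J.L i" "y \<in> reps"
  shows "conv M (J.hom_rep i a) y = (\<lambda>n. if i \<le> n then a \<odot>\<^sub>M y (n - i) else \<zero>\<^sub>M)"
proof
  fix n
  have "conv M (J.hom_rep i a) y n = (if i \<le> n then J.hom_rep i a i \<odot>\<^sub>M y (n - i) else \<zero>\<^sub>M)"
    by (rule M.conv_single) (use reps_carrier[OF assms(2)] J_carrier[OF assms(1)] in \<open>auto simp: J.hom_rep_def\<close>)
  then show "conv M (J.hom_rep i a) y n = (if i \<le> n then a \<odot>\<^sub>M y (n - i) else \<zero>\<^sub>M)" by (simp add: J.hom_rep_def)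
qed

lemma cls_eq_zero_iff:
  assumes "y \<in> reps" shows "cls y = \<zero>\<^bsub>gr\<^esub> \<longleftrightarrow> (\<forall>i. y i \<in> L (Suc i))"
proof -
  have "cls y = \<zero>\<^bsub>gr\<^esub> \<longleftrightarrow> (\<forall>i. y i \<ominus>\<^sub>M \<zero>\<^sub>M \<in> L (Suc i))"
    unfolding gr_zero by (rule cls_eq_iff[OF reps_carrier[OF assms]]) simp
  then show ?thesis using M.M.sub_zero[OF reps_carrier[OF assms]] by simp
qed

end

section \<open>The associated graded ring of a numerical semigroup ring\<close>

context sg_ring begin

abbreviation G where "G \<equiv> gr_ring R mm"

lemma Pw_1_iff: "a \<in> Pw (Suc 0) \<longleftrightarrow> a \<in> mm"
  unfolding Pw_iff mm_iff R_simps(1)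
  using lM_1 lM_ge[of 0 "Suc 0"] mu(2) lM_subset by (metis less_numeral_extra(3) mult_is_0 nat.simps(3) le_zero_eq)

text \<open>A ring homomorphism from the graded ring to power series in one variable. In degree i it
  records the coefficient at \<open>i * mu\<close>, the smallest exponent possible there; all
  representatives agree on it because \<open>i * mu\<close> has order exactly i. Its kernel consists
  of nilpotent elements, which gives access to the prime ideals without a presentation of the
  ring.\<close>

definition lead :: "(nat \<Rightarrow> 'k fps set) \<Rightarrow> 'k fps" where
  "lead f = Abs_fps (\<lambda>i. fps_nth (SOME r. r \<in> f i) (i * mu))"

lemma mult_mu_not_lM: "i * mu \<notin> lM (Suc i)"
proof
  assume "i * mu \<in> lM (Suc i)"
  from lM_ge[OF this] show False using mu(2) by simp
qed

lemma reps_R: "a \<in> powers.reps \<Longrightarrow> a i \<in> carrier R"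
  using powers.reps_carrier[of a i] by (simp only: self_module_simps)

lemma lead_cls:
  assumes a: "a \<in> powers.reps"
  shows "lead (powers.cls a) = Abs_fps (\<lambda>i. fps_nth (a i) (i * mu))"
proof -
  have "fps_nth (SOME r. r \<in> powers.cls a i) (i * mu) = fps_nth (a i) (i * mu)" for i
  proof -
    note ac = powers.reps_carrier[OF a]
    have z: "a i \<ominus>\<^bsub>self_module R\<^esub> a i \<in> Pw (Suc i)"
      using Pw_zero reps_R[OF a, of i] by (simp del: R_simps(1))
    have "a i \<in> powers.cls a i"
      unfolding powers.cls_def using powers.mem_coset_iff[OF ac ac] z by blast
    then have r: "(SOME r. r \<in> powers.cls a i) \<in> powers.cls a i" by (rule someI)
    define r where "r = (SOME r. r \<in> powers.cls a i)"
    have rc: "r \<in> carrier (self_module R)"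
      using r powers.coset_carrier[OF ac] unfolding r_def powers.cls_def by blast
    have "r \<ominus>\<^bsub>self_module R\<^esub> a i \<in> Pw (Suc i)"
      using r powers.mem_coset_iff[OF ac rc] unfolding r_def powers.cls_def by blast
    then have "r - a i \<in> Pw (Suc i)" using reps_R[OF a, of i] by (simp del: R_simps(1))
    then have "fps_nth (r - a i) (i * mu) = 0" unfolding Pw_iff using mult_mu_not_lM by blast
    then show ?thesis by (simp add: r_def)
  qed
  then show ?thesis by (simp add: lead_def)
qed

lemma lead_add:
  assumes "f \<in> carrier G" "g \<in> carrier G"
  shows "lead (f \<oplus>\<^sub>G g) = lead f + lead g"
proof -
  obtain a b where a: "a \<in> powers.reps" "f = powers.cls a" and b: "b \<in> powers.reps" "g = powers.cls b"
    using assms unfolding powers.G_carrier by blast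
  have ab: "(\<lambda>i. a i \<oplus>\<^sub>R b i) \<in> powers.reps" using powers.add_reps[OF a(1) b(1)] by simp
  show ?thesis
    unfolding a(2) b(2) powers.G_add[OF a(1) b(1)] lead_cls[OF a(1)] lead_cls[OF b(1)] lead_cls[OF ab]
    by (simp add: fps_eq_iff)
qed

lemma conv_R:
  assumes "\<And>i. a i \<in> carrier R" "\<And>i. b i \<in> carrier R"
  shows "conv (self_module R) a b n = (\<Sum>i\<in>{..n}. a i * b (n - i))"
  unfolding conv_def finsum_self_module self_module_simps R_simps(2)
  by (rule finsum_R) (auto intro!: mult_closed assms simp del: R_simps(1))

text \<open>Exponents in degree i are at least \<open>i * mu\<close>, so \<open>(i + j) * mu\<close>
  arises only as the sum of the two minimal exponents.\<close>

lemma lead_mult: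
  assumes "f \<in> carrier G" "g \<in> carrier G"
  shows "lead (f \<otimes>\<^sub>G g) = lead f * lead g"
proof -
  obtain a b where a: "a \<in> powers.reps" "f = powers.cls a" and b: "b \<in> powers.reps" "g = powers.cls b"
    using assms unfolding powers.G_carrier by blast
  have "fps_nth (a i * b j) ((i + j) * mu) = fps_nth (a i) (i * mu) * fps_nth (b j) (j * mu)" for i j
  proof -
    let ?n = "(i + j) * mu"
    have "fps_nth (a i * b j) ?n = (\<Sum>u=0..?n. fps_nth (a i) u * fps_nth (b j) (?n - u))" by (simp add: fps_mult_nth)
    also have "\<dots> = (\<Sum>u\<in>{i * mu}. fps_nth (a i) u * fps_nth (b j) (?n - u))"
    proof (rule sum.mono_neutral_right)
      show "\<forall>u\<in>{0..?n} - {i * mu}. fps_nth (a i) u * fps_nth (b j) (?n - u) = 0"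
      proof (rule ballI, rule ccontr)
        fix u assume u: "u \<in> {0..?n} - {i * mu}" and nz: "fps_nth (a i) u * fps_nth (b j) (?n - u) \<noteq> 0"
        have "u \<in> lM i" using powers.reps_L[OF a(1), of i] nz unfolding Pw_iff by auto
        moreover have "?n - u \<in> lM j" using powers.reps_L[OF b(1), of j] nz unfolding Pw_iff by auto
        ultimately have "i * mu \<le> u" "j * mu \<le> ?n - u" using lM_ge by blast+
        then show False using u by (auto simp: add_mult_distrib)
      qed
    qed (auto simp: add_mult_distrib)
    finally show ?thesis by (simp add: add_mult_distrib)
  qed
  then have "fps_nth (conv (self_module R) a b n) (n * mu) =
      (\<Sum>i\<in>{..n}. fps_nth (a i) (i * mu) * fps_nth (b (n - i)) ((n - i) * mu))" for n
    unfolding conv_R[OF reps_R[OF a(1)] reps_R[OF b(1)]] fps_sum_nth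
    by (intro sum.cong[OF refl]) (metis atMost_iff le_add_diff_inverse)
  then show ?thesis
    unfolding a(2) b(2) powers.G_mult[OF a(1) b(1)] lead_cls[OF a(1)] lead_cls[OF b(1)]
      lead_cls[OF powers.conv_reps[OF a(1) b(1)]]
    by (simp add: fps_eq_iff fps_mult_nth atLeast0AtMost)
qed

lemma lead_zero: "lead \<zero>\<^sub>G = 0"
proof -
  have z: "(\<lambda>_. \<zero>\<^sub>R) \<in> powers.reps" using powers.zero_reps by simp
  show ?thesis unfolding powers.G_zero lead_cls[OF z] by (simp add: fps_eq_iff)
qed

lemma lead_one: "lead \<one>\<^sub>G = 1"
  unfolding powers.G_one lead_cls[OF powers.one_reps] by (simp add: fps_eq_iff powers.one_rep_def)

lemma Pw_Suc_iff_0: "a \<in> carrier R \<Longrightarrow> a \<in> Pw (Suc 0) \<longleftrightarrow> fps_nth a 0 = 0"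
  by (simp add: Pw_1_iff mm_iff)

lemma G_component_zero_iff:
  assumes "a \<in> powers.reps"
  shows "powers.cls a i = \<zero>\<^sub>G i \<longleftrightarrow> a i \<in> Pw (Suc i)"
proof -
  have "\<zero>\<^sub>G i = Pw (Suc i)"
    unfolding powers.G_zero powers.cls_def
    using powers.coset_eq_L[of 0 "Suc i"] Pw_zero zero_closed by (simp del: R_simps(1))
  then show ?thesis using powers.coset_eq_L[OF powers.reps_carrier[OF assms]] by (simp add: powers.cls_def)
qed

text \<open>These sets take the place of the powers of the homogeneous maximal ideal, for which
  \<open>high_mult\<close> suffices.\<close>

definition high :: "nat \<Rightarrow> (nat \<Rightarrow> 'k fps set) set" where
  "high i = {f \<in> carrier G. \<forall>j<i. f j = \<zero>\<^sub>G j}"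

lemma high_carrier: "high i \<subseteq> carrier G" by (auto simp: high_def)

lemma high_0: "high 0 = carrier G" by (auto simp: high_def)

lemma gr_plus_eq: "gr_plus R mm = high 1"
  by (auto simp: gr_plus_def high_def)

lemma cls_high_iff: "a \<in> powers.reps \<Longrightarrow> powers.cls a \<in> high i \<longleftrightarrow> (\<forall>j<i. a j \<in> Pw (Suc j))"
  unfolding high_def using G_component_zero_iff powers.G_carrier by auto

lemma gr_plus_lead: "f \<in> carrier G \<Longrightarrow> f \<in> gr_plus R mm \<longleftrightarrow> fps_nth (lead f) 0 = 0"
proof -
  assume "f \<in> carrier G"
  then obtain a where a: "a \<in> powers.reps" "f = powers.cls a" unfolding powers.G_carrier by blast
  show ?thesis
    unfolding gr_plus_eq a(2) cls_high_iff[OF a(1)] lead_cls[OF a(1)] using Pw_Suc_iff_0[OF reps_R[OF a(1)], of 0] by simp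
qed

lemma high_mult:
  assumes f: "f \<in> gr_plus R mm" and g: "g \<in> high i"
  shows "f \<otimes>\<^sub>G g \<in> high (Suc i)"
proof -
  obtain a b where a: "a \<in> powers.reps" "f = powers.cls a" and b: "b \<in> powers.reps" "g = powers.cls b"
    using f g unfolding gr_plus_eq high_def powers.G_carrier by blast
  have a0: "a 0 \<in> Pw (Suc 0)" using f unfolding gr_plus_eq a(2) cls_high_iff[OF a(1)] by simp
  have bi: "b j \<in> Pw (Suc j)" if "j < i" for j using g that unfolding b(2) cls_high_iff[OF b(1)] by simp
  have "conv (self_module R) a b n \<in> Pw (Suc n)" if n: "n < Suc i" for n
    unfolding conv_R[OF reps_R[OF a(1)] reps_R[OF b(1)]]
  proof (rule Pw_sum)
    fix j assume j: "j \<in> {..n}"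
    show "a j * b (n - j) \<in> Pw (Suc n)"
    proof (cases "j = 0")
      case True
      then show ?thesis using Pw_mult[OF a0 powers.reps_L[OF b(1), of n]] by simp
    next
      case False
      then have "b (n - j) \<in> Pw (Suc (n - j))" using bi[of "n - j"] n j by simp
      then have "a j * b (n - j) \<in> Pw (j + Suc (n - j))" by (rule Pw_mult[OF powers.reps_L[OF a(1)]])
      moreover have "j + Suc (n - j) = Suc n" using j by simp
      ultimately show ?thesis by (simp only:)
    qed
  qed simp
  then show ?thesis
    unfolding a(2) b(2) powers.G_mult[OF a(1) b(1)] cls_high_iff[OF powers.conv_reps[OF a(1) b(1)]] by simp
qed

definition xs where "xs = powers.cls (powers.hom_rep (Suc 0) (fps_X ^ mu))"

lemma X_mu_Pw: "fps_X ^ mu \<in> Pw (Suc 0)"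
  unfolding Pw_1_iff using X_power_mm mu by simp

lemma xs_reps: "powers.hom_rep (Suc 0) (fps_X ^ mu) \<in> powers.reps"
  by (rule powers.hom_reps[OF X_mu_Pw])

lemma xs_carrier: "xs \<in> carrier G"
  unfolding xs_def powers.G_carrier using xs_reps by blast

lemma xs_mult:
  assumes "b \<in> powers.reps"
  shows "xs \<otimes>\<^sub>G powers.cls b = powers.cls (\<lambda>n. if 1 \<le> n then fps_X ^ mu * b (n - 1) else 0)"
  unfolding xs_def powers.G_mult[OF xs_reps assms] powers.conv_hom[OF X_mu_Pw assms] by (simp cong: if_cong)

lemma lead_xs: "lead xs = fps_X"
  unfolding xs_def lead_cls[OF xs_reps] by (auto simp: fps_eq_iff powers.hom_rep_def)

lemma xs_plus: "xs \<in> gr_plus R mm"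
  unfolding gr_plus_lead[OF xs_carrier] lead_xs by simp

text \<open>By \<open>reduction\<close>, in high degrees every exponent occurring in a power of the
  maximal ideal is \<open>mu\<close> plus an exponent of the preceding power, so each component can
  be divided by t^mu.\<close>

lemma high_multiple:
  obtains N where "\<And>f. f \<in> high N \<Longrightarrow> \<exists>g\<in>carrier G. f = xs \<otimes>\<^sub>G g"
proof -
  obtain N where N: "\<And>i s. N \<le> i \<Longrightarrow> s \<in> lM (Suc i) \<Longrightarrow> \<exists>u\<in>lM i. s = u + mu" using reduction by blast
  define sh where "sh a = Abs_fps (\<lambda>n. fps_nth a (n + mu))" for a :: "'k fps"
  have sh_Pw: "sh a \<in> Pw k" if "N \<le> k" "a \<in> Pw (Suc k)" for a k
    unfolding Pw_iff
  proof (intro allI impI)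
    fix n assume "fps_nth (sh a) n \<noteq> 0"
    then have "n + mu \<in> lM (Suc k)" using that(2) unfolding Pw_iff by (simp add: sh_def)
    then show "n \<in> lM k" using N[OF that(1)] by fastforce
  qed
  have sh_eq: "a = fps_X ^ mu * sh a" if ka: "N \<le> k" "a \<in> Pw (Suc k)" for a k
  proof (rule fps_ext)
    fix n
    show "fps_nth a n = fps_nth (fps_X ^ mu * sh a) n"
    proof (cases "fps_nth a n = 0")
      case True
      then show ?thesis by (simp add: fps_X_power_mult_nth sh_def)
    next
      case False
      then have "n \<in> lM (Suc k)" using ka(2) unfolding Pw_iff by blast
      then obtain u where "n = u + mu" using N[OF ka(1)] by blast
      then show ?thesis by (simp add: fps_X_power_mult_nth sh_def)
    qed
  qed
  show ?thesis
  proof (rule that[of "Suc N"])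
    fix f assume f: "f \<in> high (Suc N)"
    then obtain a where a: "a \<in> powers.reps" "f = powers.cls a" unfolding high_def powers.G_carrier by blast
    have aN: "a j \<in> Pw (Suc j)" if "j \<le> N" for j using f that unfolding a(2) cls_high_iff[OF a(1)] by simp
    obtain A where A: "\<And>i. A \<le> i \<Longrightarrow> a i \<in> Pw (Suc i)" using a(1) unfolding powers.reps_def by blast
    \<comment> \<open>Below degree N the quotient is zero; the components of f that would correspond
      to it vanish in the graded ring.\<close>
    define b where "b j = (if N \<le> j then sh (a (Suc j)) else 0)" for j
    have b: "b \<in> powers.reps"
      unfolding powers.reps_def
    proof (intro CollectI conjI allI exI impI)
      show "b j \<in> Pw j" for j
        using sh_Pw powers.reps_L[OF a(1), of "Suc j"] Pw_zero by (simp add: b_def)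
      show "b j \<in> Pw (Suc j)" if "A \<le> j" for j
        using sh_Pw[of "Suc j" "a (Suc j)"] A[of "Suc j"] that Pw_zero by (simp add: b_def)
    qed
    let ?c = "\<lambda>n. if 1 \<le> n then fps_X ^ mu * b (n - 1) else 0"
    have cR: "?c n \<in> carrier (self_module R)" for n
      using mult_closed[OF X_power_closed[OF mu(1)] reps_R[OF b]] zero_in by (auto simp del: R_simps(1) simp: zero_closed[simplified])
    have "f = powers.cls ?c"
      unfolding a(2)
    proof (subst powers.cls_eq_iff[OF powers.reps_carrier[OF a(1)] cR], rule allI)
      fix i
      have d: "a i \<ominus>\<^bsub>self_module R\<^esub> ?c i = a i - ?c i" using cR[of i] by (simp del: R_simps(1))
      show "a i \<ominus>\<^bsub>self_module R\<^esub> ?c i \<in> Pw (Suc i)"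
      proof (cases "i \<le> N")
        case True
        then have "?c i = 0" by (auto simp: b_def)
        then show ?thesis unfolding d using aN[OF True] by simp
      next
        case False
        then obtain k where k: "i = Suc k" "N \<le> k" by (cases i) auto
        have "a i = ?c i" using sh_eq[OF k(2), of "a (Suc k)"] powers.reps_L[OF a(1), of "Suc k"] k by (simp add: b_def)
        then show ?thesis unfolding d using Pw_zero by simp
      qed
    qed
    then have "f = xs \<otimes>\<^sub>G powers.cls b" using xs_mult[OF b] by simp
    then show "\<exists>g\<in>carrier G. f = xs \<otimes>\<^sub>G g" unfolding powers.G_carrier using b by blast
  qed
qed

text \<open>The element g is built from monomials at multiples of \<open>mu\<close> only. With d the
  order of \<open>lead f\<close> it has nonzero constant term, and f agrees with the d-th power of
  \<open>xs\<close> times g up to the kernel of \<open>lead\<close>.\<close>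

lemma lead_shift:
  assumes "f \<in> carrier G" obtains g where "g \<in> carrier G" "lead g = fps_shift d (lead f)"
proof -
  obtain a where a: "a \<in> powers.reps" "f = powers.cls a" using assms unfolding powers.G_carrier by blast
  obtain A where A: "\<And>i. A \<le> i \<Longrightarrow> a i \<in> Pw (Suc i)" using a(1) unfolding powers.reps_def by blast
  define b where "b j = fps_const (fps_nth (a (j + d)) ((j + d) * mu)) * fps_X ^ (j * mu)" for j
  have b: "b \<in> powers.reps"
    unfolding powers.reps_def
  proof (intro CollectI conjI allI exI impI)
    show "b j \<in> Pw j" for j unfolding b_def by (rule Pw_mult_R[OF const_closed X_power_Pw[OF mult_mu_lM]])
    show "b j \<in> Pw (Suc j)" if "A \<le> j" for j
    proof -
      have "fps_nth (a (j + d)) ((j + d) * mu) = 0"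
        using A[of "j + d"] that mult_mu_not_lM[of "j + d"] unfolding Pw_iff by auto
      then show ?thesis using Pw_zero by (simp add: b_def)
    qed
  qed
  have "lead (powers.cls b) = fps_shift d (lead f)"
    unfolding a(2) lead_cls[OF a(1)] lead_cls[OF b] by (simp add: fps_eq_iff b_def)
  then show ?thesis using that b powers.G_carrier by blast
qed

text \<open>If the coefficients at the minimal exponents vanish, the exponents in degree i exceed
  \<open>i * mu\<close> by at least 1, and in the k-th power by at least k. Once the excess is
  larger than all Apery elements, every exponent has order larger than its degree.\<close>

lemma lead_zero_nilpotent:
  assumes G: "cring G" and f: "f \<in> carrier G" "lead f = 0"
  shows "\<exists>k::nat. f [^]\<^sub>G k = \<zero>\<^sub>G"
proof -
  interpret G: cring G by fact
  obtain a where a: "a \<in> powers.reps" "f = powers.cls a" using f unfolding powers.G_carrier by blast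
  define E where "E k b \<longleftrightarrow> (\<forall>i n. fps_nth (b i) n \<noteq> 0 \<longrightarrow> i * mu + k \<le> n)" for k :: nat and b :: "nat \<Rightarrow> 'k fps"
  have a1: "E 1 a"
    unfolding E_def
  proof (intro allI impI)
    fix i n assume n: "fps_nth (a i) n \<noteq> 0"
    then have "i * mu \<le> n" using powers.reps_L[OF a(1), of i] lM_ge unfolding Pw_iff by blast
    moreover have "n \<noteq> i * mu"
      using n f(2) unfolding a(2) lead_cls[OF a(1)] by (metis fps_nth_Abs_fps fps_zero_nth)
    ultimately show "i * mu + 1 \<le> n" by simp
  qed
  have pow: "\<exists>b\<in>powers.reps. f [^]\<^sub>G k = powers.cls b \<and> E k b" for k :: nat
  proof (induction k)
    case 0
    have "E 0 powers.one_rep" by (auto simp: E_def powers.one_rep_def split: if_splits)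
    then show ?case using powers.one_reps powers.G_one by (intro bexI[of _ powers.one_rep]) auto
  next
    case (Suc k)
    then obtain b where b: "b \<in> powers.reps" "f [^]\<^sub>G k = powers.cls b" "E k b" by blast
    have "E (Suc k) (conv (self_module R) b a)"
      unfolding E_def
    proof (intro allI impI)
      fix i n assume "fps_nth (conv (self_module R) b a i) n \<noteq> 0"
      then have "(\<Sum>j\<in>{..i}. fps_nth (b j * a (i - j)) n) \<noteq> 0"
        unfolding conv_R[OF reps_R[OF b(1)] reps_R[OF a(1)]] fps_sum_nth .
      then obtain j where j: "j \<in> {..i}" "fps_nth (b j * a (i - j)) n \<noteq> 0"
        by (rule sum.not_neutral_contains_not_neutral)
      obtain u v where uv: "n = u + v" "fps_nth (b j) u \<noteq> 0" "fps_nth (a (i - j)) v \<noteq> 0"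
        using j(2) by (rule nonzero_mult_nth)
      have 1: "j * mu + k \<le> u" "(i - j) * mu + 1 \<le> v" using b(3) a1 uv unfolding E_def by blast+
      have 2: "j * mu + (i - j) * mu = i * mu" using j(1) by (simp flip: add_mult_distrib)
      show "i * mu + Suc k \<le> n" using 1 2 uv(1) by linarith
    qed
    then show ?case
      using powers.G_mult[OF b(1) a(1)] powers.conv_reps[OF b(1) a(1)] b(2) a(2) by auto
  qed
  define W where "W = Suc (Max (Ap S mu))"
  obtain b where b: "b \<in> powers.reps" "f [^]\<^sub>G W = powers.cls b" "E W b" using pow by blast
  have "b i \<in> Pw (Suc i)" for i
    unfolding Pw_iff
  proof (intro allI impI)
    fix n assume n: "fps_nth (b i) n \<noteq> 0"
    have "n \<in> S" using n reps_R[OF b(1), of i] by simp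
    then obtain w c where wc: "w \<in> Ap S mu" "n = w + c * mu" by (rule Ap_decomp)
    have "w < W" using Max_ge[OF finite_Ap wc(1)] by (simp add: W_def)
    moreover have "i * mu + W \<le> n" using b(3) n unfolding E_def by blast
    ultimately have "i * mu < c * mu" using wc(2) by linarith
    then have "Suc i \<le> c" by simp
    moreover have "n \<in> lM c" using lM_add_S[OF mult_mu_lM Ap_S[OF wc(1)]] wc(2) by (simp add: add.commute)
    ultimately show "n \<in> lM (Suc i)" by (rule lM_mono)
  qed
  then have "powers.cls b = powers.cls (\<lambda>_. \<zero>\<^sub>R)"
    using powers.cls_eq_zero_iff[OF b(1)] powers.gr_zero by simp
  then show ?thesis using b(2) powers.G_zero by auto
qed

end

section \<open>The height of the homogeneous maximal ideal and the regularity of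
  \<open>xs\<close>\<close>

locale sg_graded = sg_ring + assumes G: "cring G"
begin

sublocale G: cring G by (rule G)

lemma lead_uminus: "f \<in> carrier G \<Longrightarrow> lead (\<ominus>\<^sub>G f) = - lead f"
  using lead_add[of "\<ominus>\<^sub>G f" f] lead_zero by (simp add: G.l_neg eq_neg_iff_add_eq_0)

lemma lead_minus: "f \<in> carrier G \<Longrightarrow> g \<in> carrier G \<Longrightarrow> lead (f \<ominus>\<^sub>G g) = lead f - lead g"
  by (simp add: a_minus_def lead_add lead_uminus)

lemma lead_ideal:
  assumes "0 \<in> T" "\<And>a b. a \<in> T \<Longrightarrow> b \<in> T \<Longrightarrow> a + b \<in> T" "\<And>a b. a \<in> T \<Longrightarrow> b * a \<in> T"
  shows "ideal {f \<in> carrier G. lead f \<in> T} G"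
  by (rule cring_idealI[OF G]) (use assms lead_zero lead_add lead_mult in auto)

lemma gr_plus_set: "gr_plus R mm = {f \<in> carrier G. lead f \<in> {h. fps_nth h 0 = 0}}"
  using gr_plus_lead high_carrier[of 1] gr_plus_eq by auto

definition const where "const c = powers.cls (powers.hom_rep 0 (fps_const c))"

lemma const_reps: "powers.hom_rep 0 (fps_const c) \<in> powers.reps"
  by (rule powers.hom_reps) (use const_closed in simp)

lemma const_carrier: "const c \<in> carrier G"
  unfolding const_def powers.G_carrier using const_reps by blast

lemma lead_const: "lead (const c) = fps_const c"
  unfolding const_def lead_cls[OF const_reps] by (auto simp: fps_eq_iff powers.hom_rep_def)

lemma maximal_plus: "maximalideal (gr_plus R mm) G"
proof (rule maximalidealI)
  show "ideal (gr_plus R mm) G" unfolding gr_plus_set by (rule lead_ideal) auto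
  show "carrier G \<noteq> gr_plus R mm"
    using gr_plus_lead[OF G.one_closed] lead_one G.one_closed by auto
  fix J assume J: "ideal J G" "gr_plus R mm \<subseteq> J" "J \<subseteq> carrier G"
  interpret J: ideal J G by (rule J(1))
  show "J = gr_plus R mm \<or> J = carrier G"
  proof (rule disjCI)
    assume "J \<noteq> carrier G"
    have "f \<in> gr_plus R mm" if f: "f \<in> J" for f
    proof (rule ccontr)
      assume "f \<notin> gr_plus R mm"
      have fc: "f \<in> carrier G" using f J(3) by blast
      define c where "c = fps_nth (lead f) 0"
      have c: "c \<noteq> 0" using gr_plus_lead[OF fc] \<open>f \<notin> _\<close> by (simp add: c_def)
      \<comment> \<open>Scaling f by the inverse of its constant term makes it congruent to 1 modulo
        \<open>gr_plus R mm\<close>.\<close>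
      let ?g = "const (inverse c) \<otimes>\<^sub>G f"
      have gc: "?g \<in> carrier G" using const_carrier fc by simp
      have "fps_nth (lead (\<one>\<^sub>G \<ominus>\<^sub>G ?g)) 0 = 0"
        using lead_minus[OF G.one_closed gc] lead_mult[OF const_carrier fc] lead_one lead_const c
        by (simp add: c_def)
      then have "\<one>\<^sub>G \<ominus>\<^sub>G ?g \<in> J" using J(2) gr_plus_lead[of "\<one>\<^sub>G \<ominus>\<^sub>G ?g"] gc by auto
      moreover have "?g \<in> J" using J.I_l_closed[OF f const_carrier] .
      ultimately have "(\<one>\<^sub>G \<ominus>\<^sub>G ?g) \<oplus>\<^sub>G ?g \<in> J" by (rule J.a_closed)
      then have "\<one>\<^sub>G \<in> J" using G.sub_add_cancel[OF G.one_closed gc] by simp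
      then show False using J.one_imp_carrier \<open>J \<noteq> carrier G\<close> by blast
    qed
    then show "J = gr_plus R mm" using J(2) by blast
  qed
qed

lemma pow_high: "f \<in> gr_plus R mm \<Longrightarrow> f [^]\<^sub>G (k::nat) \<in> high k"
proof (induction k)
  case 0 then show ?case by (simp add: high_0)
next
  case (Suc k)
  have "f \<in> carrier G" using Suc.prems by (simp add: gr_plus_set)
  then show ?case using high_mult[OF Suc.prems Suc.IH[OF Suc.prems]] by (simp add: G.m_comm)
qed

text \<open>The kernel Q of \<open>lead\<close> is the only prime strictly below the homogeneous
  maximal ideal: nilpotence puts Q into every prime, and modulo Q a nonzero element is a power of
  \<open>xs\<close> times an element with nonzero constant term.\<close>

lemma height_plus: "height G (gr_plus R mm) = enat 1"
proof -
  define Q where "Q = {f \<in> carrier G. lead f \<in> {0}}"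
  have Q: "primeideal Q G"
  proof (rule primeidealI)
    show "ideal Q G" unfolding Q_def by (rule lead_ideal) auto
    show "carrier G \<noteq> Q"
    proof
      assume "carrier G = Q"
      then have "\<one>\<^sub>G \<in> Q" using G.one_closed by simp
      then show False using lead_one by (simp add: Q_def)
    qed
    show "f \<in> Q \<or> g \<in> Q" if "f \<in> carrier G" "g \<in> carrier G" "f \<otimes>\<^sub>G g \<in> Q" for f g
      using that lead_mult by (auto simp: Q_def)
  qed (rule G)
  have P: "primeideal (gr_plus R mm) G" by (rule G.maximalideal_prime[OF maximal_plus])
  have QP: "Q \<subset> gr_plus R mm"
  proof (rule psubsetI)
    show "Q \<subseteq> gr_plus R mm" by (auto simp: Q_def gr_plus_set)
    have "xs \<notin> Q" using lead_xs by (simp add: Q_def)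
    then show "Q \<noteq> gr_plus R mm" using xs_plus by blast
  qed
  show ?thesis
  proof (rule height_eq_one[OF Q P QP])
    fix P' assume P': "primeideal P' G" "P' \<subset> gr_plus R mm"
    interpret P': primeideal P' G by (rule P'(1))
    \<comment> \<open>A prime containing \<open>xs\<close> contains the homogeneous maximal ideal,
      because high powers of elements of that ideal are multiples of \<open>xs\<close>.\<close>
    have xs: "xs \<notin> P'"
    proof
      assume x: "xs \<in> P'"
      obtain N where N: "\<And>f. f \<in> high N \<Longrightarrow> \<exists>g\<in>carrier G. f = xs \<otimes>\<^sub>G g" using high_multiple by blast
      have "gr_plus R mm \<subseteq> P'"
      proof
        fix f assume f: "f \<in> gr_plus R mm"
        then obtain g where "g \<in> carrier G" "f [^]\<^sub>G N = xs \<otimes>\<^sub>G g" using N[OF pow_high] by blast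
        then have "f [^]\<^sub>G N \<in> P'" using P'.I_r_closed[OF x] by simp
        moreover have "f \<in> carrier G" using f by (simp add: gr_plus_set)
        ultimately show "f \<in> P'" using prime_pow_mem[OF P'(1)] by blast
      qed
      then show False using P'(2) by blast
    qed
    have QP': "Q \<subseteq> P'"
    proof
      fix f assume "f \<in> Q"
      then have f: "f \<in> carrier G" "lead f = 0" by (auto simp: Q_def)
      obtain k :: nat where "f [^]\<^sub>G k = \<zero>\<^sub>G" using lead_zero_nilpotent[OF G f] by blast
      then have "f [^]\<^sub>G k \<in> P'" using P'.zero_closed by simp
      then show "f \<in> P'" by (rule prime_pow_mem[OF P'(1) f(1)])
    qed
    moreover have "P' \<subseteq> Q"
    proof (rule subsetI, rule ccontr)
      fix f assume f: "f \<in> P'" "f \<notin> Q"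
      have fc: "f \<in> carrier G" by (rule P'.a_Hcarr[OF f(1)])
      have nz: "lead f \<noteq> 0" using f fc by (auto simp: Q_def)
      define n where "n = subdegree (lead f)"
      obtain g where g: "g \<in> carrier G" "lead g = fps_shift n (lead f)" by (rule lead_shift[OF fc])
      have xn: "xs [^]\<^sub>G n \<in> carrier G" using xs_carrier by simp
      have "lead (xs [^]\<^sub>G k) = fps_X ^ k" for k :: nat
        by (induction k) (simp_all add: lead_one lead_mult lead_xs xs_carrier mult.commute)
      then have "lead (xs [^]\<^sub>G n \<otimes>\<^sub>G g) = lead f"
        using lead_mult[OF xn g(1)] g(2) subdegree_decompose[of "lead f"] by (simp add: n_def mult.commute)
      then have "f \<ominus>\<^sub>G xs [^]\<^sub>G n \<otimes>\<^sub>G g \<in> Q" using lead_minus fc xn g(1) by (simp add: Q_def)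
      then have "f \<ominus>\<^sub>G xs [^]\<^sub>G n \<otimes>\<^sub>G g \<in> P'" using QP' by blast
      then have "f \<ominus>\<^sub>G (f \<ominus>\<^sub>G xs [^]\<^sub>G n \<otimes>\<^sub>G g) \<in> P'"
        unfolding a_minus_def using f(1) P'.a_closed P'.a_inv_closed by blast
      moreover have "f \<ominus>\<^sub>G (f \<ominus>\<^sub>G xs [^]\<^sub>G n \<otimes>\<^sub>G g) = xs [^]\<^sub>G n \<otimes>\<^sub>G g"
        using fc xn g(1) by (simp add: a_minus_def G.minus_add G.a_assoc[symmetric] G.r_neg)
      ultimately have "xs [^]\<^sub>G n \<in> P' \<or> g \<in> P'" using P'.I_prime[OF xn g(1)] by simp
      then have "g \<in> P'" using xs prime_pow_mem[OF P'(1) xs_carrier] by blast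
      then have "fps_nth (lead g) 0 = 0" using P'(2) gr_plus_lead[OF g(1)] by blast
      then show False using g(2) nz by (simp add: n_def)
    qed
    ultimately show "P' = Q" by blast
  qed
qed

text \<open>Grade one supplies a regular element y in the homogeneous maximal ideal. Some power of y
  is a multiple of \<open>xs\<close>, so whatever \<open>xs\<close> kills is killed by that
  power.\<close>

lemma xs_regular:
  assumes cm: "cohen_macaulay G" and z: "z \<in> carrier G" "xs \<otimes>\<^sub>G z = \<zero>\<^sub>G"
  shows "z = \<zero>\<^sub>G"
proof -
  have "grade G (gr_plus R mm) = enat 1"
    using cm maximal_plus height_plus by (simp add: cohen_macaulay_def)
  moreover have "grade G (gr_plus R mm) \<le> 0" if "\<And>ys. regular_sequence G ys \<Longrightarrow> set ys \<subseteq> gr_plus R mm \<Longrightarrow> ys = []"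
    unfolding grade_def by (rule Sup_least) (use that in \<open>auto simp: zero_enat_def\<close>)
  ultimately obtain ys where ys: "regular_sequence G ys" "set ys \<subseteq> gr_plus R mm" "ys \<noteq> []"
    by (metis enat_ord_simps(1) not_one_le_zero zero_enat_def)
  define y where "y = ys ! 0"
  have y: "y \<in> gr_plus R mm" using ys(2,3) nth_mem[of 0 ys] by (auto simp: y_def)
  then have yc: "y \<in> carrier G" by (simp add: gr_plus_set)
  have "genideal G {} \<subseteq> {\<zero>\<^sub>G}" by (rule G.genideal_minimal[OF G.zeroideal]) simp
  then have g0: "genideal G {} = {\<zero>\<^sub>G}"
    using additive_subgroup.zero_closed[OF ideal.axioms(1)[OF G.genideal_ideal[of "{}"]]] by auto
  have reg: "a = \<zero>\<^sub>G" if "a \<in> carrier G" "y \<otimes>\<^sub>G a = \<zero>\<^sub>G" for a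
    using ys(1,3) that g0 unfolding regular_sequence_def y_def by (metis length_greater_0_conv set_empty singletonD singletonI take_0)
  have pow: "a = \<zero>\<^sub>G" if "a \<in> carrier G" "y [^]\<^sub>G k \<otimes>\<^sub>G a = \<zero>\<^sub>G" for a and k :: nat
    using that
  proof (induction k arbitrary: a)
    case (Suc k)
    have "y [^]\<^sub>G k \<otimes>\<^sub>G (y \<otimes>\<^sub>G a) = \<zero>\<^sub>G" using Suc.prems yc by (simp add: G.m_assoc)
    then have "y \<otimes>\<^sub>G a = \<zero>\<^sub>G" using Suc.IH[of "y \<otimes>\<^sub>G a"] Suc.prems yc by simp
    then show ?case by (rule reg[OF Suc.prems(1)])
  qed simp
  obtain N where "\<And>f. f \<in> high N \<Longrightarrow> \<exists>g\<in>carrier G. f = xs \<otimes>\<^sub>G g" using high_multiple by blast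
  then obtain g where g: "g \<in> carrier G" "y [^]\<^sub>G N = xs \<otimes>\<^sub>G g" using pow_high[OF y] by blast
  have "y [^]\<^sub>G N \<otimes>\<^sub>G z = g \<otimes>\<^sub>G (xs \<otimes>\<^sub>G z)"
    using g xs_carrier z(1) by (simp add: G.m_comm[of xs g] G.m_assoc)
  then have "y [^]\<^sub>G N \<otimes>\<^sub>G z = \<zero>\<^sub>G" using z g(1) by simp
  then show ?thesis by (rule pow[OF z(1)])
qed

text \<open>Were the order of \<open>s + mu\<close> larger, the class of t^s in degree
  \<open>ord s\<close> would be a nonzero element killed by \<open>xs\<close>.\<close>

lemma ord_linear:
  assumes cm: "cohen_macaulay G" and s: "s \<in> S"
  shows "ord (s + mu) = Suc (ord s)"
proof (rule antisym)
  have sm: "s + mu \<in> S" by (rule add_in[OF s mu(1)])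
  have "1 \<le> ord mu" using lM_iff[OF mu(1), of "Suc 0"] lM_1[OF mu(1)] mu(2) by simp
  then show "Suc (ord s) \<le> ord (s + mu)" using ord_add[OF s mu(1)] by simp
  show "ord (s + mu) \<le> Suc (ord s)"
  proof (rule ccontr)
    assume "\<not> ?thesis"
    then have big: "s + mu \<in> lM (Suc (Suc (ord s)))" using lM_iff[OF sm, of "Suc (Suc (ord s))"] by simp
    have sL: "s \<in> lM (ord s)" using lM_iff[OF s] by simp
    let ?z = "powers.hom_rep (ord s) (fps_X ^ s)"
    have z: "?z \<in> powers.reps" by (rule powers.hom_reps[OF X_power_Pw[OF sL]])
    let ?w = "\<lambda>n. if 1 \<le> n then fps_X ^ mu * ?z (n - 1) else 0"
    have wr: "?w \<in> powers.reps"
      using powers.conv_reps[OF xs_reps z] unfolding powers.conv_hom[OF X_mu_Pw z] by (simp cong: if_cong)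
    have "?w n \<in> Pw (Suc n)" for n
    proof (cases "n = Suc (ord s)")
      case True
      then have "?w n = fps_X ^ (s + mu)" by (simp add: powers.hom_rep_def power_add mult.commute)
      then show ?thesis using X_power_Pw[OF big] True by simp
    next
      case False
      then have "?w n = 0" by (auto simp: powers.hom_rep_def)
      then show ?thesis using Pw_zero by simp
    qed
    then have "powers.cls ?w = \<zero>\<^sub>G"
      using powers.cls_eq_zero_iff[OF wr] powers.gr_zero powers.G_zero by simp
    then have "xs \<otimes>\<^sub>G powers.cls ?z = \<zero>\<^sub>G" using xs_mult[OF z] by simp
    then have "powers.cls ?z = \<zero>\<^sub>G" using xs_regular[OF cm] z powers.G_carrier by blast
    then have "?z (ord s) \<in> Pw (Suc (ord s))"
      using powers.cls_eq_zero_iff[OF z] powers.gr_zero powers.G_zero by simp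
    then have "fps_X ^ s \<in> Pw (Suc (ord s))" by (simp add: powers.hom_rep_def)
    then have "s \<in> lM (Suc (ord s))" unfolding Pw_iff by simp
    then show False using lM_iff[OF s, of "Suc (ord s)"] by simp
  qed
qed

end

section \<open>The associated graded module of the canonical module\<close>

text \<open>The canonical module enters the graded argument only through regularity of the monomials
  and through the functionals of all nonzero q in S.\<close>

locale sg_dual = sg_ring S R mm for S and R :: "'k::field fps ring" and mm +
  fixes M :: "('k fps, 'b) module"
  assumes M: "module R M"
    and regular: "q \<in> S \<Longrightarrow> q \<noteq> 0 \<Longrightarrow> y \<in> carrier M \<Longrightarrow> fps_X ^ q \<odot>\<^sub>M y = \<zero>\<^sub>M \<Longrightarrow> y = \<zero>\<^sub>M"
    and dual: "q \<in> S \<Longrightarrow> q \<noteq> 0 \<Longrightarrow> \<exists>\<tau>. dualizing S M q \<tau>"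
begin

sublocale W: filtered R mm M by (simp add: filtered_def M mm.is_ideal)

lemma W_smult: "f \<in> carrier R \<Longrightarrow> y \<in> carrier M \<Longrightarrow> f \<odot>\<^sub>M y \<in> carrier M"
  by (rule W.M.smult_closed)

lemma W_X: "s \<in> S \<Longrightarrow> y \<in> carrier M \<Longrightarrow> fps_X ^ s \<odot>\<^sub>M y \<in> carrier M"
  by (rule W_smult[OF X_power_closed])

lemma smult_mult: "f \<in> carrier R \<Longrightarrow> g \<in> carrier R \<Longrightarrow> y \<in> carrier M \<Longrightarrow> (f * g) \<odot>\<^sub>M y = f \<odot>\<^sub>M (g \<odot>\<^sub>M y)"
  using W.M.smult_assoc1[of f g y] by (simp del: R_simps(1))

lemma X_add: "a \<in> S \<Longrightarrow> b \<in> S \<Longrightarrow> y \<in> carrier M \<Longrightarrow> fps_X ^ (a + b) \<odot>\<^sub>M y = fps_X ^ a \<odot>\<^sub>M (fps_X ^ b \<odot>\<^sub>M y)"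
  using smult_mult[OF X_power_closed X_power_closed] by (simp add: power_add)

lemma Pw_L: "f \<in> Pw i \<Longrightarrow> y \<in> W.L j \<Longrightarrow> f \<odot>\<^sub>M y \<in> W.L (i + j)"
  by (rule W.J_L)

lemma L_add: "y \<in> W.L i \<Longrightarrow> z \<in> W.L i \<Longrightarrow> y \<oplus>\<^sub>M z \<in> W.L i"
  by (rule W.M.submoduleE(5)[OF W.L_submodule])

lemma L_diff: "y \<in> W.L i \<Longrightarrow> z \<in> W.L i \<Longrightarrow> y \<ominus>\<^sub>M z \<in> W.L i"
  by (rule W.M.submodule_diff[OF W.L_submodule])

lemma L_smult: "f \<in> carrier R \<Longrightarrow> y \<in> W.L i \<Longrightarrow> f \<odot>\<^sub>M y \<in> W.L i"
  by (rule W.M.submoduleE(4)[OF W.L_submodule])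

lemma L_zero: "\<zero>\<^sub>M \<in> W.L i"
  by (rule submodule_zero[OF W.L_submodule])

section \<open>Powers of the maximal ideal seen through a dualizing functional\<close>

context
  fixes q \<tau> assumes q: "q \<in> S" "q \<noteq> 0" and tau: "dualizing S M q \<tau>"
begin

lemma tau_k: "k_functional M \<tau>" using tau by (simp add: dualizing_def)

lemma tau_add: "x \<in> carrier M \<Longrightarrow> y \<in> carrier M \<Longrightarrow> \<tau> (x \<oplus>\<^sub>M y) = \<tau> x + \<tau> y"
  and tau_const: "y \<in> carrier M \<Longrightarrow> \<tau> (fps_const c \<odot>\<^sub>M y) = c * \<tau> y"
  using tau_k by (auto simp: k_functional_def)

lemma tau_q: "y \<in> carrier M \<Longrightarrow> \<tau> (fps_X ^ q \<odot>\<^sub>M y) = 0"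
  using tau by (simp add: dualizing_def)

lemma tau_zero: "\<tau> \<zero>\<^sub>M = 0" by (rule k_functional_zero[OF M tau_k])

lemma tau_uminus: "y \<in> carrier M \<Longrightarrow> \<tau> (\<ominus>\<^sub>M y) = - \<tau> y"
  using tau_add[of "\<ominus>\<^sub>M y" y] tau_zero by (simp add: W.M.M.l_neg eq_neg_iff_add_eq_0)

lemma tau_diff: "x \<in> carrier M \<Longrightarrow> y \<in> carrier M \<Longrightarrow> \<tau> (x \<ominus>\<^sub>M y) = \<tau> x - \<tau> y"
  by (simp add: a_minus_def tau_add tau_uminus)

lemma tau_X_q: "s \<in> S \<Longrightarrow> y \<in> carrier M \<Longrightarrow> \<tau> (fps_X ^ s \<odot>\<^sub>M (fps_X ^ q \<odot>\<^sub>M y)) = 0"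
  using tau_q[OF W_X[of s y]] X_add[of s q y] X_add[of q s y] q(1) by (simp add: add.commute)

lemma tau_not_Ap: "s \<in> S \<Longrightarrow> s \<notin> Ap S q \<Longrightarrow> y \<in> carrier M \<Longrightarrow> \<tau> (fps_X ^ s \<odot>\<^sub>M y) = 0"
  using Ap_cases[of s q] X_add[OF _ q(1), of _ y] tau_X_q by metis

lemma tau_expansion: "f \<in> carrier R \<Longrightarrow> y \<in> carrier M \<Longrightarrow>
    \<tau> (f \<odot>\<^sub>M y) = (\<Sum>s\<in>Ap S q. fps_nth f s * \<tau> (fps_X ^ s \<odot>\<^sub>M y))"
  by (rule k_functional_expansion[OF M tau_k q(1) tau_q])

text \<open>By \<open>L_vanishing\<close> and \<open>vanishing_decomp\<close> this is the i-th power
  of the maximal ideal times M, plus t^q M.\<close>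

definition vanishing where
  "vanishing i = {y \<in> carrier M. \<forall>s\<in>Ap S q. \<not> reaches S q i s \<longrightarrow> \<tau> (fps_X ^ s \<odot>\<^sub>M y) = 0}"

text \<open>The product of t^s and f has exponents s + v with v of order at least j. If s + v
  reaches i, then s reaches i + j; so for an s that does not, every term of the expansion is
  zero.\<close>

lemma vanishing_smult:
  assumes f: "f \<in> Pw j" and y: "y \<in> vanishing i"
  shows "f \<odot>\<^sub>M y \<in> vanishing (i + j)"
proof -
  have fR: "f \<in> carrier R" using f powers.L_carrier by simp
  have yc: "y \<in> carrier M" using y by (simp add: vanishing_def)
  have "\<tau> (fps_X ^ s \<odot>\<^sub>M (f \<odot>\<^sub>M y)) = 0" if s: "s \<in> Ap S q" "\<not> reaches S q (i + j) s" for s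
  proof -
    have Xs: "fps_X ^ s \<in> carrier R" by (rule X_power_closed[OF Ap_S[OF s(1)]])
    have "\<tau> (fps_X ^ s \<odot>\<^sub>M (f \<odot>\<^sub>M y)) = (\<Sum>s'\<in>Ap S q. fps_nth (fps_X ^ s * f) s' * \<tau> (fps_X ^ s' \<odot>\<^sub>M y))"
      using tau_expansion[OF mult_closed[OF Xs fR] yc] smult_mult[OF Xs fR yc] by simp
    also have "\<dots> = 0"
    proof (rule sum.neutral, rule ballI)
      fix s' assume s': "s' \<in> Ap S q"
      show "fps_nth (fps_X ^ s * f) s' * \<tau> (fps_X ^ s' \<odot>\<^sub>M y) = 0"
      proof (cases "fps_nth (fps_X ^ s * f) s' = 0")
        case False
        then have "s \<le> s'" "fps_nth f (s' - s) \<noteq> 0" by (auto simp: fps_X_power_mult_nth split: if_splits)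
        then obtain v where v: "s' = s + v" "v \<in> lM j" using f unfolding Pw_iff by (metis le_add_diff_inverse)
        have "\<not> reaches S q i s'"
        proof
          assume "reaches S q i s'"
          then obtain u where "u \<in> lM i" "s' + u \<in> Ap S q" by (auto simp: reaches_def)
          then have "u + v \<in> lM (i + j)" "s + (u + v) \<in> Ap S q" using lM_add v by (auto simp: ac_simps)
          then show False using s(2) by (auto simp: reaches_def)
        qed
        then show ?thesis using y s' by (simp add: vanishing_def)
      qed simp
    qed
    finally show ?thesis .
  qed
  then show ?thesis using W_smult[OF fR yc] by (simp add: vanishing_def)
qed

lemma vanishing_submodule: "submodule (vanishing i) R M"
proof (rule W.M.submoduleI)
  show sm: "f \<odot>\<^sub>M y \<in> vanishing i" if "f \<in> carrier R" "y \<in> vanishing i" for f y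
    using vanishing_smult[of f 0 y i] that by simp
  show sub: "vanishing i \<subseteq> carrier M" by (auto simp: vanishing_def)
  show "\<ominus>\<^sub>M y \<in> vanishing i" if "y \<in> vanishing i" for y
    proof -
    have "\<ominus>\<^sub>R \<one>\<^sub>R \<in> carrier R" using cring.cring_simprules(3,6)[OF cring_R] by blast
    then show ?thesis using sm[OF _ that] W.M.smult_minus_one[of y] that sub by (metis subsetD)
  qed
  show "\<zero>\<^sub>M \<in> vanishing i"
    using tau_zero W.M.smult_r_null[OF X_power_closed[OF Ap_S]] by (simp add: vanishing_def)
  fix y z assume y: "y \<in> vanishing i" and z: "z \<in> vanishing i"
  have yz: "y \<in> carrier M" "z \<in> carrier M" using y z sub by auto
  have "fps_X ^ s \<odot>\<^sub>M (y \<oplus>\<^sub>M z) = fps_X ^ s \<odot>\<^sub>M y \<oplus>\<^sub>M fps_X ^ s \<odot>\<^sub>M z" if "s \<in> Ap S q" for s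
    by (rule W.M.smult_r_distr[OF X_power_closed[OF Ap_S[OF that]] yz])
  then have "\<tau> (fps_X ^ s \<odot>\<^sub>M (y \<oplus>\<^sub>M z)) = \<tau> (fps_X ^ s \<odot>\<^sub>M y) + \<tau> (fps_X ^ s \<odot>\<^sub>M z)" if "s \<in> Ap S q" for s
    using tau_add[OF W_X W_X] yz Ap_S that by simp
  then show "y \<oplus>\<^sub>M z \<in> vanishing i" using y z by (simp add: vanishing_def)
qed

lemma L_vanishing: "W.L i \<subseteq> vanishing i"
proof (induction i)
  case 0
  have "reaches S q 0 s" if "s \<in> Ap S q" for s using that zero_in by (auto simp: reaches_def intro!: bexI[of _ 0])
  then show ?case by (auto simp: vanishing_def)
next
  case (Suc i)
  show ?case
  proof (rule W.L_least[OF vanishing_submodule])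
    show "a \<odot>\<^sub>M y \<in> vanishing (Suc i)" if "a \<in> mm" "y \<in> W.L i" for a y
      using vanishing_smult[of a "Suc 0" y i] that Suc Pw_1_iff by auto
  qed
qed

lemma dual_family: obtains y where "y \<in> carrier M" "\<And>s. s \<in> Ap S q \<Longrightarrow> \<tau> (fps_X ^ s \<odot>\<^sub>M y) = c s"
proof -
  have "\<exists>y\<in>carrier M. \<forall>s\<in>Ap S q. \<tau> (fps_X ^ s \<odot>\<^sub>M y) = c s" using tau unfolding dualizing_def by simp
  then show ?thesis using that by blast
qed

lemma multiple_of_X_q:
  assumes "y \<in> carrier M" "\<And>s. s \<in> Ap S q \<Longrightarrow> \<tau> (fps_X ^ s \<odot>\<^sub>M y) = 0"
  obtains z where "z \<in> carrier M" "y = fps_X ^ q \<odot>\<^sub>M z"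
proof -
  have "\<exists>z\<in>carrier M. y = fps_X ^ q \<odot>\<^sub>M z" using tau assms unfolding dualizing_def by simp
  then show ?thesis using that by blast
qed

lemma tau_L: "y \<in> W.L i \<Longrightarrow> s \<in> Ap S q \<Longrightarrow> \<not> reaches S q i s \<Longrightarrow> \<tau> (fps_X ^ s \<odot>\<^sub>M y) = 0"
  using L_vanishing by (auto simp: vanishing_def)

text \<open>With s + u in the Apery set, t^u carries a vector dual to s + u to one dual to s, and u
  of order at least i puts it into \<open>W.L i\<close>.\<close>

lemma dual_element:
  assumes "s \<in> Ap S q" "reaches S q i s"
  obtains e where "e \<in> W.L i" "\<And>s'. s' \<in> Ap S q \<Longrightarrow> \<tau> (fps_X ^ s' \<odot>\<^sub>M e) = (if s' = s then 1 else 0)"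
proof -
  obtain u where u: "u \<in> lM i" "s + u \<in> Ap S q" using assms(2) unfolding reaches_def by blast
  note uS = lM_subset[OF u(1)]
  obtain d where d: "d \<in> carrier M" "\<And>s'. s' \<in> Ap S q \<Longrightarrow> \<tau> (fps_X ^ s' \<odot>\<^sub>M d) = (if s' = s + u then 1 else 0)"
    using dual_family[of "\<lambda>s'. if s' = s + u then 1 else 0"] by blast
  show ?thesis
  proof (rule that)
    have "d \<in> W.L 0" using d(1) by simp
    then show "fps_X ^ u \<odot>\<^sub>M d \<in> W.L i" using Pw_L[OF X_power_Pw[OF u(1)], of d 0] by simp
    fix s' assume s': "s' \<in> Ap S q"
    have "\<tau> (fps_X ^ s' \<odot>\<^sub>M (fps_X ^ u \<odot>\<^sub>M d)) = \<tau> (fps_X ^ (s' + u) \<odot>\<^sub>M d)"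
      using X_add[OF Ap_S[OF s'] uS d(1)] by simp
    also have "\<dots> = (if s' = s then 1 else 0)"
    proof (cases "s' + u \<in> Ap S q")
      case True
      then show ?thesis using d(2) by simp
    next
      case False
      then have "s' \<noteq> s" using u(2) by auto
      then show ?thesis using tau_not_Ap[OF add_in[OF Ap_S[OF s'] uS] False d(1)] by simp
    qed
    finally show "\<tau> (fps_X ^ s' \<odot>\<^sub>M (fps_X ^ u \<odot>\<^sub>M d)) = (if s' = s then 1 else 0)" .
  qed
qed

text \<open>Dual vectors at the exponents s with nonzero \<tau>(t^s y) are subtracted one by one;
  such s reach i, so these vectors lie in \<open>W.L i\<close>. What remains has only zero values
  and is a multiple of t^q.\<close>

lemma vanishing_decomp:
  assumes "y \<in> vanishing i"
  obtains y' z where "y' \<in> W.L i" "z \<in> carrier M" "y = y' \<oplus>\<^sub>M fps_X ^ q \<odot>\<^sub>M z"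
proof -
  have "\<exists>y'\<in>W.L i. \<exists>z\<in>carrier M. y = y' \<oplus>\<^sub>M fps_X ^ q \<odot>\<^sub>M z"
    if "finite A" "A \<subseteq> Ap S q" "y \<in> vanishing i" "\<And>s. s \<in> Ap S q - A \<Longrightarrow> \<tau> (fps_X ^ s \<odot>\<^sub>M y) = 0" for A y
    using that
  proof (induction A arbitrary: y rule: finite_induct)
    case empty
    have yc: "y \<in> carrier M" using empty by (simp add: vanishing_def)
    obtain z where z: "z \<in> carrier M" "y = fps_X ^ q \<odot>\<^sub>M z"
      using multiple_of_X_q[OF yc] empty.prems(3) by auto
    then have "y = \<zero>\<^sub>M \<oplus>\<^sub>M fps_X ^ q \<odot>\<^sub>M z" using yc by simp
    then show ?case using z(1) L_zero by blast
  next
    case (insert s A)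
    have yc: "y \<in> carrier M" using insert by (simp add: vanishing_def)
    have s: "s \<in> Ap S q" using insert by simp
    define c where "c = \<tau> (fps_X ^ s \<odot>\<^sub>M y)"
    show ?case
    proof (cases "c = 0")
      case True
      then show ?thesis using insert c_def by (intro insert.IH) auto
    next
      case False
      then have "reaches S q i s" using insert.prems(2) s by (auto simp: vanishing_def c_def)
      then obtain e where e: "e \<in> W.L i" "\<And>s'. s' \<in> Ap S q \<Longrightarrow> \<tau> (fps_X ^ s' \<odot>\<^sub>M e) = (if s' = s then 1 else 0)"
        using dual_element[OF s] by blast
      define e' where "e' = fps_const c \<odot>\<^sub>M e"
      have e': "e' \<in> W.L i" unfolding e'_def by (rule L_smult[OF const_closed e(1)])
      have ec: "e \<in> carrier M" "e' \<in> carrier M" using W.L_carrier e(1) e' by auto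
      have te': "\<tau> (fps_X ^ s' \<odot>\<^sub>M e') = (if s' = s then c else 0)" if s': "s' \<in> Ap S q" for s'
        unfolding e'_def
        using W.M.smult_left_commute[OF X_power_closed[OF Ap_S[OF s']] const_closed ec(1)]
          tau_const[OF W_X[OF Ap_S[OF s'] ec(1)]] e(2)[OF s'] by simp
      define y1 where "y1 = y \<ominus>\<^sub>M e'"
      have ty1: "\<tau> (fps_X ^ s' \<odot>\<^sub>M y1) = \<tau> (fps_X ^ s' \<odot>\<^sub>M y) - (if s' = s then c else 0)" if s': "s' \<in> Ap S q" for s'
        unfolding y1_def W.M.smult_diff_right[OF X_power_closed[OF Ap_S[OF s']] yc ec(2)]
        using tau_diff[OF W_X[OF Ap_S[OF s'] yc] W_X[OF Ap_S[OF s'] ec(2)]] te'[OF s'] by simp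
      have "y1 \<in> vanishing i"
        unfolding y1_def by (rule W.M.submodule_diff[OF vanishing_submodule insert.prems(2)]) (use L_vanishing e' in blast)
      moreover have "\<tau> (fps_X ^ s' \<odot>\<^sub>M y1) = 0" if "s' \<in> Ap S q - A" for s'
        using ty1[of s'] that insert.prems(3)[of s'] c_def by (cases "s' = s") auto
      ultimately obtain y' z where y': "y' \<in> W.L i" "z \<in> carrier M" "y1 = y' \<oplus>\<^sub>M fps_X ^ q \<odot>\<^sub>M z"
        using insert.IH[of y1] insert.prems(1) by blast
      have "y = (y' \<oplus>\<^sub>M fps_X ^ q \<odot>\<^sub>M z) \<oplus>\<^sub>M e'"
        using W.M.M.sub_add_cancel[OF yc ec(2)] y'(3) by (simp add: y1_def)
      also have "\<dots> = (y' \<oplus>\<^sub>M e') \<oplus>\<^sub>M fps_X ^ q \<odot>\<^sub>M z"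
        using W.L_carrier[OF y'(1)] W_X[OF q(1) y'(2)] ec(2) by (simp add: W.M.M.a_ac)
      finally show ?thesis using L_add[OF y'(1) e'] y'(2) by blast
    qed
  qed
  from this[OF finite_Ap subset_refl assms] show ?thesis using that by blast
qed

end

text \<open>The functional for q = \<open>(i + 2) * mu\<close> decides membership in
  \<open>W.L i\<close>, since t^q M is contained in it. The values at the exponents that do not
  reach i are then controlled by \<open>reaches_shift\<close>.\<close>

lemma initial_regular:
  assumes lin: "\<And>s. s \<in> S \<Longrightarrow> ord (s + mu) = Suc (ord s)"
    and pure: "\<And>w. w \<in> Ap S mu \<Longrightarrow> reaches S mu (top_order - ord w) w"
    and y: "y \<in> carrier M" "fps_X ^ mu \<odot>\<^sub>M y \<in> W.L (Suc i)"
  shows "y \<in> W.L i"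
proof -
  define n where "n = Suc (Suc i)"
  define q where "q = n * mu"
  have q: "q \<in> S" "q \<noteq> 0" using mu_multiple[of n] mu(2) by (simp_all add: q_def) (simp add: n_def)
  obtain \<tau> where t: "dualizing S M q \<tau>" using dual[OF q] by blast
  have "\<tau> (fps_X ^ s \<odot>\<^sub>M y) = 0" if s: "s \<in> Ap S q" "\<not> reaches S q i s" for s
  proof -
    consider "s \<in> Ap S mu" | u where "u \<in> S" "s = u + mu" using Ap_cases[OF Ap_S[OF s(1)]] by blast
    then show ?thesis
    proof cases
      \<comment> \<open>An element of the Apery set of \<open>mu\<close> can be raised by
        \<open>Suc i * mu\<close> to the last level of the Apery set of q, so it reaches i and this
        case cannot occur.\<close>
      case 1
      have "s + Suc i * mu \<in> Ap S q" unfolding q_def using Ap_multiple[OF 1, of "Suc i" n] by (simp add: n_def)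
      moreover have "Suc i * mu \<in> lM i" by (rule lM_Suc_subset[OF mult_mu_lM])
      ultimately have "reaches S q i s" by (auto simp: reaches_def)
      then show ?thesis using s(2) by simp
    next
      case (2 u)
      have uA: "u \<in> Ap S q" using Ap_divisor[of u mu q] s(1) 2 mu(1) by simp
      \<comment> \<open>The contrapositive of \<open>reaches_shift\<close>: passing from u to
        \<open>u + mu\<close> costs at most one step of reach.\<close>
      have "\<not> reaches S q (Suc i) u"
        using reaches_shift[OF lin pure 2(1), of n i] s 2(2) unfolding q_def by blast
      then have "\<tau> (fps_X ^ u \<odot>\<^sub>M (fps_X ^ mu \<odot>\<^sub>M y)) = 0" by (rule tau_L[OF q t y(2) uA])
      then show ?thesis using X_add[OF 2(1) mu(1) y(1)] 2(2) by simp
    qed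
  qed
  then have "y \<in> vanishing q \<tau> i" using y(1) by (simp add: vanishing_def[OF q t])
  then obtain y' z where y': "y' \<in> W.L i" "z \<in> carrier M" "y = y' \<oplus>\<^sub>M fps_X ^ q \<odot>\<^sub>M z"
    using vanishing_decomp[OF q t] by blast
  have "z \<in> W.L 0" using y'(2) by simp
  then have "fps_X ^ q \<odot>\<^sub>M z \<in> W.L (n + 0)" unfolding q_def by (intro Pw_L X_power_Pw mult_mu_lM)
  then have "fps_X ^ q \<odot>\<^sub>M z \<in> W.L i" by (rule W.L_mono[rotated]) (simp add: n_def)
  then show ?thesis using y'(1,3) L_add by blast
qed

end

section \<open>Homogeneous elements and finite generation of the graded module\<close>

context filtered begin

lemma cls_hom_zero: "cls (hom_rep i \<zero>\<^sub>M) = \<zero>\<^bsub>gr\<^esub>"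
  unfolding gr_zero hom_rep_def by simp

lemma hom_add:
  assumes "y \<in> L i" "z \<in> L i"
  shows "cls (hom_rep i y) \<oplus>\<^bsub>gr\<^esub> cls (hom_rep i z) = cls (hom_rep i (y \<oplus>\<^sub>M z))"
proof -
  have "(\<lambda>j. hom_rep i y j \<oplus>\<^sub>M hom_rep i z j) = hom_rep i (y \<oplus>\<^sub>M z)"
    by (rule ext) (simp add: hom_rep_def)
  then show ?thesis unfolding gr_add[OF hom_reps[OF assms(1)] hom_reps[OF assms(2)]] by simp
qed

lemma hom_smult:
  assumes "a \<in> J.L i" "y \<in> L j"
  shows "J.cls (J.hom_rep i a) \<odot>\<^bsub>gr\<^esub> cls (hom_rep j y) = cls (hom_rep (i + j) (a \<odot>\<^sub>M y))"
proof -
  have "(\<lambda>n. if i \<le> n then a \<odot>\<^sub>M hom_rep j y (n - i) else \<zero>\<^sub>M) = hom_rep (i + j) (a \<odot>\<^sub>M y)"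
  proof
    fix n show "(if i \<le> n then a \<odot>\<^sub>M hom_rep j y (n - i) else \<zero>\<^sub>M) = hom_rep (i + j) (a \<odot>\<^sub>M y) n"
      using J_carrier[OF assms(1)] by (auto simp: hom_rep_def)
  qed
  then show ?thesis
    unfolding gr_smult[OF J.hom_reps[OF assms(1)] hom_reps[OF assms(2)]] conv_hom[OF assms(1) hom_reps[OF assms(2)]]
    by simp
qed

lemma conv_hom_right:
  assumes a: "a \<in> J.reps" and y: "y \<in> L j"
  shows "conv M a (hom_rep j y) n = (if j \<le> n then a (n - j) \<odot>\<^sub>M y else \<zero>\<^sub>M)"
proof -
  have ac: "a i \<in> carrier R" for i using J.reps_carrier[OF a] by simp
  have yc: "y \<in> carrier M" by (rule L_carrier[OF y])
  have "conv M a (hom_rep j y) n = conv M (\<lambda>i. if j \<le> n \<and> i = n - j then a i else \<zero>\<^sub>R) (\<lambda>_. y) n"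
    by (rule M.conv_cong) (use ac yc in \<open>auto simp: hom_rep_def\<close>)
  also have "\<dots> = (if n - j \<le> n then (if j \<le> n \<and> n - j = n - j then a (n - j) else \<zero>\<^sub>R) \<odot>\<^sub>M y else \<zero>\<^sub>M)"
    by (rule M.conv_single) (use ac yc in auto)
  finally show ?thesis using yc by simp
qed

text \<open>The degree zero classes of generators of M generate. By induction on i the classes of
  degree i of all elements of \<open>L i\<close> are generated, and every element of the graded
  module is a finite sum of homogeneous ones.\<close>

lemma gr_fin_gen:
  assumes G: "cring G" and fg: "fin_gen_module R M"
  shows "fin_gen_module G gr"
proof -
  interpret gm: module G gr by (rule gr_module[OF G])
  have F: "filtered G (carrier G) gr"
    unfolding filtered_def using gr_module[OF G] ring.oneideal[OF cring.axioms(1)[OF G]] by blast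
  obtain A where A: "A \<subseteq> carrier M" "finite A" "ideal_smult M (carrier R) A = carrier M"
    using fg unfolding fin_gen_module_def by blast
  define B where "B = (\<lambda>y. cls (hom_rep 0 y)) ` A"
  define N where "N = ideal_smult gr (carrier G) B"
  have B: "B \<subseteq> carrier gr"
    unfolding B_def gr_carrier using hom_reps[of _ 0] A(1) by auto
  have N: "submodule N G gr" unfolding N_def by (rule filtered.ideal_smult_submodule[OF F B])
  note NE = gm.submoduleE[OF N]
  have BN: "b \<in> N" if b: "b \<in> B" for b
  proof -
    have "\<one>\<^sub>G \<odot>\<^bsub>gr\<^esub> b = b" using B b by (intro gm.smult_one) blast
    moreover have "\<one>\<^sub>G \<in> carrier G" using cring.cring_simprules(6)[OF G] .
    ultimately show ?thesis unfolding N_def ideal_smult_def using b by (intro generate.incl) (metis (mono_tags, lifting) mem_Collect_eq)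
  qed
  define U where "U i = {y \<in> L i. cls (hom_rep i y) \<in> N}" for i
  have Jcls: "J.cls (J.hom_rep i a) \<in> carrier G" if "a \<in> J.L i" for i a
    unfolding G_carrier using J.hom_reps[OF that] by blast
  have U_smult: "a \<odot>\<^sub>M y \<in> U (j + i)" if a: "a \<in> J.L j" and "y \<in> U i" for a y i j
  proof -
    have y: "y \<in> L i" "cls (hom_rep i y) \<in> N" using that(2) by (auto simp: U_def)
    have "cls (hom_rep (j + i) (a \<odot>\<^sub>M y)) \<in> N"
      unfolding hom_smult[OF a y(1), symmetric] by (rule NE(4)[OF Jcls[OF a] y(2)])
    then show ?thesis using J_L[OF a y(1)] by (simp add: U_def)
  qed
  have U: "submodule (U i) R M" for i
  proof (rule M.submoduleI)
    show "U i \<subseteq> carrier M" using L_carrier by (auto simp: U_def)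
    then have sub: "y \<in> carrier M" if "y \<in> U i" for y using that by blast
    show "\<zero>\<^sub>M \<in> U i"
      using submodule_zero[OF L_submodule] cls_hom_zero submodule_zero[OF N] by (simp add: U_def)
    show sm: "a \<odot>\<^sub>M y \<in> U i" if "a \<in> carrier R" "y \<in> U i" for a y
      using U_smult[of a 0 y i] that by simp
    show "\<ominus>\<^sub>M y \<in> U i" if "y \<in> U i" for y
    proof -
      have "\<ominus>\<^sub>R \<one>\<^sub>R \<in> carrier R" using cring.cring_simprules(3,6)[OF M.R.is_cring] by blast
      then show ?thesis using sm[OF _ that] M.smult_minus_one[OF sub[OF that]] by metis
    qed
    show "y \<oplus>\<^sub>M z \<in> U i" if "y \<in> U i" "z \<in> U i" for y z
    proof -
      have y: "y \<in> L i" "cls (hom_rep i y) \<in> N" and z: "z \<in> L i" "cls (hom_rep i z) \<in> N"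
        using that by (auto simp: U_def)
      have "cls (hom_rep i (y \<oplus>\<^sub>M z)) \<in> N"
        unfolding hom_add[OF y(1) z(1), symmetric] by (rule NE(5)[OF y(2) z(2)])
      then show ?thesis using M.submoduleE(5)[OF L_submodule y(1) z(1)] by (simp add: U_def)
    qed
  qed
  have LU: "L i \<subseteq> U i" for i
  proof (induction i)
    case 0
    have sg: "subgroup (U 0) (add_monoid M)" using U by (simp add: submodule_def)
    have "generate (add_monoid M) {a \<odot>\<^sub>M x | a x. a \<in> carrier R \<and> x \<in> A} \<subseteq> U 0"
    proof (rule group.generate_subgroup_incl[OF M.M.a_group _ sg], clarify)
      fix a x assume "a \<in> carrier R" "x \<in> A"
      moreover have "x \<in> U 0" using A(1) BN \<open>x \<in> A\<close> by (auto simp: U_def B_def)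
      ultimately show "a \<odot>\<^sub>M x \<in> U 0" using U_smult[of a 0 x 0] by simp
    qed
    then show ?case using A(3) by (simp add: ideal_smult_def)
  next
    case (Suc i)
    show ?case
    proof (rule L_least[OF U])
      fix a y assume a: "a \<in> I" and y: "y \<in> L i"
      have "a \<in> J.L (Suc 0)" using J.L_Suc[OF a, of "\<one>\<^sub>R" 0] I.a_Hcarr[OF a] by simp
      then show "a \<odot>\<^sub>M y \<in> U (Suc i)" using U_smult[of a "Suc 0" y i] y Suc by auto
    qed
  qed
  \<comment> \<open>Induction on a bound for the degrees of nonzero components; the component of
    highest degree is split off.\<close>
  have cN: "cls y \<in> N" if "y \<in> reps" "\<And>i. n \<le> i \<Longrightarrow> y i \<in> L (Suc i)" for n y
    using that
  proof (induction n arbitrary: y)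
    case 0
    then have "cls y = \<zero>\<^bsub>gr\<^esub>" using cls_eq_zero_iff by blast
    then show ?case using submodule_zero[OF N] by simp
  next
    case (Suc n)
    define y' where "y' j = (if j = n then \<zero>\<^sub>M else y j)" for j
    have y'L: "y' i \<in> L (Suc i)" if "n \<le> i" for i
      using Suc.prems(2)[of i] that submodule_zero[OF L_submodule[of "Suc i"]] by (auto simp: y'_def)
    have "y' i \<in> L i" for i
      using reps_L[OF Suc.prems(1)] submodule_zero[OF L_submodule[of i]] by (auto simp: y'_def)
    then have y': "y' \<in> reps" using y'L unfolding reps_def by blast
    have yn: "y n \<in> L n" by (rule reps_L[OF Suc.prems(1)])
    have "y = (\<lambda>j. y' j \<oplus>\<^sub>M hom_rep n (y n) j)"
      using reps_carrier[OF Suc.prems(1)] by (intro ext) (simp add: y'_def hom_rep_def)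
    then have "cls y = cls y' \<oplus>\<^bsub>gr\<^esub> cls (hom_rep n (y n))" using gr_add[OF y' hom_reps[OF yn]] by simp
    moreover have "cls (hom_rep n (y n)) \<in> N" using LU yn by (auto simp: U_def)
    moreover have "cls y' \<in> N" by (rule Suc.IH[OF y' y'L])
    ultimately show ?case using NE(5) by simp
  qed
  have "carrier gr \<subseteq> N"
    unfolding gr_carrier using cN by (force simp: reps_def)
  then have "N = carrier gr" using NE(1) by blast
  then show ?thesis
    unfolding fin_gen_module_def using B A(2) by (intro exI[of _ B]) (simp add: N_def B_def)
qed

end

section \<open>Initial forms of monomials and generators of the homogeneous maximal ideal\<close>

context sg_graded begin

definition initial where "initial s = powers.cls (powers.hom_rep (ord s) (fps_X ^ s))"

lemma X_power_ord: "s \<in> S \<Longrightarrow> fps_X ^ s \<in> Pw (ord s)"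
  by (rule X_power_Pw) (simp add: lM_iff)

lemma initial_carrier: "s \<in> S \<Longrightarrow> initial s \<in> carrier G"
  unfolding initial_def powers.G_carrier using powers.hom_reps[OF X_power_ord] by blast

lemma const_initial:
  assumes s: "s \<in> S"
  shows "const c \<otimes>\<^sub>G initial s = powers.cls (powers.hom_rep (ord s) (fps_const c * fps_X ^ s))"
proof -
  have c: "fps_const c \<in> Pw 0" using const_closed by simp
  note r = powers.hom_reps[OF X_power_ord[OF s]]
  have "(\<lambda>n. if 0 \<le> n then fps_const c \<odot>\<^bsub>self_module R\<^esub> powers.hom_rep (ord s) (fps_X ^ s) (n - 0) else \<zero>\<^bsub>self_module R\<^esub>)
      = powers.hom_rep (ord s) (fps_const c * fps_X ^ s)"
    by (rule ext) (simp add: powers.hom_rep_def)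
  then show ?thesis
    unfolding const_def initial_def powers.G_mult[OF const_reps r] powers.conv_hom[OF c r] by simp
qed

lemma reps_diff:
  assumes a: "a \<in> powers.reps" and b: "b \<in> powers.reps"
  shows "(\<lambda>i. a i - b i) \<in> powers.reps"
proof -
  have d: "f - g \<in> Pw i" if "f \<in> Pw i" "g \<in> Pw i" for f g i
    using that unfolding Pw_iff by (metis diff_self fps_sub_nth)
  obtain A B where A: "\<forall>i\<ge>A. a i \<in> Pw (Suc i)" and B: "\<forall>i\<ge>B. b i \<in> Pw (Suc i)"
    using a b unfolding powers.reps_def by blast
  have "\<forall>i\<ge>max A B. a i - b i \<in> Pw (Suc i)" using A B d by simp
  moreover have "a i - b i \<in> Pw i" for i by (intro d powers.reps_L a b)
  ultimately show ?thesis unfolding powers.reps_def by blast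
qed

lemma cls_diff_add:
  assumes a: "a \<in> powers.reps" and b: "b \<in> powers.reps"
  shows "powers.cls a = powers.cls (\<lambda>i. a i - b i) \<oplus>\<^sub>G powers.cls b"
  using powers.G_add[OF reps_diff[OF a b] b] by simp

text \<open>The classes of the monomials in the nonzero Apery elements generate the ideal of all
  elements of positive degree modulo the parameter.\<close>

lemma gr_plus_induct:
  assumes lin: "\<And>s. s \<in> S \<Longrightarrow> ord (s + mu) = Suc (ord s)"
    and T_add: "\<And>f g. f \<in> T \<Longrightarrow> g \<in> T \<Longrightarrow> f \<oplus>\<^sub>G g \<in> T"
    and T_initial: "\<And>c w. w \<in> Ap S mu \<Longrightarrow> w \<noteq> 0 \<Longrightarrow> const c \<otimes>\<^sub>G initial w \<in> T"
    and T_xs: "\<And>h. h \<in> carrier G \<Longrightarrow> xs \<otimes>\<^sub>G h \<in> T"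
  shows "gr_plus R mm \<subseteq> T"
proof
  \<comment> \<open>A contains the exponents that may still contribute to the class. Each step
    removes one Apery element, which contributes only in the degree given by its order.\<close>
  have peel: "powers.cls a \<in> T"
    if "finite A" "A \<subseteq> Ap S mu - {0}" "a \<in> powers.reps"
      "\<And>i s. fps_nth (a i) s \<noteq> 0 \<Longrightarrow> s \<notin> A \<Longrightarrow> s \<in> lM (Suc i)" for A a
    using that
  proof (induction A arbitrary: a rule: finite_induct)
    case empty
    then have "a i \<in> Pw (Suc i)" for i unfolding Pw_iff by blast
    then have "powers.cls a = \<zero>\<^sub>G" using powers.cls_eq_zero_iff[OF empty.prems(2)] powers.gr_zero powers.G_zero by simp
    then show ?case using T_xs[OF G.zero_closed] xs_carrier by simp
  next
    case (insert w A)
    have w: "w \<in> Ap S mu" "w \<noteq> 0" using insert.prems(1) by auto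
    note wS = Ap_S[OF w(1)]
    define c where "c = fps_nth (a (ord w)) w"
    let ?g = "powers.hom_rep (ord w) (fps_const c * fps_X ^ w)"
    have g: "?g \<in> powers.reps" by (rule powers.hom_reps[OF Pw_mult_R[OF const_closed X_power_ord[OF wS]]])
    have "powers.cls (\<lambda>i. a i - ?g i) \<in> T"
    proof (rule insert.IH)
      show "(\<lambda>i. a i - ?g i) \<in> powers.reps" by (rule reps_diff[OF insert.prems(2) g])
      show "A \<subseteq> Ap S mu - {0}" using insert.prems(1) by blast
      fix i s assume nz: "fps_nth (a i - ?g i) s \<noteq> 0" and sA: "s \<notin> A"
      have g_nth: "fps_nth (?g i) s = (if i = ord w \<and> s = w then c else 0)"
        by (auto simp: powers.hom_rep_def)
      show "s \<in> lM (Suc i)"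
      proof (cases "s = w")
        case False
        then show ?thesis using insert.prems(3)[of i s] nz sA g_nth by simp
      next
        case True
        have ni: "i \<noteq> ord w"
        proof
          assume "i = ord w"
          then show False using nz g_nth True by (simp add: c_def[symmetric])
        qed
        then have ai: "fps_nth (a i) w \<noteq> 0" using nz g_nth True by simp
        have "w \<in> lM i" using powers.reps_L[OF insert.prems(2), of i] ai unfolding Pw_iff by blast
        then have "i \<le> ord w" using lM_iff[OF wS] by simp
        then show ?thesis unfolding True lM_iff[OF wS] using ni by simp
      qed
    qed
    moreover have "powers.cls ?g \<in> T" using T_initial[OF w] const_initial[OF wS] by simp
    ultimately show ?case using cls_diff_add[OF insert.prems(2) g] T_add by simp
  qed
  fix f assume f: "f \<in> gr_plus R mm"
  then obtain a where a: "a \<in> powers.reps" "f = powers.cls a" unfolding gr_plus_eq high_def powers.G_carrier by blast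
  have a0: "a 0 \<in> Pw (Suc 0)" using f unfolding gr_plus_eq a(2) cls_high_iff[OF a(1)] by simp
  obtain N where N: "\<forall>i\<ge>N. a i \<in> Pw (Suc i)" using a(1) unfolding powers.reps_def by blast
  \<comment> \<open>The part of f divisible by \<open>xs\<close>: in degree k + 1 the exponents
    \<open>n + mu\<close> with n of order exactly k. As the order is linear, these are all exponents
    outside the Apery set that count in degree k + 1.\<close>
  define b where "b k = Abs_fps (\<lambda>n. if n \<in> S \<and> ord n = k then fps_nth (a (Suc k)) (n + mu) else 0)" for k
  have b: "b \<in> powers.reps"
    unfolding powers.reps_def
  proof (intro CollectI conjI allI exI impI)
    show "b k \<in> Pw k" for k
      unfolding Pw_iff b_def using lM_iff by (auto split: if_splits)
    fix k assume k: "N \<le> k"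
    have "fps_nth (b k) n = 0" for n
    proof (rule ccontr)
      assume "fps_nth (b k) n \<noteq> 0"
      then have n: "n \<in> S" "ord n = k" "fps_nth (a (Suc k)) (n + mu) \<noteq> 0" by (auto simp: b_def split: if_splits)
      have "n + mu \<in> lM (Suc (Suc k))" using N k n(3) unfolding Pw_iff by (meson le_SucI)
      then have "Suc (Suc k) \<le> ord (n + mu)" unfolding lM_iff[OF add_in[OF n(1) mu(1)]] .
      then show False using lin[OF n(1)] n(2) by simp
    qed
    then show "b k \<in> Pw (Suc k)" unfolding Pw_iff by simp
  qed
  let ?d = "\<lambda>n. if 1 \<le> n then fps_X ^ mu * b (n - 1) else 0"
  have d: "?d \<in> powers.reps"
    using powers.conv_reps[OF xs_reps b] unfolding powers.conv_hom[OF X_mu_Pw b] by (simp cong: if_cong)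
  have "powers.cls (\<lambda>i. a i - ?d i) \<in> T"
  proof (rule peel[of "Ap S mu - {0}"])
    show "(\<lambda>i. a i - ?d i) \<in> powers.reps" by (rule reps_diff[OF a(1) d])
    show "finite (Ap S mu - {0})" using finite_Ap by simp
    fix i s assume nz: "fps_nth (a i - ?d i) s \<noteq> 0" and sA: "s \<notin> Ap S mu - {0}"
    show "s \<in> lM (Suc i)"
    proof (rule ccontr)
      assume no: "s \<notin> lM (Suc i)"
      have si: "s \<in> lM i"
        using powers.reps_L[OF reps_diff[OF a(1) d], of i] nz unfolding Pw_iff by blast
      have sS: "s \<in> S" by (rule lM_subset[OF si])
      have os: "ord s = i" using si no lM_iff[OF sS] by (metis le_antisym not_less_eq_eq)
      have "i \<noteq> 0"
      proof
        assume i: "i = 0"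
        then have "fps_nth (a 0) s \<noteq> 0" using nz by simp
        then show False using a0 no unfolding Pw_iff i by blast
      qed
      then obtain k where k: "i = Suc k" by (cases i) auto
      have "s \<noteq> 0" using os k ord_0 by (intro notI) simp
      then obtain u where u: "u \<in> S" "s = u + mu" using sA Ap_cases[OF sS, of mu] by auto
      have "ord u = k" using lin[OF u(1)] u(2) os k by simp
      then have "fps_nth (a i - ?d i) s = 0"
        using u k by (simp add: b_def fps_X_power_mult_nth)
      then show False using nz by simp
    qed
  qed simp
  moreover have "powers.cls ?d \<in> T"
    using T_xs[of "powers.cls b"] xs_mult[OF b] b powers.G_carrier by auto
  ultimately show "f \<in> T" using cls_diff_add[OF a(1) d] T_add a(2) by simp
qed

end

section \<open>The graded module modulo the initial form \<open>xs\<close>\<close>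

locale sg_dual_graded = sg_dual S R mm M + sg_graded S R mm
  for S and R :: "'k::field fps ring" and mm and M :: "('k fps, 'b) module"
begin

sublocale gm: module G W.gr by (rule W.gr_module[OF G])

lemma one_smult: "y \<in> carrier M \<Longrightarrow> fps_X ^ 0 \<odot>\<^sub>M y = y"
  using W.M.smult_one[of y] by simp

lemma mu_nonzero: "mu \<noteq> 0" using mu(2) by simp

lemma gr_cases:
  assumes "f \<in> carrier W.gr" obtains y where "y \<in> W.reps" "f = W.cls y"
  using assms unfolding W.gr_carrier by blast

lemma G_cases:
  assumes "a \<in> carrier G" obtains \<alpha> where "\<alpha> \<in> powers.reps" "a = powers.cls \<alpha>"
  using assms unfolding powers.G_carrier by blast

lemma cls_carrier: "y \<in> W.reps \<Longrightarrow> W.cls y \<in> carrier W.gr"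
  unfolding W.gr_carrier by (rule imageI)

lemma xs_smult:
  assumes "y \<in> W.reps"
  shows "xs \<odot>\<^bsub>W.gr\<^esub> W.cls y = W.cls (\<lambda>n. if Suc 0 \<le> n then fps_X ^ mu \<odot>\<^sub>M y (n - Suc 0) else \<zero>\<^sub>M)"
  unfolding xs_def W.gr_smult[OF xs_reps assms] W.conv_hom[OF X_mu_Pw assms] ..

lemma plus_carrier: "a \<in> gr_plus R mm \<Longrightarrow> a \<in> carrier G"
  using high_carrier gr_plus_eq by blast

lemma initial_plus: "s \<in> S \<Longrightarrow> s \<noteq> 0 \<Longrightarrow> initial s \<in> gr_plus R mm"
  unfolding gr_plus_lead[OF initial_carrier] unfolding initial_def
  by (subst lead_cls[OF powers.hom_reps[OF X_power_ord]]) (auto simp: powers.hom_rep_def)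

definition xgr where "xgr = (\<lambda>f. xs \<odot>\<^bsub>W.gr\<^esub> f) ` carrier W.gr"

abbreviation Q where "Q \<equiv> quot_module W.gr xgr"

definition proj where "proj f = xgr +>\<^bsub>W.gr\<^esub> f"

lemma xgr_submodule: "submodule xgr G W.gr"
  unfolding xgr_def by (rule multiples_submodule[OF gm.module_axioms xs_carrier])

lemma xgrI: "f \<in> carrier W.gr \<Longrightarrow> xs \<odot>\<^bsub>W.gr\<^esub> f \<in> xgr" by (simp add: xgr_def)

lemma Q_module: "module G Q" by (rule module_quot_module[OF gm.module_axioms xgr_submodule])

lemma proj_linear: "linear_on G W.gr Q (carrier W.gr) proj"
  unfolding proj_def by (rule linear_on_coset[OF gm.module_axioms xgr_submodule])

lemma proj_image: "proj ` carrier W.gr = carrier Q"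
  unfolding proj_def quot_module_simps(1)[OF gm.module_axioms xgr_submodule] ..

lemma proj_zero_iff: "f \<in> carrier W.gr \<Longrightarrow> proj f = \<zero>\<^sub>Q \<longleftrightarrow> f \<in> xgr"
  unfolding proj_def quot_module_simps(2)[OF gm.module_axioms xgr_submodule]
  by (rule coset_eq_self_iff[OF gm.module_axioms xgr_submodule])

lemma proj_eq_iff: "f \<in> carrier W.gr \<Longrightarrow> g \<in> carrier W.gr \<Longrightarrow> proj f = proj g \<longleftrightarrow> f \<ominus>\<^bsub>W.gr\<^esub> g \<in> xgr"
  unfolding proj_def by (rule coset_eq_iff[OF gm.module_axioms xgr_submodule])

lemmas proj_smult = linear_on_smult[OF proj_linear]

lemma resolution_modI:
  assumes res: "free_resolution G (quot_module (self_module G) (gr_plus R mm)) n D e"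
    and reg: "\<And>y. y \<in> carrier W.gr \<Longrightarrow> xs \<odot>\<^bsub>W.gr\<^esub> y = \<zero>\<^bsub>W.gr\<^esub> \<Longrightarrow> y = \<zero>\<^bsub>W.gr\<^esub>"
  shows "resolution_mod G (gr_plus R mm) W.gr n D e xs Q proj"
proof (rule resolution_mod.intro[OF resolution.intro[OF gm.module_axioms maximal_plus res] resolution_mod_axioms.intro])
  show "y \<in> carrier W.gr \<Longrightarrow> xs \<odot>\<^bsub>W.gr\<^esub> y = \<zero>\<^bsub>W.gr\<^esub> \<Longrightarrow> y = \<zero>\<^bsub>W.gr\<^esub>" for y by (rule reg)
  show "y \<in> carrier W.gr \<Longrightarrow> (proj y = \<zero>\<^sub>Q) = (\<exists>z\<in>carrier W.gr. y = xs \<odot>\<^bsub>W.gr\<^esub> z)" for y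
    using proj_zero_iff[of y] by (auto simp: xgr_def)
qed (rule xs_plus Q_module proj_linear proj_image)+

text \<open>Climbing through the filtration: as long as z lies in \<open>W.L j\<close> with j < i,
  its class in degree j is killed by \<open>xs\<close>, hence zero, and z lies one power
  deeper.\<close>

lemma regular_L_of_regular:
  assumes reg: "\<And>y. y \<in> carrier W.gr \<Longrightarrow> xs \<odot>\<^bsub>W.gr\<^esub> y = \<zero>\<^bsub>W.gr\<^esub> \<Longrightarrow> y = \<zero>\<^bsub>W.gr\<^esub>"
    and z: "z \<in> carrier M" "fps_X ^ mu \<odot>\<^sub>M z \<in> W.L (Suc i)"
  shows "z \<in> W.L i"
proof -
  have "z \<in> W.L j" if "j \<le> i" for j
    using that
  proof (induction j)
    case 0
    then show ?case using z(1) by simp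
  next
    case (Suc j)
    then have zj: "z \<in> W.L j" by simp
    note r = W.hom_reps[OF zj]
    have "fps_X ^ mu \<odot>\<^sub>M z \<in> W.L (Suc (Suc j))" using W.L_mono[OF _ z(2), of "Suc (Suc j)"] Suc.prems by simp
    then have "fps_X ^ mu \<odot>\<^sub>M z \<in> W.L (Suc (Suc 0 + j))" by simp
    moreover have "fps_X ^ mu \<odot>\<^sub>M z \<in> W.L (Suc 0 + j)" using Pw_L[OF X_mu_Pw zj] .
    ultimately have "W.cls (W.hom_rep (Suc 0 + j) (fps_X ^ mu \<odot>\<^sub>M z)) = \<zero>\<^bsub>W.gr\<^esub>"
      unfolding W.cls_eq_zero_iff[OF W.hom_reps[OF \<open>_ \<in> W.L (Suc 0 + j)\<close>]]
      using L_zero by (simp add: W.hom_rep_def)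
    then have "xs \<odot>\<^bsub>W.gr\<^esub> W.cls (W.hom_rep j z) = \<zero>\<^bsub>W.gr\<^esub>"
      using W.hom_smult[OF X_mu_Pw zj] by (simp add: xs_def)
    then have "W.cls (W.hom_rep j z) = \<zero>\<^bsub>W.gr\<^esub>" by (rule reg[OF cls_carrier[OF r]])
    then have "W.hom_rep j z j \<in> W.L (Suc j)" unfolding W.cls_eq_zero_iff[OF r] by blast
    then show ?case by (simp add: W.hom_rep_def)
  qed
  then show ?thesis by blast
qed

context
  fixes \<tau> assumes tau: "dualizing S M mu \<tau>"
begin

lemmas mu_tau = mu(1) mu_nonzero tau

text \<open>The coefficient of a class at an Apery element \<open>w\<close> is read off in the degree that
  multiplication by the initial form of \<open>w\<close> moves into the top degree.\<close>

definition coef where "coef w f = \<tau> (fps_X ^ w \<odot>\<^sub>M (SOME r. r \<in> f (top_order - ord w)))"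

lemma not_reaches_Suc: "w \<in> Ap S mu \<Longrightarrow> \<not> reaches S mu (Suc (top_order - ord w)) w"
  using reaches_le[of "Suc (top_order - ord w)" w] Ap_S[of w mu] by auto

text \<open>Representatives differ by elements one power deeper, which is beyond the reach of w, so
  that \<tau> after t^w is zero on the difference.\<close>

lemma coef_cls:
  assumes w: "w \<in> Ap S mu" and y: "y \<in> W.reps"
  shows "coef w (W.cls y) = \<tau> (fps_X ^ w \<odot>\<^sub>M y (top_order - ord w))"
proof -
  let ?i = "top_order - ord w"
  define r where "r = (SOME r. r \<in> W.cls y ?i)"
  note yc = W.reps_carrier[OF y]
  have "y ?i \<ominus>\<^sub>M y ?i \<in> W.L (Suc ?i)" using L_zero yc by (simp add: a_minus_def W.M.M.r_neg)
  then have "y ?i \<in> W.cls y ?i" unfolding W.cls_def using W.mem_coset_iff[OF yc yc] by blast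
  then have r: "r \<in> W.cls y ?i" unfolding r_def by (rule someI)
  have rc: "r \<in> carrier M" using r W.coset_carrier[OF yc] unfolding W.cls_def by blast
  have rd: "r \<ominus>\<^sub>M y ?i \<in> W.L (Suc ?i)"
    using r W.mem_coset_iff[OF yc rc] unfolding W.cls_def by blast
  note wS = Ap_S[OF w]
  have "\<tau> (fps_X ^ w \<odot>\<^sub>M (r \<ominus>\<^sub>M y ?i)) = 0"
    by (rule tau_L[OF mu_tau rd w not_reaches_Suc[OF w]])
  then have "\<tau> (fps_X ^ w \<odot>\<^sub>M r) = \<tau> (fps_X ^ w \<odot>\<^sub>M y ?i)"
    unfolding W.M.smult_diff_right[OF X_power_closed[OF wS] rc yc]
      tau_diff[OF mu_tau W_X[OF wS rc] W_X[OF wS yc]] by simp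
  then show ?thesis by (simp add: coef_def r_def)
qed

lemma coef_add:
  assumes w: "w \<in> Ap S mu" and f: "f \<in> carrier W.gr" and g: "g \<in> carrier W.gr"
  shows "coef w (f \<oplus>\<^bsub>W.gr\<^esub> g) = coef w f + coef w g"
proof -
  obtain y z where y: "y \<in> W.reps" "f = W.cls y" and z: "z \<in> W.reps" "g = W.cls z"
    using f g gr_cases by metis
  note wS = Ap_S[OF w] note yc = W.reps_carrier[OF y(1)] note zc = W.reps_carrier[OF z(1)]
  show ?thesis
    unfolding y(2) z(2) W.gr_add[OF y(1) z(1)] coef_cls[OF w y(1)] coef_cls[OF w z(1)]
      coef_cls[OF w W.add_reps[OF y(1) z(1)]] W.M.smult_r_distr[OF X_power_closed[OF wS] yc zc]
    by (rule tau_add[OF mu_tau W_X[OF wS yc] W_X[OF wS zc]])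
qed

lemma coef_zero: "w \<in> Ap S mu \<Longrightarrow> coef w \<zero>\<^bsub>W.gr\<^esub> = 0"
  using coef_add[of w "\<zero>\<^bsub>W.gr\<^esub>" "\<zero>\<^bsub>W.gr\<^esub>"] by (metis add_left_cancel add.right_neutral gm.M.r_zero gm.M.zero_closed)

lemma coef_diff:
  assumes w: "w \<in> Ap S mu" and f: "f \<in> carrier W.gr" and g: "g \<in> carrier W.gr"
  shows "coef w (f \<ominus>\<^bsub>W.gr\<^esub> g) = coef w f - coef w g"
  using coef_add[OF w _ g, of "f \<ominus>\<^bsub>W.gr\<^esub> g"] f g by (simp add: gm.M.sub_add_cancel)

lemma coef_const:
  assumes w: "w \<in> Ap S mu" and f: "f \<in> carrier W.gr"
  shows "coef w (const c \<odot>\<^bsub>W.gr\<^esub> f) = c * coef w f"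
proof -
  obtain y where y: "y \<in> W.reps" "f = W.cls y" using f gr_cases by blast
  have c: "fps_const c \<in> Pw 0" using const_closed by simp
  note wS = Ap_S[OF w] note yc = W.reps_carrier[OF y(1)]
  have "coef w (const c \<odot>\<^bsub>W.gr\<^esub> f) = \<tau> (fps_X ^ w \<odot>\<^sub>M (fps_const c \<odot>\<^sub>M y (top_order - ord w)))"
    unfolding y(2) const_def W.gr_smult[OF const_reps y(1)] coef_cls[OF w W.conv_reps[OF const_reps y(1)]]
    unfolding W.conv_hom[OF c y(1)] by simp
  also have "\<dots> = c * coef w f"
    unfolding y(2) coef_cls[OF w y(1)] W.M.smult_left_commute[OF X_power_closed[OF wS] const_closed yc]
    by (rule tau_const[OF mu_tau W_X[OF wS yc]])
  finally show ?thesis .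
qed

text \<open>The components of a multiple of \<open>xs\<close> carry a factor t^mu, which \<tau>
  annihilates.\<close>

lemma coef_xs:
  assumes w: "w \<in> Ap S mu" and f: "f \<in> carrier W.gr"
  shows "coef w (xs \<odot>\<^bsub>W.gr\<^esub> f) = 0"
proof -
  obtain y where y: "y \<in> W.reps" "f = W.cls y" using f gr_cases by blast
  note wS = Ap_S[OF w] note yc = W.reps_carrier[OF y(1)]
  let ?v = "\<lambda>n. if Suc 0 \<le> n then fps_X ^ mu \<odot>\<^sub>M y (n - Suc 0) else \<zero>\<^sub>M"
  have v: "?v \<in> W.reps"
    using W.conv_reps[OF xs_reps y(1)] unfolding W.conv_hom[OF X_mu_Pw y(1)] .
  have z: "fps_X ^ w \<odot>\<^sub>M \<zero>\<^sub>M = \<zero>\<^sub>M" by (rule W.M.smult_r_null[OF X_power_closed[OF wS]])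
  show ?thesis
    unfolding y(2) xs_smult[OF y(1)] coef_cls[OF w v]
    using tau_X_q[OF mu_tau wS yc] tau_zero[OF mu_tau] z by simp
qed

lemma coef_xgr: "w \<in> Ap S mu \<Longrightarrow> f \<in> xgr \<Longrightarrow> coef w f = 0"
  unfolding xgr_def using coef_xs by blast

lemma coef_proj:
  "w \<in> Ap S mu \<Longrightarrow> f \<in> carrier W.gr \<Longrightarrow> g \<in> carrier W.gr \<Longrightarrow> proj f = proj g \<Longrightarrow> coef w f = coef w g"
  using coef_xgr[of w "f \<ominus>\<^bsub>W.gr\<^esub> g"] coef_diff[of w f g] proj_eq_iff[of f g] by simp

text \<open>The initial form of w has degree \<open>ord w\<close>, so the part of the product in
  degree \<open>top_order\<close> comes from degree \<open>top_order - ord w\<close> of f. All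
  coefficients are thereby expressed through \<open>coef 0\<close>.\<close>

lemma coef_initial:
  assumes w: "w \<in> Ap S mu" and f: "f \<in> carrier W.gr"
  shows "coef 0 (initial w \<odot>\<^bsub>W.gr\<^esub> f) = coef w f"
proof -
  obtain y where y: "y \<in> W.reps" "f = W.cls y" using f gr_cases by blast
  note wS = Ap_S[OF w] note yc = W.reps_carrier[OF y(1)]
  note r = powers.hom_reps[OF X_power_ord[OF wS]]
  have "coef 0 (initial w \<odot>\<^bsub>W.gr\<^esub> f) = \<tau> (fps_X ^ 0 \<odot>\<^sub>M (fps_X ^ w \<odot>\<^sub>M y (top_order - ord w)))"
    unfolding y(2) initial_def W.gr_smult[OF r y(1)] coef_cls[OF zero_Ap[OF mu_nonzero] W.conv_reps[OF r y(1)]]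
    unfolding W.conv_hom[OF X_power_ord[OF wS] y(1)] ord_0 using ord_le_top[OF w] by simp
  then show ?thesis unfolding y(2) coef_cls[OF w y(1)] one_smult[OF W_X[OF wS yc]] .
qed

text \<open>Only the scalar component of complementary degree \<open>top_order - l\<close> meets the
  dual vector in top degree, and the expansion of \<tau> returns its coefficient at w.\<close>

lemma coef_dual:
  assumes w: "w \<in> Ap S mu" and d: "d \<in> W.L l" and dual: "\<And>s. s \<in> Ap S mu \<Longrightarrow> \<tau> (fps_X ^ s \<odot>\<^sub>M d) = (if s = w then 1 else 0)"
    and l: "l \<le> top_order" and \<alpha>: "\<alpha> \<in> powers.reps"
  shows "coef 0 (powers.cls \<alpha> \<odot>\<^bsub>W.gr\<^esub> W.cls (W.hom_rep l d)) = fps_nth (\<alpha> (top_order - l)) w"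
proof -
  note dc = W.L_carrier[OF d] note dr = W.hom_reps[OF d]
  note aR = reps_R[OF \<alpha>]
  have "coef 0 (powers.cls \<alpha> \<odot>\<^bsub>W.gr\<^esub> W.cls (W.hom_rep l d)) = \<tau> (fps_X ^ 0 \<odot>\<^sub>M (\<alpha> (top_order - l) \<odot>\<^sub>M d))"
    unfolding W.gr_smult[OF \<alpha> dr] coef_cls[OF zero_Ap[OF mu_nonzero] W.conv_reps[OF \<alpha> dr]] ord_0
      W.conv_hom_right[OF \<alpha> d] using l by simp
  also have "\<dots> = \<tau> (\<alpha> (top_order - l) \<odot>\<^sub>M d)" unfolding one_smult[OF W_smult[OF aR dc]] ..
  also have "\<dots> = (\<Sum>s\<in>Ap S mu. fps_nth (\<alpha> (top_order - l)) s * \<tau> (fps_X ^ s \<odot>\<^sub>M d))"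
    by (rule tau_expansion[OF mu_tau aR dc])
  also have "\<dots> = (\<Sum>s\<in>Ap S mu. if s = w then fps_nth (\<alpha> (top_order - l)) s else 0)"
    by (rule sum.cong[OF refl]) (simp add: dual)
  also have "\<dots> = fps_nth (\<alpha> (top_order - l)) w" using w finite_Ap by simp
  finally show ?thesis .
qed

text \<open>An Apery element of top order shows that 0 reaches \<open>top_order\<close>, so a vector
  dual to the exponent 0 can be found in that power.\<close>

lemma top_element:
  obtains d where "d \<in> W.L top_order" "\<And>s. s \<in> Ap S mu \<Longrightarrow> \<tau> (fps_X ^ s \<odot>\<^sub>M d) = (if s = 0 then 1 else 0)"
proof -
  obtain w where w: "w \<in> Ap S mu" "ord w = top_order" by (rule top_order_attained)
  have "w \<in> lM top_order" using lM_iff[OF Ap_S[OF w(1)]] w(2) by simp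
  then have "reaches S mu top_order 0" unfolding reaches_def using w(1) by auto
  then show ?thesis using dual_element[OF mu_tau zero_Ap[OF mu_nonzero]] that by blast
qed

context
  assumes regL: "\<And>z i. z \<in> carrier M \<Longrightarrow> fps_X ^ mu \<odot>\<^sub>M z \<in> W.L (Suc i) \<Longrightarrow> z \<in> W.L i"
begin

text \<open>Each component is a multiple of t^mu modulo the next power. The regularity assumption
  \<open>regL\<close> places each quotient one power lower, so together the quotients represent an
  element whose product with \<open>xs\<close> is the given class.\<close>

lemma multiple_criterion:
  assumes y: "y \<in> W.reps" and van: "\<And>i. y i \<in> vanishing mu \<tau> (Suc i)"
  shows "W.cls y \<in> xgr"
proof -
  note yc = W.reps_carrier[OF y]
  let ?X = "fps_X ^ mu"
  \<comment> \<open>Choosing z = 0 whenever the component is already trivial keeps the support of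
    the quotient finite.\<close>
  have "\<exists>z\<in>carrier M. y i \<ominus>\<^sub>M ?X \<odot>\<^sub>M z \<in> W.L (Suc i) \<and> (y i \<in> W.L (Suc i) \<longrightarrow> z = \<zero>\<^sub>M)" for i
  proof (cases "y i \<in> W.L (Suc i)")
    case True
    then show ?thesis
      using W.M.smult_r_null[OF X_power_closed[OF mu(1)]] W.M.M.sub_zero[OF yc] by (intro bexI[of _ "\<zero>\<^sub>M"]) simp_all
  next
    case False
    obtain y' z where z: "y' \<in> W.L (Suc i)" "z \<in> carrier M" "y i = y' \<oplus>\<^sub>M ?X \<odot>\<^sub>M z"
      using vanishing_decomp[OF mu_tau van[of i]] by blast
    then have e: "y i \<ominus>\<^sub>M ?X \<odot>\<^sub>M z = y'" using W.M.M.add_sub_cancel W.L_carrier[OF z(1)] W_X[OF mu(1) z(2)] by simp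
    have "y i \<ominus>\<^sub>M ?X \<odot>\<^sub>M z \<in> W.L (Suc i)" unfolding e by (rule z(1))
    then show ?thesis using z(2) False by blast
  qed
  then obtain Z where Z: "\<And>i. Z i \<in> carrier M" "\<And>i. y i \<ominus>\<^sub>M ?X \<odot>\<^sub>M Z i \<in> W.L (Suc i)"
      "\<And>i. y i \<in> W.L (Suc i) \<Longrightarrow> Z i = \<zero>\<^sub>M" by metis
  have XZc: "?X \<odot>\<^sub>M Z i \<in> carrier M" for i by (rule W_X[OF mu(1) Z(1)])
  have yXZ: "y i = (y i \<ominus>\<^sub>M ?X \<odot>\<^sub>M Z i) \<oplus>\<^sub>M ?X \<odot>\<^sub>M Z i" for i using W.M.M.sub_add_cancel[OF yc XZc] by simp
  have XZ: "?X \<odot>\<^sub>M Z i \<in> W.L i" for i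
  proof -
    have "y i \<ominus>\<^sub>M (y i \<ominus>\<^sub>M ?X \<odot>\<^sub>M Z i) \<in> W.L i"
      by (rule L_diff[OF W.reps_L[OF y]]) (use Z(2)[of i] W.L_Suc_subset in blast)
    moreover have "y i \<ominus>\<^sub>M (y i \<ominus>\<^sub>M ?X \<odot>\<^sub>M Z i) = ?X \<odot>\<^sub>M Z i"
      using yc[of i] XZc[of i] by (simp add: a_minus_def W.M.M.minus_add W.M.M.r_neg1 W.M.M.a_assoc[symmetric] W.M.M.r_neg)
    ultimately show ?thesis by simp
  qed
  define z where "z i = Z (Suc i)" for i
  obtain N where N: "\<forall>i\<ge>N. y i \<in> W.L (Suc i)" using y unfolding W.reps_def by blast
  have "z i \<in> W.L i" for i unfolding z_def by (rule regL[OF Z(1) XZ])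
  moreover have "\<forall>i\<ge>N. z i \<in> W.L (Suc i)" using N Z(3) L_zero by (simp add: z_def)
  ultimately have z: "z \<in> W.reps" unfolding W.reps_def by blast
  let ?v = "\<lambda>n. if Suc 0 \<le> n then ?X \<odot>\<^sub>M z (n - Suc 0) else \<zero>\<^sub>M"
  have vc: "?v n \<in> carrier M" for n using XZc by (simp add: z_def)
  have "W.cls y = W.cls ?v"
  proof (subst W.cls_eq_iff[OF yc vc], rule allI)
    fix n
    show "y n \<ominus>\<^sub>M ?v n \<in> W.L (Suc n)"
    proof (cases n)
      case 0
      \<comment> \<open>In degree zero there is no lower degree to divide into; the component is
        trivial there because t^mu M lies in the first power.\<close>
      have "?X \<odot>\<^sub>M Z 0 \<in> W.L (Suc 0 + 0)" by (rule Pw_L[OF X_mu_Pw]) (simp add: Z(1))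
      then have "?X \<odot>\<^sub>M Z 0 \<in> W.L (Suc 0)" by simp
      then have "y 0 \<in> W.L (Suc 0)" using L_add[OF Z(2)[of 0]] yXZ[of 0] by metis
      then show ?thesis using 0 W.M.M.sub_zero[OF yc] by simp
    next
      case (Suc k)
      then show ?thesis using Z(2)[of n] by (simp add: z_def)
    qed
  qed
  then have "W.cls y = xs \<odot>\<^bsub>W.gr\<^esub> W.cls z" using xs_smult[OF z] by simp
  then show ?thesis using xgrI[OF cls_carrier[OF z]] by simp
qed

text \<open>In degree \<open>top_order\<close> the degree zero part of the scalar lies in
  \<open>mm\<close> and pushes the product one power deeper. In higher degrees no Apery element has
  enough reach, so all values of \<tau> are zero.\<close>

lemma top_socle:
  assumes a: "a \<in> gr_plus R mm" and d: "d \<in> W.L top_order"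
  shows "a \<odot>\<^bsub>W.gr\<^esub> W.cls (W.hom_rep top_order d) \<in> xgr"
proof -
  obtain \<alpha> where \<alpha>: "\<alpha> \<in> powers.reps" "a = powers.cls \<alpha>" using plus_carrier[OF a] G_cases by blast
  have a0: "\<alpha> 0 \<in> Pw (Suc 0)" using a unfolding gr_plus_eq \<alpha>(2) cls_high_iff[OF \<alpha>(1)] by simp
  note dr = W.hom_reps[OF d] note Lv = L_vanishing[OF mu_tau]
  show ?thesis
    unfolding \<alpha>(2) W.gr_smult[OF \<alpha>(1) dr]
  proof (rule multiple_criterion[OF W.conv_reps[OF \<alpha>(1) dr]])
    fix n
    have e: "conv M \<alpha> (W.hom_rep top_order d) n = (if top_order \<le> n then \<alpha> (n - top_order) \<odot>\<^sub>M d else \<zero>\<^sub>M)"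
      by (rule W.conv_hom_right[OF \<alpha>(1) d])
    consider "n < top_order" | "n = top_order" | "top_order < n" by linarith
    then show "conv M \<alpha> (W.hom_rep top_order d) n \<in> vanishing mu \<tau> (Suc n)"
    proof cases
      case 1
      then show ?thesis unfolding e using L_zero[of "Suc n"] Lv[of "Suc n"] by auto
    next
      case 2
      have "\<alpha> 0 \<odot>\<^sub>M d \<in> W.L (Suc 0 + top_order)" by (rule Pw_L[OF a0 d])
      then have "conv M \<alpha> (W.hom_rep top_order d) n \<in> W.L (Suc n)" unfolding e using 2 by simp
      then show ?thesis using Lv by blast
    next
      case 3
      have y: "conv M \<alpha> (W.hom_rep top_order d) n \<in> W.L n" by (rule W.reps_L[OF W.conv_reps[OF \<alpha>(1) dr]])
      have "\<not> reaches S mu n s" if "s \<in> Ap S mu" for s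
        using reaches_le[of n s] Ap_S[OF that] 3 by auto
      then have "\<tau> (fps_X ^ s \<odot>\<^sub>M conv M \<alpha> (W.hom_rep top_order d) n) = 0" if "s \<in> Ap S mu" for s
        using tau_L[OF mu_tau y that] that by blast
      then show ?thesis unfolding vanishing_def[OF mu_tau] using W.L_carrier[OF y] by blast
    qed
  qed
qed

context
  assumes pure: "\<And>w. w \<in> Ap S mu \<Longrightarrow> reaches S mu (top_order - ord w) w"
begin

text \<open>For each w a single degree carries information. Below \<open>top_order - ord w\<close>
  purity lets w reach the next degree, so \<open>vanishing\<close> imposes no condition; above it
  the value at w vanishes by itself; in that degree the value is the coefficient.\<close>

lemma coef_criterion:
  assumes f: "f \<in> carrier W.gr" and 0: "\<And>w. w \<in> Ap S mu \<Longrightarrow> coef w f = 0"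
  shows "f \<in> xgr"
proof -
  obtain y where y: "y \<in> W.reps" "f = W.cls y" using f gr_cases by blast
  show ?thesis
    unfolding y(2)
  proof (rule multiple_criterion[OF y(1)])
    fix i
    have "\<tau> (fps_X ^ w \<odot>\<^sub>M y i) = 0" if w: "w \<in> Ap S mu" and n: "\<not> reaches S mu (Suc i) w" for w
    proof (cases "i = top_order - ord w")
      case True
      then show ?thesis using 0[OF w] coef_cls[OF w y(1)] y(2) by simp
    next
      case False
      have "\<not> reaches S mu i w"
      proof
        assume "reaches S mu i w"
        then have "Suc i \<le> top_order - ord w" using reaches_le[of i w] Ap_S[OF w] False by simp
        then show False using reaches_antimono[OF _ pure[OF w]] n by blast
      qed
      then show ?thesis by (rule tau_L[OF mu_tau W.reps_L[OF y(1)] w])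
    qed
    then show "y i \<in> vanishing mu \<tau> (Suc i)"
      unfolding vanishing_def[OF mu_tau] using W.reps_carrier[OF y(1)] by blast
  qed
qed

lemma proj_eqI:
  assumes "f \<in> carrier W.gr" "g \<in> carrier W.gr" "\<And>w. w \<in> Ap S mu \<Longrightarrow> coef w f = coef w g"
  shows "proj f = proj g"
  unfolding proj_eq_iff[OF assms(1,2)] by (rule coef_criterion) (use assms coef_diff in auto)

text \<open>In each degree i a component with prescribed values at all exponents reaching i is
  chosen; purity ensures that w reaches the degree in which its coefficient is read.\<close>

lemma coef_surj:
  obtains f where "f \<in> carrier W.gr" "\<And>w. w \<in> Ap S mu \<Longrightarrow> coef w f = c w"
proof -
  have "\<exists>y\<in>W.L i. \<forall>s\<in>Ap S mu. reaches S mu i s \<longrightarrow> \<tau> (fps_X ^ s \<odot>\<^sub>M y) = c s" for i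
  proof -
    obtain y where y: "y \<in> carrier M" "\<And>s. s \<in> Ap S mu \<Longrightarrow> \<tau> (fps_X ^ s \<odot>\<^sub>M y) = (if reaches S mu i s then c s else 0)"
      using dual_family[OF mu_tau, of "\<lambda>s. if reaches S mu i s then c s else 0"] by blast
    have "y \<in> vanishing mu \<tau> i" unfolding vanishing_def[OF mu_tau] using y by simp
    then obtain y' z where z: "y' \<in> W.L i" "z \<in> carrier M" "y = y' \<oplus>\<^sub>M fps_X ^ mu \<odot>\<^sub>M z"
      using vanishing_decomp[OF mu_tau] by blast
    note y'c = W.L_carrier[OF z(1)] note zc = W_X[OF mu(1) z(2)]
    have "\<tau> (fps_X ^ s \<odot>\<^sub>M y') = \<tau> (fps_X ^ s \<odot>\<^sub>M y)" if s: "s \<in> Ap S mu" for s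
      unfolding z(3) W.M.smult_r_distr[OF X_power_closed[OF Ap_S[OF s]] y'c zc]
        tau_add[OF mu_tau W_X[OF Ap_S[OF s] y'c] W_X[OF Ap_S[OF s] zc]]
        tau_X_q[OF mu_tau Ap_S[OF s] z(2)] by simp
    then show ?thesis using z(1) y(2) by (intro bexI[of _ y']) auto
  qed
  then obtain Y where Y: "\<And>i. Y i \<in> W.L i"
      "\<And>i s. s \<in> Ap S mu \<Longrightarrow> reaches S mu i s \<Longrightarrow> \<tau> (fps_X ^ s \<odot>\<^sub>M Y i) = c s" by metis
  \<comment> \<open>No coefficient is read above \<open>top_order\<close>; cutting off there makes
    the support finite.\<close>
  define y where "y i = (if i \<le> top_order then Y i else \<zero>\<^sub>M)" for i
  have "y i \<in> W.L i" for i using Y(1) L_zero by (simp add: y_def)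
  moreover have "\<forall>i\<ge>Suc top_order. y i \<in> W.L (Suc i)" using L_zero by (simp add: y_def)
  ultimately have y: "y \<in> W.reps" unfolding W.reps_def by blast
  show ?thesis
  proof (rule that[OF cls_carrier[OF y]])
    fix w assume w: "w \<in> Ap S mu"
    show "coef w (W.cls y) = c w" unfolding coef_cls[OF w y] using Y(2)[OF w pure[OF w]] by (simp add: y_def)
  qed
qed

end

end

end

end

section \<open>Canonical modules and purity\<close>

context sg_dual_graded begin

lemma canonical_regular:
  assumes can: "canonical_module G (gr_plus R mm) W.gr"
  shows "y \<in> carrier W.gr \<Longrightarrow> xs \<odot>\<^bsub>W.gr\<^esub> y = \<zero>\<^bsub>W.gr\<^esub> \<Longrightarrow> y = \<zero>\<^bsub>W.gr\<^esub>"
proof -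
  obtain n D e where res: "free_resolution G (quot_module (self_module G) (gr_plus R mm)) n D e"
    and Ext: "\<And>i. if enat i = height G (gr_plus R mm)
        then module_isomorphic G (Ext_module W.gr n D i) (quot_module (self_module G) (gr_plus R mm))
        else carrier (Ext_module W.gr n D i) = {\<zero>\<^bsub>Ext_module W.gr n D i\<^esub>}"
    using can unfolding canonical_module_def by blast
  have E0: "carrier (Ext_module W.gr n D 0) = {\<zero>\<^bsub>Ext_module W.gr n D 0\<^esub>}"
    using Ext[of 0] unfolding height_plus by simp
  obtain N where N: "\<And>f. f \<in> high N \<Longrightarrow> \<exists>g\<in>carrier G. f = xs \<otimes>\<^sub>G g" using high_multiple by blast
  assume y: "y \<in> carrier W.gr" "xs \<odot>\<^bsub>W.gr\<^esub> y = \<zero>\<^bsub>W.gr\<^esub>"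
  show ?thesis
    by (rule regular_of_Ext_0[where B = high and N = N,
          OF resolution.intro[OF gm.module_axioms maximal_plus res] E0 xs_carrier high_0 high_carrier high_mult N y])
qed

lemma M_pure_of_canonical:
  assumes can: "canonical_module G (gr_plus R mm) W.gr"
  shows "M_pure S"
  unfolding M_pure_iff
proof
  note reg = canonical_regular[OF can]
  obtain n D e where res: "free_resolution G (quot_module (self_module G) (gr_plus R mm)) n D e"
    and Ext: "\<And>i. if enat i = height G (gr_plus R mm)
        then module_isomorphic G (Ext_module W.gr n D i) (quot_module (self_module G) (gr_plus R mm))
        else carrier (Ext_module W.gr n D i) = {\<zero>\<^bsub>Ext_module W.gr n D i\<^esub>}"
    using can unfolding canonical_module_def by blast
  have E1: "module_isomorphic G (Ext_module W.gr n D (Suc 0)) (quot_module (self_module G) (gr_plus R mm))"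
    using Ext[of "Suc 0"] unfolding height_plus by simp
  have rm: "resolution_mod G (gr_plus R mm) W.gr n D e xs Q proj" by (rule resolution_modI[OF res reg])
  obtain \<sigma> where \<sigma>: "\<sigma> \<in> carrier W.gr" "proj \<sigma> \<noteq> \<zero>\<^sub>Q" "\<And>a. a \<in> gr_plus R mm \<Longrightarrow> proj (a \<odot>\<^bsub>W.gr\<^esub> \<sigma>) = \<zero>\<^sub>Q"
    and soc: "\<And>y. y \<in> carrier W.gr \<Longrightarrow> (\<And>a. a \<in> gr_plus R mm \<Longrightarrow> proj (a \<odot>\<^bsub>W.gr\<^esub> y) = \<zero>\<^sub>Q) \<Longrightarrow>
       \<exists>a\<in>carrier G. proj y = a \<odot>\<^sub>Q proj \<sigma>"
    using resolution_mod.socle_of_Ext_1[OF rm E1] by blast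
  obtain \<tau> where tau: "dualizing S M mu \<tau>" using dual[OF mu(1) mu_nonzero] by blast
  note mu_tau = mu(1) mu_nonzero tau
  have regL: "y \<in> W.L i" if "y \<in> carrier M" "fps_X ^ mu \<odot>\<^sub>M y \<in> W.L (Suc i)" for y i
    by (rule regular_L_of_regular[OF reg that])
  note z0 = zero_Ap[OF mu_nonzero]
  obtain d0 where d0: "d0 \<in> W.L top_order" "\<And>s. s \<in> Ap S mu \<Longrightarrow> \<tau> (fps_X ^ s \<odot>\<^sub>M d0) = (if s = 0 then 1 else 0)"
    using top_element[OF tau] by blast
  define \<sigma>0 where "\<sigma>0 = W.cls (W.hom_rep top_order d0)"
  have \<sigma>0: "\<sigma>0 \<in> carrier W.gr" unfolding \<sigma>0_def by (rule cls_carrier[OF W.hom_reps[OF d0(1)]])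
  have "a \<odot>\<^bsub>W.gr\<^esub> \<sigma>0 \<in> xgr" if "a \<in> gr_plus R mm" for a
    unfolding \<sigma>0_def by (rule top_socle[OF tau regL that d0(1)])
  then have "proj (a \<odot>\<^bsub>W.gr\<^esub> \<sigma>0) = \<zero>\<^sub>Q" if "a \<in> gr_plus R mm" for a
    using proj_zero_iff[OF gm.smult_closed[OF plus_carrier[OF that] \<sigma>0]] that by blast
  \<comment> \<open>The class \<sigma>0 of the vector dual to the exponent 0 lies in the socle,
    hence is a multiple of the generator \<sigma>; a priori a0 may have zero constant term.\<close>
  then obtain a0 where a0: "a0 \<in> carrier G" "proj \<sigma>0 = a0 \<odot>\<^sub>Q proj \<sigma>" using soc[OF \<sigma>0] by blast
  fix w assume w: "w \<in> Ap S mu"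
  note wS = Ap_S[OF w]
  have r0: "reaches S mu 0 w" using w zero_in unfolding reaches_def by (intro bexI[of _ 0]) auto
  \<comment> \<open>l is the exact reach of w; the aim is that it attains the bound
    \<open>top_order - ord w\<close>.\<close>
  have "\<exists>l. reaches S mu l w \<and> \<not> reaches S mu (Suc l) w"
  proof (rule ccontr)
    assume "\<not> ?thesis"
    then have "reaches S mu l w" for l using r0 by (induction l) auto
    then show False using reaches_le[of "Suc top_order" w] wS by auto
  qed
  then obtain l where l: "reaches S mu l w" "\<not> reaches S mu (Suc l) w" by blast
  have ltop: "l \<le> top_order" using reaches_le[OF l(1) wS] by simp
  obtain d where d: "d \<in> W.L l" "\<And>s. s \<in> Ap S mu \<Longrightarrow> \<tau> (fps_X ^ s \<odot>\<^sub>M d) = (if s = w then 1 else 0)"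
    using dual_element[OF mu_tau w l(1)] by blast
  note dc = W.L_carrier[OF d(1)]
  define \<epsilon> where "\<epsilon> = W.cls (W.hom_rep l d)"
  have \<epsilon>: "\<epsilon> \<in> carrier W.gr" unfolding \<epsilon>_def by (rule cls_carrier[OF W.hom_reps[OF d(1)]])
  \<comment> \<open>The dual vector survives modulo \<open>xs\<close> in degree l: multiples of t^mu
    and elements of the next power have value zero at w, whereas its own value is 1.\<close>
  have ne: "\<epsilon> \<notin> xgr"
  proof
    assume "\<epsilon> \<in> xgr"
    then obtain z where z: "z \<in> W.reps" "\<epsilon> = xs \<odot>\<^bsub>W.gr\<^esub> W.cls z" unfolding xgr_def using gr_cases by blast
    let ?v = "\<lambda>n. if Suc 0 \<le> n then fps_X ^ mu \<odot>\<^sub>M z (n - Suc 0) else \<zero>\<^sub>M"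
    note zc = W.reps_carrier[OF z(1)]
    have vc: "?v n \<in> carrier M" for n using W_X[OF mu(1) zc] by simp
    have "W.cls (W.hom_rep l d) = W.cls ?v" using z(2) xs_smult[OF z(1)] by (simp add: \<epsilon>_def)
    then have "W.hom_rep l d l \<ominus>\<^sub>M ?v l \<in> W.L (Suc l)"
      unfolding W.cls_eq_iff[OF W.reps_carrier[OF W.hom_reps[OF d(1)]] vc] by blast
    then have dv: "d \<ominus>\<^sub>M ?v l \<in> W.L (Suc l)" by (simp add: W.hom_rep_def)
    have tv: "\<tau> (fps_X ^ w \<odot>\<^sub>M ?v l) = 0"
      using tau_X_q[OF mu_tau wS zc] tau_zero[OF mu_tau]
        W.M.smult_r_null[OF X_power_closed[OF wS]] by simp
    have "\<tau> (fps_X ^ w \<odot>\<^sub>M (d \<ominus>\<^sub>M ?v l)) = 0" by (rule tau_L[OF mu_tau dv w l(2)])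
    then have "\<tau> (fps_X ^ w \<odot>\<^sub>M d) = 0"
      unfolding W.M.smult_diff_right[OF X_power_closed[OF wS] dc vc]
        tau_diff[OF mu_tau W_X[OF wS dc] W_X[OF wS vc]] tv by simp
    then show False using d(2)[OF w] by simp
  qed
  obtain N where N: "\<And>f. f \<in> high N \<Longrightarrow> \<exists>g\<in>carrier G. f = xs \<otimes>\<^sub>G g" using high_multiple by blast
  have bN: "b \<odot>\<^bsub>W.gr\<^esub> \<epsilon> \<in> xgr" if "b \<in> high N" for b
  proof -
    obtain g where g: "g \<in> carrier G" "b = xs \<otimes>\<^sub>G g" using N \<open>b \<in> high N\<close> by blast
    then show ?thesis using gm.smult_assoc1[OF xs_carrier g(1) \<epsilon>] xgrI[OF gm.smult_closed[OF g(1) \<epsilon>]] by simp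
  qed
  have m: "gr_plus R mm \<subseteq> carrier G" using plus_carrier by blast
  obtain b where b: "b \<in> carrier G" "b \<odot>\<^bsub>W.gr\<^esub> \<epsilon> \<notin> xgr"
      "\<And>a. a \<in> gr_plus R mm \<Longrightarrow> a \<odot>\<^bsub>W.gr\<^esub> (b \<odot>\<^bsub>W.gr\<^esub> \<epsilon>) \<in> xgr"
    using socle_multiple[OF gm.module_axioms \<epsilon> ne high_0 high_carrier high_mult m bN] by blast
  note b\<epsilon> = gm.smult_closed[OF b(1) \<epsilon>]
  have "proj (a \<odot>\<^bsub>W.gr\<^esub> (b \<odot>\<^bsub>W.gr\<^esub> \<epsilon>)) = \<zero>\<^sub>Q" if "a \<in> gr_plus R mm" for a
    using proj_zero_iff[OF gm.smult_closed[OF plus_carrier[OF that] b\<epsilon>]] b(3)[OF that] by blast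
  then obtain a1 where a1: "a1 \<in> carrier G" "proj (b \<odot>\<^bsub>W.gr\<^esub> \<epsilon>) = a1 \<odot>\<^sub>Q proj \<sigma>" using soc[OF b\<epsilon>] by blast
  \<comment> \<open>The homogeneous maximal ideal kills \<sigma> modulo \<open>xs\<close>, so
    otherwise b \<epsilon> would vanish there. Hence a1 has a nonzero constant term.\<close>
  have a1n: "a1 \<notin> gr_plus R mm"
  proof
    assume "a1 \<in> gr_plus R mm"
    then have "a1 \<odot>\<^sub>Q proj \<sigma> = \<zero>\<^sub>Q" using \<sigma>(3) proj_smult[OF a1(1) \<sigma>(1)] by simp
    then show False using a1(2) proj_zero_iff[OF b\<epsilon>] b(2) by simp
  qed
  interpret Q: module G Q by (rule Q_module)
  have p\<sigma>: "proj \<sigma> \<in> carrier Q" by (rule linear_on_closed[OF proj_linear \<sigma>(1)])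
  \<comment> \<open>Multiplying one socle relation by a0 and the other by a1 eliminates
    \<sigma>.\<close>
  have "proj ((a0 \<otimes>\<^sub>G b) \<odot>\<^bsub>W.gr\<^esub> \<epsilon>) = a0 \<odot>\<^sub>Q (a1 \<odot>\<^sub>Q proj \<sigma>)"
    using gm.smult_assoc1[OF a0(1) b(1) \<epsilon>] proj_smult[OF a0(1) b\<epsilon>] a1(2) by simp
  also have "\<dots> = a1 \<odot>\<^sub>Q (a0 \<odot>\<^sub>Q proj \<sigma>)" by (rule Q.smult_left_commute[OF a0(1) a1(1) p\<sigma>])
  also have "\<dots> = proj (a1 \<odot>\<^bsub>W.gr\<^esub> \<sigma>0)" using proj_smult[OF a1(1) \<sigma>0] a0(2) by simp
  finally have pe: "proj ((a0 \<otimes>\<^sub>G b) \<odot>\<^bsub>W.gr\<^esub> \<epsilon>) = proj (a1 \<odot>\<^bsub>W.gr\<^esub> \<sigma>0)" .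
  have abc: "a0 \<otimes>\<^sub>G b \<in> carrier G" by (rule G.m_closed[OF a0(1) b(1)])
  obtain \<beta> where \<beta>: "\<beta> \<in> powers.reps" "a0 \<otimes>\<^sub>G b = powers.cls \<beta>" using G_cases[OF abc] by blast
  obtain \<gamma> where \<gamma>: "\<gamma> \<in> powers.reps" "a1 = powers.cls \<gamma>" using G_cases[OF a1(1)] by blast
  \<comment> \<open>The coefficient at 0 is taken on both sides. On the left it is the coefficient
    at w of the scalar component of degree \<open>top_order - l\<close>, on the right the nonzero
    constant term of a1; so w has order at least \<open>top_order - l\<close>.\<close>
  have "fps_nth (\<beta> (top_order - l)) w = coef \<tau> 0 ((a0 \<otimes>\<^sub>G b) \<odot>\<^bsub>W.gr\<^esub> \<epsilon>)"
    unfolding \<beta>(2) \<epsilon>_def by (rule coef_dual[OF tau w d ltop \<beta>(1), symmetric])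
  also have "\<dots> = coef \<tau> 0 (a1 \<odot>\<^bsub>W.gr\<^esub> \<sigma>0)"
    by (rule coef_proj[OF tau z0 gm.smult_closed[OF abc \<epsilon>] gm.smult_closed[OF a1(1) \<sigma>0] pe])
  also have "\<dots> = fps_nth (\<gamma> 0) 0"
    unfolding \<gamma>(2) \<sigma>0_def using coef_dual[OF tau z0 d0 order_refl \<gamma>(1)] by simp
  also have "\<dots> \<noteq> 0" using a1n gr_plus_lead[OF a1(1)] lead_cls[OF \<gamma>(1)] \<gamma>(2) by simp
  finally have "w \<in> lM (top_order - l)" using powers.reps_L[OF \<beta>(1), of "top_order - l"] unfolding Pw_iff by blast
  then have "top_order - l \<le> ord w" using lM_iff[OF wS] by simp
  then show "reaches S mu (top_order - ord w) w"
    using reaches_antimono[OF _ l(1), of "top_order - ord w"] by simp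
qed

lemma canonical_of_M_pure:
  assumes cm: "cohen_macaulay G" and MP: "M_pure S" and fg: "fin_gen_module R M"
  shows "canonical_module G (gr_plus R mm) W.gr"
proof -
  note lin = ord_linear[OF cm]
  have pure: "reaches S mu (top_order - ord w) w" if "w \<in> Ap S mu" for w
    using MP that unfolding M_pure_iff by blast
  have regL: "y \<in> W.L i" if "y \<in> carrier M" "fps_X ^ mu \<odot>\<^sub>M y \<in> W.L (Suc i)" for y i
    by (rule initial_regular[OF lin pure that])
  obtain \<tau> where tau: "dualizing S M mu \<tau>" using dual[OF mu(1) mu_nonzero] by blast
  note mu_tau = mu(1) mu_nonzero tau
  note z0 = zero_Ap[OF mu_nonzero]
  have proj_eqI': "proj f = proj g"
    if "f \<in> carrier W.gr" "g \<in> carrier W.gr" "\<And>w. w \<in> Ap S mu \<Longrightarrow> coef \<tau> w f = coef \<tau> w g" for f g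
    by (rule proj_eqI[OF tau regL pure that])
  interpret P: maximalideal "gr_plus R mm" G by (rule maximal_plus)
  interpret Q: module G Q by (rule Q_module)
  obtain N where N: "\<And>f. f \<in> high N \<Longrightarrow> \<exists>g\<in>carrier G. f = xs \<otimes>\<^sub>G g" using high_multiple by blast
  obtain d0 where d0: "d0 \<in> W.L top_order" "\<And>s. s \<in> Ap S mu \<Longrightarrow> \<tau> (fps_X ^ s \<odot>\<^sub>M d0) = (if s = 0 then 1 else 0)"
    using top_element[OF tau] by blast
  note d0r = W.hom_reps[OF d0(1)]
  define \<sigma> where "\<sigma> = W.cls (W.hom_rep top_order d0)"
  have \<sigma>: "\<sigma> \<in> carrier W.gr" unfolding \<sigma>_def by (rule cls_carrier[OF d0r])
  have \<sigma>c: "coef \<tau> w \<sigma> = (if w = 0 then 1 else 0)" if w: "w \<in> Ap S mu" for w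
  proof (cases "top_order - ord w = top_order")
    case True
    then show ?thesis unfolding \<sigma>_def coef_cls[OF tau w d0r] using d0(2)[OF w] by (simp add: W.hom_rep_def)
  next
    case False
    then have "w \<noteq> 0" using ord_0 by (intro notI) simp
    moreover have "W.hom_rep top_order d0 (top_order - ord w) = \<zero>\<^sub>M" using False by (simp add: W.hom_rep_def)
    ultimately show ?thesis
      unfolding \<sigma>_def coef_cls[OF tau w d0r]
      using tau_zero[OF mu_tau] W.M.smult_r_null[OF X_power_closed[OF Ap_S[OF w]]] by simp
  qed
  have \<sigma>x: "a \<odot>\<^bsub>W.gr\<^esub> \<sigma> \<in> xgr" if "a \<in> gr_plus R mm" for a
    unfolding \<sigma>_def by (rule top_socle[OF tau regL that d0(1)])
  show ?thesis
  proof (rule canonical_moduleI[where X = Q and proj = proj and x = xs and B = high and N = N and \<sigma> = \<sigma>])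
    show "cohen_macaulay G" by (rule cm)
    show "maximalideal (gr_plus R mm) G" by (rule maximal_plus)
    show "module G W.gr" by (rule gm.module_axioms)
    show "fin_gen_module G W.gr" by (rule W.gr_fin_gen[OF G fg])
    show "height G (gr_plus R mm) = enat 1" by (rule height_plus)
    show "xs \<in> gr_plus R mm" by (rule xs_plus)
    show "module G Q" by (rule Q_module)
    show "linear_on G W.gr Q (carrier W.gr) proj" by (rule proj_linear)
    show "proj ` carrier W.gr = carrier Q" by (rule proj_image)
    show "proj y = \<zero>\<^sub>Q \<longleftrightarrow> (\<exists>z\<in>carrier W.gr. y = xs \<odot>\<^bsub>W.gr\<^esub> z)" if "y \<in> carrier W.gr" for y
      using proj_zero_iff[OF that] by (auto simp: xgr_def)
    show "a = \<zero>\<^sub>G" if "a \<in> carrier G" "xs \<otimes>\<^sub>G a = \<zero>\<^sub>G" for a by (rule xs_regular[OF cm that])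
    show "high 0 = carrier G" by (rule high_0)
    show "high i \<subseteq> carrier G" for i by (rule high_carrier)
    show "a \<otimes>\<^sub>G b \<in> high (Suc i)" if "a \<in> gr_plus R mm" "b \<in> high i" for a b i by (rule high_mult[OF that])
    show "\<exists>r\<in>carrier G. b = xs \<otimes>\<^sub>G r" if "b \<in> high N" for b by (rule N[OF that])
    show "\<sigma> \<in> carrier W.gr" by (rule \<sigma>)
    show "proj \<sigma> \<noteq> \<zero>\<^sub>Q" using proj_zero_iff[OF \<sigma>] coef_xgr[OF tau z0, of \<sigma>] \<sigma>c[OF z0] by auto
    show "proj (a \<odot>\<^bsub>W.gr\<^esub> \<sigma>) = \<zero>\<^sub>Q" if "a \<in> gr_plus R mm" for a
      using proj_zero_iff[OF gm.smult_closed[OF plus_carrier[OF that] \<sigma>]] \<sigma>x[OF that] by blast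
    show "y = \<zero>\<^bsub>W.gr\<^esub>" if y: "y \<in> carrier W.gr" "xs \<odot>\<^bsub>W.gr\<^esub> y = \<zero>\<^bsub>W.gr\<^esub>" for y
    proof -
      obtain z where z: "z \<in> W.reps" "y = W.cls z" using gr_cases[OF y(1)] by blast
      let ?v = "\<lambda>n. if Suc 0 \<le> n then fps_X ^ mu \<odot>\<^sub>M z (n - Suc 0) else \<zero>\<^sub>M"
      have v: "?v \<in> W.reps"
        using W.conv_reps[OF xs_reps z(1)] unfolding W.conv_hom[OF X_mu_Pw z(1)] .
      have "\<forall>n. ?v n \<in> W.L (Suc n)"
        using y(2) unfolding z(2) xs_smult[OF z(1)] W.cls_eq_zero_iff[OF v] .
      then have "?v (Suc n) \<in> W.L (Suc (Suc n))" for n by blast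
      then have "fps_X ^ mu \<odot>\<^sub>M z n \<in> W.L (Suc (Suc n))" for n by simp
      then have "z n \<in> W.L (Suc n)" for n using regL[OF W.reps_carrier[OF z(1)]] by blast
      then show ?thesis unfolding z(2) W.cls_eq_zero_iff[OF z(1)] by blast
    qed
    show "\<exists>a\<in>carrier G. proj y = a \<odot>\<^sub>Q proj \<sigma>"
      if y: "y \<in> carrier W.gr" and soc: "\<And>a. a \<in> gr_plus R mm \<Longrightarrow> proj (a \<odot>\<^bsub>W.gr\<^esub> y) = \<zero>\<^sub>Q" for y
    proof
      \<comment> \<open>A socle element has zero coefficient at each nonzero w, because the initial
        form of w moves this coefficient to the one at 0 and kills the element modulo
        \<open>xs\<close>. Only the coefficient at 0 remains, and \<sigma> accounts for it.\<close>
      define c where "c = const (coef \<tau> 0 y)"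
      have cc: "c \<in> carrier G" unfolding c_def by (rule const_carrier)
      show "c \<in> carrier G" by (rule cc)
      have "proj y = proj (c \<odot>\<^bsub>W.gr\<^esub> \<sigma>)"
      proof (rule proj_eqI'[OF y gm.smult_closed[OF cc \<sigma>]])
        fix w assume w: "w \<in> Ap S mu"
        have "coef \<tau> w y = 0" if "w \<noteq> 0"
        proof -
          have p: "initial w \<in> gr_plus R mm" by (rule initial_plus[OF Ap_S[OF w] that])
          have "initial w \<odot>\<^bsub>W.gr\<^esub> y \<in> xgr"
            using soc[OF p] proj_zero_iff[OF gm.smult_closed[OF plus_carrier[OF p] y]] by blast
          then show ?thesis using coef_xgr[OF tau z0] coef_initial[OF tau w y] by simp
        qed
        then show "coef \<tau> w y = coef \<tau> w (c \<odot>\<^bsub>W.gr\<^esub> \<sigma>)"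
          unfolding c_def coef_const[OF tau w \<sigma>] \<sigma>c[OF w] by simp
      qed
      then show "proj y = c \<odot>\<^sub>Q proj \<sigma>" using proj_smult[OF cc \<sigma>] by simp
    qed
    show "\<exists>y\<in>carrier Q. \<forall>a\<in>gr_plus R mm. \<psi> a = a \<odot>\<^sub>Q y"
      if \<psi>: "linear_on G (self_module G) Q (gr_plus R mm) \<psi>" and \<psi>x: "\<psi> xs = \<zero>\<^sub>Q" for \<psi>
    proof -
      have "\<exists>y. y \<in> carrier W.gr \<and> \<psi> a = proj y" if "a \<in> gr_plus R mm" for a
        using linear_on_closed[OF \<psi> that] proj_image by (metis imageE)
      then obtain Y where Y: "\<And>a. a \<in> gr_plus R mm \<Longrightarrow> Y a \<in> carrier W.gr"
          "\<And>a. a \<in> gr_plus R mm \<Longrightarrow> \<psi> a = proj (Y a)" by metis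
      have coef_Y: "coef \<tau> 0 (Y a) = coef \<tau> 0 y"
        if a: "a \<in> gr_plus R mm" and y: "y \<in> carrier W.gr" "\<psi> a = proj y" for a y
        using coef_proj[OF tau z0 Y(1)[OF a] y(1)] Y(2)[OF a] y(2) by simp
      have \<psi>_mult: "\<psi> (g \<otimes>\<^sub>G a) = proj (g \<odot>\<^bsub>W.gr\<^esub> Y a)" if "g \<in> carrier G" "a \<in> gr_plus R mm" for g a
        using linear_on_smult[OF \<psi> that] Y(2)[OF that(2)] proj_smult[OF that(1) Y(1)[OF that(2)]] by simp
      have \<psi>_add: "\<psi> (a \<oplus>\<^sub>G b) = proj (Y a \<oplus>\<^bsub>W.gr\<^esub> Y b)" if "a \<in> gr_plus R mm" "b \<in> gr_plus R mm" for a b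
        using linear_on_add[OF \<psi> that] Y(2) that linear_on_add[OF proj_linear Y(1)[OF that(1)] Y(1)[OF that(2)]] by simp
      \<comment> \<open>The coefficients that f must have if \<psi> is multiplication on
        \<open>proj f\<close>. The value 0 at w = 0 is a default, as the initial form of 0 is the
        identity, which lies outside the domain of \<psi>.\<close>
      define c where "c w = (if w = 0 then 0 else coef \<tau> 0 (Y (initial w)))" for w
      have "\<exists>f\<in>carrier W.gr. \<forall>w\<in>Ap S mu. coef \<tau> w f = c w"
        by (rule coef_surj[OF tau regL pure, where c = c]) blast+
      then obtain f where f: "f \<in> carrier W.gr" "\<And>w. w \<in> Ap S mu \<Longrightarrow> coef \<tau> w f = c w" by blast
      \<comment> \<open>Comparing the coefficient at 0 on the whole ideal is enough: multiplication
        by initial forms stays in the ideal and recovers the coefficients at all other w.\<close>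
      define T where "T = {a \<in> gr_plus R mm. coef \<tau> 0 (Y a) = coef \<tau> 0 (a \<odot>\<^bsub>W.gr\<^esub> f)}"
      have "gr_plus R mm \<subseteq> T"
      proof (rule gr_plus_induct[OF lin])
        fix a b assume "a \<in> T" "b \<in> T"
        then have a: "a \<in> gr_plus R mm" "coef \<tau> 0 (Y a) = coef \<tau> 0 (a \<odot>\<^bsub>W.gr\<^esub> f)"
          and b: "b \<in> gr_plus R mm" "coef \<tau> 0 (Y b) = coef \<tau> 0 (b \<odot>\<^bsub>W.gr\<^esub> f)" by (auto simp: T_def)
        note ac = plus_carrier[OF a(1)] note bc = plus_carrier[OF b(1)]
        have ab: "a \<oplus>\<^sub>G b \<in> gr_plus R mm" by (rule P.a_closed[OF a(1) b(1)])
        have "coef \<tau> 0 (Y (a \<oplus>\<^sub>G b)) = coef \<tau> 0 (Y a \<oplus>\<^bsub>W.gr\<^esub> Y b)"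
          by (rule coef_Y[OF ab gm.M.a_closed[OF Y(1)[OF a(1)] Y(1)[OF b(1)]] \<psi>_add[OF a(1) b(1)]])
        also have "\<dots> = coef \<tau> 0 (a \<odot>\<^bsub>W.gr\<^esub> f \<oplus>\<^bsub>W.gr\<^esub> b \<odot>\<^bsub>W.gr\<^esub> f)"
          unfolding coef_add[OF tau z0 Y(1)[OF a(1)] Y(1)[OF b(1)]]
            coef_add[OF tau z0 gm.smult_closed[OF ac f(1)] gm.smult_closed[OF bc f(1)]] a(2) b(2) ..
        also have "\<dots> = coef \<tau> 0 ((a \<oplus>\<^sub>G b) \<odot>\<^bsub>W.gr\<^esub> f)" unfolding gm.smult_l_distr[OF ac bc f(1)] ..
        finally show "a \<oplus>\<^sub>G b \<in> T" using ab by (simp add: T_def)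
      next
        fix k w assume w: "w \<in> Ap S mu" "w \<noteq> 0"
        have p: "initial w \<in> gr_plus R mm" by (rule initial_plus[OF Ap_S[OF w(1)] w(2)])
        note pc = plus_carrier[OF p]
        have kp: "const k \<otimes>\<^sub>G initial w \<in> gr_plus R mm" by (rule P.I_l_closed[OF p const_carrier])
        have "coef \<tau> 0 (Y (const k \<otimes>\<^sub>G initial w)) = coef \<tau> 0 (const k \<odot>\<^bsub>W.gr\<^esub> Y (initial w))"
          by (rule coef_Y[OF kp gm.smult_closed[OF const_carrier Y(1)[OF p]] \<psi>_mult[OF const_carrier p]])
        also have "\<dots> = k * coef \<tau> 0 (initial w \<odot>\<^bsub>W.gr\<^esub> f)"
          unfolding coef_const[OF tau z0 Y(1)[OF p]] coef_initial[OF tau w(1) f(1)] f(2)[OF w(1)]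
          using w(2) by (simp add: c_def)
        also have "\<dots> = coef \<tau> 0 ((const k \<otimes>\<^sub>G initial w) \<odot>\<^bsub>W.gr\<^esub> f)"
          unfolding gm.smult_assoc1[OF const_carrier pc f(1)] coef_const[OF tau z0 gm.smult_closed[OF pc f(1)]] ..
        finally show "const k \<otimes>\<^sub>G initial w \<in> T" using kp by (simp add: T_def)
      next
        fix h assume h: "h \<in> carrier G"
        have hp: "xs \<otimes>\<^sub>G h \<in> gr_plus R mm" by (rule P.I_r_closed[OF xs_plus h])
        have "\<psi> (xs \<otimes>\<^sub>G h) = h \<odot>\<^sub>Q \<psi> xs"
          using linear_on_smult[OF \<psi> h xs_plus] G.m_comm[OF xs_carrier h] by simp
        also have "\<dots> = proj \<zero>\<^bsub>W.gr\<^esub>"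
          using \<psi>x Q.smult_r_null[OF h] proj_zero_iff[OF gm.M.zero_closed] submodule_zero[OF xgr_submodule] by simp
        finally have "coef \<tau> 0 (Y (xs \<otimes>\<^sub>G h)) = coef \<tau> 0 \<zero>\<^bsub>W.gr\<^esub>" by (rule coef_Y[OF hp gm.M.zero_closed])
        also have "\<dots> = coef \<tau> 0 ((xs \<otimes>\<^sub>G h) \<odot>\<^bsub>W.gr\<^esub> f)"
          unfolding gm.smult_assoc1[OF xs_carrier h f(1)] coef_zero[OF tau z0]
            coef_xs[OF tau z0 gm.smult_closed[OF h f(1)]] ..
        finally show "xs \<otimes>\<^sub>G h \<in> T" using hp by (simp add: T_def)
      qed
      then have T: "coef \<tau> 0 (Y a) = coef \<tau> 0 (a \<odot>\<^bsub>W.gr\<^esub> f)" if "a \<in> gr_plus R mm" for a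
        using that by (auto simp: T_def)
      have "\<psi> a = a \<odot>\<^sub>Q proj f" if a: "a \<in> gr_plus R mm" for a
      proof -
        note ac = plus_carrier[OF a]
        have "proj (Y a) = proj (a \<odot>\<^bsub>W.gr\<^esub> f)"
        proof (rule proj_eqI'[OF Y(1)[OF a] gm.smult_closed[OF ac f(1)]])
          fix w assume w: "w \<in> Ap S mu"
          note wc = initial_carrier[OF Ap_S[OF w]]
          have wa: "initial w \<otimes>\<^sub>G a \<in> gr_plus R mm" by (rule P.I_l_closed[OF a wc])
          have "coef \<tau> w (Y a) = coef \<tau> 0 (initial w \<odot>\<^bsub>W.gr\<^esub> Y a)"
            by (rule coef_initial[OF tau w Y(1)[OF a], symmetric])
          also have "\<dots> = coef \<tau> 0 (Y (initial w \<otimes>\<^sub>G a))"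
            by (rule coef_Y[OF wa gm.smult_closed[OF wc Y(1)[OF a]] \<psi>_mult[OF wc a], symmetric])
          also have "\<dots> = coef \<tau> w (a \<odot>\<^bsub>W.gr\<^esub> f)"
            unfolding T[OF wa] gm.smult_assoc1[OF wc ac f(1)] by (rule coef_initial[OF tau w gm.smult_closed[OF ac f(1)]])
          finally show "coef \<tau> w (Y a) = coef \<tau> w (a \<odot>\<^bsub>W.gr\<^esub> f)" .
        qed
        then show ?thesis using Y(2)[OF a] proj_smult[OF ac f(1)] by simp
      qed
      then show ?thesis using linear_on_closed[OF proj_linear f(1)] by blast
    qed
  qed
qed

end

theorem corollary3p11:
  fixes S :: "nat set"
    and R :: "'k::field fps ring"
    and \<mm> :: "'k fps set"
    and \<omega> :: "('k fps, 'b) module"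
  assumes "numerical_semigroup S"
    and "R = semigroup_ring S"
    and "\<mm> = semigroup_max_ideal S"
    and "canonical_module R \<mm> \<omega>"
  shows "canonical_module (gr_ring R \<mm>) (gr_plus R \<mm>) (gr_module R \<mm> \<omega>) \<longleftrightarrow>
           cohen_macaulay (gr_ring R \<mm>) \<and> M_pure S"
proof -
  have \<omega>: "maximalideal \<mm> R" "module R \<omega>" "fin_gen_module R \<omega>"
    using assms(4) by (auto simp: canonical_module_def)
  have ring: "sg_ring S R \<mm>"
    by (intro sg_ring.intro numerical_sg.intro sg_ring_axioms.intro assms(1-3) \<omega>(1))
  note dz = sg_ring.canonical_module_dualizing[OF ring assms(4)]
  have dual: "sg_dual S R \<mm> \<omega>"
    by (rule sg_dual.intro[OF ring sg_dual_axioms.intro[OF \<omega>(2)]]) (rule dz; assumption)+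
  \<comment> \<open>Commutativity of the graded ring, on which the graded development rests, is part
    of \<open>cohen_macaulay\<close>, and each side of the equivalence contains that
    property.\<close>
  have graded: "sg_dual_graded S R \<mm> \<omega>" if "cohen_macaulay (gr_ring R \<mm>)"
    using that dual ring
    by (intro sg_dual_graded.intro sg_graded.intro sg_graded_axioms.intro) (auto simp: cohen_macaulay_def)
  have cm: "cohen_macaulay (gr_ring R \<mm>)" if "canonical_module (gr_ring R \<mm>) (gr_plus R \<mm>) (gr_module R \<mm> \<omega>)"
    using that by (simp add: canonical_module_def)
  show ?thesis
    using sg_dual_graded.M_pure_of_canonical[OF graded] sg_dual_graded.canonical_of_M_pure[OF graded _ _ \<omega>(3)] cm
    by blast
qed

end
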